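(* Suppose that the Coxeter group $W=W(X)$ has Property F and Property W. Then the structure constants of $TL(X)$ with respect to the basis $\{c_w:w\in W_c\}$ lie in $\mathbb Z^{\ge0}[\delta]$, where $\delta=v+v^{-1}$; that is, for all $a,b\in W_c$, writing $c_ac_b=\sum_{w\in W_c}\lambda_w c_w$ with $\lambda_w\in\mathbb Z[v,v^{-1}]$, each $\lambda_w$ is a polynomial in $\delta$ with nonnegative integer coefficients.
   Context: **Hecke algebra.** $X$ is an arbitrary Coxeter graph and $W=W(X)$ the Coxeter group with finite set $S$ of distinguished generating involutions, $W=\langle S\mid (st)^{m(s,t)}=1 \text{ for } m(s,t)<\infty\rangle$, $m(s,s)=1$; $\ell$ is the length function. Put $\mathcal A=\mathbb Z[v,v^{-1}]$, $\mathcal A^-=\mathbb Z[v^{-1}]$, $q=v^2$. $\mathcal H=\mathcal H(X)$ is the $\mathcal A$-algebra with basis $\{T_w:w\in W\}$ such that, for $s\in S$, $T_sT_w=T_{sw}$ if $\ell(sw)>\ell(w)$ and $T_sT_w=qT_{sw}+(q-1)T_w$ if $\ell(sw)<\ell(w)$. Put $\widetilde T_w=v^{-\ell(w)}T_w$. The bar involution is the ring automorphism of $\mathcal H$ with $\overline{\sum a_w\widetilde T_w}=\sum\overline{a_w}\,\widetilde T_{w^{-1}}^{-1}$, where $\bar{\ }$ on $\mathcal A$ exchanges $v$ and $v^{-1}$. **Temperley--Lieb quotient.** $J(X)$ is the two-sided ideal of $\mathcal H$ generated by the elements $\sum_{w\in\langle s,s'\rangle}T_w$, for all pairs of noncommuting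 $s,s'\in S$ with $m(s,s')<\infty$. $TL(X)=\mathcal H/J(X)$, and $\widetilde t_w$ is the image of $\widetilde T_w$. The bar involution descends to $TL(X)$. An element $w\in W$ is complex if $w=x_1w_{ss'}x_2$ with $\ell(w)=\ell(x_1)+\ell(w_{ss'})+\ell(x_2)$, where $w_{ss'}$ is the longest element of a finite parabolic subgroup $\langle s,s'\rangle$ with $s,s'\in S$ noncommuting; $W_c$ is the set of elements that are not complex (fully commutative elements). $\{\widetilde t_w:w\in W_c\}$ is an $\mathcal A$-basis of $TL(X)$; $\mathcal L$ is its $\mathcal A^-$-span. For $w\in W_c$, $c_w$ is the unique element of $TL(X)$ with $\overline{c_w}=c_w$ and $c_w-\widetilde t_w\in v^{-1}\mathcal L$; $\{c_w:w\in W_c\}$ is an $\mathcal A$-basis of $TL(X)$. **Star reducibility and Property F.** Let $I=\{s,t\}\subseteq S$ be noncommuting generators with $m=m(s,t)$ ($m=\infty$ allowed). Let $W_I=\langle s,t\rangle$ and $W^I=\{w\in W:\ell(sw)>\ell(w),\ \ell(tw)>\ell(w)\}$; each $w\in W$ is uniquely $w=w_Iw^I$ with $w_I\in W_I$, $w^I\in W^I$, and $\ell(w)=\ell(w_I)+\ell(w^I)$. The left $\{s,t\}$-strings are the sequences of $m-1$ elements $sw^I,tsw^I,stsw^I,\dots$ and $tw^I,stw^I,tstw^I,\dots$. If $x,y$ belong to the same left $\{s,t\}$-string and $\ell(x)=\ell(y)-1$, then $y$ is left star reducible to $x$. Right strings and right star reducibility are defined symmetrically. $y$ is star reducible to $x$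 if there is a (possibly trivial) sequence $x=w_0,w_1,\dots,w_k=y$ such that each $w_{i+1}$ is left or right star reducible to $w_i$ with respect to some pair of noncommuting generators. $W$ has Property F if every element of $W_c$ is star reducible to a product of (distinct) commuting generators from $S$. **Property W.** $w\in W$ is weakly complex if $w$ is complex and $w=su$ with $s\in S$ and $u\in W_c$. $W$ has Property W if $\widetilde t_x\in v^{-1}\mathcal L$ for every weakly complex $x\in W$. *)

theory Defs
  imports
    "HOL-Library.Poly_Mapping"
    "HOL-Library.Extended_Nat"
    "HOL-Computational_Algebra.Polynomial"
    "HOL-Algebra.Generated_Groups"
    "HOL-Algebra.QuotRing"
    "HOL-Algebra.Module"
begin

section \<open>Coxeter groups\<close>

record 's coxeter_graph =
  gens :: "'s set"
  bond :: "'s \<Rightarrow> 's \<Rightarrow> enat"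

definition coxeter_graph :: "'s coxeter_graph \<Rightarrow> bool" where
  "coxeter_graph X \<longleftrightarrow> finite (gens X) \<and> (\<forall>s\<in>gens X. bond X s s = 1) \<and>
     (\<forall>s\<in>gens X. \<forall>t\<in>gens X. bond X s t = bond X t s \<and> (s \<noteq> t \<longrightarrow> 2 \<le> bond X s t))"

text \<open>The group \<open>W(X)\<close> consists of the classes of words in the generators modulo the congruence
  generated by \<open>(st)\<^sup>m = 1\<close> for \<open>m = m(s,t) < \<infinity>\<close>.  Since \<open>m(s,s) = 1\<close> gives \<open>ss = 1\<close>, every
  generator is its own inverse, so this monoid presentation is the group presentation.\<close>

inductive cox_cong :: "'s coxeter_graph \<Rightarrow> 's list \<Rightarrow> 's list \<Rightarrow> bool" for X where
  cox_rel: "\<lbrakk>x \<in> lists (gens X); y \<in> lists (gens X); s \<in> gens X; t \<in> gens X; bond X s t = enat k\<rbrakk>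
      \<Longrightarrow> cox_cong X (x @ concat (replicate k [s, t]) @ y) (x @ y)"
| cox_refl: "x \<in> lists (gens X) \<Longrightarrow> cox_cong X x x"
| cox_sym: "cox_cong X x y \<Longrightarrow> cox_cong X y x"
| cox_trans: "\<lbrakk>cox_cong X x y; cox_cong X y z\<rbrakk> \<Longrightarrow> cox_cong X x z"

definition word_class :: "'s coxeter_graph \<Rightarrow> 's list \<Rightarrow> 's list set" where
  "word_class X x = {y. cox_cong X x y}"

definition coxeter_group :: "'s coxeter_graph \<Rightarrow> 's list set monoid" where
  "coxeter_group X =
    \<lparr>carrier = word_class X ` lists (gens X),
     mult = (\<lambda>u w. \<Union>x\<in>u. \<Union>y\<in>w. word_class X (x @ y)),
     one = word_class X []\<rparr>"

definition gen :: "'s coxeter_graph \<Rightarrow> 's \<Rightarrow> 's list set" where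
  "gen X s = word_class X [s]"

definition len :: "'s list set \<Rightarrow> nat" where
  "len w = (LEAST n. \<exists>x\<in>w. length x = n)"

definition commuting :: "'s coxeter_graph \<Rightarrow> 's \<Rightarrow> 's \<Rightarrow> bool" where
  "commuting X s t \<longleftrightarrow>
     gen X s \<otimes>\<^bsub>coxeter_group X\<^esub> gen X t = gen X t \<otimes>\<^bsub>coxeter_group X\<^esub> gen X s"

definition parabolic :: "'s coxeter_graph \<Rightarrow> 's \<Rightarrow> 's \<Rightarrow> 's list set set" where
  "parabolic X s t = generate (coxeter_group X) {gen X s, gen X t}"

definition is_longest :: "'s list set set \<Rightarrow> 's list set \<Rightarrow> bool" where
  "is_longest P w \<longleftrightarrow> w \<in> P \<and> (\<forall>y\<in>P. len y \<le> len w)"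

definition complex :: "'s coxeter_graph \<Rightarrow> 's list set \<Rightarrow> bool" where
  "complex X w \<longleftrightarrow>
    (\<exists>x1\<in>carrier (coxeter_group X). \<exists>x2\<in>carrier (coxeter_group X).
     \<exists>s\<in>gens X. \<exists>t\<in>gens X. \<exists>w0.
       \<not> commuting X s t \<and> finite (parabolic X s t) \<and> is_longest (parabolic X s t) w0 \<and>
       w = x1 \<otimes>\<^bsub>coxeter_group X\<^esub> w0 \<otimes>\<^bsub>coxeter_group X\<^esub> x2 \<and>
       len w = len x1 + len w0 + len x2)"

definition W_c :: "'s coxeter_graph \<Rightarrow> 's list set set" where
  "W_c X = {w \<in> carrier (coxeter_group X). \<not> complex X w}"

definition weakly_complex :: "'s coxeter_graph \<Rightarrow> 's list set \<Rightarrow> bool" where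
  "weakly_complex X w \<longleftrightarrow> complex X w \<and>
     (\<exists>s\<in>gens X. \<exists>u\<in>W_c X. w = gen X s \<otimes>\<^bsub>coxeter_group X\<^esub> u)"

section \<open>Star reducibility\<close>

text \<open>\<open>alt s t k\<close> is the alternating word \<open>\<dots>sts\<close> with \<open>k\<close> letters ending in \<open>s\<close>.\<close>

fun alt :: "'s \<Rightarrow> 's \<Rightarrow> nat \<Rightarrow> 's list" where
  "alt s t 0 = []"
| "alt s t (Suc k) = alt t s k @ [s]"

definition left_string :: "'s coxeter_graph \<Rightarrow> 's \<Rightarrow> 's \<Rightarrow> 's list set \<Rightarrow> 's list set set" where
  "left_string X s t u =
     {word_class X (alt s t k) \<otimes>\<^bsub>coxeter_group X\<^esub> u |k. 1 \<le> k \<and> enat k < bond X s t}"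

definition right_string :: "'s coxeter_graph \<Rightarrow> 's \<Rightarrow> 's \<Rightarrow> 's list set \<Rightarrow> 's list set set" where
  "right_string X s t u =
     {u \<otimes>\<^bsub>coxeter_group X\<^esub> word_class X (rev (alt s t k)) |k. 1 \<le> k \<and> enat k < bond X s t}"

text \<open>The two strings through a given coset are obtained from the ordered pairs \<open>(s,t)\<close> and \<open>(t,s)\<close>.\<close>

definition left_star_reducible :: "'s coxeter_graph \<Rightarrow> 's list set \<Rightarrow> 's list set \<Rightarrow> bool" where
  "left_star_reducible X y x \<longleftrightarrow>
    (\<exists>s\<in>gens X. \<exists>t\<in>gens X. \<exists>u\<in>carrier (coxeter_group X).
       \<not> commuting X s t \<and>
       len (gen X s \<otimes>\<^bsub>coxeter_group X\<^esub> u) > len u \<and>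
       len (gen X t \<otimes>\<^bsub>coxeter_group X\<^esub> u) > len u \<and>
       x \<in> left_string X s t u \<and> y \<in> left_string X s t u \<and> len y = len x + 1)"

definition right_star_reducible :: "'s coxeter_graph \<Rightarrow> 's list set \<Rightarrow> 's list set \<Rightarrow> bool" where
  "right_star_reducible X y x \<longleftrightarrow>
    (\<exists>s\<in>gens X. \<exists>t\<in>gens X. \<exists>u\<in>carrier (coxeter_group X).
       \<not> commuting X s t \<and>
       len (u \<otimes>\<^bsub>coxeter_group X\<^esub> gen X s) > len u \<and>
       len (u \<otimes>\<^bsub>coxeter_group X\<^esub> gen X t) > len u \<and>
       x \<in> right_string X s t u \<and> y \<in> right_string X s t u \<and> len y = len x + 1)"

definition star_reducible :: "'s coxeter_graph \<Rightarrow> 's list set \<Rightarrow> 's list set \<Rightarrow> bool" where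
  "star_reducible X = (\<lambda>y x. left_star_reducible X y x \<or> right_star_reducible X y x)\<^sup>*\<^sup>*"

definition commuting_product :: "'s coxeter_graph \<Rightarrow> 's list set \<Rightarrow> bool" where
  "commuting_product X w \<longleftrightarrow>
    (\<exists>x\<in>lists (gens X). distinct x \<and> (\<forall>s\<in>set x. \<forall>t\<in>set x. commuting X s t) \<and> w = word_class X x)"

definition property_F :: "'s coxeter_graph \<Rightarrow> bool" where
  "property_F X \<longleftrightarrow> (\<forall>w\<in>W_c X. \<exists>x. commuting_product X x \<and> star_reducible X w x)"

section \<open>Laurent polynomials\<close>

text \<open>\<open>\<int>[v,v\<^sup>-\<^sup>1]\<close> is the group ring of \<open>\<int>\<close>: the type carries the convolution product, and
  \<open>v_pow n\<close> is \<open>v\<^sup>n\<close>.\<close>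

type_synonym laurent = "(int, int) poly_mapping"

definition v_pow :: "int \<Rightarrow> laurent" where
  "v_pow n = Poly_Mapping.single n 1"

definition laurent_bar :: "laurent \<Rightarrow> laurent" where
  "laurent_bar a = Poly_Mapping.map_key uminus a"

definition A_minus :: "laurent set" where
  "A_minus = {a. \<forall>n\<in>Poly_Mapping.keys a. n \<le> 0}"

definition delta :: laurent where
  "delta = v_pow 1 + v_pow (-1)"

definition nonneg_delta :: "laurent set" where
  "nonneg_delta = {poly (map_poly of_nat p) delta |p :: nat poly. True}"

section \<open>The Hecke algebra\<close>

type_synonym 's hecke_elt = "('s list set, laurent) poly_mapping"

definition T :: "'s list set \<Rightarrow> 's hecke_elt" where
  "T w = Poly_Mapping.single w 1"

definition scale :: "laurent \<Rightarrow> 's hecke_elt \<Rightarrow> 's hecke_elt" where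
  "scale a h = Poly_Mapping.map ((*) a) h"

text \<open>The free module on the basis \<open>T\<^sub>w\<close>, \<open>w \<in> W\<close>, with a candidate product \<open>\<mu>\<close>.\<close>

definition hecke_with :: "'s coxeter_graph \<Rightarrow> ('s hecke_elt \<Rightarrow> 's hecke_elt \<Rightarrow> 's hecke_elt)
    \<Rightarrow> (laurent, 's hecke_elt) module" where
  "hecke_with X \<mu> =
    \<lparr>carrier = {h. Poly_Mapping.keys h \<subseteq> carrier (coxeter_group X)},
     mult = \<mu>,
     one = T \<one>\<^bsub>coxeter_group X\<^esub>,
     zero = 0,
     add = (+),
     smult = scale\<rparr>"

text \<open>The unit is forced to be \<open>T\<^sub>1\<close>: the relations make \<open>T\<^sub>1\<close> a right identity.  The library
  locale \<open>algebra\<close> is not applicable, as it requires commutativity.\<close>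

definition is_hecke_product ::
    "'s coxeter_graph \<Rightarrow> ('s hecke_elt \<Rightarrow> 's hecke_elt \<Rightarrow> 's hecke_elt) \<Rightarrow> bool" where
  "is_hecke_product X \<mu> \<longleftrightarrow>
     ring (hecke_with X \<mu>) \<and>
     (\<forall>a. \<forall>g\<in>carrier (hecke_with X \<mu>). \<forall>h\<in>carrier (hecke_with X \<mu>).
        \<mu> (scale a g) h = scale a (\<mu> g h) \<and> \<mu> g (scale a h) = scale a (\<mu> g h)) \<and>
     (\<forall>s\<in>gens X. \<forall>w\<in>carrier (coxeter_group X).
        (len (gen X s \<otimes>\<^bsub>coxeter_group X\<^esub> w) > len w \<longrightarrow>
           \<mu> (T (gen X s)) (T w) = T (gen X s \<otimes>\<^bsub>coxeter_group X\<^esub> w)) \<and>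
        (len (gen X s \<otimes>\<^bsub>coxeter_group X\<^esub> w) < len w \<longrightarrow>
           \<mu> (T (gen X s)) (T w) =
             scale (v_pow 2) (T (gen X s \<otimes>\<^bsub>coxeter_group X\<^esub> w)) + scale (v_pow 2 - 1) (T w)))"

text \<open>Such a product exists, and on the carrier it is unique: the relations determine left
  multiplication by each \<open>T\<^sub>s\<close>, and \<open>T\<^sub>w\<close> is the product of the \<open>T\<^sub>s\<close> along a reduced word.
  Its values outside the carrier are irrelevant.\<close>

definition hecke :: "'s coxeter_graph \<Rightarrow> (laurent, 's hecke_elt) module" where
  "hecke X = hecke_with X (SOME \<mu>. is_hecke_product X \<mu>)"

definition Tt :: "'s list set \<Rightarrow> 's hecke_elt" where
  "Tt w = scale (v_pow (- int (len w))) (T w)"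

text \<open>As \<open>T\<^sub>w = v\<^bsup>\<ell>(w)\<^esup> Tt w\<close>, the coefficient of \<open>h\<close> at \<open>Tt w\<close> is \<open>v\<^bsup>\<ell>(w)\<^esup>\<close> times
  its coefficient at \<open>T\<^sub>w\<close>.\<close>

definition hecke_bar :: "'s coxeter_graph \<Rightarrow> 's hecke_elt \<Rightarrow> 's hecke_elt" where
  "hecke_bar X h = (\<Sum>w\<in>Poly_Mapping.keys h.
     scale (laurent_bar (v_pow (int (len w)) * Poly_Mapping.lookup h w))
       (inv\<^bsub>hecke X\<^esub> Tt (inv\<^bsub>coxeter_group X\<^esub> w)))"

section \<open>The Temperley--Lieb quotient\<close>

definition TL_ideal :: "'s coxeter_graph \<Rightarrow> 's hecke_elt set" where
  "TL_ideal X = genideal (hecke X)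
     {\<Sum>w\<in>parabolic X s t. T w |s t.
        s \<in> gens X \<and> t \<in> gens X \<and> \<not> commuting X s t \<and> bond X s t < \<infinity>}"

definition TL_proj :: "'s coxeter_graph \<Rightarrow> 's hecke_elt \<Rightarrow> 's hecke_elt set" where
  "TL_proj X h = TL_ideal X +>\<^bsub>hecke X\<^esub> h"

definition TL :: "'s coxeter_graph \<Rightarrow> (laurent, 's hecke_elt set) module" where
  "TL X = ring.extend (hecke X Quot TL_ideal X)
     (module.fields (\<lambda>a Y. \<Union>h\<in>Y. TL_proj X (scale a h)))"

definition tt :: "'s coxeter_graph \<Rightarrow> 's list set \<Rightarrow> 's hecke_elt set" where
  "tt X w = TL_proj X (Tt w)"

definition TL_bar :: "'s coxeter_graph \<Rightarrow> 's hecke_elt set \<Rightarrow> 's hecke_elt set" where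
  "TL_bar X Y = (\<Union>h\<in>Y. TL_proj X (hecke_bar X h))"

definition TL_lincomb :: "'s coxeter_graph \<Rightarrow> ('s list set, laurent) poly_mapping
    \<Rightarrow> ('s list set \<Rightarrow> 's hecke_elt set) \<Rightarrow> 's hecke_elt set" where
  "TL_lincomb X f b =
     (\<Oplus>\<^bsub>TL X\<^esub>w\<in>Poly_Mapping.keys f. Poly_Mapping.lookup f w \<odot>\<^bsub>TL X\<^esub> b w)"

definition TL_lattice :: "'s coxeter_graph \<Rightarrow> 's hecke_elt set set" where
  "TL_lattice X = {TL_lincomb X f (tt X) |f.
     Poly_Mapping.keys f \<subseteq> W_c X \<and> (\<forall>w. Poly_Mapping.lookup f w \<in> A_minus)}"

definition v_inv_lattice :: "'s coxeter_graph \<Rightarrow> 's hecke_elt set set" where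
  "v_inv_lattice X = {v_pow (-1) \<odot>\<^bsub>TL X\<^esub> y |y. y \<in> TL_lattice X}"

definition property_W :: "'s coxeter_graph \<Rightarrow> bool" where
  "property_W X \<longleftrightarrow>
     (\<forall>x\<in>carrier (coxeter_group X). weakly_complex X x \<longrightarrow> tt X x \<in> v_inv_lattice X)"

definition canon :: "'s coxeter_graph \<Rightarrow> 's list set \<Rightarrow> 's hecke_elt set" where
  "canon X w = (THE c. c \<in> carrier (TL X) \<and> TL_bar X c = c \<and>
     c \<ominus>\<^bsub>TL X\<^esub> tt X w \<in> v_inv_lattice X)"

definition canon_expansion ::
    "'s coxeter_graph \<Rightarrow> 's hecke_elt set \<Rightarrow> ('s list set, laurent) poly_mapping \<Rightarrow> bool" where
  "canon_expansion X y l \<longleftrightarrow>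
     Poly_Mapping.keys l \<subseteq> W_c X \<and> y = TL_lincomb X l (canon X)"

end

theory Submission
  imports Defs Complex_Main
begin

text \<open>Left multiplication by \<open>b\<^sub>s = v\<^sup>-\<^sup>1(1 + T\<^sub>s)\<close> makes the free module on the monomials \<open>b\<^sub>w\<close>,
  \<open>w \<in> W\<^sub>c\<close>, a faithful model of \<open>TL(X)\<close>.  Property W makes the basis \<open>c\<^sub>w\<close> behave like a
  Kazhdan--Lusztig basis: \<open>b\<^sub>s c\<^sub>w = \<delta> c\<^sub>w\<close> if \<open>sw < w\<close>, and otherwise
  \<open>b\<^sub>s c\<^sub>w = \<Sum> (\<mu>(z,w) + [sz = w]) c\<^sub>z\<close> over \<open>z\<close> with \<open>sz < z\<close>.  On a string \<open>y\<^sub>1, y\<^sub>2, \<dots>\<close> this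
  reads \<open>b c\<^bsub>y\<^sub>i\<^esub> = c\<^bsub>y\<^sub>i\<^sub>+\<^sub>1\<^esub> + c\<^bsub>y\<^sub>i\<^sub>-\<^sub>1\<^esub>\<close>.  Hence, for two strings of the same pair of generators, both
  the numbers \<open>\<mu>(z\<^sub>j, y\<^sub>i)\<close> and the structure constants satisfy
  \<open>a\<^bsub>i+1,j\<^esub> + a\<^bsub>i-1,j\<^esub> = a\<^bsub>i,j-1\<^esub> + a\<^bsub>i,j+1\<^esub>\<close>, whose solution is a nonnegative combination (with \<open>SU(2)\<close>
  fusion multiplicities) of the \<open>a\<^bsub>1,k\<^esub>\<close>.  By Property F every \<open>w \<in> W\<^sub>c\<close> is a product of commuting
  generators or lies, possibly after inversion, beyond the bottom of a string, so that first \<open>\<mu> \<ge> 0\<close>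
  and then the positivity of \<open>c\<^sub>a c\<^sub>b\<close> follow by induction on length.\<close>

text \<open>The definitions give no direct handle: W is a set of word classes, the Hecke product a
  \<open>SOME\<close>, the canonical element a \<open>THE\<close>. So the exchange condition, the
  order of st, the Hecke product and the linear independence of the monomials are all derived from
  the presentation. The last is the main obstacle. If su is complex, b_s b_u is rewritten through
  some left descent of u; that the choice is immaterial, that b_r and b_s commute when r and s do,
  and that the dihedral relations hold is shown in one joint induction on length. Property W enters
  because b_s c_w produces t_{sy} with sy complex: these stay in v^-1 L and do not disturb constant
  terms, and if sw is in W_c their total has degree at most -2 and does not disturb the coefficients
  at v^-1, which define mu. Inversion turns right star reductions into left ones, but then b_s has
  to be carried from the first factor of c_a c_b to the second. If b_s does not scale c_b by delta,
  positivity is first obtained for delta c_a c_b only, and one needs that delta g in Z_{>=0}[delta]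
  forces g in Z_{>=0}[delta].\<close>

lemma cox_rel_set: "\<lbrakk>set x \<subseteq> gens X; set y \<subseteq> gens X; s \<in> gens X; t \<in> gens X; bond X s t = enat k\<rbrakk>
      \<Longrightarrow> cox_cong X (x @ concat (replicate k [s, t]) @ y) (x @ y)"
  and cox_refl_set: "set x \<subseteq> gens X \<Longrightarrow> cox_cong X x x"
  by (simp_all add: cox_cong.cox_rel cox_cong.cox_refl subset_iff in_lists_conv_set)

lemma concat_replicate_set: "s \<in> A \<Longrightarrow> t \<in> A \<Longrightarrow> set (concat (replicate k [s, t])) \<subseteq> A"
  by (induction k) auto

lemma cox_cong_set: "cox_cong X x y \<Longrightarrow> set x \<subseteq> gens X \<and> set y \<subseteq> gens X"
proof (induction rule: cox_cong.induct)
  case (cox_rel x y s t k)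
  then show ?case using concat_replicate_set[of s "gens X" t k] by (auto simp: in_lists_conv_set)
qed (auto simp: in_lists_conv_set)

lemma cox_cong_context:
  "cox_cong X x y \<Longrightarrow> set a \<subseteq> gens X \<Longrightarrow> set b \<subseteq> gens X \<Longrightarrow> cox_cong X (a @ x @ b) (a @ y @ b)"
proof (induction rule: cox_cong.induct)
  case (cox_rel x y s t k)
  have "cox_cong X ((a @ x) @ concat (replicate k [s, t]) @ (y @ b)) ((a @ x) @ (y @ b))"
    by (rule cox_rel_set) (use cox_rel in \<open>auto simp: in_lists_conv_set\<close>)
  then show ?case by simp
next
  case (cox_refl x)
  then show ?case by (intro cox_refl_set) (auto simp: in_lists_conv_set)
qed (blast intro: cox_cong.cox_sym cox_cong.cox_trans)+

section \<open>The Coxeter group as a group of word classes\<close>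

locale cox =
  fixes X :: "'s coxeter_graph"
  assumes coxeter_graph: "coxeter_graph X"
begin

abbreviation S where "S \<equiv> gens X"
abbreviation W where "W \<equiv> carrier (coxeter_group X)"
abbreviation ev where "ev \<equiv> word_class X"
abbreviation mul (infixl "\<odot>" 70) where "u \<odot> w \<equiv> u \<otimes>\<^bsub>coxeter_group X\<^esub> w"
abbreviation lm (infixr "\<cdot>" 72) where "s \<cdot> w \<equiv> gen X s \<otimes>\<^bsub>coxeter_group X\<^esub> w"
abbreviation iv where "iv w \<equiv> inv\<^bsub>coxeter_group X\<^esub> w"

lemma bond_self: "s \<in> S \<Longrightarrow> bond X s s = 1"
  and bond_sym: "s \<in> S \<Longrightarrow> t \<in> S \<Longrightarrow> bond X s t = bond X t s"
  and bond_ge2: "s \<in> S \<Longrightarrow> t \<in> S \<Longrightarrow> s \<noteq> t \<Longrightarrow> 2 \<le> bond X s t"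
  using coxeter_graph unfolding coxeter_graph_def by blast+

lemma mem_ev: "y \<in> ev x \<longleftrightarrow> cox_cong X x y"
  by (simp add: word_class_def)

lemma ev_eq: "set x \<subseteq> S \<Longrightarrow> ev x = ev y \<longleftrightarrow> cox_cong X x y"
  unfolding word_class_def set_eq_iff mem_Collect_eq
  by (meson cox_refl_set cox_cong.cox_sym cox_cong.cox_trans cox_cong_set)

lemma W_def: "W = ev ` {x. set x \<subseteq> S}"
  by (simp add: coxeter_group_def lists_eq_set)

lemma ev_in_W [simp, intro]: "set x \<subseteq> S \<Longrightarrow> ev x \<in> W"
  by (simp add: W_def)

lemma mul_ev: assumes "set x \<subseteq> S" "set y \<subseteq> S" shows "ev x \<odot> ev y = ev (x @ y)"
proof -
  have *: "ev (x' @ y') = ev (x @ y)" if "x' \<in> ev x" "y' \<in> ev y" for x' y'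
  proof -
    have "cox_cong X x x'" "cox_cong X y y'" using that by (auto simp: mem_ev)
    then have "cox_cong X (x @ y) (x' @ y)" "cox_cong X (x' @ y) (x' @ y')"
      using cox_cong_context[of X x x' "[]" y] cox_cong_context[of X y y' x' "[]"] assms cox_cong_set[of X x x'] by auto
    then show ?thesis using assms ev_eq cox_cong.cox_trans by (metis set_append Un_subset_iff)
  qed
  have "x \<in> ev x" "y \<in> ev y" using assms by (auto simp: mem_ev cox_refl_set)
  moreover have "ev x \<odot> ev y = (\<Union>x'\<in>ev x. \<Union>y'\<in>ev y. ev (x' @ y'))"
    by (simp add: coxeter_group_def)
  ultimately show ?thesis using * by blast
qed

lemma one_ev: "\<one>\<^bsub>coxeter_group X\<^esub> = ev []"
  by (simp add: coxeter_group_def)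

lemma gen_ev: "gen X s = ev [s]"
  by (simp add: gen_def)

lemma ev_rel: assumes "s \<in> S" "t \<in> S" "bond X s t = enat k" shows "ev (concat (replicate k [s, t])) = ev []"
  using cox_rel_set[of "[]" X "[]" s t k] assms by (simp add: ev_eq concat_replicate_set)

lemma ev_ss: "s \<in> S \<Longrightarrow> ev [s, s] = ev []"
  using ev_rel[of s s 1] bond_self by (simp add: one_enat_def)

lemma ev_cancel: assumes "set x \<subseteq> S" "set y \<subseteq> S" "set z \<subseteq> S" "ev x = ev []"
  shows "ev (y @ x @ z) = ev (y @ z)"
  using assms mul_ev by (metis append_Nil empty_subsetI list.set(1) set_append Un_subset_iff)

lemma ev_ss_context: "s \<in> S \<Longrightarrow> set y \<subseteq> S \<Longrightarrow> set z \<subseteq> S \<Longrightarrow> ev (y @ s # s # z) = ev (y @ z)"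
  using ev_cancel[of "[s,s]" y z] ev_ss by auto

lemma ev_rev_left: "set x \<subseteq> S \<Longrightarrow> ev (rev x @ x) = ev []"
proof (induction x)
  case (Cons s x)
  then show ?case using ev_ss_context[of s "rev x" x] by auto
qed auto

lemma ev_rev_right: "set x \<subseteq> S \<Longrightarrow> ev (x @ rev x) = ev []"
  using ev_rev_left[of "rev x"] by simp

lemma coxeter_group_is_group: "group (coxeter_group X)"
proof (rule groupI)
  fix x y assume "x \<in> W" "y \<in> W" then show "x \<odot> y \<in> W"
    by (auto simp: W_def mul_ev)
next
  fix x y z assume "x \<in> W" "y \<in> W" "z \<in> W" then show "x \<odot> y \<odot> z = x \<odot> (y \<odot> z)"
    by (auto simp: W_def mul_ev)
next
  fix x assume "x \<in> W"
  then obtain a where a: "set a \<subseteq> S" "x = ev a" by (auto simp: W_def)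
  then show "\<exists>y\<in>W. y \<odot> x = \<one>\<^bsub>coxeter_group X\<^esub>"
    by (intro bexI[of _ "ev (rev a)"]) (auto simp: mul_ev one_ev ev_rev_left)
qed (auto simp: W_def one_ev mul_ev)

end

sublocale cox \<subseteq> G: group "coxeter_group X"
  by (rule coxeter_group_is_group)

context cox
begin

lemma iv_ev: "set x \<subseteq> S \<Longrightarrow> iv (ev x) = ev (rev x)"
  by (rule G.inv_equality) (auto simp: mul_ev one_ev ev_rev_left)

lemma gen_W [simp, intro]: "s \<in> S \<Longrightarrow> gen X s \<in> W"
  by (simp add: gen_ev)

lemma lm_ev: "s \<in> S \<Longrightarrow> set x \<subseteq> S \<Longrightarrow> s \<cdot> ev x = ev (s # x)"
  by (simp add: gen_ev mul_ev)

lemma gen_sq: "s \<in> S \<Longrightarrow> gen X s \<odot> gen X s = ev []"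
  by (simp add: gen_ev mul_ev ev_ss)

lemma iv_gen: "s \<in> S \<Longrightarrow> iv (gen X s) = gen X s"
  by (simp add: gen_ev iv_ev)

lemma lm_W [simp, intro]: "s \<in> S \<Longrightarrow> w \<in> W \<Longrightarrow> s \<cdot> w \<in> W"
  by simp

lemma lm_lm [simp]: "s \<in> S \<Longrightarrow> w \<in> W \<Longrightarrow> s \<cdot> s \<cdot> w = w"
  by (metis G.l_one G.m_assoc gen_W gen_sq one_ev)

lemma lm_inj: "s \<in> S \<Longrightarrow> u \<in> W \<Longrightarrow> w \<in> W \<Longrightarrow> s \<cdot> u = s \<cdot> w \<longleftrightarrow> u = w"
  using lm_lm by metis

lemma W_cases: assumes "w \<in> W" obtains x where "set x \<subseteq> S" "w = ev x"
  using assms by (auto simp: W_def)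

section \<open>Length and left descents\<close>

lemma len_le: "set x \<subseteq> S \<Longrightarrow> len (ev x) \<le> length x"
  unfolding len_def by (rule Least_le) (use cox_refl_set[of x X] in \<open>auto simp: mem_ev\<close>)

lemma reduced_word: assumes "w \<in> W" obtains x where "set x \<subseteq> S" "w = ev x" "length x = len w"
proof -
  obtain y where y: "set y \<subseteq> S" "w = ev y" using assms by (rule W_cases)
  have "y \<in> w" using y cox_refl_set[of y X] by (simp add: mem_ev)
  then have "\<exists>n. \<exists>x\<in>w. length x = n" by blast
  then have "\<exists>x\<in>w. length x = len w"
    unfolding len_def by (rule LeastI_ex)
  then show ?thesis using that y ev_eq cox_cong_set mem_ev by metis
qed

text \<open>A defining relator has the even length 2k, so the sign of a word depends only on its
  class; this is why a generator changes the length by exactly one.\<close>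

lemma cong_parity: "cox_cong X x y \<Longrightarrow> even (length x) = even (length y)"
proof (induction rule: cox_cong.induct)
  case (cox_rel x y s t k)
  have "even (length (concat (replicate k [s, t])))" by (induction k) auto
  then show ?case by simp
qed auto

lemma len_parity: assumes "set x \<subseteq> S" shows "even (len (ev x)) = even (length x)"
proof -
  obtain y where y: "set y \<subseteq> S" "ev x = ev y" "length y = len (ev x)"
    using assms by (meson ev_in_W reduced_word)
  then show ?thesis using assms cong_parity ev_eq by metis
qed

lemma len_mul_le: assumes "u \<in> W" "w \<in> W" shows "len (u \<odot> w) \<le> len u + len w"
proof -
  obtain x y where "set x \<subseteq> S" "u = ev x" "length x = len u" "set y \<subseteq> S" "w = ev y" "length y = len w"
    using assms by (metis reduced_word)
  then show ?thesis using len_le[of "x @ y"] by (auto simp: mul_ev)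
qed

lemma len_one [simp]: "len (ev []) = 0"
  using len_le[of "[]"] by simp

lemma len_0: "w \<in> W \<Longrightarrow> len w = 0 \<longleftrightarrow> w = ev []"
  by (metis len_one length_0_conv reduced_word)

lemma len_gen: "s \<in> S \<Longrightarrow> len (gen X s) = 1"
  using len_le[of "[s]"] len_parity[of "[s]"] by (cases "len (ev [s])") (auto simp: gen_ev)

lemma len_iv [simp]: assumes "w \<in> W" shows "len (iv w) = len w"
proof -
  have *: "len (iv w) \<le> len w" if w: "w \<in> W" for w
  proof -
    obtain x where x: "set x \<subseteq> S" "w = ev x" "length x = len w" using w by (rule reduced_word)
    then show ?thesis using len_le[of "rev x"] by (auto simp: iv_ev)
  qed
  show ?thesis using *[of w] *[of "iv w"] assms by auto
qed

lemma len_lm: assumes "s \<in> S" "w \<in> W" shows "len (s \<cdot> w) = len w + 1 \<or> len w = len (s \<cdot> w) + 1"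
proof -
  obtain x where x: "set x \<subseteq> S" "w = ev x" using assms W_cases by metis
  have 1: "len (s \<cdot> w) \<le> len w + 1" "len w \<le> len (s \<cdot> w) + 1"
    using len_mul_le[of "gen X s" w] len_mul_le[of "gen X s" "s \<cdot> w"] assms len_gen by auto
  have "even (len (s \<cdot> w)) \<noteq> even (len w)"
    using x assms len_parity by (auto simp: lm_ev)
  then show ?thesis using 1 by (cases "len (s \<cdot> w) = len w") auto
qed

definition dl :: "'s \<Rightarrow> 's list set \<Rightarrow> bool" where "dl s w \<longleftrightarrow> len (s \<cdot> w) < len w"

lemma dl_len: "s \<in> S \<Longrightarrow> w \<in> W \<Longrightarrow> dl s w \<Longrightarrow> len w = len (s \<cdot> w) + 1"
  and ndl_len: "s \<in> S \<Longrightarrow> w \<in> W \<Longrightarrow> \<not> dl s w \<Longrightarrow> len (s \<cdot> w) = len w + 1"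
  and dl_lm: "s \<in> S \<Longrightarrow> w \<in> W \<Longrightarrow> dl s (s \<cdot> w) \<longleftrightarrow> \<not> dl s w"
  using len_lm[of s w] by (auto simp: dl_def)

subsection \<open>The exchange condition\<close>

text \<open>The reflections attached to the prefixes of a word; the parity of the number of occurrences of a
  reflection depends only on the class of the word, which gives the exchange condition.\<close>

fun refs :: "'s list \<Rightarrow> 's list set list" where
  "refs [] = []"
| "refs (s # x) = ev [s] # map (\<lambda>r. s \<cdot> r \<odot> gen X s) (refs x)"

lemma refs_W: "set x \<subseteq> S \<Longrightarrow> r \<in> set (refs x) \<Longrightarrow> r \<in> W"
  by (induction x arbitrary: r) auto

lemma refs_append: "set x \<subseteq> S \<Longrightarrow> set y \<subseteq> S \<Longrightarrow>
   refs (x @ y) = refs x @ map (\<lambda>r. ev x \<odot> r \<odot> iv (ev x)) (refs y)"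
proof (induction x)
  case Nil
  have "map (\<lambda>r. ev [] \<odot> r \<odot> iv (ev [])) (refs y) = refs y"
    using refs_W[OF Nil(2)] by (intro map_idI) (simp flip: one_ev)
  then show ?case by simp
next
  case (Cons s x)
  have "s \<cdot> (ev x \<odot> r \<odot> iv (ev x)) \<odot> gen X s = ev (s # x) \<odot> r \<odot> iv (ev (s # x))" if "r \<in> W" for r
  proof -
    have "ev (s # x) = s \<cdot> ev x" "iv (ev (s # x)) = iv (ev x) \<odot> gen X s"
      using Cons by (auto simp: lm_ev G.inv_mult_group iv_gen simp flip: lm_ev)
    then show ?thesis using Cons that by (simp add: G.m_assoc)
  qed
  then show ?case using Cons refs_W[OF \<open>set y \<subseteq> S\<close>] by auto
qed

lemma refs_mem: "set x \<subseteq> S \<Longrightarrow> r \<in> set (refs x) \<Longrightarrow> \<exists>a t b. x = a @ t # b \<and> r = ev (a @ t # rev a)"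
proof (induction x arbitrary: r)
  case (Cons s x)
  show ?case
  proof (cases "r = ev [s]")
    case True then show ?thesis by (intro exI[of _ "[]"]) auto
  next
    case False
    then obtain r' where r': "r' \<in> set (refs x)" "r = s \<cdot> r' \<odot> gen X s" using Cons by auto
    moreover have "set x \<subseteq> S" using Cons by simp
    ultimately obtain a t b where *: "x = a @ t # b" "r' = ev (a @ t # rev a)" using Cons.IH by blast
    have "r = ev ((s # a) @ t # rev (s # a))"
      using r' * Cons by (simp add: lm_ev gen_ev mul_ev)
    then show ?thesis using * by (metis append_Cons)
  qed
qed auto

lemma ev_replicate: "s \<in> S \<Longrightarrow> t \<in> S \<Longrightarrow> ev (concat (replicate k [s, t])) = ev [s, t] [^]\<^bsub>coxeter_group X\<^esub> k"
proof (induction k)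
  case (Suc k)
  have "ev (concat (replicate (Suc k) [s,t])) = ev [s,t] \<odot> ev (concat (replicate k [s,t]))"
    using Suc by (subst mul_ev) (auto simp: concat_replicate_set)
  then show ?case using Suc G.nat_pow_Suc2[of "ev [s, t]" k] by simp
qed (simp add: one_ev)

text \<open>The prefix with i letters turns the next letter of stst... into the reflection (st)^i s.
  In this closed form the list visibly has period k as soon as (st)^k = 1.\<close>

lemma refs_rel:
  assumes "s \<in> S" "t \<in> S"
  shows "refs (concat (replicate k [s, t])) = map (\<lambda>i. ev [s, t] [^]\<^bsub>coxeter_group X\<^esub> i \<odot> gen X s) [0..<2 * k]"
proof (induction k)
  case (Suc k)
  let ?P = "ev [s, t]"
  have P: "?P = s \<cdot> gen X t" using assms by (simp add: gen_ev mul_ev)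
  have step: "s \<cdot> (t \<cdot> (?P [^]\<^bsub>coxeter_group X\<^esub> i \<odot> gen X s) \<odot> gen X t) \<odot> gen X s
      = ?P [^]\<^bsub>coxeter_group X\<^esub> (i + 2) \<odot> gen X s" for i :: nat
  proof -
    have "?P [^]\<^bsub>coxeter_group X\<^esub> (i + 2) = ?P \<odot> ?P [^]\<^bsub>coxeter_group X\<^esub> i \<odot> ?P"
      using assms by (metis G.nat_pow_Suc2 add_2_eq_Suc' ev_in_W G.nat_pow_Suc P gen_W G.m_closed)
    moreover have "?P [^]\<^bsub>coxeter_group X\<^esub> i \<in> W" using assms by simp
    ultimately show ?thesis using assms by (simp add: P G.m_assoc del: G.nat_pow_Suc)
  qed
  have up: "[0..<2 * Suc k] = 0 # 1 # map (\<lambda>i. i + 2) [0..<2 * k]"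
    using map_add_upt[of 2 "2 * k"] by (simp add: upt_conv_Cons numeral_2_eq_2 del: upt_Suc)
  have l: "concat (replicate (Suc k) [s, t]) = s # t # concat (replicate k [s, t])" by simp
  have 0: "ev [s] = ?P [^]\<^bsub>coxeter_group X\<^esub> (0::nat) \<odot> gen X s"
    using assms by (simp add: gen_ev)
  have 1: "s \<cdot> ev [t] \<odot> gen X s = ?P [^]\<^bsub>coxeter_group X\<^esub> (1::nat) \<odot> gen X s"
    using assms by (simp add: gen_ev mul_ev)
  show ?case
    unfolding l refs.simps Suc up list.map map_map comp_def step 1 by (simp only: 0)
qed simp

text \<open>A relator has trivial product, so deleting it does not change the reflections of the
  letters behind it; and it lists the reflections (st)^i s with i < k exactly twice over.\<close>

lemma refs_parity: "cox_cong X x y \<Longrightarrow> even (count_list (refs x) r) = even (count_list (refs y) r)"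
proof (induction rule: cox_cong.induct)
  case (cox_rel x y s t k)
  then have xy: "set x \<subseteq> S" "set y \<subseteq> S" by (auto simp: in_lists_conv_set)
  let ?c = "concat (replicate k [s, t])" and ?P = "ev [s, t]"
  let ?f = "\<lambda>i::nat. ?P [^]\<^bsub>coxeter_group X\<^esub> i \<odot> gen X s"
  have c: "set ?c \<subseteq> S" "ev ?c = ev []" using cox_rel concat_replicate_set ev_rel by auto
  then have Pk: "?P [^]\<^bsub>coxeter_group X\<^esub> k = \<one>\<^bsub>coxeter_group X\<^esub>" using cox_rel by (simp add: ev_replicate one_ev)
  have f: "?f (i + k) = ?f i" for i
    using cox_rel Pk by (simp flip: G.nat_pow_mult)
  have "map ?f [k..<k + k] = map (?f \<circ> (\<lambda>i. i + k)) [0..<k]"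
    by (subst map_map[symmetric], subst map_add_upt) simp
  also have "\<dots> = map ?f [0..<k]" by (simp only: comp_def f)
  finally have "map ?f [0..<2*k] = map ?f [0..<k] @ map ?f [0..<k]"
    using upt_add_eq_append[of 0 k k] by (simp add: mult_2)
  then have rc: "refs ?c = map ?f [0..<k] @ map ?f [0..<k]" using refs_rel cox_rel by simp
  have "refs (?c @ y) = refs ?c @ refs y"
    using refs_append[OF c(1) xy(2)] refs_append[of "[]" y] c xy by simp
  then have "refs (x @ ?c @ y) = refs x @ map (\<lambda>r. ev x \<odot> r \<odot> iv (ev x)) (refs ?c @ refs y)"
    using refs_append[of x "?c @ y"] xy c by simp
  moreover have "refs (x @ y) = refs x @ map (\<lambda>r. ev x \<odot> r \<odot> iv (ev x)) (refs y)"
    using refs_append[of x y] xy by simp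
  ultimately show ?case unfolding rc by (auto simp del: map_map)
qed auto

text \<open>If y is a reduced word of sx, then the word sy lists the reflection s at its head and
  nowhere else, since a second occurrence would shorten x. By parity s occurs among the reflections
  of x, so s = a t a^-1 for a prefix at of x. The word x itself may be arbitrary; deletion of the
  letter t is \<open>exchange_del\<close>.\<close>

lemma exchange:
  assumes s: "s \<in> S" and x: "set x \<subseteq> S" and d: "dl s (ev x)"
  obtains a t b where "x = a @ t # b" "ev (s # a) = ev (a @ [t])"
proof -
  have del: "\<exists>a t b. x = a @ t # b \<and> ev (s # a) = ev (a @ [t])"
    if "set x \<subseteq> S" "ev [s] \<in> set (refs x)" for x
  proof -
    from refs_mem[OF that] obtain a t b where *: "x = a @ t # b" "ev [s] = ev (a @ t # rev a)" by auto
    have "ev (s # a) = ev [s] \<odot> ev a" using * that s by (subst mul_ev) auto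
    also have "\<dots> = ev ((a @ [t]) @ rev a @ a)" using * that by (subst *(2), subst mul_ev) auto
    also have "\<dots> = ev (a @ [t])"
      using ev_cancel[of "rev a @ a" "a @ [t]" "[]"] that * ev_rev_left by auto
    finally show ?thesis using * by blast
  qed
  have sx: "s \<cdot> ev x \<in> W" using s x by simp
  obtain y where y: "set y \<subseteq> S" "s \<cdot> ev x = ev y" "length y = len (s \<cdot> ev x)"
    using reduced_word[OF sx] by metis
  then have exy: "ev (s # y) = ev x" using s x lm_lm by (metis ev_in_W lm_ev)
  have "gen X s \<notin> set (map (\<lambda>r. s \<cdot> r \<odot> gen X s) (refs y))"
  proof
    assume "gen X s \<in> set (map (\<lambda>r. s \<cdot> r \<odot> gen X s) (refs y))"
    then obtain r where r: "r \<in> set (refs y)" "gen X s = s \<cdot> r \<odot> gen X s" by auto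
    then have "r = gen X s"
      using s refs_W y by (metis G.l_cancel_one' G.m_assoc G.m_closed gen_W gen_sq iv_gen G.inv_solve_left one_ev G.r_one)
    then obtain a t b where *: "y = a @ t # b" "ev (s # a) = ev (a @ [t])" using del y r gen_ev by metis
    then have "ev x = ev (a @ [t]) \<odot> ev (t # b)"
      using y s by (simp flip: exy *(2)) (simp add: mul_ev)
    also have "\<dots> = ev (a @ b)" using y * ev_ss_context[of t a b] by (simp add: mul_ev)
    finally have "len (ev x) \<le> length (a @ b)" using len_le[of "a @ b"] y * by auto
    then show False using y * d by (simp add: dl_def)
  qed
  then have "odd (count_list (refs (s # y)) (ev [s]))"
    using count_list_0_iff[of "map (\<lambda>r. s \<cdot> r \<odot> gen X s) (refs y)" "gen X s"] by (simp add: gen_ev)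
  moreover have "cox_cong X (s # y) x" using exy ev_eq[of "s # y" x] y s by simp
  ultimately have "odd (count_list (refs x) (ev [s]))" using refs_parity by blast
  then have "ev [s] \<in> set (refs x)" using count_list_0_iff by (metis even_zero)
  then show ?thesis using del x that by blast
qed

lemma exchange_del:
  assumes "x = a @ t # b" "ev (s # a) = ev (a @ [t])" "set x \<subseteq> S" "s \<in> S"
  shows "s \<cdot> ev x = ev (a @ b)"
proof -
  have "s \<cdot> ev x = ev (s # a @ t # b)" using assms by (simp add: lm_ev)
  also have "\<dots> = ev (s # a) \<odot> ev (t # b)" using assms(1,3,4) by (simp add: mul_ev)
  also have "\<dots> = ev (a @ [t]) \<odot> ev (t # b)" by (simp only: assms)
  also have "\<dots> = ev (a @ t # t # b)" using assms(1,3) by (simp add: mul_ev)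
  finally show ?thesis using assms ev_ss_context[of t a b] by simp
qed

text \<open>The numbers game: the geometric representation acting on coordinate functions.  It is used
  only to see that the order of \<open>st\<close> in \<open>W\<close> is not smaller than \<open>m(s,t)\<close>.\<close>

definition kc :: "'s \<Rightarrow> 's \<Rightarrow> real" where
  "kc s u = (if s = u then - 2 else case bond X s u of enat m \<Rightarrow> 2 * cos (pi / real m) | \<infinity> \<Rightarrow> 2)"

definition fire :: "'s \<Rightarrow> ('s \<Rightarrow> real) \<Rightarrow> 's \<Rightarrow> real" where
  "fire s f = (\<lambda>u. f u + kc s u * f s)"

text \<open>Under alternate firing of t and s the values at these two vertices are, up to sign,
  consecutive terms of one linear recurrence; the vertex fired last carries the minus sign. Every
  other vertex only accumulates multiples of these terms.\<close>

lemma fire_dihedral: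
  fixes x :: "int \<Rightarrow> real"
  assumes st: "s \<in> S" "t \<in> S" "s \<noteq> t" and x: "\<And>k. x (k + 1) = kc s t * x k - x (k - 1)"
    and x0: "x 0 = f t" "x (- 1) = - f s"
  defines "g \<equiv> \<lambda>n. foldr fire (concat (replicate n [s, t])) f"
  shows "g n t = x (2 * int n) \<and> g n s = - x (2 * int n - 1) \<and>
    (\<forall>u. g n u = f u + kc t u * (\<Sum>j<n. x (2 * int j)) + kc s u * (\<Sum>j<n. x (2 * int j + 1)))"
proof (induction n)
  case 0
  then show ?case using x0 by (simp add: g_def)
next
  case (Suc n)
  have c: "kc t s = kc s t" "kc s s = - 2" "kc t t = - 2"
    using st bond_sym[of s t] by (auto simp: kc_def)
  have g: "g (Suc n) u = g n u + kc t u * g n t + kc s u * (g n s + kc s t * g n t)" for u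
    by (simp add: g_def fire_def c)
  have IH: "g n t = x (2 * int n)" "g n s = - x (2 * int n - 1)"
    "g n u = f u + kc t u * (\<Sum>j<n. x (2 * int j)) + kc s u * (\<Sum>j<n. x (2 * int j + 1))" for u
    using Suc by auto
  have f1: "g n s + kc s t * g n t = x (2 * int n + 1)" unfolding IH(1,2) using x[of "2 * int n"] by simp
  have f2: "x (2 * int (Suc n)) = kc s t * x (2 * int n + 1) - x (2 * int n)"
    using x[of "2 * int n + 1"] by (simp add: algebra_simps)
  have "g (Suc n) t = x (2 * int (Suc n))"
    using f2 c by (simp add: g f1) (simp add: IH(1))
  moreover have "g (Suc n) s = - x (2 * int (Suc n) - 1)"
    using f1 c by (simp add: g) (simp add: algebra_simps)
  moreover have "g (Suc n) u = f u + kc t u * (\<Sum>j<Suc n. x (2 * int j)) + kc s u * (\<Sum>j<Suc n. x (2 * int j + 1))" for u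
    by (simp only: g[of u] f1) (simp only: IH(1) IH(3)[of u], simp add: algebra_simps)
  ultimately show ?case by blast
qed

lemma sin_chain:
  fixes \<theta> a b :: real and k :: int
  assumes "sin \<theta> \<noteq> 0"
  defines "x \<equiv> \<lambda>k::int. (a * sin ((k + 1) * \<theta>) + b * sin (k * \<theta>)) / sin \<theta>"
  shows "x (k + 1) = 2 * cos \<theta> * x k - x (k - 1)" "x 0 = a" "x (- 1) = - b"
proof -
  have *: "sin (y + \<theta>) = 2 * cos \<theta> * sin y - sin (y - \<theta>)" for y
    by (simp add: sin_add sin_diff)
  show "x (k + 1) = 2 * cos \<theta> * x k - x (k - 1)"
  proof -
    have "a * sin ((k + 2) * \<theta>) = a * (2 * cos \<theta> * sin ((k + 1) * \<theta>) - sin (k * \<theta>))"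
      by (rule arg_cong[where f = "(*) a"]) (use *[of "(k + 1) * \<theta>"] in \<open>simp add: algebra_simps\<close>)
    moreover have "b * sin ((k + 1) * \<theta>) = b * (2 * cos \<theta> * sin (k * \<theta>) - sin ((k - 1) * \<theta>))"
      by (rule arg_cong[where f = "(*) b"]) (use *[of "k * \<theta>"] in \<open>simp add: algebra_simps\<close>)
    ultimately have "a * sin ((k + 2) * \<theta>) + b * sin ((k + 1) * \<theta>) = 2 * cos \<theta> *
        (a * sin ((k + 1) * \<theta>) + b * sin (k * \<theta>)) - (a * sin (k * \<theta>) + b * sin ((k - 1) * \<theta>))"
      by (simp only:) (simp add: algebra_simps)
    then show ?thesis unfolding x_def by (simp add: add.commute[of 2] flip: diff_divide_distrib)
  qed
qed (use assms in \<open>auto simp: x_def\<close>)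

text \<open>The sum over a full period is invariant under the shift by 2, while two steps of the
  recurrence show that its shifts by 2 and -2 add up to c^2 - 2 times the sum. Hence c^2 - 4
  annihilates it.\<close>

lemma even_chain_sum:
  fixes x :: "int \<Rightarrow> real" and m :: nat
  assumes x: "\<And>k. x (k + 1) = c * x k - x (k - 1)" and per: "\<And>k. x (k + 2 * int m) = x k"
    and c: "c\<^sup>2 \<noteq> 4"
  shows "(\<Sum>j<m. x (2 * int j + r)) = 0"
proof -
  define T where "T r = (\<Sum>j<m. x (2 * int j + r))" for r
  have shift: "T (r + 2) = T r" for r
  proof -
    have "T (r + 2) - T r = (\<Sum>j<m. x (2 * int (Suc j) + r) - x (2 * int j + r))"
      by (simp add: T_def sum_subtractf algebra_simps)
    also have "\<dots> = x (2 * int m + r) - x r"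
      using sum_lessThan_telescope[of "\<lambda>j. x (2 * int j + r)" m] by simp
    finally show ?thesis using per[of r] by (simp add: algebra_simps)
  qed
  have "x (k + 2) + x (k - 2) = (c\<^sup>2 - 2) * x k" for k
  proof -
    have "x (k + 2) = c * x (k + 1) - x k" "x (k - 2) = c * x (k - 1) - x k"
      using x[of "k + 1"] x[of "k - 1"] by (simp_all add: algebra_simps)
    then show ?thesis using x[of k] by (simp only:) (simp add: algebra_simps power2_eq_square)
  qed
  then have "(\<Sum>j<m. x ((2 * int j + r) + 2) + x ((2 * int j + r) - 2)) = (\<Sum>j<m. (c\<^sup>2 - 2) * x (2 * int j + r))"
    by (intro sum.cong) auto
  then have "T (r + 2) + T (r - 2) = (c\<^sup>2 - 2) * T r"
    unfolding T_def by (simp add: sum.distrib add.assoc diff_add_eq sum_distrib_left add_diff_eq)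
  then have "(c\<^sup>2 - 4) * T r = 0"
    using shift[of r] shift[of "r - 2"] by (simp add: algebra_simps)
  then show ?thesis using c by (simp add: T_def)
qed

lemma bond_finite_angle:
  assumes "s \<in> S" "t \<in> S" "s \<noteq> t" "bond X s t = enat m"
  shows "2 \<le> m" "kc s t = 2 * cos (pi / real m)" "0 < sin (pi / real m)"
proof -
  show m: "2 \<le> m" using bond_ge2[of s t] assms by (auto simp: numeral_eq_enat)
  show "kc s t = 2 * cos (pi / real m)" using assms by (simp add: kc_def)
  have "pi / real m < pi" using m by (simp add: field_simps)
  then show "0 < sin (pi / real m)" using m by (intro sin_gt_zero) auto
qed

lemma fire_rel:
  assumes "s \<in> S" "t \<in> S" "bond X s t = enat m"
  shows "foldr fire (concat (replicate m [s, t])) f = f"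
proof (cases "s = t")
  case True
  then have "m = 1" using assms bond_self[of s] by (simp add: one_enat_def)
  then show ?thesis using True by (auto simp: fire_def kc_def algebra_simps)
next
  case False
  note m = bond_finite_angle[OF assms(1,2) False assms(3)]
  define \<theta> where "\<theta> = pi / real m"
  define x where "x = (\<lambda>k::int. (f t * sin ((k + 1) * \<theta>) + f s * sin (k * \<theta>)) / sin \<theta>)"
  have \<theta>: "sin \<theta> \<noteq> 0" "kc s t = 2 * cos \<theta>" using m by (auto simp: \<theta>_def)
  have per: "x (k + 2 * int m) = x k" for k
  proof -
    have "real_of_int (k + 2 * int m) * \<theta> = k * \<theta> + 2 * pi" for k :: int
      using m by (simp add: \<theta>_def field_simps)
    then have "sin ((k + 2 * int m) * \<theta>) = sin (k * \<theta>)" for k :: int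
      by (simp only: sin_periodic)
    from this[of k] this[of "k + 1"] show ?thesis by (simp add: x_def algebra_simps)
  qed
  \<comment> \<open>Since the sine is nonzero, the cosine is not 1 or -1. This makes the accumulated
    sums at the other vertices vanish, so that they return to their values as well.\<close>
  have "(kc s t)\<^sup>2 \<noteq> 4" using \<theta> by (simp add: power_mult_distrib cos_squared_eq)
  note * = even_chain_sum[of x "kc s t", OF _ per this]
  have rec: "x (k + 1) = kc s t * x k - x (k - 1)" "x 0 = f t" "x (- 1) = - f s" for k
    unfolding x_def \<theta>(2) using sin_chain[OF \<theta>(1)] by auto
  show ?thesis
    using fire_dihedral[OF assms(1,2) False rec, of m] *[OF rec(1), of 0] *[OF rec(1), of 1] by auto
qed

lemma fire_cong: "cox_cong X x y \<Longrightarrow> foldr fire x f = foldr fire y f"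
proof (induction arbitrary: f rule: cox_cong.induct)
  case (cox_rel x y s t k)
  then show ?case using fire_rel[of s t k] by simp
qed auto

lemma order_ge:
  assumes st: "s \<in> S" "t \<in> S" "s \<noteq> t" and n: "0 < n" "ev (concat (replicate n [s, t])) = ev []"
  shows "bond X s t \<le> enat n"
proof (rule ccontr)
  assume lt: "\<not> bond X s t \<le> enat n"
  \<comment> \<open>The value 1 at t and 0 at s start the chain with x_{-1} = 0 and x_0 = 1. A
    return to this state after n rounds forces sin (n theta) = 0, impossible for 0 < n < m.\<close>
  define f where "f u = (if u = t then 1 else 0 :: real)" for u
  have "cox_cong X (concat (replicate n [s, t])) []"
    using n ev_eq concat_replicate_set st by metis
  then have ff: "foldr fire (concat (replicate n [s, t])) f = f" using fire_cong by fastforce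
  show False
  proof (cases "bond X s t")
    case (enat m)
    note m = bond_finite_angle[OF st enat]
    define \<theta> where "\<theta> = pi / real m"
    define x where "x = (\<lambda>k::int. (f t * sin ((k + 1) * \<theta>) + f s * sin (k * \<theta>)) / sin \<theta>)"
    have \<theta>: "sin \<theta> \<noteq> 0" "kc s t = 2 * cos \<theta>" using m by (auto simp: \<theta>_def)
    have rec: "x (k + 1) = kc s t * x k - x (k - 1)" "x 0 = f t" "x (- 1) = - f s" for k
      unfolding x_def \<theta>(2) using sin_chain[OF \<theta>(1)] by auto
    have "x (2 * int n) = 1" "x (2 * int n - 1) = 0"
      using fire_dihedral[OF st rec, of n] st unfolding ff by (auto simp: f_def)
    then have "sin (2 * n * \<theta> + \<theta>) = sin \<theta>" "sin (2 * n * \<theta>) = 0"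
      using \<theta> st by (auto simp: x_def f_def field_simps)
    then have "cos (2 * (n * \<theta>)) = 1" using \<theta> by (simp add: sin_add mult.assoc)
    then have "sin (n * \<theta>) = 0" unfolding cos_double_sin by simp
    moreover have "n * \<theta> < pi" using lt enat m by (simp add: \<theta>_def field_simps)
    moreover have "0 < n * \<theta>" using n m by (simp add: \<theta>_def)
    ultimately show False using sin_gt_zero by fastforce
  next
    case infinity
    then have kc: "kc s t = 2" using st by (simp add: kc_def)
    \<comment> \<open>For infinite m the recurrence has coefficient 2 and a solution that grows
      linearly, so it never returns.\<close>
    define x where "x = (\<lambda>k::int. of_int (k + 1) :: real)"
    have "x (2 * int n) = f t"
      using fire_dihedral[OF st, of x f n] st kc unfolding ff by (auto simp: f_def x_def)
    then show False using n by (simp add: x_def f_def)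
  qed
qed

end

subsection \<open>Dihedral subgroups\<close>

text \<open>The words \<open>alt\<close> are anchored at their last letter, these at their first.
  Prefixes are then of the same form (\<open>prefix_altl\<close>), which is what an exchange
  argument needs.\<close>

fun altl :: "'a \<Rightarrow> 'a \<Rightarrow> nat \<Rightarrow> 'a list" where
  "altl a b 0 = []"
| "altl a b (Suc k) = a # altl b a k"

lemma alt_eq_rev: "alt a b k = rev (altl a b k)"
  by (induction k arbitrary: a b) auto

lemma length_altl [simp]: "length (altl a b k) = k"
  by (induction k arbitrary: a b) auto

lemma length_alt [simp]: "length (alt a b k) = k"
  by (simp add: alt_eq_rev)

lemma set_altl: "set (altl a b k) \<subseteq> {a, b}"
  by (induction k arbitrary: a b) auto

lemma altl_add: "altl a b (i + j) = altl a b i @ (if even i then altl a b j else altl b a j)"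
  by (induction i arbitrary: a b) auto

lemma altl_double: "altl a b (2 * n) = concat (replicate n [a, b])"
  by (induction n) auto

lemma rev_altl: "rev (altl a b k) = (if odd k then altl a b k else altl b a k)"
proof (induction k arbitrary: a b)
  case (Suc k)
  then show ?case using altl_add[of a b k 1] altl_add[of b a k 1] by (cases "even k") auto
qed simp

lemma altl_rev_altl: "altl a b n @ rev (altl b a n) = concat (replicate n [a, b])"
  unfolding altl_double[symmetric] mult_2 altl_add rev_altl by auto

text \<open>\<open>tp a b n\<close> is the leftmost letter of \<open>alt a b n\<close>.\<close>

definition tp :: "'a \<Rightarrow> 'a \<Rightarrow> nat \<Rightarrow> 'a" where "tp a b n = (if odd n then a else b)"

lemma alt_Suc: "alt a b (Suc k) = tp a b (Suc k) # alt a b k"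
  unfolding alt_eq_rev rev_altl by (auto simp: tp_def)

lemma tp_cases: "tp a b n = a \<and> tp b a n = b \<or> tp a b n = b \<and> tp b a n = a"
  by (auto simp: tp_def)

lemma tp_swap: "tp a b (Suc n) = tp b a n"
  by (auto simp: tp_def)

declare alt.simps(2) [simp del]

lemma prefix_altl:
  assumes "altl a b k = p @ q" shows "p = altl a b (length p)"
proof -
  have "length p \<le> k" using assms by (metis le_add1 length_altl length_append)
  then have "altl a b k = altl a b (length p) @ (if even (length p) then altl a b (k - length p) else altl b a (k - length p))"
    using altl_add[of a b "length p" "k - length p"] by simp
  then show ?thesis using assms by (metis append_eq_append_conv length_altl)
qed

context cox
begin

lemma set_altl_S [simp]: "a \<in> S \<Longrightarrow> b \<in> S \<Longrightarrow> set (altl a b k) \<subseteq> S"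
  using set_altl[of a b k] by auto

lemma set_alt_S [simp]: "a \<in> S \<Longrightarrow> b \<in> S \<Longrightarrow> set (alt a b k) \<subseteq> S"
  by (simp add: alt_eq_rev)

lemma tp_S [simp]: "a \<in> S \<Longrightarrow> b \<in> S \<Longrightarrow> tp a b k \<in> S"
  by (simp add: tp_def)

lemma altl_coincide:
  assumes "a \<in> S" "b \<in> S" "a \<noteq> b" "0 < n" "ev (altl a b n) = ev (altl b a n)"
  shows "bond X a b \<le> enat n"
proof (rule order_ge[OF assms(1-4)])
  have "ev (concat (replicate n [a, b])) = ev (altl a b n) \<odot> ev (rev (altl b a n))"
    using assms(1,2) by (simp add: mul_ev flip: altl_rev_altl)
  also have "\<dots> = ev (altl b a n) \<odot> ev (rev (altl b a n))" by (simp only: assms(5))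
  also have "\<dots> = ev []"
    using assms(1,2) by (simp add: mul_ev ev_rev_right)
  finally show "ev (concat (replicate n [a, b])) = ev []" .
qed

lemma braid:
  assumes "a \<in> S" "b \<in> S" "bond X a b = enat m"
  shows "ev (altl a b m) = ev (altl b a m)"
proof -
  have "ev (altl a b m @ rev (altl b a m) @ altl b a m) = ev (concat (replicate m [a, b])) \<odot> ev (altl b a m)"
    using assms concat_replicate_set[of a S b m] by (subst mul_ev) (simp_all add: altl_rev_altl flip: append_assoc)
  also have "\<dots> = ev (altl b a m)" using ev_rel[OF assms] assms by (simp flip: one_ev)
  finally show ?thesis
    using assms ev_cancel[of "rev (altl b a m) @ altl b a m" "altl a b m" "[]"] ev_rev_left by simp
qed

lemma braid_alt:
  assumes "a \<in> S" "b \<in> S" "bond X a b = enat m"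
  shows "ev (alt a b m) = ev (alt b a m)"
  using braid[OF assms] unfolding alt_eq_rev rev_altl by simp

text \<open>An exchange inside an alternating word would make \<open>ab\<close> have too small an order.\<close>

lemma no_exchange_in_altl:
  assumes "a \<in> S" "b \<in> S" "a \<noteq> b" "altl a b k = p @ t # q" "ev (b # p) = ev (p @ [t])"
  shows "bond X a b \<le> enat k"
proof -
  have p: "p @ [t] = altl a b (Suc (length p))"
    using prefix_altl[of a b k "p @ [t]" q] assms by simp
  have "b # p = altl b a (Suc (length p))"
    using prefix_altl[of a b k p "t # q"] assms by simp
  then have "bond X a b \<le> enat (Suc (length p))"
    using altl_coincide[of a b "Suc (length p)"] assms p by simp
  also have "\<dots> \<le> enat k" using arg_cong[OF assms(4), of length] by simp
  finally show ?thesis .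
qed

lemma len_altl:
  assumes "a \<in> S" "b \<in> S" "a \<noteq> b" "enat k \<le> bond X a b"
  shows "len (ev (altl a b k)) = k"
  using assms
proof (induction k arbitrary: a b)
  case (Suc k)
  have k: "enat k < bond X b a"
    using Suc.prems bond_sym[of a b] Suc_ile_eq by auto
  then have IH: "len (ev (altl b a k)) = k" using Suc by auto
  have "\<not> dl a (ev (altl b a k))"
  proof
    assume "dl a (ev (altl b a k))"
    then obtain p t q where "altl b a k = p @ t # q" "ev (a # p) = ev (p @ [t])"
      using exchange[of a "altl b a k"] Suc.prems by (metis set_altl_S)
    then show False using no_exchange_in_altl[of b a k] Suc.prems k by (simp add: leD)
  qed
  then show ?case using ndl_len[of a "ev (altl b a k)"] IH Suc.prems by (simp add: lm_ev)
qed simp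

lemma len_alt:
  assumes "a \<in> S" "b \<in> S" "a \<noteq> b" "enat k \<le> bond X a b"
  shows "len (ev (alt a b k)) = k"
  using len_altl[OF assms] len_altl[of b a k] assms bond_sym[of a b] unfolding alt_eq_rev rev_altl by auto

text \<open>The exchange with b cannot take place inside the alternating prefix
  (\<open>no_exchange_in_altl\<close>), so it deletes a letter of the tail, and putting b in front
  lengthens the prefix by one.\<close>

lemma alternating_prefix_step:
  assumes ab: "a \<in> S" "b \<in> S" "a \<noteq> b" and z: "z \<in> W" and w: "w = ev (altl a b k) \<odot> z" "len w = k + len z"
    and d: "dl b w" and k: "enat k < bond X a b"
  shows "\<exists>z'\<in>W. w = ev (altl b a (Suc k)) \<odot> z' \<and> len w = Suc k + len z'"
proof -
  obtain x where x: "set x \<subseteq> S" "z = ev x" "length x = len z" using z by (rule reduced_word)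
  let ?y = "altl a b k @ x"
  have y: "set ?y \<subseteq> S" "w = ev ?y" using x ab w by (auto simp: mul_ev)
  obtain p t q where pq: "?y = p @ t # q" "ev (b # p) = ev (p @ [t])"
    using exchange[of b ?y] y ab d by metis
  then have del: "b \<cdot> w = ev (p @ q)" using exchange_del[OF pq] y ab by simp
  have "\<not> length p < k"
  proof
    assume "length p < k"
    then obtain q' where "altl a b k = p @ t # q'"
      using pq(1) unfolding append_eq_append_conv2
      by (metis Cons_eq_append_conv append_Nil2 length_altl length_append less_irrefl not_add_less1)
    then show False using no_exchange_in_altl[of a b k] ab pq k by (simp add: leD)
  qed
  then obtain p' where p': "p = altl a b k @ p'" "x = p' @ t # q"
    using pq(1) unfolding append_eq_append_conv2
    by (metis append_Nil append_Nil2 append_eq_append_conv_if append_same_eq length_altl length_append not_add_less1 not_less linorder_not_less append_assoc same_append_eq append_eq_conv_conj)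
  have S': "set p' \<subseteq> S" "set q \<subseteq> S" using p' x by auto
  have "w = b \<cdot> ev (p @ q)" using del ab y lm_lm by (metis ev_in_W)
  also have "\<dots> = ev (altl b a (Suc k)) \<odot> ev (p' @ q)"
    using S' ab by (simp add: p' lm_ev mul_ev)
  finally have w2: "w = ev (altl b a (Suc k)) \<odot> ev (p' @ q)" .
  have "len w \<le> Suc k + len (ev (p' @ q))"
    using len_mul_le[of "ev (altl b a (Suc k))" "ev (p' @ q)"] len_le[of "altl b a (Suc k)"] ab S'
    unfolding w2 by (simp del: altl.simps)
  moreover have "len (ev (p' @ q)) \<le> length (p' @ q)" using S' by (intro len_le) auto
  ultimately have "len w = Suc k + len (ev (p' @ q))" using w p' x by simp
  then show ?thesis using w2 S' by (intro bexI[of _ "ev (p' @ q)"]) auto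
qed

text \<open>An alternating prefix of w can be lengthened as long as it has fewer than m letters. It
  cannot outgrow w, so m is finite and the prefix becomes the longest element of the dihedral
  subgroup.\<close>

lemma two_descents:
  assumes ab: "a \<in> S" "b \<in> S" "a \<noteq> b" and w: "w \<in> W" "dl a w" "dl b w"
  obtains m z where "bond X a b = enat m" "z \<in> W" "w = ev (alt a b m) \<odot> z" "len w = m + len z"
proof -
  define Q where "Q a b k \<longleftrightarrow> (\<exists>z\<in>W. w = ev (altl a b k) \<odot> z \<and> len w = k + len z)" for a b k
  have ba: "bond X b a = bond X a b" using bond_sym ab by auto
  have step: "Q a b (Suc k) \<or> Q b a (Suc k)" if "Q a b k \<or> Q b a k" "enat k < bond X a b" for k
    using that alternating_prefix_step[of a b _ w k] alternating_prefix_step[of b a _ w k] ab w ba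
    unfolding Q_def by (metis (no_types, lifting))
  have Q: "Q a b k \<or> Q b a k" if "enat k \<le> bond X a b" for k
    using that
  proof (induction k)
    case 0
    then show ?case using w by (auto simp: Q_def simp flip: one_ev)
  next
    case (Suc k)
    then show ?case using step[of k] by (metis Suc_ile_eq order_less_imp_le)
  qed
  have "bond X a b \<le> enat (len w)"
  proof (rule ccontr)
    assume "\<not> bond X a b \<le> enat (len w)"
    then have "enat (Suc (len w)) \<le> bond X a b" by (simp add: Suc_ile_eq)
    from Q[OF this] show False unfolding Q_def by auto
  qed
  then obtain m where m: "bond X a b = enat m" by (cases "bond X a b") auto
  have "ev (altl b a m) = ev (altl a b m)" using braid[of a b m] ab m by simp
  then have "Q a b m" using Q[of m] m by (auto simp: Q_def)
  then show ?thesis using that m braid[of a b m] ab unfolding Q_def alt_eq_rev rev_altl by auto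
qed

text \<open>A descent s that appears only after t is appended must exchange with this last t: an
  exchange inside a reduced word of w would make s a descent of w already.\<close>

lemma right_left_exchange:
  assumes st: "s \<in> S" "t \<in> S" and w: "w \<in> W" "\<not> dl s w"
    and r: "len (w \<odot> gen X t) = len w + 1" "dl s (w \<odot> gen X t)"
  shows "s \<cdot> w = w \<odot> gen X t"
proof -
  obtain x where x: "set x \<subseteq> S" "w = ev x" "length x = len w" using w by (meson reduced_word)
  have wt: "w \<odot> gen X t = ev (x @ [t])" using x st by (simp add: gen_ev mul_ev)
  have "set (x @ [t]) \<subseteq> S" "dl s (ev (x @ [t]))" using r st x wt by auto
  from exchange[OF st(1) this] obtain p r q where pq: "x @ [t] = p @ r # q" "ev (s # p) = ev (p @ [r])"
    by metis
  show ?thesis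
  proof (cases q rule: rev_cases)
    case Nil
    then show ?thesis using pq x st wt by (simp add: lm_ev)
  next
    case (snoc q' t')
    then have x': "x = p @ r # q'" using pq by simp
    then have "s \<cdot> w = ev (p @ q')" using exchange_del[OF _ pq(2)] x st by simp
    then have "len (s \<cdot> w) \<le> length (p @ q')" using len_le[of "p @ q'"] x x' by auto
    then show ?thesis using x x' w by (simp add: dl_def)
  qed
qed

lemma commuting_iff:
  assumes "s \<in> S" "t \<in> S" shows "commuting X s t \<longleftrightarrow> s = t \<or> bond X s t = 2"
proof -
  have c: "commuting X s t \<longleftrightarrow> ev (altl s t 2) = ev (altl t s 2)"
    using assms by (simp add: commuting_def gen_ev mul_ev numeral_2_eq_2)
  show ?thesis
  proof (cases "s = t")
    case False
    then show ?thesis using c altl_coincide[of s t 2] braid[of s t 2] bond_ge2[of s t] assms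
      by (auto simp: numeral_eq_enat)
  next
    case True
    then show ?thesis using c by simp
  qed
qed

lemma commuting_sym: "commuting X s t \<longleftrightarrow> commuting X t s"
  by (auto simp: commuting_def)

lemma commuting_lm: "s \<in> S \<Longrightarrow> t \<in> S \<Longrightarrow> commuting X s t \<Longrightarrow> w \<in> W \<Longrightarrow> s \<cdot> t \<cdot> w = t \<cdot> s \<cdot> w"
  unfolding commuting_def by (metis G.m_assoc gen_W)

lemma noncommuting_bond:
  assumes "s \<in> S" "t \<in> S" "\<not> commuting X s t" "bond X s t = enat m" shows "3 \<le> m"
  using assms commuting_iff[of s t] bond_ge2[of s t] by (auto simp: numeral_eq_enat le_eq_less_or_eq)

lemma noncommuting_neq: "\<not> commuting X s t \<Longrightarrow> s \<noteq> t"
  by (auto simp: commuting_def)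

subsection \<open>Parabolic dihedral subgroups\<close>

lemma parabolic_words: assumes "a \<in> S" "b \<in> S" shows "parabolic X a b = ev ` {x. set x \<subseteq> {a, b}}"
proof
  show "parabolic X a b \<subseteq> ev ` {x. set x \<subseteq> {a, b}}"
    unfolding parabolic_def
  proof
    fix w assume "w \<in> generate (coxeter_group X) {gen X a, gen X b}"
    then show "w \<in> ev ` {x. set x \<subseteq> {a, b}}"
    proof (induction rule: generate.induct)
      case (eng u w)
      then obtain x y where "set x \<subseteq> {a, b}" "u = ev x" "set y \<subseteq> {a, b}" "w = ev y" by auto
      then show ?case using mul_ev[of x y] assms by (intro image_eqI[of _ _ "x @ y"]) auto
    next
      case one
      then show ?case by (auto simp: one_ev)
    next
      case (incl h)
      then have "h = ev [a] \<or> h = ev [b]" by (auto simp: gen_ev)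
      then show ?case by (elim disjE) (auto intro: image_eqI[of _ _ "[a]"] image_eqI[of _ _ "[b]"])
    next
      case (inv h)
      then have "iv h = ev [a] \<or> iv h = ev [b]" using assms by (auto simp: gen_ev iv_ev)
      then show ?case by (elim disjE) (auto intro: image_eqI[of _ _ "[a]"] image_eqI[of _ _ "[b]"])
    qed
  qed
  have "ev x \<in> parabolic X a b" if "set x \<subseteq> {a, b}" for x
    using that
  proof (induction x)
    case Nil
    then show ?case by (auto simp: parabolic_def simp flip: one_ev intro: generate.one)
  next
    case (Cons c x)
    then have "gen X c \<odot> ev x \<in> parabolic X a b"
      unfolding parabolic_def by (intro generate.eng) (auto intro: generate.incl)
    moreover have "c \<in> S" "set x \<subseteq> S" using Cons assms by auto
    ultimately show ?case by (simp add: lm_ev)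
  qed
  then show "ev ` {x. set x \<subseteq> {a, b}} \<subseteq> parabolic X a b" by auto
qed

text \<open>The asymmetric ranges name each element once: the identity and the longest element
  belong to both families of alternating words and are counted in the first.\<close>

lemma parabolic_alt:
  assumes ab: "a \<in> S" "b \<in> S" and m: "bond X a b = enat m" "0 < m"
  shows "parabolic X a b = (\<lambda>j. ev (alt a b j)) ` {..m} \<union> (\<lambda>j. ev (alt b a j)) ` {1..<m}"
proof
  let ?Q = "(\<lambda>j. ev (alt a b j)) ` {..m} \<union> (\<lambda>j. ev (alt b a j)) ` {1..<m}"
  have Q: "ev (alt c d j) \<in> ?Q" if "{c, d} = {a, b}" "j \<le> m" for c d j
  proof -
    have "j = 0 \<or> j = m \<or> j \<in> {1..<m}" using that by auto
    moreover have "c = a \<and> d = b \<or> c = b \<and> d = a" using that by (auto simp: doubleton_eq_iff)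
    moreover have "ev (alt b a m) \<in> ?Q" "ev (alt b a 0) \<in> ?Q" using braid_alt[OF ab m(1)] by force+
    ultimately show ?thesis using that by auto
  qed
  have "\<exists>c d j. {c, d} = {a, b} \<and> j \<le> m \<and> ev x = ev (alt c d j)" if "set x \<subseteq> {a, b}" for x
    using that
  proof (induction x)
    case Nil
    then show ?case by (intro exI[of _ a] exI[of _ b] exI[of _ 0]) auto
  next
    case (Cons e x)
    then obtain c d j where j: "{c, d} = {a, b}" "j \<le> m" "ev x = ev (alt c d j)" by auto
    have e: "e \<in> S" "set x \<subseteq> S" "e = a \<or> e = b" "c \<in> S" "d \<in> S" using Cons ab j by (auto simp: doubleton_eq_iff)
    have cd: "bond X c d = enat m" using j m bond_sym[of a b] ab by (auto simp: doubleton_eq_iff)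
    have ex: "ev (e # x) = e \<cdot> ev (alt c d j)" using e j by (simp add: lm_ev flip: j(3))
    have down: "\<exists>c d j. {c, d} = {a, b} \<and> j \<le> m \<and> ev (e # x) = ev (alt c d j)"
      if "ev x = ev (alt c d (Suc i))" "e = tp c d (Suc i)" "{c, d} = {a, b}" "Suc i \<le> m" "c \<in> S" "d \<in> S" for c d i
    proof -
      have "ev (e # x) = e \<cdot> e \<cdot> ev (alt c d i)" using e that by (simp add: lm_ev alt_Suc flip: lm_ev)
      then show ?thesis using that e by (intro exI[of _ c] exI[of _ d] exI[of _ i]) auto
    qed
    show ?case
    proof (cases j)
      case 0
      then show ?thesis using e j ex m(2)
        by (intro exI[of _ e] exI[of _ "if e = a then b else a"] exI[of _ 1])
          (auto simp: lm_ev alt_eq_rev)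
    next
      case (Suc i)
      have "e = c \<or> e = d" using e j by (auto simp: doubleton_eq_iff)
      then have "e = tp c d (Suc i) \<or> e = tp c d (Suc j)" using Suc by (auto simp: tp_def)
      then show ?thesis
      proof
        assume "e = tp c d (Suc i)"
        then show ?thesis using down[of c d i] j e Suc by simp
      next
        assume et: "e = tp c d (Suc j)"
        show ?thesis
        proof (cases "j = m")
          case True
          then have "ev x = ev (alt d c (Suc i))" using j braid_alt[of c d m] cd e Suc by simp
          moreover have "e = tp d c (Suc i)" using et Suc by (simp add: tp_swap)
          ultimately show ?thesis using down[of d c i] j e Suc by (simp add: insert_commute)
        next
          case False
          then show ?thesis using j et ex e
            by (intro exI[of _ c] exI[of _ d] exI[of _ "Suc j"]) (auto simp: alt_Suc lm_ev)
        qed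
      qed
    qed
  qed
  then show "parabolic X a b \<subseteq> ?Q" unfolding parabolic_words[OF ab] using Q by (metis (no_types, lifting) image_subsetI mem_Collect_eq)
  have "set (alt c d j) \<subseteq> {c, d}" for c d :: 's and j using set_altl[of c d j] by (simp add: alt_eq_rev)
  then show "?Q \<subseteq> parabolic X a b" unfolding parabolic_words[OF ab] by (fastforce simp: insert_commute)
qed

lemma parabolic_inj:
  assumes ab: "a \<in> S" "b \<in> S" "a \<noteq> b" and m: "bond X a b = enat m"
  shows "inj_on (\<lambda>j. ev (alt a b j)) {..m}"
    and "(\<lambda>j. ev (alt a b j)) ` {..m} \<inter> (\<lambda>j. ev (alt b a j)) ` {1..<m} = {}"
proof -
  have l: "len (ev (alt a b j)) = j" "len (ev (alt b a j)) = j" if "j \<le> m" for j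
    using len_alt[of a b j] len_alt[of b a j] ab m bond_sym[of a b] that by auto
  show "inj_on (\<lambda>j. ev (alt a b j)) {..m}" by (rule inj_on_inverseI[of _ len]) (use l in auto)
  have "ev (alt a b i) \<noteq> ev (alt b a j)" if "i \<le> m" "j \<in> {1..<m}" for i j
  proof
    assume eq: "ev (alt a b i) = ev (alt b a j)"
    then have "i = j" using l[of i] l[of j] that by simp
    then have "ev (altl a b i) = ev (altl b a i)" using eq unfolding alt_eq_rev rev_altl by (auto split: if_splits)
    then show False using altl_coincide[of a b i] ab m that \<open>i = j\<close> by simp
  qed
  then show "(\<lambda>j. ev (alt a b j)) ` {..m} \<inter> (\<lambda>j. ev (alt b a j)) ` {1..<m} = {}" by blast
qed

lemma longest_iff:
  assumes ab: "a \<in> S" "b \<in> S" "\<not> commuting X a b"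
  shows "finite (parabolic X a b) \<and> is_longest (parabolic X a b) w0 \<longleftrightarrow>
    (\<exists>m. bond X a b = enat m \<and> w0 = ev (alt a b m))"
proof (cases "bond X a b")
  case (enat m)
  have ne: "a \<noteq> b" using ab noncommuting_neq by blast
  have "3 \<le> m" using ab enat noncommuting_bond by blast
  then have P: "parabolic X a b = (\<lambda>j. ev (alt a b j)) ` {..m} \<union> (\<lambda>j. ev (alt b a j)) ` {1..<m}"
    using parabolic_alt ab enat by simp
  have l: "len (ev (alt a b j)) = j" "len (ev (alt b a j)) = j" if "j \<le> m" for j
    using len_alt[of a b j] len_alt[of b a j] ab ne enat bond_sym[of a b] that by auto
  have "is_longest (parabolic X a b) w0 \<longleftrightarrow> w0 = ev (alt a b m)"
  proof
    assume w0: "is_longest (parabolic X a b) w0"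
    have "len (ev (alt a b m)) \<le> len w0" using w0 unfolding is_longest_def P by blast
    then show "w0 = ev (alt a b m)" using w0 l unfolding is_longest_def P by auto
  qed (use l in \<open>auto simp: is_longest_def P\<close>)
  then show ?thesis using enat by (simp add: P)
next
  case infinity
  have ne: "a \<noteq> b" using ab noncommuting_neq by blast
  have "\<not> finite (parabolic X a b)"
  proof
    assume "finite (parabolic X a b)"
    moreover have "range (\<lambda>j. ev (alt a b j)) \<subseteq> parabolic X a b"
      using set_altl[of a b] unfolding parabolic_words[OF ab(1,2)] by (auto simp: alt_eq_rev)
    moreover have "inj (\<lambda>j. ev (alt a b j))"
      by (rule inj_on_inverseI[of _ len]) (use len_alt[of a b] ab ne infinity in simp)
    ultimately show False by (meson finite_subset range_inj_infinite)
  qed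
  then show ?thesis using infinity by simp
qed

lemma ev_Nil_mul [simp]: "w \<in> W \<Longrightarrow> ev [] \<odot> w = w" "w \<in> W \<Longrightarrow> w \<odot> ev [] = w"
  by (simp_all flip: one_ev)

subsection \<open>Fully commutative elements\<close>

lemma complex_iff:
  "complex X w \<longleftrightarrow> (\<exists>x1\<in>W. \<exists>x2\<in>W. \<exists>a\<in>S. \<exists>b\<in>S. \<exists>m. \<not> commuting X a b \<and> bond X a b = enat m \<and>
     w = x1 \<odot> ev (alt a b m) \<odot> x2 \<and> len w = len x1 + m + len x2)"
proof -
  have l: "len (ev (alt a b m)) = m" if "a \<in> S" "b \<in> S" "\<not> commuting X a b" "bond X a b = enat m" for a b m
    using that len_alt[of a b m] noncommuting_neq by auto
  show ?thesis unfolding complex_def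
    apply (intro bex_cong refl)
    using longest_iff l by (metis (no_types, lifting))
qed

lemma complexE:
  assumes "complex X w"
  obtains x1 x2 a b m where "x1 \<in> W" "x2 \<in> W" "a \<in> S" "b \<in> S" "\<not> commuting X a b" "bond X a b = enat m"
     "w = x1 \<odot> ev (alt a b m) \<odot> x2" "len w = len x1 + m + len x2"
  using assms[unfolded complex_iff] by (elim bexE exE conjE)

lemma complexI:
  assumes "x1 \<in> W" "x2 \<in> W" "a \<in> S" "b \<in> S" "\<not> commuting X a b" "bond X a b = enat m"
     "w = x1 \<odot> ev (alt a b m) \<odot> x2" "len w = len x1 + m + len x2"
  shows "complex X w"
  unfolding complex_iff using assms by (intro bexI exI conjI)

lemma complexI_left:
  assumes "z \<in> W" "a \<in> S" "b \<in> S" "\<not> commuting X a b" "bond X a b = enat m"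
     "w = ev (alt a b m) \<odot> z" "len w = m + len z"
  shows "complex X w"
proof (rule complexI[of "ev []" z a b m])
  show "w = ev [] \<odot> ev (alt a b m) \<odot> z" using assms by simp
qed (use assms in auto)

abbreviation Wc where "Wc \<equiv> W_c X"

lemma Wc_iff: "w \<in> W \<Longrightarrow> w \<in> Wc \<longleftrightarrow> \<not> complex X w"
  and Wc_not_complex: "w \<in> Wc \<Longrightarrow> \<not> complex X w"
  by (simp_all add: W_c_def)

lemma Wc_W [simp, dest]: "w \<in> Wc \<Longrightarrow> w \<in> W"
  by (simp add: W_c_def)

lemma complex_context:
  assumes "x \<in> W" "y \<in> W" "u \<in> W" "complex X u" "len (x \<odot> u \<odot> y) = len x + len u + len y"
  shows "complex X (x \<odot> u \<odot> y)"
proof -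
  obtain x1 x2 a b m where u: "x1 \<in> W" "x2 \<in> W" "a \<in> S" "b \<in> S" "\<not> commuting X a b" "bond X a b = enat m"
     "u = x1 \<odot> ev (alt a b m) \<odot> x2" "len u = len x1 + m + len x2"
    by (rule complexE[OF assms(4)])
  have eq: "x \<odot> u \<odot> y = (x \<odot> x1) \<odot> ev (alt a b m) \<odot> (x2 \<odot> y)"
    using u assms by (simp add: G.m_assoc)
  have "len (ev (alt a b m)) = m" using len_alt[of a b m] noncommuting_neq u by auto
  then have "len (x \<odot> u \<odot> y) \<le> len (x \<odot> x1) + m + len (x2 \<odot> y)"
    unfolding eq using len_mul_le[of "(x \<odot> x1) \<odot> ev (alt a b m)" "x2 \<odot> y"] len_mul_le[of "x \<odot> x1" "ev (alt a b m)"] u assms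
    by simp
  moreover have "len (x \<odot> x1) \<le> len x + len x1" "len (x2 \<odot> y) \<le> len x2 + len y"
    using len_mul_le u assms by auto
  ultimately have "len (x \<odot> u \<odot> y) = len (x \<odot> x1) + m + len (x2 \<odot> y)" using u assms by linarith
  then show ?thesis using complexI[of "x \<odot> x1" "x2 \<odot> y" a b m, OF _ _ _ _ _ _ eq] u assms by simp
qed

lemma Wc_right_factor:
  assumes "x \<in> W" "u \<in> W" "x \<odot> u \<in> Wc" "len (x \<odot> u) = len x + len u" shows "u \<in> Wc"
proof -
  have "x \<odot> u \<odot> ev [] = x \<odot> u" using assms by simp
  moreover have "len (ev []) = 0" "ev [] \<in> W" by simp_all
  ultimately show ?thesis using complex_context[of x "ev []" u] assms by (simp only: Wc_iff G.m_closed) auto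
qed

lemma Wc_lm: assumes "s \<in> S" "w \<in> Wc" "dl s w" shows "s \<cdot> w \<in> Wc"
  by (rule Wc_right_factor[of "gen X s"]) (use assms dl_len[of s w] len_gen in auto)

lemma iv_Wc: assumes "w \<in> Wc" shows "iv w \<in> Wc"
proof -
  have "complex X (iv w)" if w: "complex X w" "w \<in> W" for w
  proof -
    obtain x1 x2 a b m where u: "x1 \<in> W" "x2 \<in> W" "a \<in> S" "b \<in> S" "\<not> commuting X a b" "bond X a b = enat m"
       "w = x1 \<odot> ev (alt a b m) \<odot> x2" "len w = len x1 + m + len x2"
      using w by (meson complexE)
    have "iv (ev (alt a b m)) = ev (alt a b m)"
      using u braid[of a b m] by (simp add: iv_ev alt_eq_rev rev_altl)
    then have "iv w = iv x2 \<odot> ev (alt a b m) \<odot> iv x1"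
      using u by (simp add: G.inv_mult_group G.m_assoc)
    moreover have "len (iv w) = len (iv x2) + m + len (iv x1)" using u w by simp
    ultimately show ?thesis using complexI[of "iv x2" "iv x1" a b m "iv w"] u by simp
  qed
  from this[of "iv w"] show ?thesis
    using assms Wc_iff[of "iv w"] Wc_not_complex[of w] Wc_W[of w] by (metis G.inv_closed G.inv_inv)
qed

lemma descent_exists: assumes "w \<in> W" "w \<noteq> ev []" obtains s where "s \<in> S" "dl s w"
proof -
  obtain x where x: "set x \<subseteq> S" "w = ev x" "length x = len w" using assms by (metis reduced_word)
  then obtain s y where y: "x = s # y" using assms by (cases x) auto
  then have "s \<cdot> w = ev y" using x lm_lm[of s "ev y"] by (simp flip: lm_ev)
  then have "dl s w" using len_le[of y] x y by (simp add: dl_def)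
  then show ?thesis using that x y by auto
qed

lemma alt_prefix:
  assumes "a \<in> S" "b \<in> S" "z \<in> W" "w = ev (alt a b (Suc k)) \<odot> z" "len w = Suc k + len z"
  shows "dl (tp a b (Suc k)) w" "tp a b (Suc k) \<cdot> w = ev (alt a b k) \<odot> z" "len (ev (alt a b k) \<odot> z) = k + len z"
proof -
  let ?t = "tp a b (Suc k)"
  have w: "w = ?t \<cdot> (ev (alt a b k) \<odot> z)" using assms by (simp add: alt_Suc G.m_assoc flip: lm_ev)
  then show *: "?t \<cdot> w = ev (alt a b k) \<odot> z" using assms by simp
  have le: "len (ev (alt a b k) \<odot> z) \<le> k + len z"
    using len_mul_le[of "ev (alt a b k)" z] len_le[of "alt a b k"] assms by simp
  then show "dl ?t w" using assms * by (simp add: dl_def)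
  then show "len (ev (alt a b k) \<odot> z) = k + len z"
    using dl_len[of ?t w] assms * by simp
qed

text \<open>As \<open>alt\<close> is anchored on the right, its first letter depends on the parity
  of m. The braid relation allows the names to be swapped so that the two words for the longest
  element begin with a and with b.\<close>

lemma two_descents_oriented:
  assumes "a \<in> S" "b \<in> S" "a \<noteq> b" "w \<in> W" "dl a w" "dl b w"
  obtains c d m z where "bond X a b = enat m" "z \<in> W" "w = ev (alt c d m) \<odot> z" "len w = m + len z"
    "{c, d} = {a, b}" "tp c d m = a" "tp d c m = b" "2 \<le> m"
proof -
  obtain m z where m: "bond X a b = enat m" "z \<in> W" "w = ev (alt a b m) \<odot> z" "len w = m + len z"
    using two_descents assms by metis
  have m2: "2 \<le> m" using bond_ge2[of a b] assms m by (simp add: numeral_eq_enat)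
  have b: "ev (alt a b m) = ev (alt b a m)" using braid_alt m assms by simp
  show ?thesis
  proof (cases "odd m")
    case True
    then show ?thesis by (intro that[of m z a b]) (use m m2 in \<open>simp_all add: tp_def\<close>)
  next
    case False
    then show ?thesis by (intro that[of m z b a]) (use m b m2 in \<open>simp_all add: tp_def insert_commute\<close>)
  qed
qed

lemma descent_chain:
  assumes "a \<in> S" "b \<in> S" "a \<noteq> b" "w \<in> W" "dl a w" "dl b w"
  shows "dl b (a \<cdot> w)" "bond X a b \<noteq> 2 \<Longrightarrow> dl a (b \<cdot> a \<cdot> w)"
proof -
  obtain c d m z where m: "bond X a b = enat m" "z \<in> W" "w = ev (alt c d m) \<odot> z" "len w = m + len z"
    "{c, d} = {a, b}" "tp c d m = a" "tp d c m = b" "2 \<le> m"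
    using two_descents_oriented assms by metis
  have cd: "c \<in> S" "d \<in> S" using m assms by (auto simp: doubleton_eq_iff)
  obtain k where k: "m = Suc (Suc k)" using m(8) by (metis add_2_eq_Suc le_Suc_ex)
  note 1 = alt_prefix[of c d z w "Suc k"]
  have t: "tp c d (Suc (Suc k)) = a" "tp c d (Suc k) = b" "tp c d k = a" using m k by (auto simp: tp_def)
  note 2 = alt_prefix[of c d z "a \<cdot> w" k]
  show "dl b (a \<cdot> w)" using 1 2 m k cd t by simp
  assume "bond X a b \<noteq> 2"
  then obtain j where j: "k = Suc j" using m k by (cases k) (auto simp: numeral_eq_enat)
  show "dl a (b \<cdot> a \<cdot> w)" using alt_prefix[of c d z "b \<cdot> a \<cdot> w" j] 1 2 m k j cd t by simp
qed

lemma dl_commute: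
  assumes "a \<in> S" "b \<in> S" "a \<noteq> b" "commuting X a b" "w \<in> W"
  shows "dl b (a \<cdot> w) \<longleftrightarrow> dl b w"
proof -
  have *: "dl b (a \<cdot> w)" if "dl b w" "w \<in> W" for w
  proof (cases "dl a w")
    case True
    then show ?thesis using descent_chain assms that by blast
  next
    case False
    show ?thesis
    proof (rule ccontr)
      assume "\<not> dl b (a \<cdot> w)"
      then have "len (b \<cdot> a \<cdot> w) = len w + 2" using False ndl_len[of b "a \<cdot> w"] ndl_len[of a w] assms that by simp
      moreover have "len (b \<cdot> a \<cdot> w) \<le> len (b \<cdot> w) + 1"
        using len_lm[of a "b \<cdot> w"] assms that commuting_lm[of a b w] by auto
      ultimately show False using that by (simp add: dl_def)
    qed
  qed
  from *[of w] *[of "a \<cdot> w"] show ?thesis using assms by auto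
qed

lemma Wc_descents: assumes "w \<in> Wc" "a \<in> S" "b \<in> S" "dl a w" "dl b w" shows "commuting X a b"
proof (rule ccontr)
  assume n: "\<not> commuting X a b"
  have ab: "a \<noteq> b" using n noncommuting_neq by blast
  have w: "w \<in> W" using assms by blast
  obtain m z where "bond X a b = enat m" "z \<in> W" "w = ev (alt a b m) \<odot> z" "len w = m + len z"
    using two_descents[OF assms(2,3) ab w assms(4,5)] by metis
  then have "complex X w" using complexI_left[of z a b m w] assms n by blast
  then show False using assms by (simp add: Wc_not_complex)
qed

text \<open>Peels letters off x1 in w = x1 w_ab x2. While x1 is nontrivial, one of its descents can
  be removed without losing complexity; once it is trivial, a and b are both descents. This is the
  induction scheme for complex elements.\<close>

lemma complex_cases:
  assumes "complex X w" "w \<in> W"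
  obtains a b where "a \<in> S" "b \<in> S" "\<not> commuting X a b" "dl a w" "dl b w"
  | p where "p \<in> S" "dl p w" "complex X (p \<cdot> w)"
proof -
  obtain x1 x2 a b m where u: "x1 \<in> W" "x2 \<in> W" "a \<in> S" "b \<in> S" "\<not> commuting X a b" "bond X a b = enat m"
     "w = x1 \<odot> ev (alt a b m) \<odot> x2" "len w = len x1 + m + len x2"
    by (rule complexE[OF assms(1)])
  show ?thesis
  proof (cases "x1 = ev []")
    case True
    obtain k where k: "m = Suc k" using noncommuting_bond[of a b m] u by (cases m) auto
    have "w = ev (alt a b m) \<odot> x2" "w = ev (alt b a m) \<odot> x2" "len w = m + len x2"
      using True u braid_alt[of a b m] by simp_all
    then have "dl (tp a b m) w" "dl (tp b a m) w"
      using alt_prefix(1)[of a b x2 w k] alt_prefix(1)[of b a x2 w k] u k by auto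
    then show ?thesis using that(1)[of a b] u tp_cases[of a b m] by metis
  next
    case False
    then obtain p where p: "p \<in> S" "dl p x1" using descent_exists u by metis
    have eq: "p \<cdot> w = (p \<cdot> x1) \<odot> ev (alt a b m) \<odot> x2" using p u by (simp add: G.m_assoc)
    have l: "len x1 = len (p \<cdot> x1) + 1" using p u dl_len by blast
    have "len (p \<cdot> w) \<le> len (p \<cdot> x1) + m + len x2"
      unfolding eq using len_mul_le[of "(p \<cdot> x1) \<odot> ev (alt a b m)" x2] len_mul_le[of "p \<cdot> x1" "ev (alt a b m)"]
        len_le[of "alt a b m"] u p by simp
    then have "dl p w" "len (p \<cdot> w) = len (p \<cdot> x1) + m + len x2"
      using u l len_lm[of p w] p assms by (auto simp: dl_def)
    then show ?thesis using that(2)[of p] complexI[of "p \<cdot> x1" x2 a b m, OF _ _ _ _ _ _ eq] p u by simp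
  qed
qed

text \<open>If su becomes complex, the pair s, t is responsible. A descent b of su not commuting
  with s must be t (\<open>T1\<close>), since otherwise s and t would both be descents of bu, which
  lies in W_c. So either the complex part sits at the left end and involves s, hence t, or a descent
  commuting with s can be stripped off.\<close>

lemma complex_top:
  assumes "u \<in> Wc" "s \<in> S" "t \<in> S" "\<not> commuting X s t" "dl t u" "\<not> dl s u" "complex X (s \<cdot> u)"
  shows "dl t (s \<cdot> u)"
  using assms
proof (induction "len u" arbitrary: u rule: less_induct)
  case less
  let ?w = "s \<cdot> u"
  have uW: "u \<in> W" and w: "?w \<in> W" "dl s ?w" using less.prems dl_lm by auto
  have T1: "b = t" if b: "b \<in> S" "\<not> commuting X s b" "dl b ?w" for b
  proof (rule ccontr)
    assume bt: "b \<noteq> t"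
    have sb: "s \<noteq> b" "bond X s b \<noteq> 2" using b noncommuting_neq commuting_iff[of s b] less.prems by auto
    have "dl b u" "dl s (b \<cdot> u)"
      using descent_chain[of s b ?w] sb b w less.prems uW by auto
    moreover have "commuting X b t" using Wc_descents less.prems b \<open>dl b u\<close> by blast
    then have "dl t (b \<cdot> u)" using dl_commute[of b t u] bt b less.prems uW by blast
    ultimately show False using Wc_descents[of "b \<cdot> u" s t] Wc_lm[of b u] less.prems b by blast
  qed
  show ?case
  proof (rule complex_cases[OF less.prems(7) w(1)])
    fix a b assume ab: "a \<in> S" "b \<in> S" "\<not> commuting X a b" "dl a ?w" "dl b ?w"
    have "\<not> commuting X s a \<or> \<not> commuting X s b"
    proof (rule ccontr)
      assume c: "\<not> ?thesis"
      then have "s \<noteq> a" "s \<noteq> b" using ab commuting_sym by blast+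
      then have "dl a u" "dl b u" using c dl_commute less.prems ab uW by blast+
      then show False using Wc_descents less.prems ab by blast
    qed
    then show ?thesis using T1 ab by blast
  next
    fix p assume p: "p \<in> S" "dl p ?w" "complex X (p \<cdot> ?w)"
    have ps: "p \<noteq> s" using p less.prems uW by (auto simp: Wc_not_complex)
    show ?thesis
    proof (cases "commuting X s p")
      case False
      then show ?thesis using T1 p by blast
    next
      case True
      then have pu: "dl p u" using dl_commute[of s p u] ps p less.prems uW by blast
      have pt: "p \<noteq> t" "commuting X p t" using True less.prems Wc_descents pu p by blast+
      have c: "p \<cdot> ?w = s \<cdot> p \<cdot> u" using True commuting_lm[of s p u] p less.prems uW by simp
      have "dl t (s \<cdot> p \<cdot> u)"
      proof (rule less.hyps)
        show "len (p \<cdot> u) < len u" using pu by (simp add: dl_def)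
        show "p \<cdot> u \<in> Wc" using Wc_lm p pu less.prems by blast
        show "dl t (p \<cdot> u)" using dl_commute[of p t u] pt p less.prems uW by blast
        show "\<not> dl s (p \<cdot> u)" using dl_commute[of p s u] ps True commuting_sym p less.prems uW by blast
      qed (use less.prems p c in auto)
      then show ?thesis using dl_commute[of p t ?w] pt p less.prems w c by simp
    qed
  qed
qed

text \<open>A descent b of w commutes with both r and s (\<open>T2\<close>): if it failed to commute
  with s, say, then rw would have the noncommuting descents b, s, or sw the noncommuting descents b,
  r. So a complex w has no noncommuting pair of descents, and a descent can be stripped off until a
  contradiction appears.\<close>

lemma Wc_of_commuting_quotients:
  assumes "w \<in> W" "r \<in> S" "s \<in> S" "r \<noteq> s" "commuting X r s" "dl r w" "dl s w" "s \<cdot> w \<in> Wc" "r \<cdot> w \<in> Wc"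
  shows "w \<in> Wc"
  using assms
proof (induction "len w" arbitrary: w rule: less_induct)
  case less
  note [simp] = less.prems(2,3)
  have T2: False if "b \<in> S" "dl b w" "\<not> commuting X s b" "r \<in> S" "s \<in> S" "r \<noteq> s" "commuting X r s" "dl r w" "dl s w"
      "s \<cdot> w \<in> Wc" "r \<cdot> w \<in> Wc" for r s b
  proof -
    have sb: "s \<noteq> b" using that noncommuting_neq by blast
    have br: "b \<noteq> r" using that commuting_sym by blast
    show False
    proof (cases "commuting X r b")
      case True
      then have "dl b (r \<cdot> w)" "dl s (r \<cdot> w)" using dl_commute that br less.prems by metis+
      then show False using Wc_descents that by blast
    next
      case False
      have "dl b (s \<cdot> w)" using descent_chain(1)[of s b w] that sb less.prems by blast
      moreover have "dl r (s \<cdot> w)" using dl_commute[of s r w] that commuting_sym less.prems by metis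
      ultimately show False using Wc_descents that False by blast
    qed
  qed
  show ?case
  proof (rule ccontr)
    assume "w \<notin> Wc"
    then have cw: "complex X w" using less.prems Wc_iff by blast
    have rs: "commuting X s r" "s \<noteq> r" using less.prems commuting_sym by auto
    have T: "commuting X s b \<and> commuting X r b" if "b \<in> S" "dl b w" for b
      using T2[of b s r] T2[of b r s] that less.prems rs by blast
    show False
    proof (rule complex_cases[OF cw less.prems(1)])
      fix a b assume ab: "a \<in> S" "b \<in> S" "\<not> commuting X a b" "dl a w" "dl b w"
      then have "s \<noteq> a" "s \<noteq> b" using T commuting_sym by blast+
      then have "dl a (s \<cdot> w)" "dl b (s \<cdot> w)" using T dl_commute ab less.prems by blast+
      then show False using Wc_descents ab less.prems by blast
    next
      fix p assume p: "p \<in> S" "dl p w" "complex X (p \<cdot> w)"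
      have ps: "p \<noteq> s" "p \<noteq> r" using p less.prems by (auto simp: Wc_not_complex)
      have cs: "commuting X p s" "commuting X p r" "commuting X s p" "commuting X r p" using T p commuting_sym by blast+
      have d: "dl r (p \<cdot> w)" "dl s (p \<cdot> w)" "dl p (s \<cdot> w)" "dl p (r \<cdot> w)"
        using dl_commute[of p r w] dl_commute[of p s w] dl_commute[of s p w] dl_commute[of r p w] ps cs p less.prems by auto
      have "p \<cdot> w \<in> Wc"
      proof (rule less.hyps)
        show "len (p \<cdot> w) < len w" using p by (simp add: dl_def)
        show "s \<cdot> p \<cdot> w \<in> Wc" "r \<cdot> p \<cdot> w \<in> Wc"
          using Wc_lm[of p "s \<cdot> w"] Wc_lm[of p "r \<cdot> w"] d p less.prems cs commuting_lm[of s p w] commuting_lm[of r p w] by auto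
      qed (use less.prems p d in auto)
      then show False using p by (simp add: Wc_not_complex)
    qed
  qed
qed

lemma complex_commuting_down:
  assumes "u \<in> Wc" "r \<in> S" "s \<in> S" "commuting X r s" "dl r u" "\<not> dl s u" "s \<cdot> u \<notin> Wc"
  shows "s \<cdot> r \<cdot> u \<notin> Wc"
proof
  assume *: "s \<cdot> r \<cdot> u \<in> Wc"
  have u: "u \<in> W" "r \<noteq> s" "commuting X s r" using assms commuting_sym by auto
  have "s \<cdot> u \<in> Wc"
    by (rule Wc_of_commuting_quotients[of _ r s])
      (use u assms * dl_commute[of s r u] dl_lm[of s u] commuting_lm[of r s u] in auto)
  then show False using assms by blast
qed

lemma short_Wc: assumes "w \<in> W" "len w < 3" shows "w \<in> Wc"
proof (rule ccontr)
  assume "w \<notin> Wc"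
  then have "complex X w" using assms Wc_iff by blast
  then show False
  proof (rule complexE)
    fix x1 x2 a b m
    assume "a \<in> S" "b \<in> S" "\<not> commuting X a b" "bond X a b = enat m" "len w = len x1 + m + len x2"
    then show False using noncommuting_bond[of a b m] assms by simp
  qed
qed

lemma one_Wc [simp]: "ev [] \<in> Wc"
  by (rule short_Wc) auto

subsection \<open>Strings\<close>

text \<open>The string proper consists of the indices 0 < k < m. Index 0 is x itself and index m, if
  finite, is the complex element w_ab x; both serve as boundary positions of the recursions.\<close>

definition ystr :: "'s \<Rightarrow> 's \<Rightarrow> nat \<Rightarrow> 's list set \<Rightarrow> 's list set" where
  "ystr a b k x = ev (alt a b k) \<odot> x"

text \<open>\<open>x\<close> lies in W^I for I = {a, b}: the coset representative over which the two
  strings of the pair are built.\<close>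

definition base :: "'s \<Rightarrow> 's \<Rightarrow> 's list set \<Rightarrow> bool" where
  "base a b x \<longleftrightarrow> a \<in> S \<and> b \<in> S \<and> \<not> commuting X a b \<and> x \<in> W \<and> \<not> dl a x \<and> \<not> dl b x"

lemma base_sym: "base a b x \<longleftrightarrow> base b a x"
  by (auto simp: base_def commuting_sym)

lemma baseD: "base a b x \<Longrightarrow> a \<in> S" "base a b x \<Longrightarrow> b \<in> S" "base a b x \<Longrightarrow> x \<in> W"
  "base a b x \<Longrightarrow> a \<noteq> b" "base a b x \<Longrightarrow> \<not> commuting X a b"
  "base a b x \<Longrightarrow> tp a b k \<in> S"
  using noncommuting_neq by (auto simp: base_def tp_def)

lemma ystr_W [simp]: "base a b x \<Longrightarrow> ystr a b k x \<in> W"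
  by (auto simp: ystr_def base_def)

lemma ystr_0 [simp]: "base a b x \<Longrightarrow> ystr a b 0 x = x"
  by (auto simp: ystr_def base_def simp flip: one_ev)

lemma ystr_Suc: "base a b x \<Longrightarrow> ystr a b (Suc k) x = tp a b (Suc k) \<cdot> ystr a b k x"
  by (auto simp: ystr_def base_def alt_Suc G.m_assoc simp flip: lm_ev)

lemma tp_ystr: "base a b x \<Longrightarrow> tp a b (Suc k) \<cdot> ystr a b (Suc k) x = ystr a b k x"
  by (simp add: ystr_Suc baseD)

text \<open>The additivity of length on W_I times W^I. A premature descent a next to the leading
  letter b would split off the longest element of W_I (\<open>two_descents\<close>); cancelling the
  alternating word already present leaves a further letter that is a descent of x.\<close>

lemma len_altl_base:
  assumes "base a b x" "enat k \<le> bond X a b"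
  shows "len (ev (altl a b k) \<odot> x) = k + len x"
  using assms
proof (induction k arbitrary: a b)
  case 0
  then show ?case using baseD by (simp flip: one_ev)
next
  case (Suc k)
  note ab = baseD[OF Suc.prems(1)]
  have sym: "bond X b a = bond X a b" using bond_sym ab by auto
  have k: "enat k < bond X a b" using Suc.prems Suc_ile_eq by auto
  then have k': "enat k \<le> bond X b a" by (simp add: sym)
  let ?y = "ev (altl b a k) \<odot> x"
  have IH: "len ?y = k + len x" using Suc.IH[of b a] Suc.prems k' base_sym by blast
  have yW: "?y \<in> W" using ab by auto
  have "\<not> dl a ?y"
  proof
    assume d: "dl a ?y"
    show False
    proof (cases k)
      case 0
      then show False using d Suc.prems ab by (simp add: base_def flip: one_ev)
    next
      case (Suc j)
      have "b \<cdot> ?y = ev (altl a b j) \<odot> x"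
        using ab Suc by (simp add: G.m_assoc flip: lm_ev)
      then have "dl b ?y" using len_mul_le[of "ev (altl a b j)" x] len_le[of "altl a b j"] ab IH Suc by (simp add: dl_def)
      then obtain m z where m: "bond X b a = enat m" "z \<in> W" "?y = ev (alt b a m) \<odot> z" "len ?y = m + len z"
        using two_descents[of b a ?y] d ab yW by metis
      have "ev (alt b a m) = ev (altl b a m)" using braid[of b a m] m ab by (simp add: alt_eq_rev rev_altl)
      moreover define v where "v = (if even k then altl b a (m - k) else altl a b (m - k))"
      moreover have "altl b a m = altl b a k @ v"
        using altl_add[of b a k "m - k"] m k sym by (auto simp: v_def)
      moreover have v: "set v \<subseteq> S" using ab by (auto simp: v_def)
      ultimately have "?y = ev (altl b a k) \<odot> (ev v \<odot> z)"
        using m ab by (simp add: G.m_assoc flip: mul_ev)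
      then have x: "x = ev v \<odot> z" using ab m v by simp
      obtain i where i: "m - k = Suc i" using k m sym by (metis Suc_diff_Suc enat_ord_simps(2))
      define c where "c = (if even k then b else a)"
      define v' where "v' = (if even k then altl a b i else altl b a i)"
      have v': "v = c # v'" "set v' \<subseteq> S" "length v' = i" "c \<in> S" using i ab by (auto simp: v_def v'_def c_def)
      have "c \<cdot> x = ev v' \<odot> z" using x v' m by (simp add: G.m_assoc flip: lm_ev)
      then have "len (c \<cdot> x) \<le> i + len z" using len_mul_le[of "ev v'" z] len_le[of v'] v' m by simp
      then have "dl c x" using IH m i by (simp add: dl_def)
      then show False using Suc.prems by (auto simp: base_def c_def split: if_splits)
    qed
  qed
  then have "len (a \<cdot> ?y) = Suc k + len x" using ndl_len ab yW IH by simp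
  then show ?case using ab by (simp add: G.m_assoc flip: lm_ev)
qed

lemma len_ystr:
  assumes "base a b x" "enat k \<le> bond X a b" shows "len (ystr a b k x) = k + len x"
  using len_altl_base[OF assms] len_altl_base[of b a x k] assms base_sym bond_sym[of a b] baseD[OF assms(1)]
  by (auto simp: ystr_def alt_eq_rev rev_altl)

lemma ystr_descents:
  assumes "base a b x" "enat k < bond X a b"
  shows "0 < k \<Longrightarrow> dl (tp a b k) (ystr a b k x)" "\<not> dl (tp a b (Suc k)) (ystr a b k x)"
proof -
  have le: "enat k \<le> bond X a b" "enat (Suc k) \<le> bond X a b" using assms Suc_ile_eq by auto
  show "dl (tp a b k) (ystr a b k x)" if k: "0 < k"
  proof -
    obtain j where j: "k = Suc j" using k by (cases k) auto
    then have "enat j \<le> bond X a b" using le by (meson enat_ord_simps(1) le_SucI order.trans order_refl)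
    then show ?thesis using j tp_ystr[OF assms(1), of j] len_ystr[OF assms(1)] le by (simp add: dl_def)
  qed
  show "\<not> dl (tp a b (Suc k)) (ystr a b k x)"
    using len_ystr[OF assms(1)] le by (simp add: dl_def flip: ystr_Suc[OF assms(1)])
qed

lemma ystr_Wc_Suc:
  assumes b: "base a b x" and k: "enat (Suc k) < bond X a b" "0 < k" "ystr a b k x \<in> Wc"
  shows "ystr a b (Suc k) x \<in> Wc"
proof (rule ccontr)
  assume "ystr a b (Suc k) x \<notin> Wc"
  then have "complex X (tp a b (Suc k) \<cdot> ystr a b k x)"
    using b Wc_iff[of "ystr a b (Suc k) x"] ystr_W[OF b, of "Suc k"] ystr_Suc[OF b, of k] by metis
  moreover have "enat k < bond X a b" using k by (meson Suc_ile_eq less_imp_le)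
  moreover have "\<not> commuting X (tp a b (Suc k)) (tp a b k)"
    using baseD[OF b] commuting_sym by (auto simp: tp_def)
  ultimately have "dl (tp a b k) (ystr a b (Suc k) x)"
    using complex_top[of "ystr a b k x" "tp a b (Suc k)" "tp a b k"] k ystr_descents[OF b, of k] baseD[OF b]
    by (simp add: ystr_Suc b)
  moreover have "tp a b (Suc (Suc k)) = tp a b k" by (simp add: tp_def)
  ultimately show False using ystr_descents(2)[OF b k(1)] by simp
qed

lemma ystr_Wc_pred:
  assumes b: "base a b x" and k: "enat (Suc k) < bond X a b" "ystr a b (Suc k) x \<in> Wc"
  shows "ystr a b k x \<in> Wc"
  using Wc_lm[OF baseD(6)[OF b] k(2) ystr_descents(1)[OF b k(1)]] tp_ystr[OF b, of k] by simp

text \<open>A string lies in W_c entirely or not at all. Going down, descents preserve W_c; going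
  up, \<open>complex_top\<close> would make the previous letter a descent again, which cannot happen
  below index m. The known index i is positive, as x may be in W_c while the string over it is
  not.\<close>

lemma ystr_Wc:
  assumes b: "base a b x" and i: "enat i < bond X a b" "0 < i" "ystr a b i x \<in> Wc" and k: "enat k < bond X a b"
  shows "ystr a b k x \<in> Wc"
proof -
  have "ystr a b j x \<in> Wc \<longleftrightarrow> ystr a b (Suc j) x \<in> Wc" if "0 < j" "enat (Suc j) < bond X a b" for j
    using ystr_Wc_Suc[OF b that(2,1)] ystr_Wc_pred[OF b that(2)] by blast
  then have *: "ystr a b (Suc j) x \<in> Wc \<longleftrightarrow> ystr a b 1 x \<in> Wc" if "enat (Suc j) < bond X a b" for j
    using that
  proof (induction j)
    case (Suc j)
    then have "enat (Suc j) < bond X a b" by (meson Suc_ile_eq less_imp_le)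
    then show ?case using Suc by blast
  qed simp
  obtain i' where i': "i = Suc i'" using i by (cases i) auto
  show ?thesis
  proof (cases k)
    case 0
    have one: "enat 1 < bond X a b" using bond_ge2[of a b] baseD[OF b] by (cases "bond X a b") (auto simp: numeral_eq_enat)
    have "ystr a b (Suc 0) x \<in> Wc" using *[of i'] i i' by simp
    then have "ystr a b 0 x \<in> Wc" using ystr_Wc_pred[OF b, of 0] one by simp
    then show ?thesis using 0 by simp
  next
    case (Suc k')
    then show ?thesis using *[of k'] *[of i'] i i' k by simp
  qed
qed

lemma ystr_top_notin_Wc:
  assumes b: "base a b x" and m: "bond X a b = enat m" shows "ystr a b m x \<notin> Wc"
proof -
  have "complex X (ystr a b m x)"
    by (rule complexI_left[of x a b m]) (use b m len_ystr[OF b, of m] in \<open>auto simp: ystr_def base_def\<close>)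
  then show ?thesis using Wc_not_complex by blast
qed

text \<open>Stripping p and q alternately while they are descents ends in an element of W^I. The
  index stays below m because the element at index m is complex.\<close>

lemma string_of:
  assumes "z \<in> Wc" "p \<in> S" "q \<in> S" "\<not> commuting X p q" "dl p z"
  obtains c d k x where "{c, d} = {p, q}" "base c d x" "0 < k" "enat k < bond X p q" "z = ystr c d k x" "tp c d k = p"
proof -
  have "\<exists>c d k x. {c, d} = {p, q} \<and> base c d x \<and> 0 < k \<and> enat k < bond X p q \<and> z = ystr c d k x \<and> tp c d k = p"
    using assms
  proof (induction "len z" arbitrary: z p q rule: less_induct)
    case less
    have zW: "z \<in> W" using less.prems by blast
    have pq: "p \<noteq> q" "bond X q p = bond X p q" using less.prems noncommuting_neq bond_sym by blast+
    have 1: "enat 1 < bond X p q" using bond_ge2[of p q] less.prems pq by (cases "bond X p q") (auto simp: numeral_eq_enat)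
    let ?z = "p \<cdot> z"
    have z': "?z \<in> Wc" "\<not> dl p ?z" "len ?z < len z" "p \<cdot> ?z = z"
      using Wc_lm[of p z] less.prems dl_lm[of p z] zW by (simp_all add: dl_def)
    show ?case
    proof (cases "dl q ?z")
      case False
      then have b: "base p q ?z" using less.prems z' zW by (simp add: base_def)
      then have "z = ystr p q (Suc 0) ?z" using z' by (simp add: ystr_Suc tp_def)
      then show ?thesis using 1 b
        by (intro exI[of _ p] exI[of _ q] exI[of _ "Suc 0"] exI[of _ ?z] conjI) (simp_all add: tp_def)
    next
      case True
      then obtain c d k x where k: "{c, d} = {q, p}" "base c d x" "0 < k" "enat k < bond X q p" "?z = ystr c d k x" "tp c d k = q"
        using less.hyps[of ?z q p] z' less.prems commuting_sym by blast
      have t: "tp c d (Suc k) = p" using k pq by (auto simp: tp_def doubleton_eq_iff split: if_splits)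
      have z: "z = ystr c d (Suc k) x" using z' k t by (simp add: ystr_Suc)
      have "enat (Suc k) \<noteq> bond X p q"
      proof
        assume "enat (Suc k) = bond X p q"
        moreover have "bond X c d = bond X p q" using k pq by (auto simp: doubleton_eq_iff)
        ultimately show False using ystr_top_notin_Wc[OF k(2), of "Suc k"] z less.prems by simp
      qed
      moreover have "enat (Suc k) \<le> bond X p q" using k(4) pq Suc_ile_eq by metis
      ultimately have "enat (Suc k) < bond X p q" using order_less_le by blast
      then show ?thesis using z t k by (intro exI[of _ c] exI[of _ d] exI[of _ "Suc k"] exI[of _ x]) auto
    qed
  qed
  then show ?thesis using that by blast
qed

end

subsection \<open>Linear maps on free modules\<close>

abbreviation lookup where "lookup \<equiv> Poly_Mapping.lookup"
abbreviation keys where "keys \<equiv> Poly_Mapping.keys"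

lemma lookup_scale [simp]: "lookup (scale a h) w = a * lookup h w"
  by (simp add: scale_def Poly_Mapping.map.rep_eq when_def)

lemma lookup_T: "lookup (T w) u = (if u = w then 1 else 0)"
  by (simp add: T_def lookup_single when_def)

lemma keys_T [simp]: "keys (T w) = {w}"
  by (simp add: T_def)

lemma scale_simps [simp]:
  "scale a (g + h) = scale a g + scale a h" "scale (a + b) h = scale a h + scale b h"
  "scale a (scale b h) = scale (a * b) h" "scale 1 h = h" "scale 0 h = 0" "scale a 0 = 0"
  "scale a (g - h) = scale a g - scale a h" "scale (a - b) h = scale a h - scale b h"
  "scale (- a) h = - scale a h" "scale a (- h) = - scale a h"
  by (auto intro!: poly_mapping_eqI simp: lookup_add lookup_minus algebra_simps)

lemma scale_sum: "scale a (sum f A) = (\<Sum>x\<in>A. scale a (f x))"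
  by (auto intro!: poly_mapping_eqI simp: lookup_sum sum_distrib_left)

lemma scale_cancel: "a \<noteq> 0 \<Longrightarrow> scale a g = scale a h \<longleftrightarrow> g = h"
  by (metis lookup_scale mult_left_cancel poly_mapping_eqI)

lemma scale_eq_0: "a \<noteq> 0 \<Longrightarrow> scale a g = 0 \<longleftrightarrow> g = 0"
  using scale_cancel[of a g 0] by simp

lemma keys_scale: "keys (scale a h) \<subseteq> keys h"
  by (auto simp: in_keys_iff)

lemma keys_scale_eq: "a \<noteq> 0 \<Longrightarrow> keys (scale a h) = keys h"
  by (auto simp: in_keys_iff)

lemma keys_add_subset: "keys g \<subseteq> A \<Longrightarrow> keys h \<subseteq> A \<Longrightarrow> keys (g + h) \<subseteq> A"
  using Poly_Mapping.keys_add[of g h] by blast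

lemma keys_diff_subset: "keys g \<subseteq> A \<Longrightarrow> keys h \<subseteq> A \<Longrightarrow> keys (g - h :: 's hecke_elt) \<subseteq> A"
  by (intro subsetI) (metis (no_types, lifting) in_keys_iff lookup_minus diff_self subsetD)

lemma keys_sum_subset: "(\<And>i. i \<in> I \<Longrightarrow> keys (f i) \<subseteq> A) \<Longrightarrow> keys (sum f I) \<subseteq> A"
  by (induction I rule: infinite_finite_induct) (simp_all add: keys_add_subset)

text \<open>One type serves several free modules: the Hecke algebra, the monomial module in which
  \<open>T w\<close> stands for b_w, and coordinate vectors with respect to other bases.
  \<open>lin f\<close> extends to any of them a map given on basis elements.\<close>

definition lin :: "('s list set \<Rightarrow> 's hecke_elt) \<Rightarrow> 's hecke_elt \<Rightarrow> 's hecke_elt" where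
  "lin f h = (\<Sum>w\<in>keys h. scale (lookup h w) (f w))"

definition linear_op :: "('s hecke_elt \<Rightarrow> 's hecke_elt) \<Rightarrow> bool" where
  "linear_op F \<longleftrightarrow> (\<forall>g h. F (g + h) = F g + F h) \<and> (\<forall>a h. F (scale a h) = scale a (F h))"

lemma lin_superset: "finite A \<Longrightarrow> keys h \<subseteq> A \<Longrightarrow> lin f h = (\<Sum>w\<in>A. scale (lookup h w) (f w))"
  unfolding lin_def by (rule sum.mono_neutral_left) (auto simp: in_keys_iff)

lemma linear_lin: "linear_op (lin f)"
proof -
  have "lin f (g + h) = lin f g + lin f h" for g h
  proof -
    have "keys (g + h) \<subseteq> keys g \<union> keys h" by (rule Poly_Mapping.keys_add)
    then show ?thesis
      using lin_superset[of "keys g \<union> keys h" _ f] by (simp add: lookup_add sum.distrib)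
  qed
  moreover have "lin f (scale a h) = scale a (lin f h)" for a h
    using lin_superset[of "keys h" "scale a h" f] keys_scale[of a h] by (simp add: lin_def scale_sum)
  ultimately show ?thesis by (simp add: linear_op_def)
qed

lemma linear_opD:
  assumes "linear_op F"
  shows "F (g + h) = F g + F h" "F (scale a h) = scale a (F h)" "F 0 = 0" "F (- h) = - F h" "F (g - h) = F g - F h"
proof -
  have a: "F (g + h) = F g + F h" for g h using assms by (auto simp: linear_op_def)
  then show "F (g + h) = F g + F h" .
  have s: "F (scale a h) = scale a (F h)" for a h using assms by (auto simp: linear_op_def)
  then show "F (scale a h) = scale a (F h)" .
  from s[of 0 0] show "F 0 = 0" by simp
  have m: "F (- h) = - F h" for h
    using s[of "- 1" h] by simp
  then show "F (- h) = - F h" .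
  show "F (g - h) = F g - F h" using a[of g "- h"] m by simp
qed

lemma linear_sum: "linear_op F \<Longrightarrow> F (sum f A) = (\<Sum>x\<in>A. F (f x))"
  by (induction A rule: infinite_finite_induct) (auto simp: linear_opD)

lemma lin_T [simp]: "lin f (T w) = f w"
  by (simp add: lin_def lookup_T)

lemma lin_id: "lin T h = h"
  by (rule poly_mapping_eqI) (auto simp: lin_def lookup_sum lookup_T in_keys_iff if_distrib[of "(*) _"] cong: if_cong)

lemma linear_eq_lin: assumes "linear_op F" shows "F h = lin (\<lambda>w. F (T w)) h"
proof -
  have "F h = F (lin T h)" by (simp add: lin_id)
  also have "\<dots> = lin (\<lambda>w. F (T w)) h" unfolding lin_def by (simp add: linear_sum[OF assms] linear_opD(2)[OF assms])
  finally show ?thesis .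
qed

lemma linear_ext:
  assumes "linear_op F" "linear_op G" "\<And>w. w \<in> keys h \<Longrightarrow> F (T w) = G (T w)" shows "F h = G h"
  by (subst linear_eq_lin[OF assms(1)], subst linear_eq_lin[OF assms(2)]) (simp add: lin_def assms(3))

lemma linear_comp: "linear_op F \<Longrightarrow> linear_op G \<Longrightarrow> linear_op (\<lambda>h. F (G h))"
  and linear_id: "linear_op (\<lambda>h. h)"
  and linear_scale: "linear_op F \<Longrightarrow> linear_op (\<lambda>h. scale a (F h))"
  and linear_add: "linear_op F \<Longrightarrow> linear_op G \<Longrightarrow> linear_op (\<lambda>h. F h + G h)"
  and linear_diff: "linear_op F \<Longrightarrow> linear_op G \<Longrightarrow> linear_op (\<lambda>h. F h - G h)"
  and linear_zero: "linear_op (\<lambda>h. 0)"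
  by (auto simp: linear_op_def algebra_simps)

lemma linear_sums: "(\<And>i. i \<in> I \<Longrightarrow> linear_op (F i)) \<Longrightarrow> linear_op (\<lambda>h. \<Sum>i\<in>I. F i h)"
  by (induction I rule: infinite_finite_induct) (auto intro: linear_zero linear_add)

lemma linear_foldr: "(\<And>s. linear_op (b s)) \<Longrightarrow> linear_op (foldr b x)"
  by (induction x) (auto simp: linear_op_def)

lemma lin_cong: "(\<And>w. w \<in> keys h \<Longrightarrow> f w = g w) \<Longrightarrow> lin f h = lin g h"
  by (simp add: lin_def)

lemma keys_lin: "(\<And>w. w \<in> keys h \<Longrightarrow> keys (f w) \<subseteq> A) \<Longrightarrow> keys (lin f h) \<subseteq> A"
  unfolding lin_def by (rule keys_sum_subset) (meson keys_scale order_trans)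

lemma v_pow_add: "v_pow a * v_pow b = v_pow (a + b)"
  by (simp add: v_pow_def mult_single)

lemma v_pow_0 [simp]: "v_pow 0 = 1"
  by (simp add: v_pow_def)

lemma v_pow_inverse [simp]: "v_pow a * v_pow (- a) = 1" "v_pow (- a) * v_pow a = 1"
  by (simp_all add: v_pow_add)

lemma v_pow_ne_0 [simp]: "v_pow a \<noteq> 0"
  by (simp add: v_pow_def)

lemma lookup_v_pow_mult: "lookup (v_pow a * p) n = lookup p (n - a)"
proof -
  have "Sum_any (\<lambda>q. lookup p q when n = a + q) = Sum_any (\<lambda>q. lookup p q when q = n - a)"
    by (intro Sum_any.cong when_cong) auto
  moreover have "Sum_any (\<lambda>l. lookup (v_pow a) l * G l) = Sum_any (\<lambda>l. G l when l = a)" for G :: "int \<Rightarrow> int"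
    by (intro Sum_any.cong) (auto simp: v_pow_def lookup_single when_def)
  ultimately show ?thesis unfolding times_poly_mapping.rep_eq prod_fun_def by simp
qed

lemma lookup_delta_mult: "lookup (delta * p) n = lookup p (n - 1) + lookup p (n + 1)"
  by (simp add: delta_def distrib_right lookup_add lookup_v_pow_mult)

lemma delta_ne_0 [simp]: "delta \<noteq> 0"
proof
  assume "delta = 0"
  then have "lookup (delta * 1) 1 = 0" by simp
  then show False unfolding lookup_delta_mult by (simp add: lookup_one)
qed

subsection \<open>Chebyshev relations\<close>

text \<open>The coefficient of x^j in x U_{k-1}(x/2), with U the Chebyshev polynomials of the second
  kind: x, x^2, x^3 - x, and so on. The extra factor x makes j the number of letters of an
  alternating word.\<close>

fun cheb :: "nat \<Rightarrow> nat \<Rightarrow> int" where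
  "cheb 0 j = 0"
| "cheb (Suc 0) j = (if j = 1 then 1 else 0)"
| "cheb (Suc (Suc k)) j = (if j = 0 then 0 else cheb (Suc k) (j - 1)) - cheb k j"

lemma cheb_gt: "k < j \<Longrightarrow> cheb k j = 0"
  by (induction k j rule: cheb.induct) auto

lemma cheb_0_right [simp]: "cheb k 0 = 0"
  by (induction k "0::nat" rule: cheb.induct) auto

lemma cheb_diag: "cheb (Suc k) (Suc k) = 1"
  by (induction k) (auto simp: cheb_gt)

lemma cheb_parity: "odd (k + j) \<Longrightarrow> cheb k j = 0"
  by (induction k j rule: cheb.induct) auto

text \<open>\<open>chebop b k a c\<close> is the Chebyshev polynomial in the operators \<open>b a\<close> and \<open>b c\<close> whose monomials
  all end in \<open>b a\<close>; on \<open>TL(X)\<close> it is left multiplication by the image of \<open>C'\<^sub>w\<close>, \<open>w = \<dots>aca\<close> with \<open>k\<close> letters.\<close>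

definition chebop :: "('s \<Rightarrow> 's hecke_elt \<Rightarrow> 's hecke_elt) \<Rightarrow> nat \<Rightarrow> 's \<Rightarrow> 's \<Rightarrow> 's hecke_elt \<Rightarrow> 's hecke_elt" where
  "chebop b k a c h = (\<Sum>j\<le>k. scale (of_int (cheb k j)) (foldr b (alt a c j) h))"

lemma chebop_0 [simp]: "chebop b 0 a c h = 0" by (simp add: chebop_def)
lemma chebop_1: "chebop b (Suc 0) a c h = b a h" by (simp add: chebop_def alt_Suc tp_def)

lemma chebop_superset: "k \<le> n \<Longrightarrow> chebop b k a c h = (\<Sum>j\<le>n. scale (of_int (cheb k j)) (foldr b (alt a c j) h))"
  unfolding chebop_def by (rule sum.mono_neutral_left) (auto simp: cheb_gt)

lemma linear_chebop: "(\<And>s. linear_op (b s)) \<Longrightarrow> linear_op (chebop b k a c)"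
  unfolding chebop_def by (intro linear_sums linear_scale linear_foldr)

lemma chebop_rec:
  assumes "\<And>s. linear_op (b s)" "0 < k"
  shows "b (tp a c (Suc k)) (chebop b k a c h) = chebop b (Suc k) a c h + chebop b (k - 1) a c h"
proof -
  obtain i where k: "k = Suc i" using assms by (cases k) auto
  have "b (tp a c (Suc k)) (chebop b k a c h) = (\<Sum>j\<le>k. scale (of_int (cheb k j)) (foldr b (alt a c (Suc j)) h))"
  proof -
    \<comment> \<open>Only words with j of the same parity as k have nonzero coefficient, and these
      all begin with the same letter, so one new letter fits in front of all of them.\<close>
    have *: "scale (of_int (cheb k j)) (b (tp a c (Suc k)) g) = scale (of_int (cheb k j)) (b (tp a c (Suc j)) g)" for j g
      using cheb_parity[of k j] by (cases "odd (k + j)") (auto simp: tp_def)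
    show ?thesis unfolding chebop_def using assms
      by (simp add: linear_sum linear_opD alt_Suc *)
  qed
  also have "\<dots> = (\<Sum>j\<le>Suc k. scale (of_int (if j = 0 then 0 else cheb k (j - 1))) (foldr b (alt a c j) h))"
    by (subst sum.atMost_Suc_shift) simp
  also have "\<dots> = (\<Sum>j\<le>Suc k. scale (of_int (cheb (Suc k) j)) (foldr b (alt a c j) h) + scale (of_int (cheb i j)) (foldr b (alt a c j) h))"
  proof (rule sum.cong)
    fix j
    have "(if j = 0 then 0 else cheb k (j - 1)) = cheb (Suc k) j + cheb i j" by (simp add: k)
    then show "scale (of_int (if j = 0 then 0 else cheb k (j - 1))) (foldr b (alt a c j) h) =
      scale (of_int (cheb (Suc k) j)) (foldr b (alt a c j) h) + scale (of_int (cheb i j)) (foldr b (alt a c j) h)"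
      by (simp only: of_int_add scale_simps(2))
  qed simp
  also have "\<dots> = chebop b (Suc k) a c h + chebop b (k - 1) a c h"
    using chebop_superset[of i "Suc k" b a c h] k unfolding sum.distrib by (simp only: chebop_def diff_Suc_1)
  finally show ?thesis .
qed

lemma foldr_alt_Suc: "foldr b (alt a c (Suc j)) h = foldr b (alt c a j) (b a h)"
  by (simp add: alt.simps(2))

lemma chebop_same:
  assumes "\<And>s. linear_op (b s)" "b a (b a h) = scale delta (b a h)"
  shows "chebop b k a c (b a h) = scale delta (chebop b k a c h)"
proof -
  have "scale (of_int (cheb k j)) (foldr b (alt a c j) (b a h)) = scale delta (scale (of_int (cheb k j)) (foldr b (alt a c j) h))" for j
    using assms linear_foldr[of b] by (cases j) (auto simp: foldr_alt_Suc linear_opD mult.commute)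
  then show ?thesis by (simp add: chebop_def scale_sum)
qed

text \<open>A word ...aca followed by c is an alternating word ending in c with one more letter. Its
  first letter depends only on the parity of k, so it factors out on the left.\<close>

lemma chebop_other:
  assumes "\<And>s. linear_op (b s)"
  shows "chebop b k a c (b c h) = b (tp c a (Suc k)) (chebop b k c a h)"
proof -
  have "scale (of_int (cheb k j)) (foldr b (alt a c j) (b c h)) = scale (of_int (cheb k j)) (b (tp c a (Suc k)) (foldr b (alt c a j) h))" for j
  proof (cases "odd (k + j)")
    case False
    then have "tp c a (Suc k) = tp c a (Suc j)" by (auto simp: tp_def)
    then show ?thesis by (simp add: alt_Suc flip: foldr_alt_Suc)
  qed (simp add: cheb_parity)
  then show ?thesis using assms by (simp add: chebop_def linear_sum linear_opD)
qed

subsection \<open>The bar involution on Laurent polynomials\<close>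

lemma lookup_laurent_bar [simp]: "lookup (laurent_bar a) n = lookup a (- n)"
  by (simp add: laurent_bar_def Poly_Mapping.map_key.rep_eq)

lemma lookup_of_int_mult [simp]: "lookup (of_int c * (a :: laurent)) n = c * lookup a n"
proof -
  have "of_int c * a = Poly_Mapping.map ((*) c) a" by (simp add: mult_map_scale_conv_mult flip: single_of_int)
  then show ?thesis by (simp add: Poly_Mapping.map.rep_eq when_def)
qed

lemma laurent_expand: "a = (\<Sum>k\<in>keys a. of_int (lookup a k) * v_pow k)"
proof (rule poly_mapping_eqI)
  fix n
  show "lookup a n = lookup (\<Sum>k\<in>keys a. of_int (lookup a k) * v_pow k) n"
    by (simp add: lookup_sum v_pow_def lookup_single when_def if_distrib[of "(*) _"] in_keys_iff cong: if_cong)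
qed

lemma laurent_bar_simps [simp]:
  "laurent_bar (a + b) = laurent_bar a + laurent_bar b" "laurent_bar 0 = 0" "laurent_bar (- a) = - laurent_bar a"
  "laurent_bar (a - b) = laurent_bar a - laurent_bar b" "laurent_bar (of_int c * a) = of_int c * laurent_bar a"
  "laurent_bar 1 = 1" "laurent_bar (laurent_bar a) = a" "laurent_bar (v_pow n) = v_pow (- n)"
  by (auto intro!: poly_mapping_eqI simp: lookup_add lookup_minus lookup_one v_pow_def lookup_single when_def)

lemma laurent_bar_of_int [simp]: "laurent_bar (of_int c) = of_int c"
  using laurent_bar_simps(5)[of c 1] by simp

lemma laurent_bar_sum: "laurent_bar (sum f A) = (\<Sum>x\<in>A. laurent_bar (f x))"
  by (induction A rule: infinite_finite_induct) auto

lemma laurent_bar_mult: "laurent_bar (a * b) = laurent_bar a * laurent_bar b"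
proof -
  have v: "laurent_bar (v_pow k * b) = v_pow (- k) * laurent_bar b" for k b
    by (rule poly_mapping_eqI) (simp add: lookup_v_pow_mult)
  have "a * b = (\<Sum>k\<in>keys a. of_int (lookup a k) * (v_pow k * b))"
    by (subst laurent_expand[of a]) (simp add: sum_distrib_right mult.assoc)
  then have "laurent_bar (a * b) = (\<Sum>k\<in>keys a. of_int (lookup a k) * (v_pow (- k) * laurent_bar b))"
    by (simp only: laurent_bar_sum laurent_bar_simps v)
  also have "\<dots> = laurent_bar (\<Sum>k\<in>keys a. of_int (lookup a k) * v_pow k) * laurent_bar b"
    by (simp add: laurent_bar_sum sum_distrib_right mult.assoc)
  finally show ?thesis by (simp flip: laurent_expand)
qed

lemma laurent_bar_delta [simp]: "laurent_bar delta = delta"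
  by (simp add: delta_def)

context cox
begin

subsection \<open>Generators acting on the monomial basis\<close>

text \<open>The free module on \<open>W\<^sub>c\<close> becomes a \<open>TL(X)\<close>-module in which \<open>T w\<close> stands for the monomial
  \<open>b\<^sub>s\<^sub>1 \<cdots> b\<^sub>s\<^sub>n\<close>, \<open>s\<^sub>1 \<cdots> s\<^sub>n\<close> reduced for \<open>w\<close>.  If \<open>sw\<close> is complex then \<open>b\<^sub>s\<close> is moved past
  a left descent \<open>r\<close> of \<open>w\<close> until the Chebyshev relation of \<open>s\<close> and \<open>r\<close> applies on the left.\<close>

definition pick :: "'s list set \<Rightarrow> 's" where
  "pick u = (SOME r. r \<in> S \<and> dl r u)"

text \<open>The Chebyshev relation of s and r, whose leading coefficient is 1, solved for its
  monomial with m letters. Here c and d are s and r, named so that \<open>alt c d m\<close> begins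
  with s; the element u is taken to be index m - 1 of the string, and the inverse of its alternating
  part recovers the base of that string. The readable form is \<open>cand_eq\<close>.\<close>

definition cand :: "'s \<Rightarrow> 's \<Rightarrow> 's list set \<Rightarrow> 's hecke_elt" where
  "cand s r u = (let m = the_enat (bond X s r); c = (if odd m then s else r); d = (if odd m then r else s) in
     - (\<Sum>j<m. scale (of_int (cheb m j)) (T (ev (alt c d j) \<odot> (iv (ev (alt c d (m - 1))) \<odot> u)))))"

text \<open>The guard \<open>len y < len u\<close> only serves termination.\<close>

function bt :: "'s \<Rightarrow> 's list set \<Rightarrow> 's hecke_elt" where
  "bt s u = (if s \<notin> S \<or> u \<notin> Wc then 0 else if dl s u then scale delta (T u)
     else if s \<cdot> u \<in> Wc then T (s \<cdot> u)
     else let r = pick u in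
       if r \<in> S \<and> dl r u then
         if commuting X r s
         then \<Sum>y\<in>{y\<in>keys (bt s (r \<cdot> u)). len y < len u}. scale (lookup (bt s (r \<cdot> u)) y) (bt r y)
         else cand s r u
       else 0)"
  by pat_completeness auto
termination by (relation "measure (len \<circ> snd)") (auto simp: dl_def)

declare bt.simps [simp del]

definition bop :: "'s \<Rightarrow> 's hecke_elt \<Rightarrow> 's hecke_elt" where "bop s = lin (bt s)"

lemma linear_bop: "linear_op (bop s)" by (simp add: bop_def linear_lin)

lemma bop_T [simp]: "bop s (T u) = bt s u" by (simp add: bop_def)

lemma bt_outside: "s \<notin> S \<or> u \<notin> Wc \<Longrightarrow> bt s u = 0"
  and bt_dl: "s \<in> S \<Longrightarrow> u \<in> Wc \<Longrightarrow> dl s u \<Longrightarrow> bt s u = scale delta (T u)"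
  and bt_up: "s \<in> S \<Longrightarrow> u \<in> Wc \<Longrightarrow> \<not> dl s u \<Longrightarrow> s \<cdot> u \<in> Wc \<Longrightarrow> bt s u = T (s \<cdot> u)"
  by (subst bt.simps; simp)+

lemma bop_dl: assumes "s \<in> S" "keys h \<subseteq> {y\<in>Wc. dl s y}" shows "bop s h = scale delta h"
  by (rule linear_ext[OF linear_bop linear_scale[OF linear_id]]) (use assms bt_dl in auto)

lemma cand_eq:
  assumes b: "base c d x" and m: "bond X c d = enat m"
  shows "cand (tp c d m) (tp d c m) (ystr c d (m - 1) x) = - (\<Sum>j<m. scale (of_int (cheb m j)) (T (ystr c d j x)))"
proof -
  note cd = baseD[OF b]
  have "bond X (tp c d m) (tp d c m) = enat m" using m bond_sym cd by (auto simp: tp_def)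
  moreover have "(if odd m then tp c d m else tp d c m) = c" "(if odd m then tp d c m else tp c d m) = d"
    by (auto simp: tp_def)
  moreover have "iv (ev (alt c d (m - 1))) \<odot> ystr c d (m - 1) x = x"
    using cd by (simp add: ystr_def flip: G.m_assoc)
  ultimately show ?thesis by (simp only: cand_def Let_def the_enat.simps ystr_def)
qed

lemma top_decomposition:
  assumes "u \<in> Wc" "s \<in> S" "r \<in> S" "\<not> commuting X s r" "dl r u" "\<not> dl s u" "s \<cdot> u \<notin> Wc"
  obtains c d m x where "base c d x" "bond X c d = enat m" "3 \<le> m" "{c, d} = {s, r}" "u = ystr c d (m - 1) x"
    "s = tp c d m" "r = tp d c m"
proof -
  have uW: "u \<in> W" "s \<noteq> r" using assms noncommuting_neq by auto
  have cx: "complex X (s \<cdot> u)" using assms uW Wc_iff[of "s \<cdot> u"] by auto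
  have d: "dl r (s \<cdot> u)" "dl s (s \<cdot> u)" using complex_top[OF assms(1-6) cx] dl_lm assms uW by auto
  obtain c d m z where m: "bond X s r = enat m" "z \<in> W" "s \<cdot> u = ev (alt c d m) \<odot> z" "len (s \<cdot> u) = m + len z"
    "{c, d} = {s, r}" "tp c d m = s" "tp d c m = r" "2 \<le> m"
    using two_descents_oriented[of s r "s \<cdot> u"] d assms uW by (metis lm_W)
  have cd: "c \<in> S" "d \<in> S" "\<not> commuting X c d" "bond X c d = enat m"
    using m assms commuting_sym bond_sym[of s r] by (auto simp: doubleton_eq_iff)
  obtain k where k: "m = Suc k" using m by (cases m) auto
  have u: "u = ystr c d (m - 1) z"
    using alt_prefix(2)[of c d z "s \<cdot> u" k] m cd k lm_lm[of s u] assms(2) uW by (simp add: ystr_def del: lm_lm)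
  \<comment> \<open>The longest element can be written so as to end in e. A descent e of z would
    cancel against it and make su too short.\<close>
  have nd: "\<not> dl e z" if "{e, f} = {c, d}" "ev (alt e f m) = ev (alt c d m)" for e f
  proof
    assume e: "dl e z"
    have ef: "e \<in> S" "f \<in> S" using that cd by (auto simp: doubleton_eq_iff)
    have "s \<cdot> u = ev (alt f e k) \<odot> (e \<cdot> z)"
    proof -
      have "ev (alt e f m) = ev (alt f e k) \<odot> gen X e" using ef by (simp add: k alt.simps(2) gen_ev mul_ev)
      then show ?thesis using m(2,3) that(2) ef by (simp add: G.m_assoc)
    qed
    then have "len (s \<cdot> u) \<le> k + len (e \<cdot> z)"
      using len_mul_le[of "ev (alt f e k)" "e \<cdot> z"] len_le[of "alt f e k"] ef m by simp
    then show False using m k e by (simp add: dl_def)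
  qed
  have "base c d z" using nd[of c d] nd[of d c] braid_alt[of c d m] cd m by (auto simp: base_def insert_commute)
  then show ?thesis using that[of c d z m] cd m u noncommuting_bond[of c d m] by metis
qed

lemma ystr_commute:
  assumes b: "base c d x" and r: "r \<in> S" "r \<noteq> c" "r \<noteq> d" "commuting X r c" "commuting X r d"
  shows "base c d (r \<cdot> x)" "r \<cdot> ystr c d k x = ystr c d k (r \<cdot> x)" "dl r (ystr c d k x) \<longleftrightarrow> dl r x"
proof -
  note cd = baseD[OF b]
  show b': "base c d (r \<cdot> x)"
    using b r dl_commute[of r c x] dl_commute[of r d x] by (auto simp: base_def)
  have t: "tp c d k \<noteq> r" "commuting X (tp c d k) r" "commuting X r (tp c d k)" for k
    using r commuting_sym by (auto simp: tp_def)
  show "r \<cdot> ystr c d k x = ystr c d k (r \<cdot> x)"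
  proof (induction k)
    case (Suc k)
    have "r \<cdot> ystr c d (Suc k) x = tp c d (Suc k) \<cdot> r \<cdot> ystr c d k x"
      unfolding ystr_Suc[OF b] using commuting_lm[of r "tp c d (Suc k)" "ystr c d k x"] b cd r t by simp
    then show ?case using Suc ystr_Suc[OF b'] by simp
  qed (use b b' in simp)
  show "dl r (ystr c d k x) \<longleftrightarrow> dl r x"
  proof (induction k)
    case (Suc k)
    then show ?case unfolding ystr_Suc[OF b]
      using dl_commute[of "tp c d (Suc k)" r "ystr c d k x"] b cd r t by simp
  qed (use b in simp)
qed

lemma foldr_bop_alt:
  assumes b: "base c d x" and c: "c \<cdot> x \<in> Wc" and j: "enat j < bond X c d"
  shows "foldr bop (alt c d j) (T x) = T (ystr c d j x)"
proof -
  note cd = baseD[OF b]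
  have one: "enat 1 < bond X c d"
    using bond_ge2[of c d] cd by (cases "bond X c d") (auto simp: numeral_eq_enat)
  have "ystr c d 1 x \<in> Wc" using c b by (simp add: ystr_Suc tp_def)
  then have y: "ystr c d j x \<in> Wc" if "enat j < bond X c d" for j using ystr_Wc[OF b one] that by simp
  show ?thesis using j
  proof (induction j)
    case (Suc j)
    then have j: "enat j < bond X c d" by (meson Suc_ile_eq less_imp_le)
    have "bt (tp c d (Suc j)) (ystr c d j x) = T (ystr c d (Suc j) x)"
      using bt_up[of "tp c d (Suc j)" "ystr c d j x"] y[OF j] y[OF Suc.prems] ystr_descents(2)[OF b j] cd ystr_Suc[OF b, of j]
      by simp
    then show ?case using Suc j by (simp add: alt_Suc)
  qed (use b in simp)
qed

text \<open>All monomials below the leading one are honest basis elements of the string. So the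
  Chebyshev relation holds at the base x exactly if the value of b_s at index m - 1 is the
  candidate; this links \<open>chebyshev_inv\<close> to \<open>support_inv\<close>.\<close>

lemma chebop_bop_eq:
  assumes b: "base c d x" and c: "c \<cdot> x \<in> Wc" and m: "bond X c d = enat m"
  shows "chebop bop m c d (T x) = bt (tp c d m) (ystr c d (m - 1) x) - cand (tp c d m) (tp d c m) (ystr c d (m - 1) x)"
proof -
  obtain k where k: "m = Suc k" using noncommuting_bond[of c d m] baseD[OF b] m by (cases m) auto
  have f: "foldr bop (alt c d j) (T x) = T (ystr c d j x)" if "j < m" for j
    using foldr_bop_alt[OF b c, of j] that m by simp
  have "chebop bop m c d (T x) = (\<Sum>j<m. scale (of_int (cheb m j)) (T (ystr c d j x))) + foldr bop (alt c d m) (T x)"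
    unfolding chebop_def k using f by (simp add: k lessThan_Suc_atMost[symmetric] cheb_diag del: foldr.simps)
  also have "foldr bop (alt c d m) (T x) = bt (tp c d m) (ystr c d (m - 1) x)"
    using f[of k] k by (simp add: alt_Suc)
  finally show ?thesis unfolding cand_eq[OF b m] by simp
qed

text \<open>Each letter stripped from the string commutes with r, so
  \<open>complex_commuting_down\<close> keeps the product with r complex down to the base.\<close>

lemma complex_ystr_down:
  assumes b: "base c d x" and r: "r \<in> S" "r \<noteq> c" "r \<noteq> d" "commuting X r c" "commuting X r d" "\<not> dl r x"
    and k: "enat k < bond X c d" "ystr c d k x \<in> Wc" "r \<cdot> ystr c d k x \<notin> Wc"
  shows "r \<cdot> x \<notin> Wc"
  using k
proof (induction k)
  case (Suc k)
  let ?t = "tp c d (Suc k)"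
  have k: "enat k < bond X c d" using Suc.prems by (meson Suc_ile_eq less_imp_le)
  have t: "?t \<in> S" "commuting X ?t r" using r baseD[OF b] commuting_sym by (auto simp: tp_def)
  have "r \<cdot> ?t \<cdot> ystr c d (Suc k) x \<notin> Wc"
    using complex_commuting_down[of "ystr c d (Suc k) x" ?t r] Suc.prems t r ystr_descents(1)[OF b Suc.prems(1)]
      ystr_commute(3)[OF b r(1-5)] by simp
  then show ?case using Suc.IH[OF k ystr_Wc_pred[OF b Suc.prems(1,2)]] tp_ystr[OF b, of k] by simp
qed (use b in simp)

text \<open>The three invariants of the joint induction. Their length bounds look different but fit
  together: b_s raises length by at most one, so each invariant concerns exactly elements of length
  up to n + 1. The last clause says that the value of \<open>bt\<close> does not depend on the
  descent chosen by \<open>pick\<close>.\<close>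

definition support_inv :: "nat \<Rightarrow> bool" where
  "support_inv n \<longleftrightarrow> (\<forall>u\<in>Wc. len u \<le> n \<longrightarrow> (\<forall>s\<in>S.
     keys (bt s u) \<subseteq> {y\<in>Wc. dl s y \<and> len y \<le> len u + 1} \<and>
     (\<not> dl s u \<longrightarrow> s \<cdot> u \<notin> Wc \<longrightarrow> (\<forall>y\<in>keys (bt s u). len y < len u) \<and>
       (\<forall>r\<in>S. dl r u \<longrightarrow> bt s u = (if commuting X r s then bop r (bt s (r \<cdot> u)) else cand s r u)))))"

definition commute_inv :: "nat \<Rightarrow> bool" where
  "commute_inv n \<longleftrightarrow> (\<forall>u\<in>Wc. len u < n \<longrightarrow> (\<forall>r\<in>S. \<forall>s\<in>S. commuting X r s \<longrightarrow> bop r (bt s u) = bop s (bt r u)))"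

definition chebyshev_inv :: "nat \<Rightarrow> bool" where
  "chebyshev_inv n \<longleftrightarrow> (\<forall>u\<in>Wc. \<forall>a\<in>S. \<forall>c\<in>S. \<forall>m. \<not> commuting X a c \<longrightarrow> bond X a c = enat m \<longrightarrow> len u + m \<le> n + 1 \<longrightarrow>
     chebop bop m a c (T u) = 0)"

lemma support_inv_keys: "support_inv n \<Longrightarrow> u \<in> Wc \<Longrightarrow> len u \<le> n \<Longrightarrow> s \<in> S \<Longrightarrow> keys (bt s u) \<subseteq> {y\<in>Wc. dl s y \<and> len y \<le> len u + 1}"
  and support_inv_less: "support_inv n \<Longrightarrow> u \<in> Wc \<Longrightarrow> len u \<le> n \<Longrightarrow> s \<in> S \<Longrightarrow> \<not> dl s u \<Longrightarrow> s \<cdot> u \<notin> Wc \<Longrightarrow> y \<in> keys (bt s u) \<Longrightarrow> len y < len u"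
  and support_inv_eq: "support_inv n \<Longrightarrow> u \<in> Wc \<Longrightarrow> len u \<le> n \<Longrightarrow> s \<in> S \<Longrightarrow> \<not> dl s u \<Longrightarrow> s \<cdot> u \<notin> Wc \<Longrightarrow> r \<in> S \<Longrightarrow> dl r u
     \<Longrightarrow> bt s u = (if commuting X r s then bop r (bt s (r \<cdot> u)) else cand s r u)"
  unfolding support_inv_def by blast+

lemma support_inv_bop_keys:
  assumes "support_inv n" "s \<in> S" "keys h \<subseteq> {y\<in>Wc. len y \<le> k}" "k \<le> n"
  shows "keys (bop s h) \<subseteq> {y\<in>Wc. dl s y \<and> len y \<le> k + 1}"
  unfolding bop_def
proof (rule keys_lin)
  fix w assume "w \<in> keys h"
  then have "w \<in> Wc" "len w \<le> k" using assms by auto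
  then show "keys (bt s w) \<subseteq> {y\<in>Wc. dl s y \<and> len y \<le> k + 1}"
    using support_inv_keys[OF assms(1), of w s] assms by auto
qed

lemma support_inv_bop_bop:
  assumes "support_inv n" "s \<in> S" "keys h \<subseteq> {y\<in>Wc. len y \<le> n}" shows "bop s (bop s h) = scale delta (bop s h)"
  using bop_dl[OF assms(2)] support_inv_bop_keys[OF assms order.refl] by blast

lemma commute_inv_bop:
  assumes "commute_inv n" "r \<in> S" "s \<in> S" "commuting X r s" "keys h \<subseteq> {y\<in>Wc. len y < n}"
  shows "bop r (bop s h) = bop s (bop r h)"
  by (rule linear_ext) (use assms in \<open>auto simp: commute_inv_def intro: linear_comp linear_bop\<close>)

lemma chebyshev_inv_chebop:
  assumes "chebyshev_inv n" "a \<in> S" "c \<in> S" "\<not> commuting X a c" "bond X a c = enat m" "keys h \<subseteq> {y\<in>Wc. len y + m \<le> n + 1}"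
  shows "chebop bop m a c h = 0"
  by (rule linear_ext[OF linear_chebop linear_zero]) (use assms linear_bop in \<open>auto simp: chebyshev_inv_def\<close>)

text \<open>The heart is that \<open>Q r\<close>, the value computed through the descent r, is the
  same for all descents r of u. Once this is known, support and length bounds can be read off from
  any convenient r.\<close>

lemma support_inv_Suc:
  assumes i1: "support_inv n" and i2: "commute_inv n" shows "support_inv (Suc n)"
proof -
  have main: "keys (bt s u) \<subseteq> {y\<in>Wc. dl s y \<and> len y < len u} \<and>
    (\<forall>r\<in>S. dl r u \<longrightarrow> bt s u = (if commuting X r s then bop r (bt s (r \<cdot> u)) else cand s r u))"
    if u: "u \<in> Wc" "len u = Suc n" and s: "s \<in> S" "\<not> dl s u" "s \<cdot> u \<notin> Wc" for u s
  proof -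
    have uW: "u \<in> W" using u by blast
    define Q where "Q r = (if commuting X r s then bop r (bt s (r \<cdot> u)) else cand s r u)" for r
    have A: "r \<cdot> u \<in> Wc" "len (r \<cdot> u) = n" "\<not> dl s (r \<cdot> u)" "s \<cdot> r \<cdot> u \<notin> Wc"
        "keys (bt s (r \<cdot> u)) \<subseteq> {y\<in>Wc. dl s y \<and> len y < n}" "r \<noteq> s"
      if r: "r \<in> S" "dl r u" "commuting X r s" for r
    proof -
      show rs: "r \<noteq> s" using r s by auto
      show 1: "r \<cdot> u \<in> Wc" "len (r \<cdot> u) = n" using Wc_lm dl_len[of r u] r u uW by auto
      show 2: "\<not> dl s (r \<cdot> u)" using dl_commute[of r s u] rs r s uW by blast
      show 3: "s \<cdot> r \<cdot> u \<notin> Wc" using complex_commuting_down u r s by blast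
      show "keys (bt s (r \<cdot> u)) \<subseteq> {y\<in>Wc. dl s y \<and> len y < n}"
        using support_inv_keys[OF i1, of "r \<cdot> u" s] support_inv_less[OF i1, of "r \<cdot> u" s] 1 2 3 s by auto
    qed
    have one_comm: "Q r = Q r'" if r: "r \<in> S" "dl r u" "commuting X r s" and r': "r' \<in> S" "dl r' u" for r r'
    proof (cases "r = r'")
      case False
      have rr: "commuting X r r'" "commuting X r' r" using Wc_descents u r r' by blast+
      have d: "dl r' (r \<cdot> u)" using dl_commute[of r r' u] False rr r r' uW by blast
      note Ar = A[OF r]
      have eq: "bt s (r \<cdot> u) = (if commuting X r' s then bop r' (bt s (r' \<cdot> r \<cdot> u)) else cand s r' (r \<cdot> u))"
        using support_inv_eq[OF i1, of "r \<cdot> u" s r'] Ar d r' s by auto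
      show ?thesis
      proof (cases "commuting X r' s")
        case True
        note Ar' = A[OF r' True]
        have d': "dl r (r' \<cdot> u)" using dl_commute[of r' r u] False rr r r' uW by blast
        have eq': "bt s (r' \<cdot> u) = bop r (bt s (r \<cdot> r' \<cdot> u))"
          using support_inv_eq[OF i1, of "r' \<cdot> u" s r] Ar' d' r s by auto
        let ?v = "r' \<cdot> r \<cdot> u"
        have vc: "r \<cdot> r' \<cdot> u = ?v" using commuting_lm rr r r' uW by blast
        have v: "?v \<in> Wc" "len ?v < n" "\<not> dl s ?v" "s \<cdot> ?v \<notin> Wc"
          using Wc_lm[of r' "r \<cdot> u"] dl_len[of r' "r \<cdot> u"] d Ar r' complex_commuting_down[of "r \<cdot> u" r' s] s True
            dl_commute[of r' s "r \<cdot> u"] Ar'(6) uW r by auto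
        have kv: "keys (bt s ?v) \<subseteq> {y\<in>Wc. len y < n}"
          using support_inv_keys[OF i1, of ?v s] support_inv_less[OF i1, of ?v s] v s by fastforce
        show ?thesis unfolding Q_def using r True eq eq' vc commute_inv_bop[OF i2 r(1) r'(1) rr(1) kv] by simp
      next
        case F: False
        have F': "\<not> commuting X s r'" using F commuting_sym by blast
        obtain c d m x where t: "base c d x" "bond X c d = enat m" "3 \<le> m" "{c, d} = {s, r'}" "u = ystr c d (m - 1) x"
          "s = tp c d m" "r' = tp d c m"
          using top_decomposition[OF u(1) s(1) r'(1) F' r'(2) s(2,3)] by metis
        \<comment> \<open>Here r commutes with both letters of the dihedral pair and moves through
          the whole string, so b_r carries the candidate over rx to the candidate over x term by
          term.\<close>
        have rcd: "r \<noteq> c" "r \<noteq> d" "commuting X r c" "commuting X r d"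
          using t(4) r s False rr Ar(6) by (auto simp: doubleton_eq_iff)
        note yc = ystr_commute[OF t(1) r(1) rcd]
        have ru: "r \<cdot> u = ystr c d (m - 1) (r \<cdot> x)" using yc(2) t(5) by simp
        have y1: "ystr c d j x \<in> Wc" if "j < m" for j
          using ystr_Wc[OF t(1), of "m - 1" j] t u that by simp
        have drx: "dl r x" using yc(3) r t(5) by blast
        have y2: "bop r (T (ystr c d j (r \<cdot> x))) = T (ystr c d j x)" if "j < m" for j
        proof -
          have y: "ystr c d j (r \<cdot> x) = r \<cdot> ystr c d j x" using yc(2) by simp
          have "r \<cdot> ystr c d j x \<in> Wc" using Wc_lm[OF r(1) y1[OF that]] yc(3) drx by blast
          moreover have "\<not> dl r (r \<cdot> ystr c d j x)" using dl_lm[of r "ystr c d j x"] yc(3) drx r t(1) by simp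
          ultimately show ?thesis unfolding y using bt_up[of r "r \<cdot> ystr c d j x"] y1[OF that] r t(1) by simp
        qed
        have "Q r = bop r (cand s r' (r \<cdot> u))" unfolding Q_def eq using r F by simp
        also have "\<dots> = bop r (- (\<Sum>j<m. scale (of_int (cheb m j)) (T (ystr c d j (r \<cdot> x)))))"
          using cand_eq[OF yc(1) t(2)] t(6,7) ru by simp
        also have "\<dots> = - (\<Sum>j<m. scale (of_int (cheb m j)) (T (ystr c d j x)))"
          unfolding linear_opD(4)[OF linear_bop] linear_sum[OF linear_bop] linear_opD(2)[OF linear_bop]
          by (intro arg_cong[where f = uminus] sum.cong) (simp_all only: y2 lessThan_iff)
        also have "\<dots> = Q r'" unfolding Q_def using F cand_eq[OF t(1,2)] t(5-7) by simp
        finally show ?thesis .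
      qed
    qed simp
    have eqQ: "Q r = Q r'" if r: "r \<in> S" "dl r u" and r': "r' \<in> S" "dl r' u" for r r'
    proof (cases "commuting X r s \<or> commuting X r' s")
      case True
      then show ?thesis using one_comm r r' by metis
    next
      case False
      \<comment> \<open>Two distinct descents, neither commuting with s, cannot occur: as m(s,r) >
        2, s is a descent of ru, and so is r', contradicting that ru lies in W_c.\<close>
      have "r = r'"
      proof (rule ccontr)
        assume ne: "r \<noteq> r'"
        have F: "\<not> commuting X s r" "s \<noteq> r" "bond X s r \<noteq> 2"
          using False commuting_sym noncommuting_neq commuting_iff[of s r] s r by blast+
        have cx: "complex X (s \<cdot> u)" using s uW Wc_iff[of "s \<cdot> u"] by auto
        have "dl r (s \<cdot> u)" "dl s (s \<cdot> u)" using complex_top[OF u(1) s(1) r(1) F(1) r(2) s(2) cx] dl_lm s uW by auto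
        then have "dl s (r \<cdot> u)" using descent_chain(2)[of s r "s \<cdot> u"] F s r uW by simp
        moreover have "dl r' (r \<cdot> u)" using dl_commute[of r r' u] ne Wc_descents[OF u(1)] r r' uW by blast
        ultimately show False using Wc_descents[of "r \<cdot> u" s r'] Wc_lm[of r u] False commuting_sym u r r' s by blast
      qed
      then show ?thesis by simp
    qed
    have "u \<noteq> ev []" using u by auto
    then have pick: "pick u \<in> S \<and> dl (pick u) u"
      unfolding pick_def using descent_exists[OF uW] by (metis (mono_tags, lifting) someI_ex)
    have btQ: "bt s u = Q (pick u)"
    proof (cases "commuting X (pick u) s")
      case True
      have "{y \<in> keys (bt s (pick u \<cdot> u)). len y < len u} = keys (bt s (pick u \<cdot> u))"
        using A(5)[OF _ _ True] pick u by auto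
      then show ?thesis using True pick u s by (subst bt.simps) (simp add: Q_def bop_def lin_def Let_def)
    next
      case False
      then show ?thesis using pick u s by (subst bt.simps) (simp add: Q_def Let_def)
    qed
    have kQ: "keys (Q r) \<subseteq> {y\<in>Wc. dl s y \<and> len y < len u}" if r: "r \<in> S" "dl r u" for r
    proof (cases "commuting X r s")
      case True
      let ?h = "bt s (r \<cdot> u)"
      note Ar = A[OF r True]
      have kh: "keys ?h \<subseteq> {y\<in>Wc. len y \<le> n - 1}" "keys ?h \<subseteq> {y\<in>Wc. len y < n}" "keys ?h \<subseteq> {y\<in>Wc. dl s y}" using Ar(5) by auto
      have k1: "keys (bop r ?h) \<subseteq> {y\<in>Wc. len y \<le> n - 1 + 1}"
        using support_inv_bop_keys[OF i1 r(1) kh(1)] by auto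

      have len: "keys (bop r ?h) \<subseteq> {y\<in>Wc. len y < len u}"
      proof (cases n)
        case 0
        then have "?h = 0" using Ar(5) by (auto simp: keys_eq_empty)
        then show ?thesis by (simp add: linear_opD(3)[OF linear_bop])
      next
        case (Suc k)
        then show ?thesis using k1 u by auto
      qed
      then have len': "keys (bop r ?h) \<subseteq> {y\<in>Wc. len y \<le> n}" using u by auto
      \<comment> \<open>By induction h is supported where s is a descent, so b_s h = delta h.
        Commuting b_s to the front shows that delta times the value lies in the image of b_s;
        cancelling delta gives the support of the value itself.\<close>
      have "scale delta (bop r ?h) = bop r (bop s ?h)"
        using bop_dl[OF s(1) kh(3)] linear_opD(2)[OF linear_bop] by simp
      also have "\<dots> = bop s (bop r ?h)" by (rule commute_inv_bop[OF i2 r(1) s(1) True kh(2)])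
      finally have "keys (scale delta (bop r ?h)) \<subseteq> {y\<in>Wc. dl s y}"
        using support_inv_bop_keys[OF i1 s(1) len'] by auto
      then show ?thesis using len True keys_scale_eq[of delta "bop r ?h"] by (auto simp: Q_def)
    next
      case False
      have F: "\<not> commuting X s r" using False commuting_sym by blast
      obtain c d m x where t: "base c d x" "bond X c d = enat m" "3 \<le> m" "{c, d} = {s, r}" "u = ystr c d (m - 1) x"
        "s = tp c d m" "r = tp d c m"
        using top_decomposition[OF u(1) s(1) r(1) F r(2) s(2,3)] by metis
      have "keys (scale (of_int (cheb m j)) (T (ystr c d j x))) \<subseteq> {y\<in>Wc. dl s y \<and> len y < len u}" if j: "j < m" for j
      proof (cases "cheb m j = 0")
        case False
        then have ev: "even (m + j)" "j \<noteq> 0" using cheb_parity by (auto intro: Nat.gr0I)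
        \<comment> \<open>By parity the index m - 1 has coefficient 0. The remaining j have the
          parity of m, hence leading letter s, and are strictly lower in the string than u.\<close>
        have jm: "j < m - 1" using ev(1) j by (cases "j = m - 1") auto
        have e: "enat j < bond X c d" "enat (m - 1) < bond X c d" using t j by auto
        have tj: "tp c d j = s" using ev t(6) by (auto simp: tp_def)
        have "ystr c d j x \<in> Wc" using ystr_Wc[OF t(1) e(2) _ _ e(1)] t u by simp
        moreover have "dl s (ystr c d j x)" using ystr_descents(1)[OF t(1) e(1)] ev tj by simp
        moreover have "len (ystr c d j x) < len u"
          using len_ystr[OF t(1), of j] len_ystr[OF t(1), of "m - 1"] t j jm by simp
        ultimately show ?thesis using keys_scale[of "of_int (cheb m j)" "T (ystr c d j x)"] by auto
      qed simp
      then show ?thesis unfolding Q_def using False cand_eq[OF t(1,2)] t(5-7)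
        by (simp add: keys_minus) (intro keys_sum_subset, simp)
    qed
    have "bt s u = Q r" if "r \<in> S" "dl r u" for r using btQ eqQ[of "pick u" r] pick that by simp
    moreover have "keys (bt s u) \<subseteq> {y\<in>Wc. dl s y \<and> len y < len u}" using btQ kQ pick by simp
    ultimately show ?thesis unfolding Q_def by blast
  qed
  show ?thesis unfolding support_inv_def
  proof (intro ballI impI)
    fix u s assume u: "u \<in> Wc" "len u \<le> Suc n" and s: "s \<in> S"
    have uW: "u \<in> W" using u by blast
    show "keys (bt s u) \<subseteq> {y\<in>Wc. dl s y \<and> len y \<le> len u + 1} \<and>
     (\<not> dl s u \<longrightarrow> s \<cdot> u \<notin> Wc \<longrightarrow> (\<forall>y\<in>keys (bt s u). len y < len u) \<and>
       (\<forall>r\<in>S. dl r u \<longrightarrow> bt s u = (if commuting X r s then bop r (bt s (r \<cdot> u)) else cand s r u)))"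
    proof (cases "len u \<le> n")
      case True
      then show ?thesis using i1 u s unfolding support_inv_def by blast
    next
      case False
      then have n: "len u = Suc n" using u by simp
      show ?thesis
      proof (cases "dl s u")
        case True
        then show ?thesis using u s bt_dl[of s u] keys_scale[of delta "T u"] by auto
      next
        case F: False
        show ?thesis
        proof (cases "s \<cdot> u \<in> Wc")
          case True
          then show ?thesis using F u s bt_up[of s u] dl_lm[of s u] ndl_len[of s u] uW by auto
        next
          case False
          then show ?thesis using main[OF u(1) n s F False] F by fastforce
        qed
      qed
    qed
  qed
qed

lemma bop_foldr_commute:
  assumes b: "base c d x" and c: "c \<cdot> x \<in> Wc" and i2: "commute_inv n"
    and r: "r \<in> S" "commuting X r c" "commuting X r d"
    and j: "enat j < bond X c d" "j + len x \<le> n"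
  shows "bop r (foldr bop (alt c d j) (T x)) = foldr bop (alt c d j) (bop r (T x))"
  using j
proof (induction j)
  case (Suc j)
  let ?t = "tp c d (Suc j)"
  have j: "enat j < bond X c d" using Suc.prems by (meson Suc_ile_eq less_imp_le)
  have one: "enat 1 < bond X c d"
    using bond_ge2[of c d] baseD[OF b] by (cases "bond X c d") (auto simp: numeral_eq_enat)
  have "ystr c d 1 x \<in> Wc" using c b by (simp add: ystr_Suc tp_def)
  then have y: "ystr c d j x \<in> Wc" using ystr_Wc[OF b one] j by simp
  have f: "foldr bop (alt c d j) (T x) = T (ystr c d j x)" using foldr_bop_alt[OF b c j] .
  have "len (ystr c d j x) < n" using len_ystr[OF b, of j] j Suc.prems by simp
  then have "bop r (bop ?t (T (ystr c d j x))) = bop ?t (bop r (T (ystr c d j x)))"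
    using commute_inv_bop[OF i2 r(1), of ?t "T (ystr c d j x)"] r baseD[OF b] y by (auto simp: tp_def)
  then show ?case using Suc.IH j Suc.prems by (simp only: alt_Suc foldr.simps comp_def f)
qed simp

lemma commute_inv_Suc:
  assumes i1: "support_inv (Suc n)" and i2: "commute_inv n" and i3: "chebyshev_inv n" shows "commute_inv (Suc n)"
proof -
  have i1': "support_inv n" using i1 by (auto simp: support_inv_def)
  define C where "C u r s \<longleftrightarrow> bop r (bt s u) = bop s (bt r u)" for u r s
  \<comment> \<open>If r is a descent of u, both sides equal delta b_s b_u. When su is complex, b_s
    b_u is of the form b_r h, which b_r multiplies by delta.\<close>
  have one: "C u r s" if u: "u \<in> Wc" "len u = n" and rs: "r \<in> S" "s \<in> S" "r \<noteq> s" "commuting X r s" and d: "dl r u" for u r s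
  proof -
    have uW: "u \<in> W" using u by blast
    have L: "bop s (bt r u) = scale delta (bt s u)"
      using bt_dl[OF rs(1) u(1) d] by (simp add: linear_opD(2)[OF linear_bop])
    have "bop r (bt s u) = scale delta (bt s u)"
    proof (cases "dl s u")
      case True
      then show ?thesis using bt_dl[of s u] bt_dl[of r u] rs u d by (simp add: linear_opD(2)[OF linear_bop])
    next
      case F: False
      show ?thesis
      proof (cases "s \<cdot> u \<in> Wc")
        case True
        then show ?thesis using bt_up[of s u] bt_dl[of r "s \<cdot> u"] F rs u uW d dl_commute[of s r u] commuting_sym by auto
      next
        case False
        have eq: "bt s u = bop r (bt s (r \<cdot> u))"
          using support_inv_eq[OF i1' u(1) _ rs(2) F False rs(1) d] u rs by simp
        have ru: "r \<cdot> u \<in> Wc" "len (r \<cdot> u) < n" using Wc_lm dl_len[of r u] d rs u uW by auto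
        have "keys (bt s (r \<cdot> u)) \<subseteq> {y\<in>Wc. len y \<le> n}"
          using support_inv_keys[OF i1' ru(1) _ rs(2)] ru by fastforce
        then show ?thesis unfolding eq using support_inv_bop_bop[OF i1' rs(1)] by blast
      qed
    qed
    then show ?thesis using L by (simp add: C_def)
  qed
  \<comment> \<open>If both ru and su are in W_c, both sides are the monomial of rsu. If only ru is,
    b_s at ru may be computed through the descent r, which gives b_r b_s b_u.\<close>
  have up: "C u r s" if u: "u \<in> Wc" "len u = n" and rs: "r \<in> S" "s \<in> S" "r \<noteq> s" "commuting X r s"
      and d: "\<not> dl r u" "\<not> dl s u" and ru: "r \<cdot> u \<in> Wc" for u r s
  proof -
    have uW: "u \<in> W" and rs': "commuting X s r" using u rs commuting_sym by blast+
    have dd: "\<not> dl r (s \<cdot> u)" "\<not> dl s (r \<cdot> u)" using dl_commute rs rs' uW d by blast+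
    have c: "r \<cdot> s \<cdot> u = s \<cdot> r \<cdot> u" using commuting_lm rs uW by blast
    have dr: "dl r (r \<cdot> u)" "dl s (s \<cdot> u)" using dl_lm rs uW d by auto
    show ?thesis
    proof (cases "s \<cdot> u \<in> Wc")
      case True
      have "r \<cdot> s \<cdot> u \<in> Wc"
      proof (rule Wc_of_commuting_quotients[of _ r s])
        show "dl r (r \<cdot> s \<cdot> u)" using dl_lm[of r "s \<cdot> u"] dd rs uW by simp
        show "dl s (r \<cdot> s \<cdot> u)" using dl_lm[of s "r \<cdot> u"] dd rs uW c by simp
        show "s \<cdot> r \<cdot> s \<cdot> u \<in> Wc" unfolding c using ru rs uW by simp
        show "r \<cdot> r \<cdot> s \<cdot> u \<in> Wc" using True rs uW by simp
      qed (use rs uW in auto)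
      then show ?thesis
        using bt_up[of r u] bt_up[of s u] bt_up[of s "r \<cdot> u"] bt_up[of r "s \<cdot> u"] True ru u rs d dd c by (simp add: C_def)
    next
      case False
      have "r \<cdot> s \<cdot> r \<cdot> u = s \<cdot> u" using lm_lm[of r "s \<cdot> u"] rs uW by (simp flip: c)
      moreover have "dl r (s \<cdot> r \<cdot> u)" using dl_lm[of r "s \<cdot> u"] dd rs uW by (simp flip: c)
      ultimately have "s \<cdot> r \<cdot> u \<notin> Wc" using Wc_lm[of r "s \<cdot> r \<cdot> u"] rs False by auto
      then have "bt s (r \<cdot> u) = bop r (bt s (r \<cdot> r \<cdot> u))"
        using support_inv_eq[OF i1 ru _ rs(2) dd(2) _ rs(1) dr(1)] ndl_len[of r u] u rs d uW by simp
      then show ?thesis using bt_up[of r u] ru u rs d uW by (simp add: C_def)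
    qed
  qed
  \<comment> \<open>Here u is index m - 1 of an {s,t}-string over x, and r commutes with s and t.
    Sliding b_r down to x turns the claim into the Chebyshev relation at b_r b_x. As rx is complex,
    this vector involves only elements shorter than x, where the relation is known.\<close>
  have noncomm: "C u r s" if u: "u \<in> Wc" "len u = n" and rs: "r \<in> S" "s \<in> S" "r \<noteq> s" "commuting X r s"
      and d: "\<not> dl r u" "\<not> dl s u" and cx: "r \<cdot> u \<notin> Wc" "s \<cdot> u \<notin> Wc"
      and t: "t \<in> S" "dl t u" "commuting X t r" "\<not> commuting X s t" for u r s t
  proof -
    have uW: "u \<in> W" using u by blast
    obtain c e m x where h: "base c e x" "bond X c e = enat m" "3 \<le> m" "{c, e} = {s, t}" "u = ystr c e (m - 1) x"
        "s = tp c e m" "t = tp e c m"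
      using top_decomposition[OF u(1) rs(2) t(1,4,2) d(2) cx(2)] by metis
    have rce: "r \<noteq> c" "r \<noteq> e" "commuting X r c" "commuting X r e"
      using h(4) rs t d commuting_sym by (auto simp: doubleton_eq_iff)
    have m1: "enat (m - 1) < bond X c e" "enat 1 < bond X c e" using h by auto
    have drx: "\<not> dl r x" using ystr_commute(3)[OF h(1) rs(1) rce] d h(5) by blast
    have rx: "r \<cdot> x \<notin> Wc" using complex_ystr_down[OF h(1) rs(1) rce drx m1(1)] u cx h(5) by simp
    have xWc: "x \<in> Wc" using ystr_Wc[OF h(1) m1(1) _ _, of 0] h u by simp
    have cx': "c \<cdot> x \<in> Wc" using ystr_Wc[OF h(1) m1(1) _ _ m1(2)] h u by (simp add: ystr_Suc tp_def)
    have lx: "len x + (m - 1) = n" using len_ystr[OF h(1), of "m - 1"] h u by simp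
    have F: "bop r (foldr bop (alt c e j) (T x)) = foldr bop (alt c e j) (bop r (T x))" if "j < m" for j
      by (rule bop_foldr_commute[OF h(1) cx' i2 rs(1) rce(3,4)]) (use that lx h in auto)
    have bs: "bt s u = - (\<Sum>j<m. scale (of_int (cheb m j)) (foldr bop (alt c e j) (T x)))"
    proof -
      have "\<not> commuting X t s" using t commuting_sym by blast
      then have "bt s u = cand s t u" using support_inv_eq[OF i1' u(1) _ rs(2) d(2) cx(2) t(1,2)] u by simp
      also have "\<dots> = - (\<Sum>j<m. scale (of_int (cheb m j)) (T (ystr c e j x)))" using cand_eq[OF h(1,2)] h by simp
      finally show ?thesis using foldr_bop_alt[OF h(1) cx'] h by simp
    qed
    have kr: "keys (bop r (T x)) \<subseteq> {y\<in>Wc. len y + m \<le> n + 1}"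
      using support_inv_keys[OF i1', of x r] support_inv_less[OF i1', of x r] xWc rs drx rx lx by fastforce
    have "chebop bop m c e (bop r (T x)) = 0"
      by (rule chebyshev_inv_chebop[OF i3 _ _ _ h(2) kr]) (use baseD[OF h(1)] in auto)
    moreover have "chebop bop m c e (bop r (T x)) = (\<Sum>j<m. scale (of_int (cheb m j)) (foldr bop (alt c e j) (bop r (T x))))
        + foldr bop (alt c e m) (bop r (T x))"
    proof -
      obtain k where k: "m = Suc k" using h by (cases m) auto
      show ?thesis unfolding chebop_def k by (simp add: lessThan_Suc_atMost[symmetric] cheb_diag del: foldr.simps)
    qed
    moreover have "foldr bop (alt c e m) (bop r (T x)) = bop s (bt r u)"
    proof -
      obtain k where k: "m = Suc k" using h by (cases m) auto
      have "foldr bop (alt c e m) (bop r (T x)) = bop s (foldr bop (alt c e (m - 1)) (bop r (T x)))"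
        using h(6) k by (simp add: alt_Suc)
      also have "\<dots> = bop s (bop r (foldr bop (alt c e (m - 1)) (T x)))" using F[of "m - 1"] h by simp
      finally show ?thesis using foldr_bop_alt[OF h(1) cx' m1(1)] h(5) by simp
    qed
    moreover have "bop r (bt s u) = - (\<Sum>j<m. scale (of_int (cheb m j)) (foldr bop (alt c e j) (bop r (T x))))"
      unfolding bs linear_opD(4)[OF linear_bop] linear_sum[OF linear_bop] linear_opD(2)[OF linear_bop]
      by (intro arg_cong[where f = uminus] sum.cong) (simp_all only: F lessThan_iff)
    ultimately show ?thesis by (simp add: C_def add_eq_0_iff)
  qed
  \<comment> \<open>If t commutes with neither r nor s, then m(s,t) = 3, since a larger bond would
    make r and t noncommuting descents of stu. The relation b_s b_t b_s = b_s then gives a value in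
    which s no longer appears; by symmetry r gives the same.\<close>
  have bond3: "bt s u = T (t \<cdot> u)"
    if u: "u \<in> Wc" "len u = n" and rs: "r \<in> S" "s \<in> S" "r \<noteq> s" "commuting X r s"
      and d: "\<not> dl r u" "\<not> dl s u" and cx: "r \<cdot> u \<notin> Wc" "s \<cdot> u \<notin> Wc"
      and t: "t \<in> S" "dl t u" "\<not> commuting X r t" "\<not> commuting X s t" for u r s t
  proof -
    have uW: "u \<in> W" using u by blast
    have drt: "dl r (t \<cdot> u)"
    proof -
      have "complex X (r \<cdot> u)" using cx uW rs Wc_iff[of "r \<cdot> u"] by auto
      then have "dl t (r \<cdot> u)" "dl r (r \<cdot> u)" using complex_top[OF u(1) rs(1) t(1,3,2) d(1)] dl_lm d rs uW by auto
      moreover have "r \<noteq> t" "bond X r t \<noteq> 2" using t rs commuting_iff[of r t] noncommuting_neq by blast+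
      ultimately show ?thesis using descent_chain(2)[of r t "r \<cdot> u"] rs t uW by simp
    qed
    obtain c e m x where h: "base c e x" "bond X c e = enat m" "3 \<le> m" "{c, e} = {s, t}" "u = ystr c e (m - 1) x"
        "s = tp c e m" "t = tp e c m"
      using top_decomposition[OF u(1) rs(2) t(1,4,2) d(2) cx(2)] by metis
    obtain k where k: "m = Suc (Suc (Suc k))" using h(3) that[of "m - 3"] by simp
    have tps: "tp c e (Suc (Suc k)) = t" "tp c e (Suc k) = s" "tp c e k = t" using h(6,7) k by (auto simp: tp_def)
    have tu: "t \<cdot> u = ystr c e (Suc k) x" using tp_ystr[OF h(1), of "Suc k"] tps h(5) k by simp
    have tuWc: "t \<cdot> u \<in> Wc" using Wc_lm t u by blast
    have lt: "enat (Suc k) < bond X c e" "enat k < bond X c e" using h k by auto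
    have "k = 0"
    proof (rule ccontr)
      assume "k \<noteq> 0"
      then have "dl t (s \<cdot> t \<cdot> u)" using ystr_descents(1)[OF h(1) lt(2)] tp_ystr[OF h(1), of k] tps tu by simp
      moreover have "dl s (t \<cdot> u)" using ystr_descents(1)[OF h(1) lt(1)] tps tu by simp
      moreover have "dl r (s \<cdot> t \<cdot> u)" using dl_commute[of s r "t \<cdot> u"] drt rs commuting_sym t uW by auto
      ultimately show False using Wc_descents[of "s \<cdot> t \<cdot> u" r t] Wc_lm[of s "t \<cdot> u"] tuWc rs t by blast
    qed
    then have m3: "m = 3" using k by simp
    have "\<not> commuting X t s" using t commuting_sym by blast
    then have "bt s u = cand s t u" using support_inv_eq[OF i1' u(1) _ rs(2) d(2) cx(2) t(1,2)] u by simp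
    also have "\<dots> = - (\<Sum>j<m. scale (of_int (cheb m j)) (T (ystr c e j x)))" using cand_eq[OF h(1,2)] h by simp
    also have "\<dots> = T (ystr c e 1 x)" unfolding m3 by (simp add: numeral_3_eq_3)
    finally show ?thesis using tu \<open>k = 0\<close> by simp
  qed
  have two: "C u r s" if u: "u \<in> Wc" "len u = n" and rs: "r \<in> S" "s \<in> S" "r \<noteq> s" "commuting X r s"
      and d: "\<not> dl r u" "\<not> dl s u" and cx: "r \<cdot> u \<notin> Wc" "s \<cdot> u \<notin> Wc" for u r s
  proof -
    have uW: "u \<in> W" and rs': "commuting X s r" using u rs commuting_sym by blast+
    have "u \<noteq> ev []"
    proof
      assume "u = ev []"
      then have "r \<cdot> u \<in> Wc" using short_Wc[of "r \<cdot> u"] ndl_len[of r u] rs d uW by simp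
      then show False using cx by blast
    qed
    then obtain t where t: "t \<in> S" "dl t u" using descent_exists uW by metis
    consider (A) "commuting X t r" "commuting X t s" | (B) "commuting X t r" "\<not> commuting X s t"
      | (B') "commuting X t s" "\<not> commuting X r t" | (D) "\<not> commuting X r t" "\<not> commuting X s t"
      using commuting_sym by blast
    then show ?thesis
    proof cases
      case A
      have tu: "t \<cdot> u \<in> Wc" "len (t \<cdot> u) < n" using Wc_lm dl_len[of t u] t u uW by auto
      have *: "bt p u = bop t (bt p (t \<cdot> u)) \<and> keys (bt p (t \<cdot> u)) \<subseteq> {y\<in>Wc. len y < n}"
        if p: "p \<in> S" "\<not> dl p u" "p \<cdot> u \<notin> Wc" "commuting X t p" for p
      proof -
        have "bt p u = bop t (bt p (t \<cdot> u))" using support_inv_eq[OF i1' u(1) _ p(1-3) t] u p by simp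
        moreover have "p \<cdot> t \<cdot> u \<notin> Wc" using complex_commuting_down u t p by blast
        moreover have "\<not> dl p (t \<cdot> u)" using dl_commute[of t p u] t p uW by blast
        ultimately show ?thesis using support_inv_keys[OF i1' tu(1) _ p(1)] support_inv_less[OF i1' tu(1) _ p(1)] tu by fastforce
      qed
      note 1 = *[OF rs(1) d(1) cx(1) A(1)] and 2 = *[OF rs(2) d(2) cx(2) A(2)]
      have "bop r (bt s u) = bop t (bop r (bt s (t \<cdot> u)))"
        using 2 commute_inv_bop[OF i2 t(1) rs(1) A(1)] by simp
      also have "bop r (bt s (t \<cdot> u)) = bop s (bt r (t \<cdot> u))"
        using i2 tu rs by (auto simp: commute_inv_def)
      also have "bop t (bop s (bt r (t \<cdot> u))) = bop s (bop t (bt r (t \<cdot> u)))"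
        using 1 commute_inv_bop[OF i2 t(1) rs(2) A(2)] by blast
      finally show ?thesis using 1 by (simp add: C_def)
    next
      case B
      then show ?thesis using noncomm[OF u rs d cx t] by blast
    next
      case B'
      then show ?thesis using noncomm[OF u rs(2,1) rs(3)[symmetric] rs' d(2,1) cx(2,1) t] by (simp add: C_def)
    next
      case D
      have "bt s u = T (t \<cdot> u)" using bond3[OF u rs d cx t D] .
      moreover have "bt r u = T (t \<cdot> u)" using bond3[OF u rs(2,1) rs(3)[symmetric] rs' d(2,1) cx(2,1) t D(2,1)] .
      moreover have "dl p (t \<cdot> u)" if p: "p \<in> S" "\<not> dl p u" "p \<cdot> u \<notin> Wc" "\<not> commuting X p t" for p
      proof -
        have "complex X (p \<cdot> u)" using p uW Wc_iff[of "p \<cdot> u"] by auto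
        then have "dl t (p \<cdot> u)" "dl p (p \<cdot> u)" using complex_top[OF u(1) p(1) t(1) p(4) t(2) p(2)] dl_lm p uW by auto
        moreover have "p \<noteq> t" "bond X p t \<noteq> 2" using p t commuting_iff[of p t] noncommuting_neq by blast+
        ultimately show ?thesis using descent_chain(2)[of p t "p \<cdot> u"] p t uW by simp
      qed
      ultimately show ?thesis
        using bt_dl[of r "t \<cdot> u"] bt_dl[of s "t \<cdot> u"] Wc_lm[OF t(1) u(1) t(2)] D rs d cx by (simp add: C_def)
    qed
  qed
  have "C u r s" if u: "u \<in> Wc" "len u < Suc n" and rs: "r \<in> S" "s \<in> S" "commuting X r s" for u r s
  proof (cases "len u < n \<or> r = s")
    case True
    then show ?thesis using i2 u rs by (auto simp: commute_inv_def C_def)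
  next
    case False
    then have n: "len u = n" "r \<noteq> s" using u by auto
    have rs': "commuting X s r" using rs commuting_sym by blast
    have sym: "C u s r \<Longrightarrow> C u r s" by (simp add: C_def)
    show ?thesis
      using one[OF u(1) n(1) rs(1,2) n(2) rs(3)] sym[OF one[OF u(1) n(1) rs(2,1) n(2)[symmetric] rs']]
        up[OF u(1) n(1) rs(1,2) n(2) rs(3)] sym[OF up[OF u(1) n(1) rs(2,1) n(2)[symmetric] rs']]
        two[OF u(1) n(1) rs(1,2) n(2) rs(3)] by blast
  qed
  then show ?thesis by (auto simp: commute_inv_def C_def)
qed

text \<open>If a or c is a descent of u, one letter is moved into the operator and the shorter case
  applies. Otherwise u is the base of a string: if au is in W_c the relation is the definition of
  b_s at index m - 1, made independent of choices by \<open>support_inv\<close>; the remaining case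
  multiplies by delta.\<close>

lemma chebyshev_inv_Suc:
  assumes i1: "support_inv (Suc n)" and i3: "chebyshev_inv n" shows "chebyshev_inv (Suc n)"
proof -
  have i1': "support_inv n" using i1 by (auto simp: support_inv_def)
  have "chebop bop m a c (T u) = 0" if u: "u \<in> Wc" and ac: "a \<in> S" "c \<in> S" "\<not> commuting X a c" "bond X a c = enat m"
      and l: "len u + m \<le> n + 2" for u a c m
  proof -
    have uW: "u \<in> W" using u by blast
    have ca: "\<not> commuting X c a" "bond X c a = enat m" using ac commuting_sym bond_sym by metis+
    have m3: "3 \<le> m" using noncommuting_bond ac by blast
    have lower: "chebop bop m a c (T y) = 0" "chebop bop m c a (T y) = 0" if "y \<in> Wc" "len y < len u" for y
    proof -
      have "len y + m \<le> n + 1" using that l by simp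
      then show "chebop bop m a c (T y) = 0" "chebop bop m c a (T y) = 0"
        using i3 that(1) ac ca unfolding chebyshev_inv_def by blast+
    qed
    consider "dl a u" | "dl c u" | "\<not> dl a u" "\<not> dl c u" by blast
    then show ?thesis
    proof cases
      case 1
      have au: "a \<cdot> u \<in> Wc" "len (a \<cdot> u) < len u" "\<not> dl a (a \<cdot> u)" "a \<cdot> a \<cdot> u = u"
        using Wc_lm dl_lm[of a u] 1 ac u uW by (auto simp: dl_def)
      have Tu: "T u = bop a (T (a \<cdot> u))" using bt_up[of a "a \<cdot> u"] au ac u by simp
      have "chebop bop m a c (bop a (T (a \<cdot> u))) = scale delta (chebop bop m a c (T (a \<cdot> u)))"
        by (rule chebop_same[OF linear_bop]) (simp only: Tu[symmetric], simp add: bt_dl[OF ac(1) u 1])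
      then show ?thesis using lower(1)[OF au(1,2)] Tu by simp
    next
      case 2
      have cu: "c \<cdot> u \<in> Wc" "len (c \<cdot> u) < len u" "\<not> dl c (c \<cdot> u)" "c \<cdot> c \<cdot> u = u"
        using Wc_lm dl_lm[of c u] 2 ac u uW by (auto simp: dl_def)
      have Tu: "T u = bop c (T (c \<cdot> u))" using bt_up[of c "c \<cdot> u"] cu ac u by simp
      have "chebop bop m a c (bop c (T (c \<cdot> u))) = bop (tp c a (Suc m)) (chebop bop m c a (T (c \<cdot> u)))"
        by (rule chebop_other[where b = bop, OF linear_bop])
      then show ?thesis unfolding Tu lower(2)[OF cu(1,2)] by (simp only: linear_opD(3)[OF linear_bop])
    next
      case 3
      have b: "base a c u" using 3 ac uW by (simp add: base_def)
      show ?thesis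
      proof (cases "a \<cdot> u \<in> Wc")
        case True
        let ?y = "ystr a c (m - 1) u"
        have lt: "enat (m - 1) < bond X a c" "enat 1 < bond X a c" using ac m3 by auto
        have "ystr a c 1 u \<in> Wc" using True b by (simp add: ystr_Suc tp_def)
        then have y: "?y \<in> Wc" using ystr_Wc[OF b lt(2) _ _ lt(1)] by simp
        have l': "len ?y \<le> Suc n" using len_ystr[OF b, of "m - 1"] ac l m3 by simp
        have "tp a c m \<cdot> ?y = ystr a c m u" using ystr_Suc[OF b, of "m - 1"] m3 by simp
        then have nw: "tp a c m \<cdot> ?y \<notin> Wc" using ystr_top_notin_Wc[OF b ac(4)] by simp
        have nd: "\<not> dl (tp a c m) ?y" using ystr_descents(2)[OF b lt(1)] m3 by simp
        have "tp a c (m - 1) = tp c a m" using m3 by (auto simp: tp_def)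
        then have dt: "dl (tp c a m) ?y" using ystr_descents(1)[OF b lt(1)] m3 by simp
        have "\<not> commuting X (tp c a m) (tp a c m)" using ac ca by (auto simp: tp_def)
        then have "bt (tp a c m) ?y = cand (tp a c m) (tp c a m) ?y"
          using support_inv_eq[OF i1 y l' _ nd nw _ dt] ac by simp
        then show ?thesis using chebop_bop_eq[OF b True ac(4)] by simp
      next
        case False
        have un: "len u \<le> n" using l m3 by simp
        have k: "keys (bt a u) \<subseteq> {y\<in>Wc. len y + m \<le> n + 1}"
          using support_inv_keys[OF i1' u un ac(1)] support_inv_less[OF i1' u un ac(1) 3(1) False] l by fastforce
        have 0: "chebop bop m a c (bop a (T u)) = 0"
          using chebyshev_inv_chebop[OF i3 ac k] by simp
        \<comment> \<open>Since au is complex, b_a b_u involves only shorter elements, on which the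
          operator vanishes. As every word of the operator ends in a, this is delta times the wanted
          value.\<close>
        have "bop a (bop a (T u)) = scale delta (bop a (T u))"
          using support_inv_bop_bop[OF i1' ac(1), of "T u"] u un by simp
        then have "scale delta (chebop bop m a c (T u)) = 0"
          using chebop_same[where b = bop and a = a and h = "T u", OF linear_bop] 0 by simp
        then show ?thesis using scale_eq_0[OF delta_ne_0] by blast
      qed
    qed
  qed
  then show ?thesis by (simp add: chebyshev_inv_def)
qed

lemma invs: "support_inv n \<and> commute_inv n \<and> chebyshev_inv n"
proof (induction n)
  case 0
  have "gen X s \<in> Wc" if "s \<in> S" for s using short_Wc[of "gen X s"] len_gen that by simp
  then have "keys (bt s u) \<subseteq> {y\<in>Wc. dl s y \<and> len y \<le> len u + 1} \<and> s \<cdot> u \<in> Wc" if "u \<in> Wc" "len u \<le> 0" "s \<in> S" for s u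
    using that len_0[of u] bt_up[of s u] dl_lm[of s "ev []"] by (auto simp: dl_def len_gen)
  moreover have "chebyshev_inv 0"
    unfolding chebyshev_inv_def using noncommuting_bond by fastforce
  ultimately show ?case by (auto simp: support_inv_def commute_inv_def)
next
  case (Suc n)
  then show ?case using support_inv_Suc commute_inv_Suc chebyshev_inv_Suc by blast
qed

lemma bt_keys: "keys (bt s u) \<subseteq> {y\<in>Wc. dl s y \<and> len y \<le> len u + 1}"
  using invs[of "len u"] support_inv_keys[of "len u" u s] bt_outside[of s u] by (cases "s \<in> S \<and> u \<in> Wc") auto

lemma bop_keys: "keys (bop s h) \<subseteq> {y\<in>Wc. dl s y}"
  unfolding bop_def by (rule keys_lin) (use bt_keys in blast)

lemma bop_outside: "s \<notin> S \<Longrightarrow> bop s h = 0"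
  by (simp add: bop_def lin_def bt_outside)

lemma bop_bop: "bop s (bop s h) = scale delta (bop s h)"
  using bop_dl[OF _ bop_keys] bop_outside[of s] by (cases "s \<in> S") (auto simp: linear_opD(3)[OF linear_bop])

lemma bop_commute: assumes "r \<in> S" "s \<in> S" "commuting X r s" shows "bop r (bop s h) = bop s (bop r h)"
proof (rule linear_ext[where F = "\<lambda>h. bop r (bop s h)" and G = "\<lambda>h. bop s (bop r h)"])
  fix w
  show "bop r (bop s (T w)) = bop s (bop r (T w))"
  proof (cases "w \<in> Wc")
    case True
    then show ?thesis using commute_inv_bop[of "Suc (len w)" r s "T w"] invs assms by simp
  qed (simp add: bt_outside linear_opD(3)[OF linear_bop])
qed (auto intro: linear_comp linear_bop)

lemma chebop_zero:
  assumes "a \<in> S" "c \<in> S" "\<not> commuting X a c" "bond X a c = enat m"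
  shows "chebop bop m a c h = 0"
proof (rule linear_ext[OF linear_chebop[OF linear_bop] linear_zero])
  fix w
  show "chebop bop m a c (T w) = 0"
  proof (cases "w \<in> Wc")
    case True
    then show ?thesis using invs[of "len w + m"] assms by (auto simp: chebyshev_inv_def)
  next
    case False
    have "foldr bop (alt a c (Suc j)) (T w) = 0" for j
      using False bt_outside linear_opD(3)[OF linear_foldr[OF linear_bop]] by (simp add: foldr_alt_Suc)
    then have "scale (of_int (cheb m j)) (foldr bop (alt a c j) (T w)) = 0" for j by (cases j) auto
    then show ?thesis by (simp add: chebop_def)
  qed
qed

lemma foldr_bop_reduced:
  assumes "set x \<subseteq> S" "len (ev x) = length x" "ev x \<in> Wc"
  shows "foldr bop x (T (ev [])) = T (ev x)"
  using assms
proof (induction x)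
  case (Cons s x)
  have s: "s \<in> S" "set x \<subseteq> S" using Cons by auto
  have l: "len (ev x) = length x"
    using Cons.prems len_le[of x] len_lm[of s "ev x"] s by (auto simp: lm_ev)
  have d: "\<not> dl s (ev x)" using Cons.prems s l by (simp add: dl_def lm_ev)
  have "ev x \<in> Wc"
    using Wc_lm[of s "ev (s # x)"] Cons.prems s dl_lm[of s "ev x"] d by (simp flip: lm_ev)
  then show ?case using Cons l s bt_up[of s "ev x"] d by (simp add: lm_ev)
qed simp

text \<open>Only delta and integers enter the recursion, and both are fixed by the bar. Hence
  barring coefficients commutes with every b_s (\<open>barM_bop\<close>).\<close>

lemma bt_bar_invariant: "laurent_bar (lookup (bt s u) y) = lookup (bt s u) y"
proof (induction "len u" arbitrary: s u y rule: less_induct)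
  case less
  show ?case
  proof (cases "s \<in> S \<and> u \<in> Wc")
    case True
    then have su: "s \<in> S" "u \<in> Wc" "u \<in> W" by auto
    show ?thesis
    proof (cases "dl s u \<or> s \<cdot> u \<in> Wc")
      case True
      then show ?thesis using bt_dl[OF su(1,2)] bt_up[OF su(1,2)] by (cases "dl s u") (auto simp: lookup_T)
    next
      case False
      then have F: "\<not> dl s u" "s \<cdot> u \<notin> Wc" by auto
      have "u \<noteq> ev []"
      proof
        assume "u = ev []"
        then have "s \<cdot> u \<in> Wc" using short_Wc[of "s \<cdot> u"] ndl_len[of s u] su F by simp
        then show False using F by blast
      qed
      then obtain r where r: "r \<in> S" "dl r u" using descent_exists su by metis
      have i1: "support_inv (len u)" using invs by blast
      note eq = support_inv_eq[OF i1 su(2) order.refl su(1) F r]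
      show ?thesis
      proof (cases "commuting X r s")
        case True
        have ru: "r \<cdot> u \<in> Wc" "len (r \<cdot> u) < len u" using Wc_lm r su by (auto simp: dl_def)
        have nd: "\<not> dl s (r \<cdot> u)" "s \<cdot> r \<cdot> u \<notin> Wc"
          using dl_commute[of r s u] complex_commuting_down[of u r s] True r su F by auto
        have "len w < len u" if "w \<in> keys (bt s (r \<cdot> u))" for w
          using support_inv_less[OF i1 ru(1) _ su(1) nd that] ru by simp
        then show ?thesis using eq True less ru(2)
          by (simp add: bop_def lin_def lookup_sum laurent_bar_sum laurent_bar_mult)
      next
        case False
        then show ?thesis using eq
          by (simp add: cand_def Let_def lookup_sum lookup_T laurent_bar_sum laurent_bar_mult if_distrib[of laurent_bar] cong: if_cong)
      qed
    qed
  qed (simp add: bt_outside)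
qed

subsection \<open>The product of the Hecke algebra\<close>

abbreviation HW :: "'s hecke_elt set" where "HW \<equiv> {h. keys h \<subseteq> W}"

text \<open>The value \<open>- T w\<close> outside the range makes the quadratic relation hold there too.\<close>

definition lt :: "'s \<Rightarrow> 's list set \<Rightarrow> 's hecke_elt" where
  "lt s w = (if s \<in> S \<and> w \<in> W then
     (if dl s w then scale (v_pow 2) (T (s \<cdot> w)) + scale (v_pow 2 - 1) (T w) else T (s \<cdot> w)) else - T w)"

definition lam :: "'s \<Rightarrow> 's hecke_elt \<Rightarrow> 's hecke_elt" where "lam s = lin (lt s)"

text \<open>The anti-automorphism exchanging T_w and T_{w^-1}. Conjugating left multiplication
  \<open>lam\<close> with it gives right multiplication \<open>rho\<close>. Keys outside W are left
  alone, so that it is an involution everywhere.\<close>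

definition io :: "'s hecke_elt \<Rightarrow> 's hecke_elt" where "io = lin (\<lambda>w. T (if w \<in> W then iv w else w))"

definition rho :: "'s \<Rightarrow> 's hecke_elt \<Rightarrow> 's hecke_elt" where "rho s h = io (lam s (io h))"

lemma linear_lam: "linear_op (lam s)" by (simp add: lam_def linear_lin)
lemma linear_io: "linear_op io" by (simp add: io_def linear_lin)
lemma linear_rho: "linear_op (rho s)"
  using linear_comp[OF linear_io linear_comp[OF linear_lam linear_io]] by (simp add: rho_def[abs_def])

lemma lam_T [simp]: "lam s (T w) = lt s w" by (simp add: lam_def)
lemma io_T: "w \<in> W \<Longrightarrow> io (T w) = T (iv w)" by (simp add: io_def)

lemma io_io [simp]: "io (io h) = h"
proof -
  have "io (io (T w)) = T w" for w :: "'s list set" by (simp add: io_def)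
  then show ?thesis using linear_ext[OF linear_comp[OF linear_io linear_io] linear_id] by blast
qed

lemma HW_T [simp]: "w \<in> W \<Longrightarrow> T w \<in> HW" by simp

lemma HW_closed: "g \<in> HW \<Longrightarrow> h \<in> HW \<Longrightarrow> g + h \<in> HW" "h \<in> HW \<Longrightarrow> scale a h \<in> HW" "h \<in> HW \<Longrightarrow> - h \<in> HW"
  "g \<in> HW \<Longrightarrow> h \<in> HW \<Longrightarrow> g - h \<in> HW" "0 \<in> HW"
  using keys_scale[of a h] keys_add_subset[of g W h] keys_diff_subset[of g W h] by (auto simp: keys_minus)

lemma lt_simps:
  "s \<in> S \<Longrightarrow> w \<in> W \<Longrightarrow> dl s w \<Longrightarrow> lt s w = scale (v_pow 2) (T (s \<cdot> w)) + scale (v_pow 2 - 1) (T w)"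
  "s \<in> S \<Longrightarrow> w \<in> W \<Longrightarrow> \<not> dl s w \<Longrightarrow> lt s w = T (s \<cdot> w)"
  by (simp_all add: lt_def)

lemma lt_HW: assumes "s \<in> S" "w \<in> W" shows "lt s w \<in> HW"
proof (cases "dl s w")
  case True
  show ?thesis unfolding lt_simps(1)[OF assms True]
    by (intro HW_closed(1) HW_closed(2) HW_T assms lm_W)
next
  case False
  show ?thesis unfolding lt_simps(2)[OF assms False] by (intro HW_T assms lm_W)
qed

lemma lam_HW: "s \<in> S \<Longrightarrow> h \<in> HW \<Longrightarrow> lam s h \<in> HW"
  unfolding lam_def mem_Collect_eq by (rule keys_lin) (use lt_HW in blast)

lemma io_HW: "h \<in> HW \<Longrightarrow> io h \<in> HW"
  unfolding io_def mem_Collect_eq by (rule keys_lin) (use G.inv_closed in \<open>simp add: subset_iff\<close>)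

lemma rho_HW: "s \<in> S \<Longrightarrow> h \<in> HW \<Longrightarrow> rho s h \<in> HW"
  unfolding rho_def using lam_HW io_HW by blast

lemma foldr_lam_HW: "set x \<subseteq> S \<Longrightarrow> h \<in> HW \<Longrightarrow> foldr lam x h \<in> HW"
proof (induction x)
  case (Cons s x)
  then show ?case using lam_HW[of s "foldr lam x h"] by simp
qed simp

lemma dr_eq: assumes "t \<in> S" "w \<in> W" shows "iv (t \<cdot> iv w) = w \<odot> gen X t" "len (t \<cdot> iv w) = len (w \<odot> gen X t)"
proof -
  show 1: "iv (t \<cdot> iv w) = w \<odot> gen X t" using assms by (simp add: G.inv_mult_group iv_gen)
  have "len (iv (t \<cdot> iv w)) = len (t \<cdot> iv w)" using assms by (intro len_iv) simp
  then show "len (t \<cdot> iv w) = len (w \<odot> gen X t)" using 1 by simp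
qed

lemma dl_right:
  assumes s: "s \<in> S" and t: "t \<in> S" and w: "w \<in> W" and ne: "s \<cdot> w \<noteq> w \<odot> gen X t"
  shows "dl s (w \<odot> gen X t) \<longleftrightarrow> dl s w"
proof -
  have l: "len (u \<odot> gen X t) = len u + 1 \<or> len u = len (u \<odot> gen X t) + 1" if "u \<in> W" for u
    using len_lm[of t "iv u"] dr_eq[of t u] that t by simp
  have *: "s \<cdot> u = u \<odot> gen X t" if u: "u \<in> W" "\<not> dl s u" "dl s (u \<odot> gen X t)" for u
  proof -
    have ut: "u \<odot> gen X t \<in> W" using u t by simp
    have "len (u \<odot> gen X t) = len u + 1"
    proof (rule ccontr)
      assume "\<not> ?thesis"
      then have a: "len u = len (u \<odot> gen X t) + 1" using l u by blast
      have "len (s \<cdot> (u \<odot> gen X t)) + 1 = len (u \<odot> gen X t)" using dl_len[OF s ut] u by simp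
      moreover have "len (s \<cdot> u) = len u + 1" using ndl_len s u by blast
      moreover have "len (s \<cdot> u) \<le> len (s \<cdot> u \<odot> gen X t) + 1" using l[of "s \<cdot> u"] s u by auto
      moreover have "s \<cdot> u \<odot> gen X t = s \<cdot> (u \<odot> gen X t)" using s t u by (simp add: G.m_assoc)
      ultimately show False using a by simp
    qed
    then show ?thesis using right_left_exchange s t u by blast
  qed
  show ?thesis
  proof (cases "dl s w \<longleftrightarrow> dl s (w \<odot> gen X t)")
    case False
    have tt: "w \<odot> gen X t \<odot> gen X t = w" using t w gen_sq[of t] by (simp add: G.m_assoc)
    show ?thesis
    proof (cases "dl s w")
      case True
      then have "s \<cdot> (w \<odot> gen X t) = w" using *[of "w \<odot> gen X t"] False tt t w by simp
      then have "s \<cdot> w = w \<odot> gen X t" using lm_lm[of s "w \<odot> gen X t"] s t w by simp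
      then show ?thesis using ne by blast
    next
      case F: False
      then show ?thesis using *[of w] False ne w by blast
    qed
  qed blast
qed

lemma rho_T:
  assumes "t \<in> S" "w \<in> W"
  shows "rho t (T w) = (if dl t (iv w) then scale (v_pow 2) (T (w \<odot> gen X t)) + scale (v_pow 2 - 1) (T w) else T (w \<odot> gen X t))"
  using assms by (simp add: rho_def io_T lt_def linear_opD[OF linear_io] dr_eq)

text \<open>That left and right multiplications commute is what makes an associative product
  possible. Descents on one side are unaffected by a letter on the other unless sw = wt, and then
  both operators act on the span of T_w and T_{sw} by the same formula.\<close>

lemma lam_rho_T:
  assumes s: "s \<in> S" and t: "t \<in> S" and w: "w \<in> W"
  shows "lam s (rho t (T w)) = rho t (lam s (T w))"
proof -
  let ?wt = "w \<odot> gen X t"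
  have wt: "?wt \<in> W" using t w by simp
  have sw: "s \<cdot> w \<in> W" using s w by simp
  have swt: "s \<cdot> w \<odot> gen X t = s \<cdot> ?wt" using s t w by (simp add: G.m_assoc)
  have dli: "dl t (iv u) \<longleftrightarrow> len (u \<odot> gen X t) < len u" if "u \<in> W" for u
    using dr_eq[of t u] that t by (simp add: dl_def)
  note L = linear_opD[OF linear_lam] linear_opD[OF linear_rho]
  have lt: "lt s u = (if dl s u then scale (v_pow 2) (T (s \<cdot> u)) + scale (v_pow 2 - 1) (T u) else T (s \<cdot> u))" if "u \<in> W" for u
    using s that by (simp add: lt_def)
  define B where "B = v_pow 2 - 1"
  show ?thesis
  proof (cases "s \<cdot> w = ?wt")
    case True
    have "dl t (iv w) \<longleftrightarrow> dl s w" using dli[OF w] True by (simp add: dl_def)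
    moreover have "dl s ?wt \<longleftrightarrow> \<not> dl s w" using dl_lm[OF s w] True by simp
    moreover have tt: "?wt \<odot> gen X t = w" using t w gen_sq[of t] by (simp add: G.m_assoc)
    moreover have "dl t (iv ?wt) \<longleftrightarrow> \<not> dl s w" using dli[OF wt] tt dl_lm[OF s w] True lm_lm[OF s w] by (simp add: dl_def)
    moreover have "s \<cdot> ?wt = w" using True lm_lm[OF s w] by simp
    ultimately show ?thesis using lt[OF w] lt[OF wt] rho_T[OF t w] rho_T[OF t wt] True
      by (cases "dl s w") (simp_all add: L)
  next
    case False
    have 1: "dl s ?wt \<longleftrightarrow> dl s w" using dl_right[OF s t w False] .
    have "t \<cdot> iv w \<noteq> iv w \<odot> gen X s"
    proof
      assume "t \<cdot> iv w = iv w \<odot> gen X s"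
      then have "iv (t \<cdot> iv w) = iv (iv w \<odot> gen X s)" by simp
      then show False using False dr_eq(1)[OF t w] s w by (simp add: G.inv_mult_group iv_gen)
    qed
    then have "dl t (iv w \<odot> gen X s) \<longleftrightarrow> dl t (iv w)" using dl_right[OF t s, of "iv w"] w by simp
    then have 2: "dl t (iv (s \<cdot> w)) \<longleftrightarrow> dl t (iv w)" using s w by (simp add: G.inv_mult_group iv_gen)
    show ?thesis using lt[OF w] lt[OF wt] rho_T[OF t w] rho_T[OF t sw] 1 2 swt
      by (cases "dl s w"; cases "dl t (iv w)") (simp_all add: L B_def[symmetric] mult_ac add_ac del: scale_simps(8))
  qed
qed

lemma lam_rho:
  assumes "s \<in> S" "t \<in> S" "h \<in> HW" shows "lam s (rho t h) = rho t (lam s h)"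
  by (rule linear_ext[OF linear_comp[OF linear_lam linear_rho] linear_comp[OF linear_rho linear_lam]])
    (use assms lam_rho_T in \<open>auto simp del: lam_T\<close>)

lemma foldr_lam_rho:
  assumes "set x \<subseteq> S" "t \<in> S" "h \<in> HW" shows "foldr lam x (rho t h) = rho t (foldr lam x h)"
  using assms(1)
proof (induction x)
  case (Cons s x)
  then show ?case using lam_rho[of s t "foldr lam x h"] foldr_lam_HW[of x h] assms by simp
qed simp

lemma foldr_lam_reduced:
  assumes "set x \<subseteq> S" "len (ev x) = length x" shows "foldr lam x (T (ev [])) = T (ev x)"
  using assms
proof (induction x)
  case (Cons s x)
  have s: "s \<in> S" "set x \<subseteq> S" using Cons by auto
  have l: "len (ev x) = length x"
    using Cons.prems len_le[of x] len_lm[of s "ev x"] s by (auto simp: lm_ev)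
  moreover have "\<not> dl s (ev x)" using Cons.prems s l by (simp add: dl_def lm_ev)
  ultimately show ?case using Cons s by (simp add: lt_def lm_ev)
qed simp

text \<open>The right multiplications produce every T_w from T_1, so a map commuting with them is
  known once its value at T_1 is.\<close>

lemma determined_at_one:
  assumes lin: "linear_op P" "linear_op Q"
    and P: "\<And>t h. t \<in> S \<Longrightarrow> h \<in> HW \<Longrightarrow> P (rho t h) = rho t (P h)"
    and Q: "\<And>t h. t \<in> S \<Longrightarrow> h \<in> HW \<Longrightarrow> Q (rho t h) = rho t (Q h)"
    and one: "P (T (ev [])) = Q (T (ev []))" and h: "h \<in> HW"
  shows "P h = Q h"
proof (rule linear_ext[OF lin])
  fix w assume "w \<in> keys h"
  then have w: "w \<in> W" using h by auto
  obtain x where x: "set x \<subseteq> S" "iv w = ev x" "length x = len (iv w)" using reduced_word[of "iv w"] w by auto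
  have 1: "foldr rho x (T (ev [])) = io (foldr lam x (T (ev [])))" for x
    by (induction x) (auto simp: rho_def io_T simp flip: one_ev)
  have "foldr rho x (T (ev [])) = io (T (iv w))" unfolding 1 using foldr_lam_reduced x by simp
  then have Tw: "T w = foldr rho x (T (ev []))" using w by (simp add: io_T)
  have HWx: "foldr rho y (T (ev [])) \<in> HW" if "set y \<subseteq> S" for y
    using that
  proof (induction y)
    case (Cons s y)
    then show ?case using rho_HW[of s "foldr rho y (T (ev []))"] by simp
  qed simp
  have "P (foldr rho y (T (ev []))) = Q (foldr rho y (T (ev [])))" if "set y \<subseteq> S" for y
    using that
  proof (induction y)
    case (Cons s y)
    then show ?case using P[of s "foldr rho y (T (ev []))"] Q[of s "foldr rho y (T (ev []))"] HWx[of y] by simp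
  qed (simp add: one)
  then show "P (T w) = Q (T w)" using Tw x by simp
qed

definition rw :: "'s list set \<Rightarrow> 's list" where
  "rw w = (SOME x. set x \<subseteq> S \<and> w = ev x \<and> length x = len w)"

lemma rw: assumes "w \<in> W" shows "set (rw w) \<subseteq> S" "ev (rw w) = w" "length (rw w) = len w"
proof -
  have "\<exists>x. set x \<subseteq> S \<and> w = ev x \<and> length x = len w" using reduced_word[OF assms] by metis
  from someI_ex[OF this] show "set (rw w) \<subseteq> S" "ev (rw w) = w" "length (rw w) = len w"
    by (simp_all add: rw_def)
qed

lemma rw_one: "rw (ev []) = []" using rw(3)[of "ev []"] by simp

text \<open>Left factors act along chosen reduced words. Associativity rests on
  \<open>lam_hm\<close>: both sides commute with right multiplications, hence need only be compared
  at T_1.\<close>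

definition hm :: "'s hecke_elt \<Rightarrow> 's hecke_elt \<Rightarrow> 's hecke_elt" where
  "hm g h = lin (\<lambda>w. foldr lam (rw w) h) g"

lemma hm_T: "hm (T w) h = foldr lam (rw w) h" by (simp add: hm_def)

lemma linear_hm_left: "linear_op (\<lambda>g. hm g h)"
  unfolding hm_def by (rule linear_lin)

lemma linear_hm_right: "linear_op (hm g)"
  unfolding hm_def[abs_def] lin_def by (intro linear_sums linear_scale linear_foldr linear_lam)

lemma hm_HW: assumes "g \<in> HW" "h \<in> HW" shows "hm g h \<in> HW"
  unfolding hm_def mem_Collect_eq
proof (rule keys_lin)
  fix w assume "w \<in> keys g"
  then show "keys (foldr lam (rw w) h) \<subseteq> W" using foldr_lam_HW[of "rw w" h] rw(1)[of w] assms by auto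
qed

lemma hm_one_right: assumes "g \<in> HW" shows "hm g (T (ev [])) = g"
proof -
  have "hm g (T (ev [])) = lin T g"
    unfolding hm_def by (rule lin_cong) (use assms foldr_lam_reduced rw in auto)
  then show ?thesis by (simp add: lin_id)
qed

lemma hm_one_left: "hm (T (ev [])) h = h"
  by (simp add: hm_T rw_one)

lemma hm_rho: assumes "g \<in> HW" "t \<in> S" "h \<in> HW" shows "hm g (rho t h) = rho t (hm g h)"
proof -
  have "hm g (rho t h) = lin (\<lambda>w. rho t (foldr lam (rw w) h)) g"
    unfolding hm_def by (rule lin_cong) (use assms foldr_lam_rho rw in auto)
  also have "\<dots> = rho t (hm g h)"
    unfolding hm_def lin_def by (simp add: linear_sum[OF linear_rho] linear_opD(2)[OF linear_rho])
  finally show ?thesis .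
qed

lemma lam_hm: assumes "s \<in> S" "g \<in> HW" "h \<in> HW" shows "hm (lam s g) h = lam s (hm g h)"
proof (rule determined_at_one[where P = "hm (lam s g)" and Q = "\<lambda>h. lam s (hm g h)"])
  show "hm (lam s g) (T (ev [])) = lam s (hm g (T (ev [])))"
    using assms lam_HW by (simp add: hm_one_right del: mem_Collect_eq)
qed (use assms hm_rho lam_HW lam_rho hm_HW linear_hm_right linear_comp[OF linear_lam linear_hm_right] in \<open>auto simp del: mem_Collect_eq\<close>)

lemma foldr_lam_hm: assumes "set x \<subseteq> S" "g \<in> HW" "h \<in> HW" shows "hm (foldr lam x g) h = foldr lam x (hm g h)"
  using assms(1)
proof (induction x)
  case (Cons s x)
  then show ?case using lam_hm[of s "foldr lam x g" h] foldr_lam_HW[of x g] assms by simp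
qed simp

lemma hm_assoc: assumes "g \<in> HW" "h \<in> HW" "k \<in> HW" shows "hm (hm g h) k = hm g (hm h k)"
proof (rule linear_ext[where F = "\<lambda>g. hm (hm g h) k" and G = "\<lambda>g. hm g (hm h k)"])
  show "linear_op (\<lambda>g. hm (hm g h) k)" by (rule linear_comp[OF linear_hm_left linear_hm_left])
  fix w assume "w \<in> keys g"
  then have "w \<in> W" using assms by auto
  then show "hm (hm (T w) h) k = hm (T w) (hm h k)"
    unfolding hm_T using foldr_lam_hm[of "rw w" h k] rw assms by blast
qed (rule linear_hm_left)

lemma lam_eq_hm: assumes "s \<in> S" "h \<in> HW" shows "hm (T (gen X s)) h = lam s h"
proof -
  have "lam s (T (ev [])) = T (gen X s)"
    using foldr_lam_reduced[of "[s]"] len_gen[of s] assms by (simp add: gen_ev)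
  then show ?thesis using lam_hm[of s "T (ev [])" h] assms by (simp add: hm_one_left)
qed

lemma hecke_with_simps [simp]:
  "carrier (hecke_with X \<mu>) = HW" "mult (hecke_with X \<mu>) = \<mu>" "one (hecke_with X \<mu>) = T (ev [])"
  "zero (hecke_with X \<mu>) = 0" "add (hecke_with X \<mu>) = (+)"
  by (simp_all add: hecke_with_def one_ev)

lemma hm_is_hecke_product: "is_hecke_product X hm"
proof -
  have "ring (hecke_with X hm)"
  proof (rule ringI)
    show "abelian_group (hecke_with X hm)"
    proof (rule abelian_groupI)
      fix x assume "x \<in> carrier (hecke_with X hm)"
      then show "\<exists>y\<in>carrier (hecke_with X hm). y \<oplus>\<^bsub>hecke_with X hm\<^esub> x = \<zero>\<^bsub>hecke_with X hm\<^esub>"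
        by (intro bexI[of _ "- x"]) (auto simp: keys_minus)
    qed (use HW_closed in \<open>auto simp: add.assoc add.commute add.left_commute simp del: mem_Collect_eq\<close>)
    show "Group.monoid (hecke_with X hm)"
      by (rule Group.monoidI) (use hm_HW hm_assoc hm_one_left hm_one_right in \<open>auto simp del: mem_Collect_eq\<close>)
  qed (simp_all add: linear_opD(1)[OF linear_hm_left] linear_opD(1)[OF linear_hm_right])
  moreover have "hm (T (gen X s)) (T w) = lt s w" if "s \<in> S" "w \<in> W" for s w
    using lam_eq_hm that by simp
  ultimately show ?thesis unfolding is_hecke_product_def
    by (auto simp: linear_opD(2)[OF linear_hm_left] linear_opD(2)[OF linear_hm_right] lt_def dl_def)
qed

text \<open>An unknown Hecke product is additive and homogeneous only on the carrier, so linearity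
  is relativised to it.\<close>

lemma linear_on_HW:
  assumes add: "\<And>g h. g \<in> HW \<Longrightarrow> h \<in> HW \<Longrightarrow> F (g + h) = F g + F h"
    and sc: "\<And>a h. h \<in> HW \<Longrightarrow> F (scale a h) = scale a (F h)" and h: "h \<in> HW"
  shows "F h = lin (\<lambda>w. F (T w)) h"
proof -
  have zero: "F 0 = 0" using sc[of 0 0] by simp
  have "(\<Sum>w\<in>A. scale (lookup h w) (T w)) \<in> HW \<and>
      F (\<Sum>w\<in>A. scale (lookup h w) (T w)) = (\<Sum>w\<in>A. scale (lookup h w) (F (T w)))" if "A \<subseteq> W" "finite A" for A
    using that(2,1)
  proof (induction A)
    case empty
    then show ?case using zero by simp
  next
    case (insert w A)
    then have "scale (lookup h w) (T w) \<in> HW" using HW_closed(2)[of "T w"] by auto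
    then show ?case using insert add[of "scale (lookup h w) (T w)"] sc[of "T w"] HW_closed(1)
      by (simp del: mem_Collect_eq)
  qed
  from this[of "keys h"] show ?thesis using h lin_id[of h] by (simp add: lin_def)
qed

lemma hecke_product_unique:
  assumes \<mu>: "is_hecke_product X \<mu>" and g: "g \<in> HW" and h: "h \<in> HW"
  shows "\<mu> g h = hm g h"
proof -
  interpret R: ring "hecke_with X \<mu>" using \<mu> by (simp add: is_hecke_product_def)
  have sc: "\<mu> (scale a g) h = scale a (\<mu> g h)" "\<mu> g (scale a h) = scale a (\<mu> g h)"
    if "g \<in> HW" "h \<in> HW" for a g h
    using \<mu>[unfolded is_hecke_product_def hecke_with_simps, THEN conjunct2, THEN conjunct1] that by blast+
  have add: "\<mu> (g + g') h = \<mu> g h + \<mu> g' h" "\<mu> h (g + g') = \<mu> h g + \<mu> h g'" if "g \<in> HW" "g' \<in> HW" "h \<in> HW" for g g' h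
    using R.l_distr[of g g' h] R.r_distr[of g g' h] that by (simp_all del: mem_Collect_eq)
  have lamT: "\<mu> (T (gen X s)) (T w) = lt s w" if "s \<in> S" "w \<in> W" for s w
    using \<mu> that len_lm[of s w] unfolding is_hecke_product_def lt_def dl_def
    by (auto simp del: mem_Collect_eq)
  have lam: "\<mu> (T (gen X s)) k = lam s k" if "s \<in> S" "k \<in> HW" for s k
  proof -
    have "\<mu> (T (gen X s)) k = lin (\<lambda>w. \<mu> (T (gen X s)) (T w)) k"
      by (rule linear_on_HW) (use add sc that in \<open>auto simp del: mem_Collect_eq\<close>)
    also have "\<dots> = lam s k" unfolding lam_def by (rule lin_cong) (use that lamT in auto)
    finally show ?thesis .
  qed
  have T: "\<mu> (T w) k = hm (T w) k" if "w \<in> W" "k \<in> HW" for w k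
    using that
  proof (induction "len w" arbitrary: w rule: less_induct)
    case less
    show ?case
    proof (cases "w = ev []")
      case True
      then show ?thesis using R.l_one[of k] less.prems by (simp add: hm_one_left)
    next
      case False
      then obtain s where s: "s \<in> S" "dl s w" using descent_exists less.prems by metis
      let ?u = "s \<cdot> w"
      have u: "?u \<in> W" "len ?u < len w" "\<not> dl s ?u" "s \<cdot> ?u = w"
        using s less.prems dl_lm[of s w] by (simp_all add: dl_def)
      have Tw: "T w = lam s (T ?u)" using u s by (simp add: lt_def)
      have HWs: "T (gen X s) \<in> HW" "T ?u \<in> HW" using s u by auto
      have "\<mu> (T w) k = \<mu> (\<mu> (T (gen X s)) (T ?u)) k" using Tw lam[of s "T ?u"] HWs s by simp
      also have "\<dots> = \<mu> (T (gen X s)) (\<mu> (T ?u) k)"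
        using R.m_assoc[of "T (gen X s)" "T ?u" k] HWs less.prems by (simp del: mem_Collect_eq)
      also have "\<dots> = lam s (hm (T ?u) k)"
        using less.hyps[of ?u] u lam[OF s(1) hm_HW] HWs less.prems by (simp del: mem_Collect_eq)
      also have "\<dots> = hm (T w) k" unfolding Tw using lam_hm[of s "T ?u" k] s HWs less.prems by (simp del: lam_T)
      finally show ?thesis .
    qed
  qed
  have "\<mu> g h = lin (\<lambda>w. \<mu> (T w) h) g"
    by (rule linear_on_HW[of "\<lambda>g. \<mu> g h"]) (use add sc g h in \<open>auto simp del: mem_Collect_eq\<close>)
  also have "\<dots> = lin (\<lambda>w. hm (T w) h) g" by (rule lin_cong) (use g h T in auto)
  also have "\<dots> = hm g h" by (simp add: hm_def)
  finally show ?thesis .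
qed

lemma hecke_simps [simp]:
  "carrier (hecke X) = HW" "one (hecke X) = T (ev [])" "zero (hecke X) = 0" "add (hecke X) = (+)"
  by (simp_all add: hecke_def)

lemma hecke_ring: "ring (hecke X)"
  and hecke_mult: "g \<in> HW \<Longrightarrow> h \<in> HW \<Longrightarrow> g \<otimes>\<^bsub>hecke X\<^esub> h = hm g h"
proof -
  have p: "is_hecke_product X (SOME \<mu>. is_hecke_product X \<mu>)"
    by (rule someI[of "is_hecke_product X", OF hm_is_hecke_product])
  show "ring (hecke X)" using p by (simp add: hecke_def is_hecke_product_def)
  show "g \<in> HW \<Longrightarrow> h \<in> HW \<Longrightarrow> g \<otimes>\<^bsub>hecke X\<^esub> h = hm g h"
    using hecke_product_unique[OF p] by (simp add: hecke_def)
qed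

lemma io_lam: "io (lam s h) = rho s (io h)" by (simp add: rho_def)

lemma io_hm: assumes "g \<in> HW" "h \<in> HW" shows "io (hm g h) = hm (io h) (io g)"
proof (rule linear_ext[where F = "\<lambda>g. io (hm g h)" and G = "\<lambda>g. hm (io h) (io g)"])
  show "linear_op (\<lambda>g. io (hm g h))" by (rule linear_comp[OF linear_io linear_hm_left])
  show "linear_op (\<lambda>g. hm (io h) (io g))" by (rule linear_comp[OF linear_hm_right linear_io])
  fix w assume "w \<in> keys g"
  then have w: "w \<in> W" using assms by auto
  have "io (foldr lam x h) = hm (io h) (io (foldr lam x (T (ev []))))" if "set x \<subseteq> S" for x
    using that
  proof (induction x)
    case Nil
    then show ?case using io_HW[OF assms(2)] hm_one_right by (simp add: io_T flip: one_ev)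
  next
    case (Cons s x)
    let ?y = "io (foldr lam x (T (ev [])))"
    have y: "?y \<in> HW" using Cons foldr_lam_HW[of x "T (ev [])"] io_HW by simp
    have s: "s \<in> S" "set x \<subseteq> S" using Cons by auto
    have "io (foldr lam (s # x) h) = rho s (hm (io h) ?y)" using Cons s by (simp add: io_lam)
    also have "\<dots> = hm (io h) (rho s ?y)" using hm_rho[OF io_HW[OF assms(2)] s(1) y] by simp
    finally show ?case by (simp add: io_lam)
  qed
  from this[of "rw w"] show "io (hm (T w) h) = hm (io h) (io (T w))"
    using foldr_lam_reduced rw w by (simp add: hm_T)
qed

subsection \<open>The representation on the monomial basis\<close>

text \<open>The operator by which \<open>T\<^sub>s\<close> acts, so that \<open>bop s\<close> is the action of \<open>v\<^sup>-\<^sup>1(1 + T\<^sub>s)\<close>.\<close>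

definition th :: "'s \<Rightarrow> 's hecke_elt \<Rightarrow> 's hecke_elt" where "th s h = scale (v_pow 1) (bop s h) - h"

lemma linear_th: "linear_op (th s)"
  using linear_diff[OF linear_scale[OF linear_bop] linear_id] by (simp add: th_def[abs_def])

lemma bop_th: "bop s h = scale (v_pow (- 1)) (h + th s h)"
  by (simp add: th_def del: scale_simps(2))

lemma th_quad: "th s (th s h) = scale (v_pow 2 - 1) (th s h) + scale (v_pow 2) h"
proof -
  have c: "v_pow 1 * (v_pow 1 * delta) = v_pow 2 * v_pow 1 + v_pow 1"
    by (simp add: delta_def distrib_left v_pow_add)
  show ?thesis
    by (simp add: th_def linear_opD[OF linear_bop] bop_bop c left_diff_distrib)
qed

text \<open>The identity, both alternating words of each length from 1 to k - 1, and the one of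
  length k ending in a, acting through T_s. For k = m this is the action of the sum of T_w over the
  dihedral subgroup.\<close>

definition Gs :: "nat \<Rightarrow> 's \<Rightarrow> 's \<Rightarrow> 's hecke_elt \<Rightarrow> 's hecke_elt" where
  "Gs k a c h = h + (\<Sum>j\<in>{1..<k}. foldr th (alt a c j) h + foldr th (alt c a j) h) + foldr th (alt a c k) h"

lemma Gs_Suc: "0 < k \<Longrightarrow> Gs (Suc k) a c h = Gs k a c h + foldr th (alt c a k) h + foldr th (alt a c (Suc k)) h"
  by (simp add: Gs_def)

lemma bop_chebop_top: "bop (tp a c k) (chebop bop k a c h) = scale delta (chebop bop k a c h)"
proof -
  have "bop (tp a c k) (scale (of_int (cheb k j)) (foldr bop (alt a c j) h)) = scale delta (scale (of_int (cheb k j)) (foldr bop (alt a c j) h))" for j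
  proof (cases "cheb k j = 0")
    case False
    then obtain i where i: "j = Suc i" by (cases j) auto
    have "tp a c k = tp a c j" using False cheb_parity[of k j] by (auto simp: tp_def)
    then show ?thesis by (simp add: i alt_Suc linear_opD[OF linear_bop] bop_bop mult.commute)
  qed (simp add: linear_opD[OF linear_bop])
  then show ?thesis by (simp add: chebop_def linear_sum[OF linear_bop] scale_sum del: scale_simps(3))
qed

text \<open>The dihedral Kazhdan--Lusztig formula C'_w = v^{-l(w)} times the sum of T_y over y <= w,
  in operator form. In a dihedral group y < w means that y is shorter than w. The induction compares
  b_t C'_w = C'_{tw} + C'_{w'} with the effect of b_t on the sum.\<close>

lemma chebop_Gs: "0 < k \<Longrightarrow> chebop bop k a c h = scale (v_pow (- int k)) (Gs k a c h)"
proof (induction k rule: less_induct)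
  case (less k)
  consider "k = 1" | "k = 2" | i where "k = Suc (Suc (Suc i))" using less.prems
    by (metis One_nat_def Suc_1 not0_implies_Suc less_irrefl)
  then show ?case
  proof cases
    case 1
    then show ?thesis by (simp add: chebop_1 Gs_def alt_Suc tp_def bop_th)
  next
    case 2
    have "chebop bop 2 a c h = bop c (bop a h)"
      using chebop_rec[where b = bop and k = 1 and a = a and c = c and h = h, OF linear_bop]
      by (simp add: chebop_1 tp_def numeral_2_eq_2)
    show ?thesis unfolding 2 \<open>chebop bop 2 a c h = bop c (bop a h)\<close>
      by (simp add: bop_th linear_opD[OF linear_th] v_pow_add Gs_def alt_Suc tp_def numeral_2_eq_2 algebra_simps)
  next
    case (3 i)
    let ?k = "Suc (Suc i)" and ?t = "tp a c (Suc (Suc (Suc i)))"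
    have t: "?t = tp a c (Suc i)" "?t = tp c a ?k" by (auto simp: tp_def)
    have IH: "chebop bop ?k a c h = scale (v_pow (- int ?k)) (Gs ?k a c h)"
      "chebop bop (Suc i) a c h = scale (v_pow (- int (Suc i))) (Gs (Suc i) a c h)"
      using less.IH[of ?k] less.IH[of "Suc i"] 3 by auto
    define G where "G = Gs (Suc i) a c h"
    \<comment> \<open>The letter t is also the leading letter two steps lower, so b_t acts on G by
      delta = v + v^-1. After rescaling, the part from v cancels against the subtracted lower
      term.\<close>
    have bG: "bop ?t G = scale delta G"
    proof -
      have "scale (v_pow (- int (Suc i))) (bop ?t G) = scale (v_pow (- int (Suc i))) (scale delta G)"
        using bop_chebop_top[of a c "Suc i" h] unfolding IH(2) t(1)[symmetric] linear_opD(2)[OF linear_bop] G_def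
        by (simp add: mult.commute)
      then show ?thesis using scale_cancel[OF v_pow_ne_0] by blast
    qed
    define A B where "A = foldr th (alt c a (Suc i)) h" and "B = foldr th (alt a c ?k) h"
    have Gk: "Gs ?k a c h = G + A + B" by (simp add: Gs_Suc G_def A_def B_def)
    have bA: "bop ?t A = scale (v_pow (- 1)) (A + foldr th (alt c a ?k) h)"
      unfolding bop_th A_def t(2) alt_Suc[of c a "Suc i"] by simp
    have bB: "bop ?t B = scale (v_pow (- 1)) (B + foldr th (alt a c k) h)"
      unfolding bop_th B_def 3 alt_Suc[of a c ?k] by simp
    have Gk1: "Gs k a c h = G + A + B + foldr th (alt c a ?k) h + foldr th (alt a c k) h"
      by (simp add: 3 Gs_Suc G_def A_def B_def)
    have "chebop bop k a c h = bop ?t (chebop bop ?k a c h) - chebop bop (Suc i) a c h"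
      using chebop_rec[where b = bop and k = ?k and a = a and c = c and h = h, OF linear_bop] 3 by simp
    also have "\<dots> = scale (v_pow (- int ?k)) (scale delta G + scale (v_pow (- 1)) (A + foldr th (alt c a ?k) h)
        + scale (v_pow (- 1)) (B + foldr th (alt a c k) h)) - scale (v_pow (- int (Suc i))) G"
      unfolding IH Gk linear_opD(1,2)[OF linear_bop] bG bA bB G_def[symmetric] ..
    also have "\<dots> = scale (v_pow (- int k)) (Gs k a c h)"
      unfolding Gk1 by (simp add: 3 v_pow_add delta_def distrib_left algebra_simps)
    finally show ?thesis .
  qed
qed

lemma Gs_zero:
  assumes "a \<in> S" "c \<in> S" "\<not> commuting X a c" "bond X a c = enat m" shows "Gs m a c h = 0"
proof -
  have "0 < m" using noncommuting_bond assms by fastforce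
  then have "scale (v_pow (- int m)) (Gs m a c h) = 0" using chebop_Gs[of m a c h] chebop_zero assms by simp
  then show ?thesis using scale_eq_0[OF v_pow_ne_0] by blast
qed

text \<open>For noncommuting generators \<open>Gs m a c\<close> and \<open>Gs m c a\<close> differ
  only in their words of length m, and both vanish.\<close>

lemma th_braid:
  assumes ac: "a \<in> S" "c \<in> S" "a \<noteq> c" "bond X a c = enat m"
  shows "foldr th (alt a c m) h = foldr th (alt c a m) h"
proof (cases "commuting X a c")
  case True
  then have "m = 2" using commuting_iff[of a c] ac by (simp add: numeral_eq_enat)
  then show ?thesis using bop_commute[OF ac(1,2) True]
    by (simp add: numeral_2_eq_2 alt_Suc tp_def th_def linear_opD[OF linear_bop])
next
  case False
  have "Gs m a c h = 0" "Gs m c a h = 0"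
    using Gs_zero[of a c m h] Gs_zero[of c a m h] ac False bond_sym[of a c] commuting_sym by auto
  then show ?thesis by (simp add: Gs_def add.commute add_eq_0_iff)
qed

text \<open>Matsumoto's theorem, for operators satisfying the braid relations.\<close>

lemma th_reduced_words:
  assumes "set x \<subseteq> S" "set y \<subseteq> S" "ev x = ev y" "len (ev x) = length x" "length y = length x"
  shows "foldr th x h = foldr th y h"
  using assms
proof (induction "length x" arbitrary: x y h rule: less_induct)
  case less
  show ?case
  proof (cases x)
    case Nil
    then show ?thesis using less.prems by simp
  next
    case (Cons s x')
    then obtain t y' where y: "y = t # y'" using less.prems by (cases y) auto
    note x = Cons
    let ?w = "ev x"
    have st: "s \<in> S" "t \<in> S" "set x' \<subseteq> S" "set y' \<subseteq> S" using less.prems x y by auto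
    have wW: "?w \<in> W" using less.prems by simp
    have sw: "s \<cdot> ?w = ev x'" and tw: "t \<cdot> ?w = ev y'"
      using x y st less.prems lm_lm[of s "ev x'"] lm_lm[of t "ev y'"] by (simp_all add: lm_ev)
    have lx: "len (ev x') = length x'" "len (ev y') = length y'"
      using len_le[of x'] len_le[of y'] len_lm[OF st(1) wW] len_lm[OF st(2) wW] sw tw less.prems x y st by auto
    have ds: "dl s ?w" "dl t ?w" using sw tw lx less.prems x y by (auto simp: dl_def)
    show ?thesis
    proof (cases "s = t")
      case True
      then have "foldr th x' h = foldr th y' h"
        using less.hyps[of x' y'] x y st lx sw tw less.prems by simp
      then show ?thesis using x y True by simp
    next
      case False
      obtain c d m z where m: "bond X s t = enat m" "z \<in> W" "?w = ev (alt c d m) \<odot> z" "len ?w = m + len z"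
        "{c, d} = {s, t}" "tp c d m = s" "tp d c m = t" "2 \<le> m"
        using two_descents_oriented[OF st(1,2) False wW ds] by metis
      have cd: "c \<in> S" "d \<in> S" "c \<noteq> d" "bond X c d = enat m"
        using m st False bond_sym[of s t] by (auto simp: doubleton_eq_iff)
      obtain k where k: "m = Suc k" using m by (cases m) auto
      obtain z' where z': "set z' \<subseteq> S" "z = ev z'" "length z' = len z" using m(2) by (rule reduced_word)
      have br: "ev (alt c d m) = ev (alt d c m)" using braid_alt cd by blast
      have sub: "foldr th x' h = foldr th (alt c d k @ z') h" "foldr th y' h = foldr th (alt d c k @ z') h"
      proof -
        have "s \<cdot> ?w = ev (alt c d k) \<odot> z"
          using alt_prefix(2)[of c d z ?w k] m(2-4,6) cd k by simp
        then have "ev x' = ev (alt c d k @ z')" using sw z' cd by (simp add: mul_ev)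
        then show "foldr th x' h = foldr th (alt c d k @ z') h"
          using less.hyps[of x' "alt c d k @ z'"] x st cd z' lx m k less.prems by simp
        have "t \<cdot> ?w = ev (alt d c k) \<odot> z"
          using alt_prefix(2)[of d c z ?w k] m(2-4,7) cd k br by simp
        then have "ev y' = ev (alt d c k @ z')" using tw z' cd by (simp add: mul_ev)
        then show "foldr th y' h = foldr th (alt d c k @ z') h"
          using less.hyps[of y' "alt d c k @ z'"] x y st cd z' lx m k less.prems by simp
      qed
      have "foldr th x h = foldr th (alt c d m) (foldr th z' h)"
        using x sub m k by (simp add: alt_Suc)
      also have "\<dots> = foldr th (alt d c m) (foldr th z' h)" using th_braid cd by blast
      also have "\<dots> = foldr th y h" using y sub m k by (simp add: alt_Suc)
      finally show ?thesis .
    qed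
  qed
qed

definition Th :: "'s hecke_elt \<Rightarrow> 's hecke_elt \<Rightarrow> 's hecke_elt" where
  "Th g h = lin (\<lambda>w. foldr th (rw w) h) g"

text \<open>The orbit map of the monomial b_1 = 1. Its kernel in the Hecke algebra turns out to be J
  (\<open>J_iff\<close>), which identifies the module with TL(X).\<close>

definition phi :: "'s hecke_elt \<Rightarrow> 's hecke_elt" where "phi g = Th g (T (ev []))"

lemma linear_Th_left: "linear_op (\<lambda>g. Th g h)"
  unfolding Th_def by (rule linear_lin)

lemma linear_Th_right: "linear_op (Th g)"
  unfolding Th_def[abs_def] lin_def by (intro linear_sums linear_scale linear_foldr linear_th)

lemma linear_phi: "linear_op phi"
  unfolding phi_def[abs_def] by (rule linear_Th_left)

lemma Th_reduced:
  assumes "set x \<subseteq> S" "len (ev x) = length x" shows "Th (T (ev x)) h = foldr th x h"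
  unfolding Th_def lin_T
proof (rule th_reduced_words)
  have r: "set (rw (ev x)) \<subseteq> S" "ev (rw (ev x)) = ev x" "length (rw (ev x)) = len (ev x)"
    using rw[of "ev x"] assms by auto
  then show "set (rw (ev x)) \<subseteq> S" "ev (rw (ev x)) = ev x" by blast+
  show "len (ev (rw (ev x))) = length (rw (ev x))" "length x = length (rw (ev x))"
    using r assms by argo+
qed (rule assms)

lemma Th_up: assumes "s \<in> S" "w \<in> W" "\<not> dl s w" shows "Th (T (s \<cdot> w)) h = th s (Th (T w) h)"
proof -
  obtain x where x: "set x \<subseteq> S" "w = ev x" "length x = len w" using assms by (meson reduced_word)
  have "Th (T (ev (s # x))) h = foldr th (s # x) h"
    using x assms ndl_len[of s w] by (intro Th_reduced) (auto simp flip: lm_ev)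
  then show ?thesis using x assms Th_reduced[of x h] by (simp add: lm_ev)
qed

lemma Th_lam: assumes s: "s \<in> S" and g: "g \<in> HW" shows "Th (lam s g) h = th s (Th g h)"
proof (rule linear_ext[where F = "\<lambda>g. Th (lam s g) h" and G = "\<lambda>g. th s (Th g h)"])
  show "linear_op (\<lambda>g. Th (lam s g) h)" by (rule linear_comp[OF linear_Th_left linear_lam])
  show "linear_op (\<lambda>g. th s (Th g h))" by (rule linear_comp[OF linear_th linear_Th_left])
  fix w assume "w \<in> keys g"
  then have w: "w \<in> W" using g by auto
  show "Th (lam s (T w)) h = th s (Th (T w) h)"
  proof (cases "dl s w")
    case True
    have "Th (T w) h = th s (Th (T (s \<cdot> w)) h)"
      using Th_up[of s "s \<cdot> w" h] s w True dl_lm[of s w] by simp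
    then have "th s (Th (T w) h) = scale (v_pow 2 - 1) (Th (T w) h) + scale (v_pow 2) (Th (T (s \<cdot> w)) h)"
      using th_quad by metis
    then show ?thesis using lt_simps(1)[OF s w True] by (simp add: linear_opD[OF linear_Th_left])
  next
    case False
    then show ?thesis using lt_simps(2)[OF s w False] Th_up[OF s w False] by simp
  qed
qed

lemma Th_one [simp]: "Th (T (ev [])) h = h"
  using Th_reduced[of "[]"] by simp

lemma Th_foldr: "set x \<subseteq> S \<Longrightarrow> g \<in> HW \<Longrightarrow> Th (foldr lam x g) h = foldr th x (Th g h)"
proof (induction x)
  case (Cons s x)
  then show ?case using Th_lam[of s "foldr lam x g" h] foldr_lam_HW[of x g] by simp
qed simp

lemma Th_hm: assumes "g \<in> HW" "h \<in> HW" shows "Th (hm g h) k = Th g (Th h k)"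
proof (rule linear_ext[where F = "\<lambda>g. Th (hm g h) k" and G = "\<lambda>g. Th g (Th h k)"])
  show "linear_op (\<lambda>g. Th (hm g h) k)" by (rule linear_comp[OF linear_Th_left linear_hm_left])
  fix w assume "w \<in> keys g"
  then have "w \<in> W" using assms by auto
  then show "Th (hm (T w) h) k = Th (T w) (Th h k)"
    using Th_foldr[of "rw w" h k] Th_reduced[of "rw w" "Th h k"] rw[of w] assms by (simp add: hm_T)
qed (rule linear_Th_left)

lemma phi_hm: "g \<in> HW \<Longrightarrow> h \<in> HW \<Longrightarrow> phi (hm g h) = Th g (phi h)"
  by (simp add: phi_def Th_hm)

lemma Th_parabolic:
  assumes ac: "a \<in> S" "c \<in> S" "\<not> commuting X a c" "bond X a c = enat m"
  shows "Th (\<Sum>w\<in>parabolic X a c. T w) h = 0"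
proof -
  have ne: "a \<noteq> c" using noncommuting_neq ac by blast
  have m: "3 \<le> m" using noncommuting_bond ac by blast
  have "inj_on (\<lambda>j. ev (alt c a j)) {..m}"
    using parabolic_inj(1)[of c a m] ac ne bond_sym[of a c] by auto
  then have inj2: "inj_on (\<lambda>j. ev (alt c a j)) {1..<m}" by (rule inj_on_subset) auto
  have T1: "Th (T (ev (alt a c j))) h = foldr th (alt a c j) h" "Th (T (ev (alt c a j))) h = foldr th (alt c a j) h" if "j \<le> m" for j
    using Th_reduced[of "alt a c j" h] Th_reduced[of "alt c a j" h] len_alt[of a c j] len_alt[of c a j] ac ne bond_sym[of a c] that
    by auto
  have "(\<Sum>w\<in>parabolic X a c. Th (T w) h) = (\<Sum>j\<le>m. Th (T (ev (alt a c j))) h) + (\<Sum>j\<in>{1..<m}. Th (T (ev (alt c a j))) h)"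
    unfolding parabolic_alt[OF ac(1,2,4) less_le_trans[OF zero_less_numeral m]]
    using parabolic_inj[OF ac(1,2) ne ac(4)] inj2 by (simp add: sum.union_disjoint sum.reindex)
  also have "\<dots> = (\<Sum>j\<le>m. foldr th (alt a c j) h) + (\<Sum>j\<in>{1..<m}. foldr th (alt c a j) h)"
    using T1 by simp
  also have "(\<Sum>j\<le>m. foldr th (alt a c j) h) = h + (\<Sum>j\<in>{1..<m}. foldr th (alt a c j) h) + foldr th (alt a c m) h"
  proof -
    have "{..m} = insert 0 (insert m {1..<m})" using m by auto
    then show ?thesis using m by simp
  qed
  finally have "(\<Sum>w\<in>parabolic X a c. Th (T w) h) = Gs m a c h"
    by (simp add: Gs_def sum.distrib algebra_simps)
  then show ?thesis using Gs_zero[OF ac] by (simp add: linear_sum[OF linear_Th_left])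
qed

section \<open>The kernel of the action is the Temperley--Lieb ideal\<close>

abbreviation J where "J \<equiv> TL_ideal X"

abbreviation TLgens :: "'s hecke_elt set" where
  "TLgens \<equiv> {\<Sum>w\<in>parabolic X s t. T w |s t. s \<in> S \<and> t \<in> S \<and> \<not> commuting X s t \<and> bond X s t < \<infinity>}"

lemma parabolic_W: assumes "a \<in> S" "c \<in> S" shows "parabolic X a c \<subseteq> W"
  using assms unfolding parabolic_words[OF assms] by auto

lemma TLgens_HW: "TLgens \<subseteq> HW"
proof -
  have "(\<Sum>w\<in>parabolic X s t. T w) \<in> HW" if "s \<in> S" "t \<in> S" for s t
    unfolding mem_Collect_eq by (rule keys_sum_subset) (use parabolic_W that in auto)
  then show ?thesis by blast
qed

lemma J_ideal: "ideal J (hecke X)" and TLgens_J: "TLgens \<subseteq> J"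
proof -
  interpret R: ring "hecke X" by (rule hecke_ring)
  show "ideal J (hecke X)" "TLgens \<subseteq> J"
    unfolding TL_ideal_def using R.genideal_ideal R.genideal_self TLgens_HW by simp_all
qed

lemma J_HW: "J \<subseteq> HW"
  using ideal.Icarr[OF J_ideal] by auto

lemma J_hm: "g \<in> J \<Longrightarrow> h \<in> HW \<Longrightarrow> hm g h \<in> J" "g \<in> J \<Longrightarrow> h \<in> HW \<Longrightarrow> hm h g \<in> J"
  using ideal.I_r_closed[OF J_ideal, of g h] ideal.I_l_closed[OF J_ideal, of g h] J_HW hecke_mult by auto

lemma J_add: "g \<in> J \<Longrightarrow> h \<in> J \<Longrightarrow> g + h \<in> J"
  using additive_subgroup.a_closed[OF ideal.axioms(1)[OF J_ideal], of g h] by simp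

lemma J_zero: "0 \<in> J"
  using additive_subgroup.zero_closed[OF ideal.axioms(1)[OF J_ideal]] by simp

lemma J_scale: assumes "g \<in> J" shows "scale a g \<in> J"
proof -
  have "hm (scale a (T (ev []))) g \<in> J" using J_hm(2)[OF assms, of "scale a (T (ev []))"] HW_closed(2)[of "T (ev [])" a] by simp
  then show ?thesis by (simp add: linear_opD(2)[OF linear_hm_left] hm_one_left)
qed

text \<open>The elements acting as zero on the whole module form a two-sided ideal, and the
  generators of J are among them because a full dihedral sum acts as \<open>Gs m\<close>.\<close>

lemma J_Th: assumes "g \<in> J" shows "Th g h = 0"
proof -
  interpret R: ring "hecke X" by (rule hecke_ring)
  let ?K = "{g \<in> HW. \<forall>h. Th g h = 0}"
  have "ideal ?K (hecke X)"
  proof (rule idealI)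
    show "subgroup ?K (add_monoid (hecke X))"
    proof (rule R.add.subgroupI)
      fix g assume g: "g \<in> ?K"
      have "\<ominus>\<^bsub>hecke X\<^esub> g = - g"
        by (rule R.minus_equality) (use g HW_closed(3)[of g] in auto)
      then show "\<ominus>\<^bsub>hecke X\<^esub> g \<in> ?K"
        using g HW_closed(3)[of g] by (simp add: linear_opD(4)[OF linear_Th_left])
    next
      have "0 \<in> ?K" using HW_closed(5) linear_opD(3)[OF linear_Th_left] by auto
      then show "?K \<noteq> {}" by blast
    qed (use HW_closed(1) linear_opD(1)[OF linear_Th_left] in auto)
    fix g k assume *: "g \<in> ?K" "k \<in> carrier (hecke X)"
    then have gk: "g \<in> HW" "k \<in> HW" by auto
    show "k \<otimes>\<^bsub>hecke X\<^esub> g \<in> ?K" "g \<otimes>\<^bsub>hecke X\<^esub> k \<in> ?K"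
      using * hm_HW[OF gk] hm_HW[OF gk(2,1)] Th_hm[OF gk] Th_hm[OF gk(2,1)] hecke_mult[OF gk] hecke_mult[OF gk(2,1)]
      by (simp_all add: linear_opD(3)[OF linear_Th_right])
  qed (rule hecke_ring)
  moreover have "TLgens \<subseteq> ?K"
    using TLgens_HW Th_parabolic by (auto simp: less_infinityE)
  ultimately have "J \<subseteq> ?K" unfolding TL_ideal_def by (rule R.genideal_minimal)
  then show ?thesis using assms by auto
qed

lemma th_keys: assumes "keys h \<subseteq> {y\<in>Wc. len y \<le> n}" shows "keys (th s h) \<subseteq> {y\<in>Wc. len y \<le> n + 1}"
proof -
  have "keys (bop s h) \<subseteq> {y\<in>Wc. len y \<le> n + 1}"
    unfolding bop_def by (rule keys_lin) (use assms bt_keys in fastforce)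
  then show ?thesis unfolding th_def
    using assms keys_scale[of "v_pow 1" "bop s h"] by (intro keys_diff_subset) force+
qed

lemma foldr_th_keys: "keys h \<subseteq> {y\<in>Wc. len y \<le> n} \<Longrightarrow> keys (foldr th x h) \<subseteq> {y\<in>Wc. len y \<le> n + length x}"
proof (induction x)
  case (Cons s x)
  then show ?case using th_keys[of "foldr th x h" "n + length x" s] by simp
qed simp

lemma phi_keys: "keys (phi g) \<subseteq> Wc"
  unfolding phi_def Th_def by (rule keys_lin) (use foldr_th_keys[of "T (ev [])" 0] in fastforce)

text \<open>T_s acts as v b_s - 1, so the leading term of T_w is v^{l(w)} b_w.\<close>

lemma phi_T:
  assumes "w \<in> Wc" shows "keys (phi (T w) - scale (v_pow (int (len w))) (T w)) \<subseteq> {y\<in>Wc. len y < len w}"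
proof -
  have "keys (foldr th x (T (ev [])) - scale (v_pow (int (length x))) (T (ev x))) \<subseteq> {y\<in>Wc. len y < length x}"
    if "set x \<subseteq> S" "len (ev x) = length x" "ev x \<in> Wc" for x
    using that
  proof (induction x)
    case (Cons s x)
    have s: "s \<in> S" "set x \<subseteq> S" using Cons by auto
    have l: "len (ev x) = length x"
      using Cons.prems len_le[of x] len_lm[of s "ev x"] s by (auto simp: lm_ev)
    have d: "\<not> dl s (ev x)" using Cons.prems s l by (simp add: dl_def lm_ev)
    have xc: "ev x \<in> Wc"
      using Wc_lm[of s "ev (s # x)"] Cons.prems s dl_lm[of s "ev x"] d by (simp flip: lm_ev)
    let ?v = "v_pow (int (length x))"
    define r where "r = foldr th x (T (ev [])) - scale ?v (T (ev x))"
    have r: "keys r \<subseteq> {y\<in>Wc. len y < length x}" using Cons.IH s l xc by (simp add: r_def)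
    have "foldr th x (T (ev [])) = scale ?v (T (ev x)) + r" by (simp add: r_def)
    then have eq: "foldr th (s # x) (T (ev [])) - scale (v_pow (int (length (s # x)))) (T (ev (s # x))) = th s r - scale ?v (T (ev x))"
      using bt_up[OF s(1) xc d] Cons.prems s
      by (simp add: linear_opD[OF linear_th]) (simp add: th_def lm_ev v_pow_add algebra_simps)
    have "keys (th s r) \<subseteq> {y\<in>Wc. len y < length (s # x)}"
    proof (cases "length x")
      case 0
      then have "r = 0" using r by auto
      then show ?thesis by (simp add: linear_opD(3)[OF linear_th])
    next
      case (Suc n)
      then show ?thesis using th_keys[of r n s] r by (simp add: less_Suc_eq_le)
    qed
    moreover have "keys (scale ?v (T (ev x))) \<subseteq> {y\<in>Wc. len y < length (s # x)}" using keys_scale[of ?v "T (ev x)"] xc l by auto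
    ultimately show ?case unfolding eq by (rule keys_diff_subset)
  qed simp
  from this[of "rw w"] show ?thesis using rw[of w] assms by (simp add: phi_def Th_def)
qed

lemma foldr_lam_keys:
  assumes "set x \<subseteq> S" "keys h \<subseteq> {w\<in>W. len w \<le> n}"
  shows "keys (foldr lam x h) \<subseteq> {w\<in>W. len w \<le> n + length x}"
  using assms(1)
proof (induction x)
  case (Cons s x)
  have "keys (lam s (foldr lam x h)) \<subseteq> {w\<in>W. len w \<le> n + length (s # x)}"
    unfolding lam_def[of s]
  proof (rule keys_lin)
    fix w assume "w \<in> keys (foldr lam x h)"
    then have w: "w \<in> W" "len w \<le> n + length x" using Cons by auto
    have s: "s \<in> S" using Cons by simp
    have T: "keys (scale a (T (s \<cdot> w))) \<subseteq> {w\<in>W. len w \<le> n + length (s # x)}" "keys (scale a (T w)) \<subseteq> {w\<in>W. len w \<le> n + length (s # x)}" for a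
      using keys_scale[of a "T (s \<cdot> w)"] keys_scale[of a "T w"] w s len_lm[of s w] by auto
    show "keys (lt s w) \<subseteq> {w\<in>W. len w \<le> n + length (s # x)}"
      using lt_simps[OF s w(1)] T T(1)[of 1] keys_add_subset[OF T(1) T(2)] by (cases "dl s w") (simp_all del: scale_simps(8))
  qed
  then show ?case by simp
qed (use assms in simp)

lemma hm_T_add:
  assumes "u \<in> W" "w \<in> W" "len (u \<odot> w) = len u + len w" shows "hm (T u) (T w) = T (u \<odot> w)"
proof -
  have r: "set (rw u) \<subseteq> S" "ev (rw u) = u" "length (rw u) = len u" "set (rw w) \<subseteq> S" "ev (rw w) = w" "length (rw w) = len w"
    using rw assms by auto
  have e: "ev (rw u @ rw w) = u \<odot> w" using mul_ev[of "rw u" "rw w"] r by simp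
  have "hm (T u) (T w) = foldr lam (rw u) (foldr lam (rw w) (T (ev [])))"
    using foldr_lam_reduced[of "rw w"] r by (simp add: hm_T)
  also have "\<dots> = T (ev (rw u @ rw w))"
    using foldr_lam_reduced[of "rw u @ rw w"] r e assms by simp
  finally show ?thesis using e by simp
qed

text \<open>\<open>Sp\<close> turns out to be everything: the \<open>T\<^sub>w\<close> with \<open>w\<close> not complex span modulo \<open>J\<close>.\<close>

definition Sp :: "'s hecke_elt set" where "Sp = {g. \<exists>f. keys f \<subseteq> Wc \<and> g - f \<in> J}"

lemma Sp_add: assumes "g \<in> Sp" "h \<in> Sp" shows "g + h \<in> Sp"
proof -
  obtain f f' where f: "keys f \<subseteq> Wc" "g - f \<in> J" "keys f' \<subseteq> Wc" "h - f' \<in> J" using assms by (auto simp: Sp_def)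
  have "(g + h) - (f + f') \<in> J" using J_add[OF f(2,4)] by (simp add: algebra_simps)
  then show ?thesis using f keys_add_subset[of f Wc f'] by (auto simp: Sp_def)
qed

lemma Sp_scale: assumes "g \<in> Sp" shows "scale a g \<in> Sp"
proof -
  obtain f where f: "keys f \<subseteq> Wc" "g - f \<in> J" using assms by (auto simp: Sp_def)
  have "scale a g - scale a f \<in> J" using J_scale[OF f(2), of a] by simp
  then show ?thesis using f keys_scale[of a f] by (auto simp: Sp_def)
qed

lemma J_Sp: "g \<in> J \<Longrightarrow> g \<in> Sp"
  unfolding Sp_def by (auto intro!: exI[of _ 0])

lemma Sp_sum: "(\<And>i. i \<in> I \<Longrightarrow> f i \<in> Sp) \<Longrightarrow> sum f I \<in> Sp"
  by (induction I rule: infinite_finite_induct) (auto intro: Sp_add J_Sp J_zero)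

lemma Sp_keys: assumes "\<And>w. w \<in> keys h \<Longrightarrow> T w \<in> Sp" shows "h \<in> Sp"
proof -
  have "lin T h \<in> Sp" unfolding lin_def by (rule Sp_sum) (use assms Sp_scale in blast)
  then show ?thesis by (simp add: lin_id)
qed

text \<open>For w = x1 w0 x2 the relation of TL(X) replaces T_{w0} modulo J by T_y with y shorter.
  Multiplying by T_{x1} and T_{x2} produces only T_z with l(z) <= l(x1) + l(y) + l(x2) <
  l(w).\<close>

lemma T_Sp: "w \<in> W \<Longrightarrow> T w \<in> Sp"
proof (induction "len w" arbitrary: w rule: less_induct)
  case less
  show ?case
  proof (cases "w \<in> Wc")
    case True
    then show ?thesis unfolding Sp_def using J_zero by (auto intro!: exI[of _ "T w"])
  next
    case False
    then have "complex X w" using less Wc_iff by blast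
    then obtain x1 x2 a b m where u: "x1 \<in> W" "x2 \<in> W" "a \<in> S" "b \<in> S" "\<not> commuting X a b" "bond X a b = enat m"
      "w = x1 \<odot> ev (alt a b m) \<odot> x2" "len w = len x1 + m + len x2" by (rule complexE)
    have ne: "a \<noteq> b" using u noncommuting_neq by blast
    have m: "3 \<le> m" using noncommuting_bond u by blast
    let ?P = "parabolic X a b" and ?w0 = "ev (alt a b m)"
    have P: "?P = (\<lambda>j. ev (alt a b j)) ` {..m} \<union> (\<lambda>j. ev (alt b a j)) ` {1..<m}"
      using parabolic_alt u m by simp
    have la: "len (ev (alt a b j)) = j" "len (ev (alt b a j)) = j" if "j \<le> m" for j
      using len_alt[of a b j] len_alt[of b a j] u ne bond_sym[of a b] that by auto
    have finP: "finite ?P" "?w0 \<in> ?P" unfolding P by auto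
    have yl: "len y < m" if "y \<in> ?P - {?w0}" for y
      using that la unfolding P by (auto simp: nat_less_le)
    let ?F = "\<lambda>y. hm (T x1) (hm (T y) (T x2))"
    have "(\<Sum>y\<in>?P. T y) \<in> TLgens" using u by (intro CollectI exI[of _ a] exI[of _ b] conjI) simp_all
    then have "(\<Sum>y\<in>?P. T y) \<in> J" using TLgens_J by blast
    then have "hm (T x1) (hm (\<Sum>y\<in>?P. T y) (T x2)) \<in> J" using J_hm u HW_T by blast
    moreover have "hm (T x1) (hm (\<Sum>y\<in>?P. T y) (T x2)) = (\<Sum>y\<in>?P. ?F y)"
      by (simp add: linear_sum[OF linear_hm_left] linear_sum[OF linear_hm_right])
    moreover have "(\<Sum>y\<in>?P. ?F y) = ?F ?w0 + (\<Sum>y\<in>?P - {?w0}. ?F y)"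
      using finP by (simp add: sum.remove)
    moreover have "?F ?w0 = T w"
    proof -
      have l0: "len ?w0 = m" "?w0 \<in> W" using la[of m] u by auto
      have "len (?w0 \<odot> x2) = len ?w0 + len x2"
        using len_mul_le[of ?w0 x2] len_mul_le[of x1 "?w0 \<odot> x2"] u l0 by (simp add: G.m_assoc)
      then show ?thesis using hm_T_add[of ?w0 x2] hm_T_add[of x1 "?w0 \<odot> x2"] u l0 by (simp add: G.m_assoc)
    qed
    ultimately have 1: "T w + (\<Sum>y\<in>?P - {?w0}. ?F y) \<in> Sp" using J_Sp by simp
    have "?F y \<in> Sp" if y: "y \<in> ?P - {?w0}" for y
    proof (rule Sp_keys)
      fix z assume z: "z \<in> keys (?F y)"
      have yW: "y \<in> W" using y parabolic_W u by blast
      have "keys (T x2) \<subseteq> {w\<in>W. len w \<le> len x2}" using u by simp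
      then have "keys (foldr lam (rw y) (T x2)) \<subseteq> {w\<in>W. len w \<le> len x2 + length (rw y)}"
        by (rule foldr_lam_keys[OF rw(1)[OF yW]])
      then have "keys (foldr lam (rw x1) (foldr lam (rw y) (T x2))) \<subseteq> {w\<in>W. len w \<le> len x2 + length (rw y) + length (rw x1)}"
        by (rule foldr_lam_keys[OF rw(1)[OF u(1)]])
      then have "z \<in> W" "len z \<le> len x2 + len y + len x1" using z rw(3)[OF yW] rw(3)[OF u(1)] by (auto simp: hm_T)
      then show "T z \<in> Sp" using less.hyps[of z] yl[OF y] u by simp
    qed
    then have "scale (- 1) (\<Sum>y\<in>?P - {?w0}. ?F y) \<in> Sp" by (intro Sp_scale Sp_sum)
    from Sp_add[OF 1 this] show ?thesis by simp
  qed
qed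

lemma phi_injective_on_Wc:
  assumes "keys f \<subseteq> Wc" "phi f = 0" shows "f = 0"
proof (rule ccontr)
  assume "f \<noteq> 0"
  then have ne: "keys f \<noteq> {}" by simp
  define n where "n = Max (len ` keys f)"
  have "n \<in> len ` keys f" unfolding n_def using ne by (intro Max_in) auto
  then obtain w where w: "w \<in> keys f" "len w = n" by auto
  have mx: "len y \<le> n" if "y \<in> keys f" for y unfolding n_def using that by (intro Max_ge) auto
  have "lookup (phi (T y)) w = (if y = w then v_pow (int n) else 0)" if y: "y \<in> keys f" for y
  proof -
    have "y \<in> Wc" using y assms by blast
    then have "w \<notin> keys (phi (T y) - scale (v_pow (int (len y))) (T y))"
      using phi_T[of y] mx[OF y] w by fastforce
    then show ?thesis using w by (auto simp: in_keys_iff lookup_minus lookup_T)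
  qed
  then have "lookup (phi f) w = (\<Sum>y\<in>keys f. lookup f y * (if y = w then v_pow (int n) else 0))"
    by (subst linear_eq_lin[OF linear_phi]) (simp add: lin_def lookup_sum)
  also have "\<dots> = lookup f w * v_pow (int n)" using w by (simp add: if_distrib[of "(*) _"] cong: if_cong)
  finally show False using assms w by (simp add: in_keys_iff)
qed

text \<open>Modulo J every element is a combination of T_w with w in W_c, and on such combinations
  \<open>phi\<close> is injective by its leading terms. This is the basis theorem for TL(X) in
  disguise.\<close>

lemma J_iff: assumes "g \<in> HW" shows "g \<in> J \<longleftrightarrow> phi g = 0"
proof
  show "g \<in> J \<Longrightarrow> phi g = 0" by (simp add: phi_def J_Th)
  assume 0: "phi g = 0"
  have "g \<in> Sp" by (rule Sp_keys) (use assms T_Sp in auto)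
  then obtain f where f: "keys f \<subseteq> Wc" "g - f \<in> J" by (auto simp: Sp_def)
  have "phi (g - f) = 0" using f by (simp add: phi_def J_Th)
  then have "phi f = 0" using 0 by (simp add: linear_opD[OF linear_phi])
  then have "f = 0" using phi_injective_on_Wc[OF f(1)] by blast
  then show "g \<in> J" using f(2) by simp
qed

subsection \<open>The algebra structure on the monomial basis\<close>

abbreviation MW :: "'s hecke_elt set" where "MW \<equiv> {m. keys m \<subseteq> Wc}"
abbreviation e1 :: "'s hecke_elt" where "e1 \<equiv> T (ev [])"

definition Bo :: "'s \<Rightarrow> 's hecke_elt \<Rightarrow> 's hecke_elt" where "Bo s h = scale (v_pow (- 1)) (h + lam s h)"

lemma linear_Bo: "linear_op (Bo s)"
  using linear_scale[OF linear_add[OF linear_id linear_lam]] by (simp add: Bo_def[abs_def])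

lemma Bo_HW: "s \<in> S \<Longrightarrow> h \<in> HW \<Longrightarrow> Bo s h \<in> HW"
  unfolding Bo_def by (intro HW_closed(1) HW_closed(2) lam_HW)

lemma foldr_Bo_HW: "set x \<subseteq> S \<Longrightarrow> h \<in> HW \<Longrightarrow> foldr Bo x h \<in> HW"
proof (induction x)
  case (Cons s x)
  then show ?case using Bo_HW[of s "foldr Bo x h"] by simp
qed simp

lemma Th_Bo: assumes "s \<in> S" "g \<in> HW" shows "Th (Bo s g) k = bop s (Th g k)"
  using Th_lam[OF assms, of k] by (simp add: Bo_def bop_th linear_opD[OF linear_Th_left])

lemma Th_foldr_Bo: "set x \<subseteq> S \<Longrightarrow> g \<in> HW \<Longrightarrow> Th (foldr Bo x g) k = foldr bop x (Th g k)"
proof (induction x)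
  case (Cons s x)
  then show ?case using Th_Bo[of s "foldr Bo x g" k] foldr_Bo_HW[of x g] by simp
qed simp

lemma Bo_hm: assumes "s \<in> S" "g \<in> HW" "h \<in> HW" shows "hm (Bo s g) h = Bo s (hm g h)"
  using lam_hm[OF assms] by (simp add: Bo_def linear_opD[OF linear_hm_left])

abbreviation bw :: "'s list \<Rightarrow> 's hecke_elt" where "bw x \<equiv> foldr Bo x (T (ev []))"

lemma bw_HW: "set x \<subseteq> S \<Longrightarrow> bw x \<in> HW" by (rule foldr_Bo_HW) auto

lemma bw_append: "set x \<subseteq> S \<Longrightarrow> set y \<subseteq> S \<Longrightarrow> hm (bw x) (bw y) = bw (x @ y)"
proof (induction x)
  case (Cons s x)
  then show ?case using Bo_hm[of s "bw x" "bw y"] bw_HW[of x] bw_HW[of y] by simp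
qed (simp add: hm_one_left)

text \<open>A section of \<open>phi\<close>.\<close>

definition sig :: "'s hecke_elt \<Rightarrow> 's hecke_elt" where "sig = lin (\<lambda>w. bw (rw w))"

lemma linear_sig: "linear_op sig" by (simp add: sig_def linear_lin)

lemma sig_HW: assumes "m \<in> MW" shows "sig m \<in> HW"
  unfolding sig_def mem_Collect_eq
proof (rule keys_lin)
  fix w assume "w \<in> keys m"
  then have "w \<in> W" using assms by auto
  then show "keys (bw (rw w)) \<subseteq> W" using bw_HW[of "rw w"] rw(1) by simp
qed

lemma phi_bw: "set x \<subseteq> S \<Longrightarrow> phi (bw x) = foldr bop x e1"
  unfolding phi_def by (subst Th_foldr_Bo) auto

lemma foldr_bop_rw: assumes "w \<in> Wc" shows "foldr bop (rw w) e1 = T w"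
  using foldr_bop_reduced[of "rw w"] rw[of w] assms by simp

lemma phi_sig: assumes "m \<in> MW" shows "phi (sig m) = m"
proof -
  have "phi (sig m) = (\<lambda>h. h) m"
  proof (rule linear_ext[OF linear_comp[OF linear_phi linear_sig] linear_id])
    fix w assume "w \<in> keys m"
    then have "w \<in> Wc" using assms by auto
    then show "phi (sig (T w)) = T w" using phi_bw[of "rw w"] foldr_bop_rw[of w] rw[of w] by (simp add: sig_def)
  qed
  then show ?thesis by simp
qed

lemma phi_MW: "phi g \<in> MW" using phi_keys by blast

text \<open>The product of TL(X) transported to the monomial module: the left factor is lifted to
  the Hecke algebra and acts.\<close>

definition star :: "'s hecke_elt \<Rightarrow> 's hecke_elt \<Rightarrow> 's hecke_elt" where "star a b = Th (sig a) b"

lemma linear_star_left: "linear_op (\<lambda>a. star a b)"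
  unfolding star_def by (rule linear_comp[OF linear_Th_left linear_sig])

lemma linear_star_right: "linear_op (star a)"
  unfolding star_def[abs_def] by (rule linear_Th_right)

lemma Th_star: assumes "g \<in> HW" shows "Th g n = star (phi g) n"
proof -
  have s: "sig (phi g) \<in> HW" using sig_HW phi_MW by blast
  have "phi (g - sig (phi g)) = 0" using phi_sig[OF phi_MW[of g]] by (simp add: linear_opD[OF linear_phi])
  then have "g - sig (phi g) \<in> J" using J_iff HW_closed(4)[OF assms s] by blast
  then have "Th (g - sig (phi g)) n = 0" by (rule J_Th)
  then show ?thesis by (simp add: star_def linear_opD[OF linear_Th_left])
qed

lemma phi_star: "g \<in> HW \<Longrightarrow> h \<in> HW \<Longrightarrow> phi (hm g h) = star (phi g) (phi h)"
  using phi_hm Th_star by simp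

lemma star_word: "set x \<subseteq> S \<Longrightarrow> star (foldr bop x e1) n = foldr bop x n"
  using Th_star[OF bw_HW, of x n] Th_foldr_Bo[of x "T (ev [])" n] phi_bw[of x] by simp

lemma star_MW: "a \<in> MW \<Longrightarrow> b \<in> MW \<Longrightarrow> star a b \<in> MW"
  using phi_star[of "sig a" "sig b"] phi_sig sig_HW phi_MW[of "hm (sig a) (sig b)"] by auto

lemma star_assoc: assumes "a \<in> MW" "b \<in> MW" "c \<in> MW" shows "star (star a b) c = star a (star b c)"
proof -
  have H: "sig a \<in> HW" "sig b \<in> HW" "sig c \<in> HW" using sig_HW assms by blast+
  have "phi (hm (hm (sig a) (sig b)) (sig c)) = phi (hm (sig a) (hm (sig b) (sig c)))"
    using hm_assoc H by simp
  then show ?thesis using phi_star H hm_HW[OF H(1,2)] hm_HW[OF H(2,3)] phi_sig assms by simp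
qed

lemma bop_star: assumes "s \<in> S" "a \<in> MW" "b \<in> MW" shows "bop s (star a b) = star (bop s a) b"
proof -
  have e: "bop s e1 \<in> MW" using bop_keys[of s e1] by blast
  have "bop s x = star (bop s e1) x" for x using star_word[of "[s]" x] assms by simp
  then show ?thesis using star_assoc[OF e assms(2,3)] by simp
qed

lemma star_one_left: "star e1 n = n" using star_word[of "[]" n] by simp

definition barM :: "'s hecke_elt \<Rightarrow> 's hecke_elt" where "barM m = Poly_Mapping.map laurent_bar m"

lemma lookup_barM [simp]: "lookup (barM m) w = laurent_bar (lookup m w)"
  by (simp add: barM_def Poly_Mapping.map.rep_eq when_def)

lemma barM_simps [simp]: "barM (a + b) = barM a + barM b" "barM 0 = 0" "barM (a - b) = barM a - barM b"
  "barM (scale c a) = scale (laurent_bar c) (barM a)" "barM (barM a) = a" "barM (T w) = T w"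
  by (rule poly_mapping_eqI, simp add: lookup_add lookup_minus laurent_bar_mult lookup_T)+

lemma barM_sum: "barM (sum f A) = (\<Sum>x\<in>A. barM (f x))"
  by (induction A rule: infinite_finite_induct) auto

lemma keys_barM [simp]: "keys (barM m) = keys m"
proof -
  have "laurent_bar a = 0 \<longleftrightarrow> a = 0" for a using laurent_bar_simps(7)[of a] by (metis laurent_bar_simps(2))
  then show ?thesis by (simp only: set_eq_iff in_keys_iff lookup_barM) blast
qed

lemma barM_lin: "barM (lin f m) = lin (\<lambda>w. barM (f w)) (barM m)"
  by (simp add: lin_def barM_sum)

lemma barM_bop: "barM (bop s m) = bop s (barM m)"
proof -
  have "barM (bt s w) = bt s w" for w
    by (rule poly_mapping_eqI) (simp add: bt_bar_invariant)
  then show ?thesis by (simp add: bop_def barM_lin)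
qed

subsection \<open>The reversal anti-automorphism\<close>

lemma io_bw: "set x \<subseteq> S \<Longrightarrow> io (bw x) = bw (rev x)"
proof (induction x)
  case Nil
  then show ?case by (simp add: io_T flip: one_ev)
next
  case (Cons s x)
  have s: "s \<in> S" "set x \<subseteq> S" using Cons by auto
  have one: "io (bw [s]) = bw [s]"
  proof -
    have "lt s (ev []) = T (gen X s)" using lam_eq_hm[of s "T (ev [])"] hm_one_right[of "T (gen X s)"] s by simp
    then show ?thesis using s by (simp add: Bo_def linear_opD[OF linear_io] io_T iv_gen) (simp add: io_T flip: one_ev)
  qed
  have "io (bw (s # x)) = io (hm (bw [s]) (bw x))" using bw_append[of "[s]" x] s by simp
  also have "\<dots> = hm (bw (rev x)) (bw [s])"
    using io_hm[of "bw [s]" "bw x"] bw_HW[of "[s]"] bw_HW[of x] s one Cons by simp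
  also have "\<dots> = bw (rev (s # x))" using bw_append[of "rev x" "[s]"] s by simp
  finally show ?case .
qed

lemma io_parabolic: assumes "a \<in> S" "c \<in> S" shows "io (\<Sum>w\<in>parabolic X a c. T w) = (\<Sum>w\<in>parabolic X a c. T w)"
proof -
  let ?P = "parabolic X a c"
  have iP: "iv w \<in> ?P" if "w \<in> ?P" for w
  proof -
    obtain x where x: "set x \<subseteq> {a, c}" "w = ev x" using \<open>w \<in> ?P\<close> parabolic_words[OF assms] by auto
    then have "iv w = ev (rev x)" using assms by (intro iv_ev[of x, folded x(2)]) auto
    then show ?thesis unfolding parabolic_words[OF assms] using x by (intro image_eqI[of _ _ "rev x"]) auto
  qed
  have bij: "bij_betw (\<lambda>w. iv w) ?P ?P"
    by (rule bij_betwI[where g = "\<lambda>w. iv w"]) (use iP parabolic_W[OF assms] in auto)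
  have "io (\<Sum>w\<in>?P. T w) = (\<Sum>w\<in>?P. T (iv w))"
    unfolding linear_sum[OF linear_io] by (rule sum.cong) (use io_T parabolic_W[OF assms] in auto)
  also have "\<dots> = (\<Sum>w\<in>?P. T w)" by (rule sum.reindex_bij_betw[OF bij])
  finally show ?thesis .
qed

lemma HW_ideal:
  assumes K: "K \<subseteq> HW" "0 \<in> K" "\<And>g h. g \<in> K \<Longrightarrow> h \<in> K \<Longrightarrow> g + h \<in> K" "\<And>g. g \<in> K \<Longrightarrow> - g \<in> K"
    "\<And>g h. g \<in> K \<Longrightarrow> h \<in> HW \<Longrightarrow> hm g h \<in> K" "\<And>g h. g \<in> K \<Longrightarrow> h \<in> HW \<Longrightarrow> hm h g \<in> K"
  shows "ideal K (hecke X)"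
proof (rule idealI)
  interpret R: ring "hecke X" by (rule hecke_ring)
  show "subgroup K (add_monoid (hecke X))"
  proof (rule R.add.subgroupI)
    show "K \<noteq> {}" using K by blast
  next
    fix g assume g: "g \<in> K"
    then have gH: "g \<in> HW" "- g \<in> HW" using K by blast+
    have "\<ominus>\<^bsub>hecke X\<^esub> g = - g" by (rule R.minus_equality) (use gH in simp_all)
    then show "\<ominus>\<^bsub>hecke X\<^esub> g \<in> K" using K(4)[OF g] by simp
  qed (use K in auto)
  fix g k assume *: "g \<in> K" "k \<in> carrier (hecke X)"
  then have gk: "g \<in> HW" "k \<in> HW" using K by auto
  show "k \<otimes>\<^bsub>hecke X\<^esub> g \<in> K" "g \<otimes>\<^bsub>hecke X\<^esub> k \<in> K"
    using K(5,6)[OF *(1) gk(2)] hecke_mult[OF gk] hecke_mult[OF gk(2,1)] by simp_all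
qed (rule hecke_ring)

lemma io_J: assumes "g \<in> J" shows "io g \<in> J"
proof -
  interpret R: ring "hecke X" by (rule hecke_ring)
  let ?K = "{g \<in> HW. io g \<in> J}"
  have "ideal ?K (hecke X)"
  proof (rule HW_ideal)
    fix g h assume g: "g \<in> ?K" and h: "h \<in> HW"
    then have "g \<in> HW" "io h \<in> HW" using io_HW by blast+
    then show "hm g h \<in> ?K" "hm h g \<in> ?K"
      using g h hm_HW io_hm J_hm by auto
  next
    fix g assume g: "g \<in> ?K"
    then have "- g \<in> HW" "- io g \<in> J" using HW_closed(3)[of g] J_scale[of "io g" "- 1"] by auto
    then show "- g \<in> ?K" by (simp add: linear_opD(4)[OF linear_io])
  next
    fix g h assume "g \<in> ?K" "h \<in> ?K"
    then show "g + h \<in> ?K" using HW_closed(1)[of g h] J_add by (simp add: linear_opD(1)[OF linear_io])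
  qed (use J_zero HW_closed(5) linear_opD(3)[OF linear_io] in auto)
  moreover have "TLgens \<subseteq> ?K"
  proof
    fix g assume g: "g \<in> TLgens"
    then have "io g = g" "g \<in> J" "g \<in> HW" using io_parabolic TLgens_J TLgens_HW by blast+
    then show "g \<in> ?K" by (simp only: mem_Collect_eq)
  qed
  ultimately have "J \<subseteq> ?K" unfolding TL_ideal_def by (rule R.genideal_minimal)
  then show ?thesis using assms by blast
qed

lemma io_MW: "m \<in> MW \<Longrightarrow> io m \<in> MW"
  unfolding io_def mem_Collect_eq by (rule keys_lin) (use iv_Wc in auto)

text \<open>The anti-automorphism preserves J, so it descends. A reversed reduced word of w is a
  reduced word of w^-1, so on monomials it is b_w -> b_{w^-1} and the same operator
  \<open>io\<close> describes it.\<close>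

lemma phi_io: assumes "g \<in> HW" shows "phi (io g) = io (phi g)"
proof -
  let ?m = "phi g"
  have s: "sig ?m \<in> HW" using sig_HW phi_MW by blast
  have "phi (g - sig ?m) = 0" using phi_sig[OF phi_MW[of g]] by (simp add: linear_opD[OF linear_phi])
  then have "g - sig ?m \<in> J" using J_iff HW_closed(4)[OF assms s] by blast
  then have "io g - io (sig ?m) \<in> J" using io_J by (metis linear_opD(5)[OF linear_io])
  then have "phi (io g - io (sig ?m)) = 0" using J_iff J_HW by blast
  then have 1: "phi (io g) = phi (io (sig ?m))" by (simp add: linear_opD[OF linear_phi])
  have "phi (io (sig ?m)) = io ?m"
  proof (rule linear_ext[OF linear_comp[OF linear_phi linear_comp[OF linear_io linear_sig]] linear_io])
    fix w assume "w \<in> keys ?m"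
    then have w: "w \<in> Wc" "w \<in> W" using phi_keys by auto
    have r: "set (rw w) \<subseteq> S" "ev (rw w) = w" "length (rw w) = len w" using rw[OF w(2)] by auto
    have e: "ev (rev (rw w)) = iv w" using iv_ev[OF r(1)] r(2) by simp
    have "phi (io (sig (T w))) = foldr bop (rev (rw w)) e1"
      using io_bw[OF r(1)] phi_bw[of "rev (rw w)"] r by (simp add: sig_def)
    also have "\<dots> = T (iv w)"
      using foldr_bop_reduced[of "rev (rw w)"] r e iv_Wc[OF w(1)] w(2) by simp
    finally show "phi (io (sig (T w))) = io (T w)" using io_T w by simp
  qed
  then show ?thesis using 1 by simp
qed

lemma io_star: assumes "a \<in> MW" "b \<in> MW" shows "io (star a b) = star (io b) (io a)"
proof -
  have H: "sig a \<in> HW" "sig b \<in> HW" using sig_HW assms by blast+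
  have "io (star a b) = phi (io (hm (sig a) (sig b)))"
    using phi_star[OF H] phi_io[OF hm_HW[OF H]] phi_sig assms by simp
  also have "\<dots> = star (io b) (io a)"
    using io_hm[OF H] phi_star[OF io_HW io_HW, OF H(2,1)] phi_io[OF H(1)] phi_io[OF H(2)] phi_sig assms by simp
  finally show ?thesis .
qed

lemma io_barM: "m \<in> MW \<Longrightarrow> io (barM m) = barM (io m)"
  unfolding io_def barM_lin by (rule lin_cong) simp

subsection \<open>Compatibility with the bar involution of the Hecke algebra\<close>

lemma lam_lam: assumes "s \<in> S" "h \<in> HW" shows "lam s (lam s h) = scale (v_pow 2 - 1) (lam s h) + scale (v_pow 2) h"
proof (rule linear_ext[OF linear_comp[OF linear_lam linear_lam] linear_add[OF linear_scale[OF linear_lam] linear_scale[OF linear_id]]])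
  fix w assume "w \<in> keys h"
  then have w: "w \<in> W" "s \<cdot> w \<in> W" using assms by auto
  have s: "s \<in> S" by fact
  have d: "dl s (s \<cdot> w) \<longleftrightarrow> \<not> dl s w" using dl_lm s w by blast
  define B where "B = v_pow 2 - 1"
  note L = lt_simps[OF s w(1), folded B_def] lt_simps[OF s w(2), folded B_def] lm_lm[OF s w(1)]
  show "lam s (lam s (T w)) = scale (v_pow 2 - 1) (lam s (T w)) + scale (v_pow 2) (T w)"
    unfolding B_def[symmetric] using L d
    by (cases "dl s w") (simp_all add: linear_opD[OF linear_lam] mult.commute add_ac)
qed

text \<open>For n = -1 this is the action of v^-1 T_s, for n = 1 that of its inverse: b_s - v^-1 and
  b_s - v.\<close>

definition Bc :: "int \<Rightarrow> 's \<Rightarrow> 's hecke_elt \<Rightarrow> 's hecke_elt" where "Bc n s h = Bo s h - scale (v_pow n) h"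

lemma Bc_HW: "s \<in> S \<Longrightarrow> h \<in> HW \<Longrightarrow> Bc n s h \<in> HW"
  unfolding Bc_def by (intro HW_closed(4) HW_closed(2) Bo_HW)

lemma foldr_Bc_HW: "set x \<subseteq> S \<Longrightarrow> h \<in> HW \<Longrightarrow> foldr (Bc n) x h \<in> HW"
proof (induction x)
  case (Cons s x)
  then show ?case using Bc_HW[of s "foldr (Bc n) x h"] by simp
qed simp

lemma Bc_lam: "Bc (- 1) s h = scale (v_pow (- 1)) (lam s h)"
  by (simp add: Bc_def Bo_def)

lemma Bc_inverse: assumes "s \<in> S" "h \<in> HW" shows "Bc (- 1) s (Bc 1 s h) = h" "Bc 1 s (Bc (- 1) s h) = h"
proof -
  have B: "Bo s (Bo s h) = scale delta (Bo s h)"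
  proof -
    have "scale (v_pow (- 2)) (lam s h) + scale (v_pow (- 2)) (lam s (lam s h)) = h + lam s h"
      unfolding lam_lam[OF assms] by (simp add: v_pow_add right_diff_distrib)
    then show ?thesis
      by (simp add: Bo_def linear_opD[OF linear_lam] delta_def distrib_right v_pow_add algebra_simps)
  qed
  have d: "scale delta k = scale (v_pow 1) k + scale (v_pow (- 1)) k" for k :: "'s hecke_elt" by (simp add: delta_def)
  show "Bc (- 1) s (Bc 1 s h) = h" "Bc 1 s (Bc (- 1) s h) = h"
    unfolding Bc_def using B d by (simp_all add: linear_opD[OF linear_Bo])
qed

lemma Bc_foldr_hm: "set x \<subseteq> S \<Longrightarrow> h \<in> HW \<Longrightarrow> hm (foldr (Bc n) x (T (ev []))) h = foldr (Bc n) x h"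
proof (induction x)
  case (Cons s x)
  let ?g = "foldr (Bc n) x (T (ev []))"
  have g: "?g \<in> HW" using Cons foldr_Bc_HW[of x "T (ev [])"] by simp
  have "hm (Bc n s ?g) h = Bc n s (hm ?g h)"
    unfolding Bc_def[of n s] using Bo_hm[of s ?g h] g Cons.prems
    by (simp add: linear_opD[OF linear_hm_left])
  then show ?case using Cons by simp
qed (simp add: hm_one_left)

lemma foldr_Bc_cancel:
  assumes "set x \<subseteq> S" "h \<in> HW"
  shows "foldr (Bc (- 1)) (rev x) (foldr (Bc 1) x h) = h" "foldr (Bc 1) x (foldr (Bc (- 1)) (rev x) h) = h"
proof -
  show "foldr (Bc (- 1)) (rev x) (foldr (Bc 1) x h) = h"
    using assms
  proof (induction x)
    case (Cons s x)
    then show ?case using Bc_inverse(1)[of s "foldr (Bc 1) x h"] foldr_Bc_HW[of x h] by simp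
  qed simp
  show "foldr (Bc 1) x (foldr (Bc (- 1)) (rev x) h) = h"
    using assms
  proof (induction x arbitrary: h)
    case (Cons s x)
    then show ?case using Bc_inverse(2)[of s h] Bc_HW[of s h "- 1"] by simp
  qed simp
qed

lemma Tt_word: assumes "set x \<subseteq> S" "len (ev x) = length x" shows "Tt (ev x) = foldr (Bc (- 1)) x (T (ev []))"
proof -
  have "foldr (Bc (- 1)) x (T (ev [])) = scale (v_pow (- int (length x))) (foldr lam x (T (ev [])))"
    by (induction x) (auto simp: Bc_lam linear_opD[OF linear_lam] v_pow_add algebra_simps)
  then show ?thesis using foldr_lam_reduced[OF assms] assms by (simp add: Tt_def)
qed

lemma Tt_inverse:
  assumes "w \<in> W" shows "inv\<^bsub>hecke X\<^esub> Tt (iv w) = foldr (Bc 1) (rw w) (T (ev []))"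
proof -
  interpret R: ring "hecke X" by (rule hecke_ring)
  let ?x = "rw w" and ?Y = "foldr (Bc 1) (rw w) (T (ev []))" and ?Z = "foldr (Bc (- 1)) (rev (rw w)) (T (ev []))"
  have r: "set ?x \<subseteq> S" "ev ?x = w" "length ?x = len w" using rw[OF assms] by auto
  have "ev (rev ?x) = iv w" using iv_ev[OF r(1)] r(2) by simp
  then have Z: "Tt (iv w) = ?Z" using Tt_word[of "rev ?x"] r assms by simp
  have H: "?Y \<in> HW" "?Z \<in> HW" using foldr_Bc_HW r by simp_all
  have "?Z \<otimes>\<^bsub>hecke X\<^esub> ?Y = \<one>\<^bsub>hecke X\<^esub>" "?Y \<otimes>\<^bsub>hecke X\<^esub> ?Z = \<one>\<^bsub>hecke X\<^esub>"
    using hecke_mult[OF H] hecke_mult[OF H(2,1)] Bc_foldr_hm[of ?x ?Z 1] Bc_foldr_hm[of "rev ?x" ?Y "- 1"]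
      foldr_Bc_cancel[OF r(1), of "T (ev [])"] H r by simp_all
  then show ?thesis unfolding Z using R.inv_unique'[of ?Z ?Y] H by simp
qed

lemma phi_foldr_Bc: "set x \<subseteq> S \<Longrightarrow> phi (foldr (Bc n) x (T (ev []))) = foldr (\<lambda>s h. bop s h - scale (v_pow n) h) x e1"
proof (induction x)
  case Nil
  then show ?case by (simp add: phi_def)
next
  case (Cons s x)
  let ?g = "foldr (Bc n) x (T (ev []))"
  have "?g \<in> HW" using foldr_Bc_HW[of x "T (ev [])"] Cons by simp
  then have "phi (Bo s ?g) = bop s (phi ?g)" using Th_Bo[of s ?g] Cons.prems by (simp add: phi_def)
  then show ?case using Cons by (simp add: Bc_def[of n s] linear_opD[OF linear_phi])
qed

lemma hecke_bar_HW: assumes "h \<in> HW" shows "hecke_bar X h \<in> HW"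
  unfolding hecke_bar_def mem_Collect_eq
proof (rule keys_sum_subset)
  fix w assume "w \<in> keys h"
  then have w: "w \<in> W" using assms by auto
  show "keys (scale (laurent_bar (v_pow (int (len w)) * lookup h w)) (inv\<^bsub>hecke X\<^esub> Tt (iv w))) \<subseteq> W"
    by (rule subset_trans[OF keys_scale])
      (use foldr_Bc_HW[of "rw w" "T (ev [])" 1] rw(1)[OF w] in \<open>simp add: Tt_inverse[OF w]\<close>)
qed

text \<open>The normalised T_w is a product of factors b_s - v^-1, and the inverse of the normalised
  T_{w^-1} is the same product with v for v^-1. As b_s commutes with barring coefficients, the bar
  involution becomes the coefficientwise bar.\<close>

lemma phi_hecke_bar: assumes "h \<in> HW" shows "phi (hecke_bar X h) = barM (phi h)"
proof -
  have t: "phi (inv\<^bsub>hecke X\<^esub> Tt (iv w)) = barM (phi (Tt w))" if w: "w \<in> W" for w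
  proof -
    have r: "set (rw w) \<subseteq> S" "ev (rw w) = w" "length (rw w) = len w" using rw[OF w] by auto
    have "barM (foldr (\<lambda>s h. bop s h - scale (v_pow (- 1)) h) x e1) = foldr (\<lambda>s h. bop s h - scale (v_pow 1) h) x e1" for x
      by (induction x) (auto simp: barM_bop)
    then show ?thesis
      using Tt_inverse[OF w] phi_foldr_Bc[OF r(1)] Tt_word[OF r(1)] r by simp
  qed
  have "phi (hecke_bar X h) = (\<Sum>w\<in>keys h. scale (laurent_bar (v_pow (int (len w)) * lookup h w)) (phi (inv\<^bsub>hecke X\<^esub> Tt (iv w))))"
    unfolding hecke_bar_def linear_sum[OF linear_phi] linear_opD(2)[OF linear_phi] ..
  also have "\<dots> = (\<Sum>w\<in>keys h. barM (scale (lookup h w) (phi (T w))))"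
  proof (rule sum.cong)
    fix w assume "w \<in> keys h"
    then have w: "w \<in> W" using assms by auto
    have "scale (v_pow (int (len w)) * lookup h w) (phi (Tt w)) = scale (lookup h w) (phi (T w))"
      by (simp add: Tt_def linear_opD(2)[OF linear_phi] mult_ac v_pow_add)
    then show "scale (laurent_bar (v_pow (int (len w)) * lookup h w)) (phi (inv\<^bsub>hecke X\<^esub> Tt (iv w))) =
        barM (scale (lookup h w) (phi (T w)))"
      using t[OF w] by (metis barM_simps(4))
  qed simp
  also have "\<dots> = barM (phi h)"
    by (subst (2) linear_eq_lin[OF linear_phi]) (simp add: lin_def barM_sum)
  finally show ?thesis .
qed

subsection \<open>The Temperley--Lieb algebra as an algebra on the monomial basis\<close>

text \<open>The cosets of \<open>J\<close>, labelled by their image in the monomial basis.\<close>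

definition fib :: "'s hecke_elt \<Rightarrow> 's hecke_elt set" where "fib m = {h \<in> HW. phi h = m}"

lemma fib_nonempty: "m \<in> MW \<Longrightarrow> sig m \<in> fib m"
  using sig_HW phi_sig by (simp add: fib_def)

lemma fib_inj: "a \<in> MW \<Longrightarrow> b \<in> MW \<Longrightarrow> fib a = fib b \<longleftrightarrow> a = b"
  using fib_nonempty[of a] by (auto simp: fib_def)

lemma TL_proj_fib: assumes "h \<in> HW" shows "TL_proj X h = fib (phi h)"
proof -
  have "TL_proj X h = {j + h |j. j \<in> J}" by (auto simp: TL_proj_def a_r_coset_def')
  also have "\<dots> = fib (phi h)"
  proof (intro Set.set_eqI iffI)
    fix g assume "g \<in> {j + h |j. j \<in> J}"
    then obtain j where "j \<in> J" "g = j + h" by blast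
    then show "g \<in> fib (phi h)" using J_HW J_iff[of j] HW_closed(1)[of j h] assms
      by (auto simp: fib_def linear_opD[OF linear_phi])
  next
    fix g assume "g \<in> fib (phi h)"
    then have g: "g \<in> HW" "phi g = phi h" by (auto simp: fib_def)
    then have "g - h \<in> J" using J_iff[OF HW_closed(4)[OF g(1) assms]] by (simp add: linear_opD[OF linear_phi])
    then show "g \<in> {j + h |j. j \<in> J}" by (intro CollectI exI[of _ "g - h"]) simp
  qed
  finally show ?thesis .
qed

lemma TL_carrier: "carrier (TL X) = fib ` MW"
proof -
  have "carrier (TL X) = TL_proj X ` HW"
    by (auto simp: TL_def ring.defs FactRing_def A_RCOSETS_def' TL_proj_def)
  also have "\<dots> = fib ` MW"
  proof (intro Set.set_eqI iffI)
    fix Y assume "Y \<in> TL_proj X ` HW"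
    then show "Y \<in> fib ` MW" using TL_proj_fib phi_MW by auto
  next
    fix Y assume "Y \<in> fib ` MW"
    then obtain m where "m \<in> MW" "Y = fib m" by blast
    then show "Y \<in> TL_proj X ` HW"
      using TL_proj_fib[of "sig m"] sig_HW[of m] phi_sig[of m] by (intro image_eqI[of _ _ "sig m"]) simp_all
  qed
  finally show ?thesis .
qed

lemma UN_fib: assumes "m \<in> MW" "\<And>h. h \<in> fib m \<Longrightarrow> F h = Z" shows "(\<Union>h\<in>fib m. F h) = Z"
  using fib_nonempty[OF assms(1)] assms(2) by auto

lemma TL_add: assumes "a \<in> MW" "b \<in> MW" shows "fib a \<oplus>\<^bsub>TL X\<^esub> fib b = fib (a + b)"
proof -
  have "fib a \<oplus>\<^bsub>TL X\<^esub> fib b = {g + h |g h. g \<in> fib a \<and> h \<in> fib b}"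
    by (auto simp: TL_def ring.defs FactRing_def set_add_def')
  also have "\<dots> = fib (a + b)"
  proof (intro Set.set_eqI iffI)
    fix k assume "k \<in> {g + h |g h. g \<in> fib a \<and> h \<in> fib b}"
    then show "k \<in> fib (a + b)" using HW_closed(1) by (auto simp: fib_def linear_opD[OF linear_phi])
  next
    fix k assume k: "k \<in> fib (a + b)"
    have "k - sig b \<in> fib a"
      using k sig_HW[OF assms(2)] HW_closed(4)[of k "sig b"] phi_sig[OF assms(2)] by (auto simp: fib_def linear_opD[OF linear_phi])
    then show "k \<in> {g + h |g h. g \<in> fib a \<and> h \<in> fib b}"
      using fib_nonempty[OF assms(2)] by (intro CollectI exI[of _ "k - sig b"] exI[of _ "sig b"]) simp
  qed
  finally show ?thesis .
qed

lemma TL_mult: assumes "a \<in> MW" "b \<in> MW" shows "fib a \<otimes>\<^bsub>TL X\<^esub> fib b = fib (star a b)"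
proof -
  have "fib a \<otimes>\<^bsub>TL X\<^esub> fib b = (\<Union>g\<in>fib a. \<Union>h\<in>fib b. TL_proj X (g \<otimes>\<^bsub>hecke X\<^esub> h))"
    by (simp add: TL_def ring.defs FactRing_def rcoset_mult_def TL_proj_def)
  also have "\<dots> = fib (star a b)"
  proof (intro UN_fib assms)
    fix g h assume "g \<in> fib a" "h \<in> fib b"
    then show "TL_proj X (g \<otimes>\<^bsub>hecke X\<^esub> h) = fib (star a b)"
      using hecke_mult[of g h] TL_proj_fib[OF hm_HW, of g h] phi_star[of g h] by (auto simp: fib_def)
  qed
  finally show ?thesis .
qed

lemma TL_zero: "zero (TL X) = fib 0"
  using J_iff J_HW by (auto simp: TL_def ring.defs FactRing_def fib_def)

lemma TL_smult: assumes "a \<in> MW" shows "c \<odot>\<^bsub>TL X\<^esub> fib a = fib (scale c a)"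
proof -
  have "c \<odot>\<^bsub>TL X\<^esub> fib a = (\<Union>h\<in>fib a. TL_proj X (scale c h))"
    by (simp add: TL_def ring.defs module.defs)
  also have "\<dots> = fib (scale c a)"
    by (intro UN_fib assms) (use TL_proj_fib[OF HW_closed(2)] in \<open>auto simp: fib_def linear_opD[OF linear_phi]\<close>)
  finally show ?thesis .
qed

lemma TL_bar_fib: assumes "a \<in> MW" shows "TL_bar X (fib a) = fib (barM a)"
  unfolding TL_bar_def
proof (intro UN_fib assms)
  fix h assume h: "h \<in> fib a"
  then have "h \<in> HW" by (simp add: fib_def)
  then show "TL_proj X (hecke_bar X h) = fib (barM a)"
    using TL_proj_fib[OF hecke_bar_HW] phi_hecke_bar h by (simp add: fib_def)
qed

lemma MW_closed: "a \<in> MW \<Longrightarrow> b \<in> MW \<Longrightarrow> a + b \<in> MW" "a \<in> MW \<Longrightarrow> scale c a \<in> MW" "a \<in> MW \<Longrightarrow> b \<in> MW \<Longrightarrow> a - b \<in> MW" "a \<in> MW \<Longrightarrow> - a \<in> MW"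
  "0 \<in> MW"
  using keys_scale[of c a] keys_add_subset[of a Wc b] keys_diff_subset[of a Wc b] by (auto simp: keys_minus)

lemma TL_abelian_group: "abelian_group (TL X)"
proof (rule abelian_groupI)
  fix x assume "x \<in> carrier (TL X)"
  then obtain a where a: "a \<in> MW" "x = fib a" using TL_carrier by blast
  then have "fib (- a) \<oplus>\<^bsub>TL X\<^esub> x = \<zero>\<^bsub>TL X\<^esub>" "fib (- a) \<in> carrier (TL X)"
    using TL_add[OF MW_closed(4)] TL_zero MW_closed(4)[OF a(1)] TL_carrier by simp_all
  then show "\<exists>y\<in>carrier (TL X). y \<oplus>\<^bsub>TL X\<^esub> x = \<zero>\<^bsub>TL X\<^esub>" by blast
next
  fix x y z assume "x \<in> carrier (TL X)" "y \<in> carrier (TL X)" "z \<in> carrier (TL X)"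
  then obtain a b c where *: "a \<in> MW" "x = fib a" "b \<in> MW" "y = fib b" "c \<in> MW" "z = fib c"
    unfolding TL_carrier by (elim imageE) metis
  then show "(x \<oplus>\<^bsub>TL X\<^esub> y) \<oplus>\<^bsub>TL X\<^esub> z = x \<oplus>\<^bsub>TL X\<^esub> (y \<oplus>\<^bsub>TL X\<^esub> z)"
    using MW_closed(1)[of a b] MW_closed(1)[of b c] by (simp add: TL_add add.assoc del: mem_Collect_eq)
next
  fix x y assume "x \<in> carrier (TL X)" "y \<in> carrier (TL X)"
  then obtain a b where *: "a \<in> MW" "x = fib a" "b \<in> MW" "y = fib b"
    unfolding TL_carrier by (elim imageE) metis
  then show "x \<oplus>\<^bsub>TL X\<^esub> y \<in> carrier (TL X)" "x \<oplus>\<^bsub>TL X\<^esub> y = y \<oplus>\<^bsub>TL X\<^esub> x"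
    using MW_closed(1)[of a b] TL_carrier by (simp_all add: TL_add add.commute del: mem_Collect_eq)
next
  show "\<zero>\<^bsub>TL X\<^esub> \<in> carrier (TL X)" using TL_zero TL_carrier MW_closed(5) by blast
  fix x assume "x \<in> carrier (TL X)"
  then obtain a where "a \<in> MW" "x = fib a" using TL_carrier by blast
  then show "\<zero>\<^bsub>TL X\<^esub> \<oplus>\<^bsub>TL X\<^esub> x = x" using TL_zero TL_add[OF MW_closed(5)] by simp
qed

lemma TL_diff: assumes "a \<in> MW" "b \<in> MW" shows "fib a \<ominus>\<^bsub>TL X\<^esub> fib b = fib (a - b)"
proof -
  interpret R: abelian_group "TL X" by (rule TL_abelian_group)
  have "\<ominus>\<^bsub>TL X\<^esub> fib b = fib (- b)"
    by (rule R.minus_equality) (use assms MW_closed(4)[OF assms(2)] TL_carrier TL_zero TL_add[OF MW_closed(4)[OF assms(2)] assms(2)] in auto)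
  then show ?thesis using TL_add[OF assms(1) MW_closed(4)[OF assms(2)]] by (simp add: a_minus_def)
qed

lemma TL_lincomb_fib:
  assumes "keys f \<subseteq> Wc" "\<And>w. w \<in> Wc \<Longrightarrow> b w = fib (\<beta> w)" "\<And>w. w \<in> Wc \<Longrightarrow> \<beta> w \<in> MW"
  shows "TL_lincomb X f b = fib (lin \<beta> f)" "lin \<beta> f \<in> MW"
proof -
  interpret R: abelian_group "TL X" by (rule TL_abelian_group)
  have t: "lookup f w \<odot>\<^bsub>TL X\<^esub> b w = fib (scale (lookup f w) (\<beta> w))" "scale (lookup f w) (\<beta> w) \<in> MW" if "w \<in> Wc" for w
    using assms(2,3)[OF that] TL_smult MW_closed(2) by simp_all
  have "(\<Oplus>\<^bsub>TL X\<^esub>w\<in>A. lookup f w \<odot>\<^bsub>TL X\<^esub> b w) = fib (\<Sum>w\<in>A. scale (lookup f w) (\<beta> w)) \<and> (\<Sum>w\<in>A. scale (lookup f w) (\<beta> w)) \<in> MW"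
    if "finite A" "A \<subseteq> Wc" for A
    using that
  proof (induction A)
    case empty
    then show ?case by (simp add: TL_zero)
  next
    case (insert w A)
    have c: "(\<lambda>w. lookup f w \<odot>\<^bsub>TL X\<^esub> b w) \<in> A \<rightarrow> carrier (TL X)" "lookup f w \<odot>\<^bsub>TL X\<^esub> b w \<in> carrier (TL X)"
      using t insert.prems TL_carrier by auto
    show ?case using R.finsum_insert[OF insert.hyps(1,2) c] insert t[of w] TL_add MW_closed(1)
      by (simp del: mem_Collect_eq)
  qed
  from this[of "keys f"] show "TL_lincomb X f b = fib (lin \<beta> f)" "lin \<beta> f \<in> MW"
    using assms(1) by (simp_all add: TL_lincomb_def lin_def)
qed

end

subsection \<open>Degrees of Laurent polynomials\<close>

text \<open>Membership in v^k Z[v^-1]; k = 0 is the coefficient ring of the lattice and k = -1 that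
  of v^-1 times the lattice.\<close>

definition degl :: "int \<Rightarrow> laurent \<Rightarrow> bool" where "degl k a \<longleftrightarrow> (\<forall>n. lookup a n \<noteq> 0 \<longrightarrow> n \<le> k)"

lemma A_minus_degl: "a \<in> A_minus \<longleftrightarrow> degl 0 a"
  by (auto simp: A_minus_def degl_def in_keys_iff)

lemma degl_add: "degl k a \<Longrightarrow> degl k b \<Longrightarrow> degl k (a + b)"
  unfolding degl_def by (metis add_cancel_right_left lookup_add)

lemma degl_zero [simp]: "degl k 0" by (simp add: degl_def)

lemma degl_minus: "degl k a \<Longrightarrow> degl k (- a)" by (simp add: degl_def)

lemma degl_diff: "degl k a \<Longrightarrow> degl k b \<Longrightarrow> degl k (a - b)"
  using degl_add[of k a "- b"] degl_minus by simp

lemma degl_sum: "(\<And>i. i \<in> I \<Longrightarrow> degl k (f i)) \<Longrightarrow> degl k (sum f I)"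
  by (induction I rule: infinite_finite_induct) (auto intro: degl_add)

lemma degl_mono: "degl j a \<Longrightarrow> j \<le> k \<Longrightarrow> degl k a"
  by (force simp: degl_def)

lemma degl_mult: assumes "degl j a" "degl k b" shows "degl (j + k) (a * b)"
  unfolding degl_def
proof (intro allI impI)
  fix n assume "lookup (a * b) n \<noteq> 0"
  then have "n \<in> {x + y |x y. x \<in> keys a \<and> y \<in> keys b}" using keys_mult[of a b] by (auto simp: in_keys_iff)
  then show "n \<le> j + k" using assms by (force simp: degl_def in_keys_iff)
qed

lemma degl_v_pow: "degl k (v_pow k)" by (simp add: degl_def v_pow_def lookup_single when_def)
lemma degl_one: "degl 0 1" using degl_v_pow[of 0] by simp

lemma degl_lookup: "degl k a \<Longrightarrow> k < n \<Longrightarrow> lookup a n = 0"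
  by (force simp: degl_def)

lemma degl_exists: "\<exists>k\<ge>0. degl k a"
proof -
  have "n \<le> Max (insert 0 (keys a))" if "lookup a n \<noteq> 0" for n using that by (simp add: in_keys_iff)
  then show ?thesis by (intro exI[of _ "Max (insert 0 (keys a))"]) (auto simp: degl_def)
qed

lemma bar_invariant_degl_neg: assumes "laurent_bar a = a" "degl (- 1) a" shows "a = 0"
proof (rule poly_mapping_eqI)
  fix n
  have "lookup a n = lookup a (- n)" using assms(1) lookup_laurent_bar by metis
  then show "lookup a n = lookup 0 n" using degl_lookup[OF assms(2), of n] degl_lookup[OF assms(2), of "- n"] by (cases "n \<ge> 0") auto
qed

lemma lookup_of_int: "lookup (of_int c :: laurent) n = (if n = 0 then c else 0)"
  using lookup_of_int_mult[of c 1 n] by (simp add: lookup_one when_def)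

lemma bar_invariant_degl_0: assumes "laurent_bar a = a" "degl 0 a" shows "a = of_int (lookup a 0)"
proof (rule poly_mapping_eqI)
  fix n
  have "lookup a n = lookup a (- n)" using assms(1) lookup_laurent_bar by metis
  then show "lookup a n = lookup (of_int (lookup a 0)) n"
    using degl_lookup[OF assms(2), of n] degl_lookup[OF assms(2), of "- n"] by (cases "n > 0"; cases "n < 0") (auto simp: lookup_of_int)
qed

lemma bar_invariant_part: obtains b where "laurent_bar b = b" "degl (- 1) (a - b)"
proof -
  define p where "p = (\<Sum>k\<in>{k\<in>keys a. k > 0}. of_int (lookup a k) * v_pow k)"
  have p: "lookup p n = (if n > 0 then lookup a n else 0)" for n
    by (simp add: p_def lookup_sum v_pow_def lookup_single when_def if_distrib[of "(*) _"] in_keys_iff cong: if_cong)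
  \<comment> \<open>The positive part is reflected and the constant term is kept once, so the error
    has only negative exponents.\<close>
  define b where "b = of_int (lookup a 0) + p + laurent_bar p"
  have "laurent_bar b = b" by (simp add: b_def algebra_simps)
  moreover have "degl (- 1) (a - b)"
  proof -
    have "lookup (a - b) n = 0" if "n \<ge> 0" for n
      using that by (cases "n = 0") (simp_all add: b_def lookup_minus lookup_add lookup_of_int p)
    then show ?thesis unfolding degl_def by (metis linorder_not_le zless_imp_add1_zle add.left_inverse add_le_cancel_right not_le uminus_add_conv_diff zle_diff1_eq minus_equation_iff)
  qed
  ultimately show ?thesis using that by blast
qed

context cox
begin

subsection \<open>Unitriangular bases\<close>

definition unitri :: "('s list set \<Rightarrow> 's hecke_elt) \<Rightarrow> bool" where
  "unitri f \<longleftrightarrow> (\<forall>w\<in>Wc. keys (f w - T w) \<subseteq> {y\<in>Wc. len y < len w})"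

lemma unitri_MW: assumes "unitri f" "w \<in> Wc" shows "f w \<in> MW" "keys (f w) \<subseteq> {y\<in>Wc. len y \<le> len w}"
proof -
  have "keys ((f w - T w) + T w) \<subseteq> {y\<in>Wc. len y \<le> len w}"
    using assms by (intro keys_add_subset) (fastforce simp: unitri_def)+
  then show "keys (f w) \<subseteq> {y\<in>Wc. len y \<le> len w}" by simp
  then show "f w \<in> MW" by auto
qed

lemma unitri_lin_MW: "unitri f \<Longrightarrow> keys l \<subseteq> Wc \<Longrightarrow> lin f l \<in> MW"
  unfolding mem_Collect_eq by (rule keys_lin) (use unitri_MW in blast)

lemma unitri_coords_exist:
  assumes f: "unitri f" and m: "keys m \<subseteq> {y\<in>Wc. len y < n}"
  shows "\<exists>l. keys l \<subseteq> {y\<in>Wc. len y < n} \<and> lin f l = m"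
  using m
proof (induction n arbitrary: m)
  case 0
  then have "m = 0" by simp
  then show ?case using linear_opD(3)[OF linear_lin] by (intro exI[of _ 0]) simp
next
  case (Suc n)
  have "m - lin f m = lin (\<lambda>w. T w - f w) m"
  proof -
    have "lin (\<lambda>w. T w - f w) m = lin T m - lin f m" by (simp add: lin_def sum_subtractf)
    then show ?thesis by (simp add: lin_id)
  qed
  moreover have "keys (lin (\<lambda>w. T w - f w) m) \<subseteq> {y\<in>Wc. len y < n}"
  proof (rule keys_lin)
    fix w assume "w \<in> keys m"
    then have w: "w \<in> Wc" "len w < Suc n" using Suc.prems by auto
    have "T w - f w = - (f w - T w)" by simp
    then have "keys (T w - f w) = keys (f w - T w)" by (metis keys_minus)
    then show "keys (T w - f w) \<subseteq> {y\<in>Wc. len y < n}" using f w by (fastforce simp: unitri_def)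
  qed
  ultimately have "keys (m - lin f m) \<subseteq> {y\<in>Wc. len y < n}" by simp
  from Suc.IH[OF this] obtain l where l: "keys l \<subseteq> {y\<in>Wc. len y < n}" "lin f l = m - lin f m" by auto
  have "lin f (m + l) = m" using l by (simp add: linear_opD(1)[OF linear_lin])
  moreover have "keys (m + l) \<subseteq> {y\<in>Wc. len y < Suc n}" using Suc.prems l by (intro keys_add_subset) auto
  ultimately show ?case by blast
qed

lemma unitri_injective:
  assumes f: "unitri f" and l: "keys l \<subseteq> Wc" "lin f l = 0" shows "l = 0"
proof (rule ccontr)
  assume "l \<noteq> 0"
  then have ne: "keys l \<noteq> {}" by simp
  define n where "n = Max (len ` keys l)"
  have "n \<in> len ` keys l" unfolding n_def using ne by (intro Max_in) auto
  then obtain w where w: "w \<in> keys l" "len w = n" by auto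
  have mx: "len y \<le> n" if "y \<in> keys l" for y unfolding n_def using that by (intro Max_ge) auto
  have "lookup (f y) w = (if y = w then 1 else 0)" if y: "y \<in> keys l" for y
  proof -
    have "y \<in> Wc" using y l by blast
    then have "w \<notin> keys (f y - T y)" using f mx[OF y] w by (fastforce simp: unitri_def)
    then show ?thesis by (auto simp: in_keys_iff lookup_minus lookup_T)
  qed
  then have "lookup (lin f l) w = (\<Sum>y\<in>keys l. lookup l y * (if y = w then 1 else 0))"
    by (simp add: lin_def lookup_sum)
  also have "\<dots> = lookup l w" using w by (simp add: if_distrib[of "(*) _"] cong: if_cong)
  finally show False using l w by (simp add: in_keys_iff)
qed

text \<open>Coordinates with respect to the basis f. The choice is made only at basis elements and
  extended linearly, so linearity comes for free; \<open>coords_unique\<close> shows that the choice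
  is forced.\<close>

definition coords :: "('s list set \<Rightarrow> 's hecke_elt) \<Rightarrow> 's hecke_elt \<Rightarrow> 's hecke_elt" where
  "coords f = lin (\<lambda>w. SOME l. keys l \<subseteq> {y\<in>Wc. len y < Suc (len w)} \<and> lin f l = T w)"

lemma linear_coords: "linear_op (coords f)" by (simp add: coords_def linear_lin)

lemma coords_T:
  assumes "unitri f" "w \<in> Wc"
  shows "keys (coords f (T w)) \<subseteq> {y\<in>Wc. len y < Suc (len w)}" "lin f (coords f (T w)) = T w"
proof -
  have "\<exists>l. keys l \<subseteq> {y\<in>Wc. len y < Suc (len w)} \<and> lin f l = T w"
    by (rule unitri_coords_exist) (use assms in auto)
  from someI_ex[OF this] show "keys (coords f (T w)) \<subseteq> {y\<in>Wc. len y < Suc (len w)}" "lin f (coords f (T w)) = T w"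
    by (auto simp: coords_def)
qed

lemma lin_coords: assumes "unitri f" "m \<in> MW" shows "lin f (coords f m) = m"
proof -
  have "lin f (coords f m) = (\<lambda>h. h) m"
    by (rule linear_ext[OF linear_comp[OF linear_lin linear_coords] linear_id]) (use assms coords_T in auto)
  then show ?thesis by simp
qed

lemma coords_keys_less: assumes "unitri f" "keys m \<subseteq> {y\<in>Wc. len y < n}" shows "keys (coords f m) \<subseteq> {y\<in>Wc. len y < n}"
proof -
  have "coords f m = lin (\<lambda>w. coords f (T w)) m" by (rule linear_eq_lin[OF linear_coords])
  moreover have "keys (lin (\<lambda>w. coords f (T w)) m) \<subseteq> {y\<in>Wc. len y < n}"
    by (rule keys_lin) (use coords_T(1)[OF assms(1)] assms(2) in fastforce)
  ultimately show ?thesis by simp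
qed

lemma coords_keys: assumes "unitri f" "m \<in> MW" shows "keys (coords f m) \<subseteq> Wc"
proof -
  have "coords f m = lin (\<lambda>w. coords f (T w)) m" by (rule linear_eq_lin[OF linear_coords])
  moreover have "keys (lin (\<lambda>w. coords f (T w)) m) \<subseteq> Wc"
    by (rule keys_lin) (use coords_T(1)[OF assms(1)] assms(2) in fastforce)
  ultimately show ?thesis by simp
qed

lemma coords_unique: assumes f: "unitri f" and l: "keys l \<subseteq> Wc" "lin f l = m" shows "coords f m = l"
proof -
  have m: "m \<in> MW" using unitri_lin_MW f l by blast
  have "lin f (coords f m - l) = 0" using lin_coords[OF f m] l by (simp add: linear_opD(5)[OF linear_lin])
  then have "coords f m - l = 0"
    by (rule unitri_injective[OF f keys_diff_subset[OF coords_keys[OF f m] l(1)]])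
  then show ?thesis by simp
qed

lemma coords_basis: assumes "unitri f" "w \<in> Wc" shows "coords f (f w) = T w"
  by (rule coords_unique) (use assms in auto)

subsection \<open>The standard basis\<close>

text \<open>The image of the normalised T_w in the model. It is used for complex w too: their
  expansion in the basis t_y, y in W_c, is what Property W speaks about.\<close>

definition t :: "'s list set \<Rightarrow> 's hecke_elt" where "t w = phi (Tt w)"

abbreviation tau :: "'s hecke_elt \<Rightarrow> 's hecke_elt" where "tau \<equiv> coords t"

lemma unitri_t: "unitri t"
  unfolding unitri_def
proof
  fix w assume w: "w \<in> Wc"
  have e: "t w - T w = scale (v_pow (- int (len w))) (phi (T w) - scale (v_pow (int (len w))) (T w))"
    by (simp add: t_def Tt_def linear_opD(2)[OF linear_phi])
  show "keys (t w - T w) \<subseteq> {y\<in>Wc. len y < len w}"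
    unfolding e by (rule subset_trans[OF keys_scale phi_T[OF w]])
qed

lemma t_MW: "t w \<in> MW" unfolding t_def by (rule phi_MW)

lemma Tt_HW: "w \<in> W \<Longrightarrow> Tt w \<in> HW"
  unfolding Tt_def by (intro HW_closed(2) HW_T)

lemma bop_t:
  assumes s: "s \<in> S" and w: "w \<in> W"
  shows "bop s (t w) = t (s \<cdot> w) + scale (if dl s w then v_pow 1 else v_pow (- 1)) (t w)"
proof -
  have "bop s (t w) = phi (Bo s (Tt w))" using Th_Bo[OF s Tt_HW[OF w]] by (simp add: t_def phi_def)
  also have "Bo s (Tt w) = Tt (s \<cdot> w) + scale (if dl s w then v_pow 1 else v_pow (- 1)) (Tt w)"
  proof (cases "dl s w")
    case True
    have l: "len w = len (s \<cdot> w) + 1" using dl_len s w True by blast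
    have "T w + lt s w = scale (v_pow 2) (T w + T (s \<cdot> w))" using lt_simps(1)[OF s w True] by simp
    moreover have "Bo s (Tt w) = scale (v_pow (- 1) * v_pow (- int (len w))) (T w + lt s w)"
      by (simp add: Bo_def Tt_def linear_opD[OF linear_lam])
    ultimately show ?thesis using True by (simp add: Tt_def v_pow_add l)
  next
    case False
    have "len (s \<cdot> w) = len w + 1" using ndl_len s w False by blast
    then show ?thesis using False lt_simps(2)[OF s w False]
      by (simp add: Bo_def Tt_def linear_opD[OF linear_lam] v_pow_add algebra_simps)
  qed
  finally show ?thesis by (simp add: linear_opD[OF linear_phi] t_def)
qed

lemma io_t: assumes "w \<in> W" shows "io (t w) = t (iv w)"
proof -
  have "io (Tt w) = Tt (iv w)" using assms by (simp add: Tt_def linear_opD(2)[OF linear_io] io_T)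
  then show ?thesis using phi_io[OF Tt_HW[OF assms]] by (simp add: t_def)
qed

lemma tau_t: "w \<in> Wc \<Longrightarrow> tau (t w) = T w"
  by (rule coords_basis[OF unitri_t])

lemma tau_io: assumes "m \<in> MW" shows "tau (io m) = io (tau m)"
proof (rule coords_unique[OF unitri_t])
  have k: "keys (tau m) \<subseteq> Wc" using coords_keys[OF unitri_t assms] .
  then show "keys (io (tau m)) \<subseteq> Wc" using io_MW by auto
  have "lin t (io (tau m)) = io (lin t (tau m))"
    by (rule linear_ext[OF linear_comp[OF linear_lin linear_io] linear_comp[OF linear_io linear_lin]]) (use k io_T io_t in auto)
  then show "lin t (io (tau m)) = io m" using lin_coords[OF unitri_t assms] by simp
qed

text \<open>Group combinatorics determines everything except the last sum, over y with sy complex;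
  this is the part that Property W controls.\<close>

lemma tau_bop:
  assumes s: "s \<in> S" and m: "m \<in> MW" and z: "z \<in> Wc"
  shows "lookup (tau (bop s m)) z = (if dl s z then v_pow 1 else v_pow (- 1)) * lookup (tau m) z + lookup (tau m) (s \<cdot> z)
    + (\<Sum>y\<in>{y\<in>keys (tau m). s \<cdot> y \<notin> Wc}. lookup (tau m) y * lookup (tau (t (s \<cdot> y))) z)"
proof -
  let ?l = "tau m" and ?v = "\<lambda>z. if dl s z then v_pow 1 else v_pow (- 1)"
  have k: "keys ?l \<subseteq> Wc" using coords_keys[OF unitri_t m] .
  have zW: "z \<in> W" using z by blast
  have y: "lookup (tau (bop s (t y))) z = (if y = z then ?v z else 0) + (if y = s \<cdot> z then 1 else 0)
      + (if s \<cdot> y \<notin> Wc then lookup (tau (t (s \<cdot> y))) z else 0)" if "y \<in> keys ?l" for y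
  proof -
    have yc: "y \<in> Wc" "y \<in> W" using that k by auto
    have e: "s \<cdot> y = z \<longleftrightarrow> y = s \<cdot> z" using lm_lm[OF s yc(2)] lm_lm[OF s zW] by metis
    show ?thesis
    proof (cases "s \<cdot> y \<in> Wc")
      case True
      then show ?thesis using tau_t[OF yc(1)] tau_t[OF True] e
        by (auto simp: bop_t[OF s yc(2)] linear_opD[OF linear_coords] lookup_add lookup_T)
    next
      case False
      then have "y \<noteq> s \<cdot> z" using e z by auto
      then show ?thesis using tau_t[OF yc(1)] False
        by (auto simp: bop_t[OF s yc(2)] linear_opD[OF linear_coords] lookup_add lookup_T)
    qed
  qed
  have "tau (bop s m) = tau (bop s (lin t ?l))" using lin_coords[OF unitri_t m] by simp
  also have "\<dots> = (\<Sum>y\<in>keys ?l. scale (lookup ?l y) (tau (bop s (t y))))"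
    by (simp add: lin_def linear_sum[OF linear_bop] linear_sum[OF linear_coords] linear_opD(2)[OF linear_bop] linear_opD(2)[OF linear_coords])
  finally have "lookup (tau (bop s m)) z = (\<Sum>y\<in>keys ?l. lookup ?l y * ((if y = z then ?v z else 0) + (if y = s \<cdot> z then 1 else 0)
      + (if s \<cdot> y \<notin> Wc then lookup (tau (t (s \<cdot> y))) z else 0)))"
    using y by (simp add: lookup_sum)
  also have "\<dots> = (\<Sum>y\<in>keys ?l. if y = z then lookup ?l y * ?v z else 0) + (\<Sum>y\<in>keys ?l. if y = s \<cdot> z then lookup ?l y else 0)
      + (\<Sum>y\<in>keys ?l. if s \<cdot> y \<notin> Wc then lookup ?l y * lookup (tau (t (s \<cdot> y))) z else 0)"
    unfolding sum.distrib[symmetric] by (rule sum.cong) (auto simp: algebra_simps)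
  also have "(\<Sum>y\<in>keys ?l. if s \<cdot> y \<notin> Wc then lookup ?l y * lookup (tau (t (s \<cdot> y))) z else 0)
      = (\<Sum>y\<in>{y\<in>keys ?l. s \<cdot> y \<notin> Wc}. lookup ?l y * lookup (tau (t (s \<cdot> y))) z)"
    by (rule sum.inter_filter[symmetric]) simp
  finally show ?thesis by (simp add: in_keys_iff mult.commute)
qed

subsection \<open>The canonical basis\<close>

definition is_canon :: "'s list set \<Rightarrow> 's hecke_elt \<Rightarrow> bool" where
  "is_canon w c \<longleftrightarrow> keys (c - T w) \<subseteq> {y\<in>Wc. len y < len w} \<and> barM c = c \<and> (\<forall>z. degl (- 1) (lookup (tau c - T w) z))"

lemma is_canon_tau: assumes "is_canon w c" shows "degl 0 (lookup (tau c) z)"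
proof -
  have "lookup (tau c) z = lookup (tau c - T w) z + lookup (T w) z" by (simp add: lookup_minus)
  moreover have "degl 0 (lookup (tau c - T w) z)" using assms degl_mono[of "- 1" _ 0] by (simp add: is_canon_def)
  ultimately show ?thesis using degl_one by (auto simp: lookup_T intro: degl_add)
qed

text \<open>The monomial b_w is already bar-invariant. Expand b_w - t_w in the shorter c_y and
  subtract, for each y, a bar-invariant Laurent polynomial that matches the coefficient modulo v^-1
  Z[v^-1].\<close>

lemma canon_exists: "w \<in> Wc \<Longrightarrow> \<exists>c. is_canon w c"
proof (induction "len w" arbitrary: w rule: less_induct)
  case less
  \<comment> \<open>The monomial is a default for elements not shorter than w; it makes
    \<open>c'\<close> unitriangular on all of W_c, so that coordinates with respect to it make
    sense.\<close>
  define c' where "c' y = (if len y < len w then SOME c. is_canon y c else T y)" for y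
  have c': "is_canon y (c' y)" if "y \<in> Wc" "len y < len w" for y
    using less.hyps[OF that(2) that(1)] that by (simp add: c'_def someI_ex)
  have u: "unitri c'" unfolding unitri_def
  proof
    fix y assume y: "y \<in> Wc"
    show "keys (c' y - T y) \<subseteq> {x \<in> Wc. len x < len y}"
      using c'[OF y] by (cases "len y < len w") (simp_all add: is_canon_def c'_def)
  qed
  define x where "x = T w - t w"
  have x: "keys x \<subseteq> {y\<in>Wc. len y < len w}"
  proof -
    have "x = - (t w - T w)" by (simp add: x_def)
    then have "keys x = keys (t w - T w)" by (metis keys_minus)
    then show ?thesis using unitri_t less.prems by (simp add: unitri_def)
  qed
  define l where "l = coords c' x"
  have l: "keys l \<subseteq> {y\<in>Wc. len y < len w}" "lin c' l = x"
    using coords_keys_less[OF u x] lin_coords[OF u, of x] x by (auto simp: l_def)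
  define b where "b a = (SOME b. laurent_bar b = b \<and> degl (- 1) (a - b))" for a
  have "\<exists>b. laurent_bar b = b \<and> degl (- 1) (a - b)" for a
    by (rule bar_invariant_part[of a]) blast
  from someI_ex[OF this] have b: "laurent_bar (b a) = b a" "degl (- 1) (a - b a)" for a
    by (auto simp: b_def)
  define N where "N = (\<Sum>y\<in>keys l. scale (b (lookup l y)) (c' y))"
  define c where "c = T w - N"
  have kN: "keys N \<subseteq> {y\<in>Wc. len y < len w}" unfolding N_def
  proof (rule keys_sum_subset)
    fix y assume "y \<in> keys l"
    then have "y \<in> Wc" "len y < len w" using l by auto
    then show "keys (scale (b (lookup l y)) (c' y)) \<subseteq> {y\<in>Wc. len y < len w}"
      using unitri_MW(2)[OF u, of y] keys_scale[of "b (lookup l y)" "c' y"] by fastforce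
  qed
  have "is_canon w c" unfolding is_canon_def
  proof (intro conjI allI)
    show "keys (c - T w) \<subseteq> {y\<in>Wc. len y < len w}" using kN by (simp add: c_def keys_minus)
    have "barM N = N" unfolding N_def barM_sum
      by (rule sum.cong) (use l c' b in \<open>auto simp: is_canon_def\<close>)
    then show "barM c = c" by (simp add: c_def)
    fix z
    have "c = t w + (\<Sum>y\<in>keys l. scale (lookup l y - b (lookup l y)) (c' y))"
      using l(2) by (simp add: c_def x_def N_def lin_def sum_subtractf algebra_simps)
    then have "tau c - T w = (\<Sum>y\<in>keys l. scale (lookup l y - b (lookup l y)) (tau (c' y)))"
      using tau_t[OF less.prems] by (simp add: linear_opD[OF linear_coords] linear_sum[OF linear_coords] del: scale_simps(8))
    then have e: "lookup (tau c - T w) z = (\<Sum>y\<in>keys l. (lookup l y - b (lookup l y)) * lookup (tau (c' y)) z)"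
      by (simp add: lookup_sum del: scale_simps(8))
    have "degl (- 1) ((lookup l y - b (lookup l y)) * lookup (tau (c' y)) z)" if "y \<in> keys l" for y
    proof -
      have "is_canon y (c' y)" using c' l that by blast
      then show ?thesis using degl_mult[OF b(2) is_canon_tau, of y "c' y" "lookup l y" z] by simp
    qed
    then show "degl (- 1) (lookup (tau c - T w) z)" unfolding e by (intro degl_sum)
  qed
  then show ?case by blast
qed

definition C :: "'s list set \<Rightarrow> 's hecke_elt" where "C w = (SOME c. is_canon w c)"

lemma C: "w \<in> Wc \<Longrightarrow> is_canon w (C w)"
  using someI_ex[OF canon_exists] by (simp add: C_def)

lemma unitri_C: "unitri C"
  using C by (simp add: unitri_def is_canon_def)

lemma C_MW: "w \<in> Wc \<Longrightarrow> C w \<in> MW" using unitri_MW unitri_C by blast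
lemma C_bar: "w \<in> Wc \<Longrightarrow> barM (C w) = C w" using C by (simp add: is_canon_def)

abbreviation kap :: "'s hecke_elt \<Rightarrow> 's hecke_elt" where "kap \<equiv> coords C"

text \<open>The coefficient p_{z,w} of t_z in c_w, the analogue of a Kazhdan--Lusztig
  polynomial.\<close>

abbreviation pp :: "'s list set \<Rightarrow> 's list set \<Rightarrow> laurent" where "pp z w \<equiv> lookup (tau (C w)) z"

lemma pp_degl: assumes "w \<in> Wc" "z \<noteq> w" shows "degl (- 1) (pp z w)"
proof -
  have "degl (- 1) (lookup (tau (C w) - T w) z)" using C[OF assms(1)] by (simp add: is_canon_def)
  then show ?thesis using assms by (simp add: lookup_minus lookup_T)
qed

lemma pp_less: assumes "w \<in> Wc" shows "keys (tau (C w) - T w) \<subseteq> {y\<in>Wc. len y < len w}"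
proof -
  have "keys ((C w - T w) - (t w - T w)) \<subseteq> {y\<in>Wc. len y < len w}"
    by (rule keys_diff_subset) (use unitri_C unitri_t assms in \<open>simp_all add: unitri_def\<close>)
  then have "keys (tau (C w - t w)) \<subseteq> {y\<in>Wc. len y < len w}" using coords_keys_less[OF unitri_t] by simp
  then show ?thesis using tau_t[OF assms] by (simp add: linear_opD(5)[OF linear_coords])
qed

lemma pp_self: assumes "w \<in> Wc" shows "pp w w = 1"
proof -
  have "w \<notin> keys (tau (C w) - T w)" using pp_less[OF assms] by blast
  then show ?thesis by (simp add: in_keys_iff lookup_minus lookup_T)
qed

lemma pp_zero: assumes "w \<in> Wc" "z \<noteq> w" "z \<notin> Wc \<or> len w \<le> len z" shows "pp z w = 0"
proof -
  have "z \<notin> keys (tau (C w) - T w)" using pp_less[OF assms(1)] assms(3) by auto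
  then show ?thesis using assms(2) by (simp add: in_keys_iff lookup_minus lookup_T)
qed

lemma lookup_pp_0: "w \<in> Wc \<Longrightarrow> lookup (pp z w) 0 = (if z = w then 1 else 0)"
  using pp_self[of w] degl_lookup[OF pp_degl, of w z 0] by (auto simp: lookup_one)

lemma tau_lin_C:
  assumes l: "keys l \<subseteq> Wc" and N: "\<And>y. degl N (lookup l y)"
  shows "degl (N - 1) (lookup (tau (lin C l)) z - lookup l z)"
proof -
  have "tau (lin C l) = (\<Sum>y\<in>keys l. scale (lookup l y) (tau (C y)))"
    by (simp add: lin_def linear_sum[OF linear_coords] linear_opD(2)[OF linear_coords])
  moreover have "l = (\<Sum>y\<in>keys l. scale (lookup l y) (T y))" using lin_id[of l] by (simp add: lin_def)
  ultimately have "tau (lin C l) - l = (\<Sum>y\<in>keys l. scale (lookup l y) (tau (C y) - T y))"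
    by (simp add: sum_subtractf)
  then have "lookup (tau (lin C l)) z - lookup l z = (\<Sum>y\<in>keys l. lookup l y * lookup (tau (C y) - T y) z)"
    by (metis (no_types, lifting) lookup_minus lookup_scale lookup_sum sum.cong)
  moreover have "degl (N - 1) (lookup l y * lookup (tau (C y) - T y) z)" if "y \<in> keys l" for y
  proof -
    have "y \<in> Wc" using l that by blast
    then have "degl (- 1) (lookup (tau (C y) - T y) z)" using C by (simp add: is_canon_def)
    from degl_mult[OF N this] show ?thesis by simp
  qed
  ultimately show ?thesis by (simp add: degl_sum)
qed

text \<open>Modulo v^-1 the bases t and c agree, so both coordinate vectors have the same
  coefficients in top degree, and a bound N > k for the canonical coordinates can be lowered by one.
  A crude bound to start from exists because only finitely many coordinates are nonzero.\<close>

lemma kap_degl: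
  assumes m: "m \<in> MW" and k: "\<And>z. degl k (lookup (tau m) z)" shows "degl k (lookup (kap m) z)"
proof -
  let ?l = "kap m"
  have l: "keys ?l \<subseteq> Wc" "lin C ?l = m" using coords_keys lin_coords unitri_C m by blast+
  have step: "\<forall>z. degl (N - 1) (lookup ?l z)" if "\<forall>z. degl N (lookup ?l z)" "k < N" for N
  proof
    fix z
    have 1: "degl (N - 1) (lookup (tau m) z - lookup ?l z)" using tau_lin_C[OF l(1), of N z] that l(2) by simp
    have 2: "degl (N - 1) (lookup (tau m) z)" using degl_mono[OF k] that by simp
    have "lookup (tau m) z - (lookup (tau m) z - lookup ?l z) = lookup ?l z" by (rule diff_diff_eq2[THEN trans]) simp
    then show "degl (N - 1) (lookup ?l z)" using degl_diff[OF 2 1] by (simp only:)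
  qed
  have down: "\<forall>z. degl k (lookup ?l z)" if "\<forall>z. degl (k + int n) (lookup ?l z)" for n
    using that
  proof (induction n)
    case (Suc n)
    then show ?case using step[of "k + int (Suc n)"] by simp
  qed simp
  define D where "D z = (SOME k. k \<ge> 0 \<and> degl k (lookup ?l z))" for z
  have D: "D z \<ge> 0" "degl (D z) (lookup ?l z)" for z
    using someI_ex[OF degl_exists, of "lookup ?l z"] by (auto simp: D_def)
  define n where "n = nat (Max (insert 0 (D ` keys ?l)) - k)"
  have "degl (k + int n) (lookup ?l z)" for z
  proof (cases "z \<in> keys ?l")
    case True
    then have "D z \<le> Max (insert 0 (D ` keys ?l))" by (intro Max_ge) auto
    then show ?thesis using degl_mono[OF D(2)] by (simp add: n_def)
  next
    case False
    then show ?thesis by (simp add: in_keys_iff)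
  qed
  then show ?thesis using down by blast
qed

lemma kap_bar: assumes "m \<in> MW" "barM m = m" shows "laurent_bar (lookup (kap m) z) = lookup (kap m) z"
proof -
  have l: "keys (kap m) \<subseteq> Wc" "lin C (kap m) = m" using coords_keys lin_coords unitri_C assms by blast+
  have "lin C (barM (kap m)) = lin (\<lambda>w. barM (C w)) (barM (kap m))"
    by (rule lin_cong) (use l C_bar in auto)
  also have "\<dots> = m" using l assms by (simp flip: barM_lin)
  finally have "kap m = barM (kap m)" using coords_unique[OF unitri_C, of "barM (kap m)" m] l by simp
  then show ?thesis by (metis lookup_barM)
qed

text \<open>A bar-invariant coefficient in Z[v^-1] is an integer, and constant terms may be read in
  the basis t because the two bases agree modulo v^-1.\<close>

lemma kap_integral:
  assumes m: "m \<in> MW" "barM m = m" and k: "\<And>z. degl 0 (lookup (tau m) z)"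
  shows "lookup (kap m) z = of_int (lookup (lookup (tau m) z) 0)"
proof -
  have l: "keys (kap m) \<subseteq> Wc" "lin C (kap m) = m" using coords_keys lin_coords unitri_C m by blast+
  have d: "degl 0 (lookup (kap m) z)" for z using kap_degl[OF m(1) k] by blast
  have "degl (- 1) (lookup (tau m) z - lookup (kap m) z)" using tau_lin_C[OF l(1) d, of z] l(2) by simp
  then have "lookup (lookup (tau m) z - lookup (kap m) z) 0 = 0" by (rule degl_lookup) simp
  then show ?thesis using bar_invariant_degl_0[OF kap_bar[OF m] d] by (simp add: lookup_minus)
qed

lemma canon_unique:
  assumes m: "m \<in> MW" "barM m = m" and k: "\<And>z. degl (- 1) (lookup (tau m) z)" shows "m = 0"
proof -
  have "lookup (kap m) z = 0" for z
    by (rule bar_invariant_degl_neg[OF kap_bar[OF m] kap_degl[OF m(1) k]])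
  then have "kap m = 0" by (simp add: poly_mapping_eq_iff fun_eq_iff)
  then show ?thesis using lin_coords[OF unitri_C m(1)] linear_opD(3)[OF linear_lin] by metis
qed

lemma io_C: assumes "w \<in> Wc" shows "io (C w) = C (iv w)"
proof -
  have i: "iv w \<in> Wc" "w \<in> W" using iv_Wc assms by auto
  let ?m = "io (C w) - C (iv w)"
  have m: "C w \<in> MW" "io (C w) \<in> MW" "C (iv w) \<in> MW" using C_MW io_MW assms i by blast+
  have "?m = 0"
  proof (rule canon_unique)
    show "?m \<in> MW" using MW_closed(3)[OF m(2,3)] .
    show "barM ?m = ?m" using io_barM[OF m(1)] C_bar assms i by simp
    fix z
    have "tau ?m = io (tau (C w) - T w) - (tau (C (iv w)) - T (iv w))"
      using tau_io[OF m(1)] i by (simp add: linear_opD(5)[OF linear_coords] linear_opD(5)[OF linear_io] io_T)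
    moreover have "degl (- 1) (lookup (io h) z)" if h: "\<And>z. degl (- 1) (lookup h z)" for h
    proof -
      have "lookup (io h) z = (\<Sum>w\<in>keys h. lookup h w * lookup (T (if w \<in> W then iv w else w)) z)"
        by (simp add: io_def lin_def lookup_sum)
      then show ?thesis by (auto intro!: degl_sum simp: lookup_T h)
    qed
    ultimately show "degl (- 1) (lookup (tau ?m) z)"
      using C[OF assms] C[OF i(1)] by (simp add: lookup_minus[of "io _"] is_canon_def degl_diff)
  qed
  then show ?thesis by simp
qed

text \<open>The analogue of the Kazhdan--Lusztig coefficient.\<close>

definition mu :: "'s list set \<Rightarrow> 's list set \<Rightarrow> int" where "mu z w = lookup (pp z w) (- 1)"

lemma mu_zero: "w \<in> Wc \<Longrightarrow> z \<notin> Wc \<or> len w \<le> len z \<Longrightarrow> mu z w = 0"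
  using pp_zero[of w z] pp_self[of w] by (cases "z = w") (auto simp: mu_def lookup_one)

lemma mu_io: assumes "w \<in> Wc" "z \<in> W" shows "mu (iv z) (iv w) = mu z w"
proof -
  have e: "tau (C (iv w)) = io (tau (C w))" using io_C[OF assms(1)] tau_io[OF C_MW[OF assms(1)]] by simp
  have "lookup (io h) (iv z) = lookup h z" if "keys h \<subseteq> W" for h
  proof -
    have "iv z = iv x \<longleftrightarrow> x = z" if "x \<in> W" for x using G.inv_inv assms that by metis
    then have "lookup (io h) (iv z) = (\<Sum>w\<in>keys h. lookup h w * (if w = z then 1 else 0))"
      unfolding io_def lin_def lookup_sum lookup_scale lookup_T
      by (intro sum.cong) (use that in auto)
    also have "\<dots> = lookup h z" by (simp add: if_distrib[of "(*) _"] in_keys_iff cong: if_cong)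
    finally show ?thesis .
  qed
  moreover have "keys (tau (C w)) \<subseteq> W" using coords_keys[OF unitri_t C_MW[OF assms(1)]] by auto
  ultimately show ?thesis by (simp add: mu_def e)
qed

subsection \<open>The lattice\<close>

lemma tt_fib: "w \<in> W \<Longrightarrow> tt X w = fib (t w)"
  using TL_proj_fib[OF Tt_HW] by (simp add: tt_def t_def)

lemma v_inv_lattice_iff:
  assumes m: "m \<in> MW" shows "fib m \<in> v_inv_lattice X \<longleftrightarrow> (\<forall>z. degl (- 1) (lookup (tau m) z))"
proof -
  have tt: "TL_lincomb X f (tt X) = fib (lin t f)" "lin t f \<in> MW" if "keys f \<subseteq> Wc" for f
    using TL_lincomb_fib[of f "tt X" t] that tt_fib t_MW Wc_W by blast+
  have *: "v_pow (- 1) \<odot>\<^bsub>TL X\<^esub> TL_lincomb X f (tt X) = fib (scale (v_pow (- 1)) (lin t f))"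
    "scale (v_pow (- 1)) (lin t f) \<in> MW" if "keys f \<subseteq> Wc" for f
    using tt[OF that] TL_smult MW_closed(2)[OF tt(2)[OF that]] by simp_all
  show ?thesis
  proof
    assume "fib m \<in> v_inv_lattice X"
    then obtain f where f: "keys f \<subseteq> Wc" "\<And>w. lookup f w \<in> A_minus"
      and "fib m = v_pow (- 1) \<odot>\<^bsub>TL X\<^esub> TL_lincomb X f (tt X)"
      unfolding v_inv_lattice_def TL_lattice_def by blast
    then have "m = scale (v_pow (- 1)) (lin t f)" using *[OF f(1)] fib_inj[OF m *(2)[OF f(1)]] by simp
    then have "tau m = scale (v_pow (- 1)) f"
      using coords_unique[OF unitri_t f(1) refl] by (simp add: linear_opD(2)[OF linear_coords])
    then show "\<forall>z. degl (- 1) (lookup (tau m) z)"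
      using degl_mult[OF degl_v_pow[of "- 1"]] f(2) by (fastforce simp: A_minus_degl)
  next
    assume d: "\<forall>z. degl (- 1) (lookup (tau m) z)"
    define f where "f = scale (v_pow 1) (tau m)"
    have f: "keys f \<subseteq> Wc" using keys_scale[of "v_pow 1" "tau m"] coords_keys[OF unitri_t m] by (simp add: f_def)
    have "scale (v_pow (- 1)) (lin t f) = m"
      using lin_coords[OF unitri_t m] by (simp add: f_def linear_opD(2)[OF linear_lin])
    then have "fib m = v_pow (- 1) \<odot>\<^bsub>TL X\<^esub> TL_lincomb X f (tt X)" using *[OF f] by simp
    moreover have "lookup f w \<in> A_minus" for w
    proof -
      have "degl (1 + - 1) (v_pow 1 * lookup (tau m) w)" by (rule degl_mult) (use d degl_v_pow in auto)
      then show ?thesis by (simp add: A_minus_degl f_def)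
    qed
    ultimately show "fib m \<in> v_inv_lattice X" unfolding v_inv_lattice_def TL_lattice_def using f by blast
  qed
qed

lemma bop_MW: "bop s m \<in> MW" using bop_keys[of s m] by blast

end

subsection \<open>Consequences of Property W\<close>

locale cox_W = cox +
  assumes property_W: "property_W X"
begin

lemma weakly_complex_degl:
  assumes "s \<in> S" "u \<in> Wc" "s \<cdot> u \<notin> Wc" shows "degl (- 1) (lookup (tau (t (s \<cdot> u))) z)"
proof -
  have x: "s \<cdot> u \<in> W" using assms by blast
  then have "weakly_complex X (s \<cdot> u)" using assms Wc_iff[OF x] unfolding weakly_complex_def by blast
  then have "fib (t (s \<cdot> u)) \<in> v_inv_lattice X" using property_W x unfolding property_W_def tt_fib[OF x, symmetric] by blast
  then show ?thesis using v_inv_lattice_iff[OF t_MW] by blast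
qed

text \<open>For y different from w one factor v^-1 comes from p_{y,w} and another from Property W.
  The term y = w supplies only the second, and it occurs only if sw is complex.\<close>

lemma complex_sum_degl:
  assumes "s \<in> S" "w \<in> Wc"
  shows "degl (- 1) (\<Sum>y\<in>{y\<in>keys (tau (C w)). s \<cdot> y \<notin> Wc}. pp y w * lookup (tau (t (s \<cdot> y))) z)" (is "degl (- 1) ?S")
    and "s \<cdot> w \<in> Wc \<Longrightarrow> degl (- 2) (\<Sum>y\<in>{y\<in>keys (tau (C w)). s \<cdot> y \<notin> Wc}. pp y w * lookup (tau (t (s \<cdot> y))) z)"
proof -
  have k: "keys (tau (C w)) \<subseteq> Wc" using coords_keys[OF unitri_t C_MW] assms by blast
  have 2: "degl (- 2) (pp y w * lookup (tau (t (s \<cdot> y))) z)" if "y \<in> keys (tau (C w))" "s \<cdot> y \<notin> Wc" "y \<noteq> w" for y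
    using degl_mult[OF pp_degl[OF assms(2) that(3)] weakly_complex_degl[OF assms(1) _ that(2)]] that k by auto
  then show "degl (- 2) ?S" if "s \<cdot> w \<in> Wc" using that by (intro degl_sum) blast
  have 1: "degl (- 1) (pp w w * lookup (tau (t (s \<cdot> w))) z)" if "s \<cdot> w \<notin> Wc"
    using weakly_complex_degl[OF assms that] pp_self[OF assms(2)] by simp
  show "degl (- 1) ?S"
  proof (rule degl_sum)
    fix y assume y: "y \<in> {y\<in>keys (tau (C w)). s \<cdot> y \<notin> Wc}"
    show "degl (- 1) (pp y w * lookup (tau (t (s \<cdot> y))) z)"
      using 1 degl_mono[OF 2, of y "- 1"] y by (cases "y = w") auto
  qed
qed

text \<open>All coordinates of b_s c_w lie in Z[v^-1], so \<open>kap_integral\<close> leaves only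
  constant terms: mu(z,w) from v p_{z,w} if s is a descent of z, [sz = w] from p_{sz,w}, and nothing
  from the complex terms.\<close>

lemma kap_bop_up:
  assumes s: "s \<in> S" and w: "w \<in> Wc" and nd: "\<not> dl s w" and z: "z \<in> Wc"
  shows "lookup (kap (bop s (C w))) z = (if dl s z then of_int (mu z w + (if s \<cdot> z = w then 1 else 0)) else 0)"
proof -
  let ?m = "bop s (C w)"
  let ?S = "\<lambda>z. \<Sum>y\<in>{y\<in>keys (tau (C w)). s \<cdot> y \<notin> Wc}. pp y w * lookup (tau (t (s \<cdot> y))) z"
  have m: "?m \<in> MW" "barM ?m = ?m" using bop_MW C_bar[OF w] barM_bop by auto
  have e: "lookup (tau ?m) z = (if dl s z then v_pow 1 else v_pow (- 1)) * pp z w + pp (s \<cdot> z) w + ?S z" if "z \<in> Wc" for z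
    using tau_bop[OF s C_MW[OF w] that] .
  have p0: "degl 0 (pp z w)" for z
    using pp_degl[OF w, of z] pp_self[OF w] degl_one degl_mono[of "- 1" "pp z w" 0] by (cases "z = w") auto
  have d: "degl 0 (lookup (tau ?m) z)" for z
  proof (cases "z \<in> Wc")
    case True
    have "degl 0 ((if dl s z then v_pow 1 else v_pow (- 1)) * pp z w)"
    proof (cases "dl s z")
      case True
      then have "z \<noteq> w" using nd by blast
      then show ?thesis using degl_mult[OF degl_v_pow[of 1] pp_degl[OF w]] True by simp
    next
      case False
      then show ?thesis using degl_mono[OF degl_mult[OF degl_v_pow[of "- 1"] p0], of 0] by simp
    qed
    moreover have "degl 0 (?S z)" using degl_mono[OF complex_sum_degl(1)[OF s w], of 0] by simp
    ultimately show ?thesis unfolding e[OF True] using p0 by (intro degl_add)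
  next
    case False
    then have "z \<notin> keys (tau ?m)" using coords_keys[OF unitri_t m(1)] by blast
    then show ?thesis by (simp add: in_keys_iff)
  qed
  have sz: "\<not> dl s z \<Longrightarrow> s \<cdot> z \<noteq> w" using dl_lm[OF s, of z] z nd by auto
  have "lookup (?S z) 0 = 0" by (rule degl_lookup[OF complex_sum_degl(1)[OF s w]]) simp
  then have "lookup (lookup (tau ?m) z) 0 = (if dl s z then mu z w + (if s \<cdot> z = w then 1 else 0) else 0)"
    unfolding e[OF z] using lookup_pp_0[OF w, of "s \<cdot> z"] sz degl_lookup[OF p0, of 1]
    by (simp add: lookup_add lookup_v_pow_mult mu_def)
  then show ?thesis using kap_integral[OF m d, of z] by simp
qed

text \<open>With u = sw, b_s c_u is c_w plus multiples of shorter c_z having descent s. The operator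
  b_s - delta kills b_s c_u since b_s^2 = delta b_s, and the shorter terms by induction, hence also
  c_w.\<close>

lemma bop_C_dl: "s \<in> S \<Longrightarrow> w \<in> Wc \<Longrightarrow> dl s w \<Longrightarrow> bop s (C w) = scale delta (C w)"
proof (induction "len w" arbitrary: w rule: less_induct)
  case less
  note s = less.prems(1) and w = less.prems(2)
  have wW: "w \<in> W" using w by blast
  define u where "u = s \<cdot> w"
  have u: "u \<in> Wc" "\<not> dl s u" "s \<cdot> u = w" using Wc_lm[OF s w less.prems(3)] dl_lm[OF s wW] less.prems(3) lm_lm[OF s wW] by (auto simp: u_def)
  have l: "len w = len u + 1" using dl_len[OF s wW less.prems(3)] by (simp add: u_def)
  let ?k = "kap (bop s (C u))"
  define D where "D h = bop s h - scale delta h" for h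
  have D: "linear_op D" unfolding D_def by (rule linear_diff[OF linear_bop linear_scale[OF linear_id]])
  have k: "keys ?k \<subseteq> Wc" using coords_keys[OF unitri_C bop_MW] .
  have z: "dl s z \<and> len z < len w" if "z \<in> keys ?k" "z \<noteq> w" for z
  proof -
    have "z \<in> Wc" using that k by blast
    moreover have "s \<cdot> z \<noteq> u" using lm_inj[OF s _ wW, of z] \<open>z \<in> Wc\<close> that(2) by (auto simp: u_def)
    ultimately have "dl s z" "mu z u \<noteq> 0"
      using kap_bop_up[OF s u(1,2), of z] that(1) by (auto simp: in_keys_iff split: if_splits)
    then show ?thesis using mu_zero[OF u(1), of z] l by force
  qed
  have w1: "lookup ?k w = 1"
    using kap_bop_up[OF s u(1,2) w] mu_zero[OF u(1), of w] l less.prems(3) by (simp add: u_def)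
  have "D (bop s (C u)) = D (lin C ?k)" using lin_coords[OF unitri_C bop_MW] by simp
  also have "\<dots> = (\<Sum>z\<in>keys ?k. scale (lookup ?k z) (D (C z)))"
    by (simp add: lin_def linear_sum[OF D] linear_opD(2)[OF D])
  also have "\<dots> = (\<Sum>z\<in>keys ?k. if z = w then D (C w) else 0)"
  proof (rule sum.cong[OF refl])
    fix z assume zk: "z \<in> keys ?k"
    have "D (C z) = 0" if "z \<noteq> w"
      using less.hyps[of z] z[OF zk that] zk k s by (auto simp: D_def)
    then show "scale (lookup ?k z) (D (C z)) = (if z = w then D (C w) else 0)" using w1 by simp
  qed
  also have "\<dots> = D (C w)" using w1 by (simp add: in_keys_iff)
  finally show ?case by (simp add: D_def bop_bop)
qed

text \<open>Comparing coefficients of t_z in b_s c_w = delta c_w gives v p_{z,w} = p_{sz,w} plus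
  complex terms. As sw is in W_c, these have degree at most -2, so the exponents 0 and -1 can be
  compared.\<close>

lemma pp_step:
  assumes s: "s \<in> S" and w: "w \<in> Wc" "dl s w" and z: "z \<in> Wc" "\<not> dl s z"
  shows "mu z w = (if s \<cdot> z = w then 1 else 0)" "lookup (pp z w) (- 2) = mu (s \<cdot> z) w"
proof -
  let ?S = "\<Sum>y\<in>{y\<in>keys (tau (C w)). s \<cdot> y \<notin> Wc}. pp y w * lookup (tau (t (s \<cdot> y))) z"
  have d: "degl (- 2) ?S" by (rule complex_sum_degl(2)[OF s w(1) Wc_lm[OF s w]])
  have "delta * pp z w = v_pow (- 1) * pp z w + pp (s \<cdot> z) w + ?S"
    using tau_bop[OF s C_MW[OF w(1)] z(1)] bop_C_dl[OF s w] z(2) by (simp add: linear_opD(2)[OF linear_coords])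
  then have e: "v_pow 1 * pp z w = pp (s \<cdot> z) w + ?S" by (simp add: delta_def algebra_simps)
  have "lookup ?S 0 = 0" "lookup ?S (- 1) = 0" using degl_lookup[OF d] by auto
  then have "lookup (v_pow 1 * pp z w) 0 = lookup (pp (s \<cdot> z) w) 0"
    "lookup (v_pow 1 * pp z w) (- 1) = lookup (pp (s \<cdot> z) w) (- 1)" unfolding e by (simp_all add: lookup_add)
  then show "mu z w = (if s \<cdot> z = w then 1 else 0)" "lookup (pp z w) (- 2) = mu (s \<cdot> z) w"
    using lookup_pp_0[OF w(1)] by (simp_all add: lookup_v_pow_mult mu_def)
qed

text \<open>Elements of W_c have no noncommuting descents. So a z with descent s lacks the descent
  r, and \<open>pp_step\<close> for r leaves z = rw as the only one with mu(z,w) nonzero.\<close>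

lemma bop_C_string:
  assumes s: "s \<in> S" "r \<in> S" "\<not> commuting X s r" and w: "w \<in> Wc" "dl r w" "\<not> dl s w"
  shows "bop s (C w) = (if s \<cdot> w \<in> Wc then C (s \<cdot> w) else 0) + (if dl s (r \<cdot> w) then C (r \<cdot> w) else 0)"
proof -
  have wW: "w \<in> W" and ne: "s \<noteq> r" using w s noncommuting_neq by blast+
  have tw: "r \<cdot> w \<in> Wc" using Wc_lm s w by blast
  let ?k = "(if s \<cdot> w \<in> Wc then T (s \<cdot> w) else 0) + (if dl s (r \<cdot> w) then T (r \<cdot> w) else 0)"
  have "kap (bop s (C w)) = ?k"
  proof (rule poly_mapping_eqI)
    fix z
    show "lookup (kap (bop s (C w))) z = lookup ?k z"
    proof (cases "z \<in> Wc")
      case z: True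
      have 1: "z = s \<cdot> w \<longleftrightarrow> s \<cdot> z = w" "z = r \<cdot> w \<longleftrightarrow> r \<cdot> z = w"
        using lm_lm s(1,2) wW Wc_W[OF z] by metis+
      have 2: "lookup (kap (bop s (C w))) z = (if dl s z then of_int ((if r \<cdot> z = w then 1 else 0) + (if s \<cdot> z = w then 1 else 0)) else 0)"
      proof (cases "dl s z")
        case True
        then have "\<not> dl r z" using Wc_descents[OF z s(1,2)] s(3) by blast
        then show ?thesis using kap_bop_up[OF s(1) w(1,3) z] pp_step(1)[OF s(2) w(1,2) z] by simp
      next
        case False
        then show ?thesis using kap_bop_up[OF s(1) w(1,3) z] by simp
      qed
      have 3: "dl s z" if "s \<cdot> z = w" using that dl_lm[OF s(1) Wc_W[OF z]] w(3) by auto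
      have "lookup ?k z = (if s \<cdot> z = w then 1 else 0) + (if dl s z \<and> r \<cdot> z = w then 1 else 0)"
        using 1 z by (auto simp: lookup_add lookup_T)
      then show ?thesis using 2 3 by auto
    next
      case False
      then have "z \<notin> keys (kap (bop s (C w)))" using coords_keys[OF unitri_C bop_MW] by blast
      moreover have "lookup ?k z = 0" using False tw by (auto simp: lookup_add lookup_T)
      ultimately show ?thesis by (simp add: in_keys_iff)
    qed
  qed
  then have "bop s (C w) = lin C ?k" using lin_coords[OF unitri_C bop_MW] by metis
  then show ?thesis by (simp add: linear_opD[OF linear_lin])
qed

text \<open>The coefficient at v^-1 of t_z in b_q c_y, computed once by the string rule and once by
  \<open>tau_bop\<close>. The latter involves p_{z,y} at v^-2, which is mu(pz,y) by
  \<open>pp_step\<close>.\<close>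

lemma mu_string:
  assumes pq: "p \<in> S" "q \<in> S" "\<not> commuting X p q" and y: "y \<in> Wc" "dl p y" "\<not> dl q y" "q \<cdot> y \<in> Wc"
    and z: "z \<in> Wc" "dl q z"
  shows "mu (p \<cdot> z) y + mu (q \<cdot> z) y = mu z (q \<cdot> y) + (if dl q (p \<cdot> y) then mu z (p \<cdot> y) else 0)"
proof -
  have nz: "\<not> dl p z" using Wc_descents[OF z(1) pq(1,2)] z(2) pq(3) by blast
  let ?S = "\<Sum>x\<in>{x\<in>keys (tau (C y)). q \<cdot> x \<notin> Wc}. pp x y * lookup (tau (t (q \<cdot> x))) z"
  have S: "lookup ?S (- 1) = 0" by (rule degl_lookup[OF complex_sum_degl(2)[OF pq(2) y(1,4)]]) simp
  have nc: "\<not> commuting X q p" using pq commuting_sym by metis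
  have "bop q (C y) = C (q \<cdot> y) + (if dl q (p \<cdot> y) then C (p \<cdot> y) else 0)"
    using bop_C_string[OF pq(2,1) nc y(1,2,3)] y(4) by simp
  then have "lookup (lookup (tau (bop q (C y))) z) (- 1) = mu z (q \<cdot> y) + (if dl q (p \<cdot> y) then mu z (p \<cdot> y) else 0)"
    by (simp add: linear_opD[OF linear_coords] lookup_add mu_def)
  moreover have "lookup (lookup (tau (bop q (C y))) z) (- 1) = lookup (pp z y) (- 2) + mu (q \<cdot> z) y"
    using tau_bop[OF pq(2) C_MW[OF y(1)] z(1)] S z(2) by (simp add: lookup_add lookup_v_pow_mult mu_def)
  ultimately show ?thesis using pp_step(2)[OF pq(1) y(1,2) z(1) nz] by simp
qed

end

subsection \<open>A fusion rule recursion\<close>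

text \<open>\<open>adm m i j k\<close> says that the simple modules of dimensions \<open>i, j, k\<close> satisfy the \<open>SU(2)\<close> fusion
  rule at level \<open>m - 2\<close>: the solution of the recursion below is governed by these multiplicities.\<close>

definition adm :: "enat \<Rightarrow> nat \<Rightarrow> nat \<Rightarrow> nat \<Rightarrow> bool" where
  "adm m i j k \<longleftrightarrow> i < j + k \<and> j < i + k \<and> k < i + j \<and> odd (i + j + k) \<and> (\<forall>M. m = enat M \<longrightarrow> i + j + k < 2 * M)"

text \<open>Associativity of fusion: both sides are the multiplicity of the module k when the
  two-dimensional module is multiplied into i, respectively into j.\<close>

lemma adm_step:
  fixes f :: "nat \<Rightarrow> 'm::ab_group_add"
  assumes "0 < i" "0 < j" "enat (Suc i) < m" "enat j < m"
  shows "(if adm m (Suc i) j k then x else 0) + (if adm m (i - 1) j k then x else 0)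
    = (if adm m i (j - 1) k then x else 0) + (if adm m i (Suc j) k then x else (0::'m))"
proof -
  have fin: "(adm (enat M) (Suc i) j k \<or> adm (enat M) (i - 1) j k) = (adm (enat M) i (j - 1) k \<or> adm (enat M) i (Suc j) k) \<and>
      (adm (enat M) (Suc i) j k \<and> adm (enat M) (i - 1) j k) = (adm (enat M) i (j - 1) k \<and> adm (enat M) i (Suc j) k)" if M: "Suc i < M" "j < M" for M
  proof (cases "even (i + j + k)")
    case True
    then obtain n where n: "i + j + k = 2 * n" by (elim evenE)
    \<comment> \<open>With n half the sum of i, j, k, the differences n - i, n - j, n - k turn the
      triangle inequalities into positivity of single variables, and the level condition into a
      bound on x + y + z.\<close>
    define x y z where "x = int n - int i" and "y = int n - int j" and "z = int n - int k"
    have e: "int i = y + z" "int j = x + z" "int k = x + y" using n by (auto simp: x_def y_def z_def)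
    have i: "int (Suc i) = y + z + 1" "int (i - 1) = y + z - 1" "int (j - 1) = x + z - 1" "int (Suc j) = x + z + 1"
      using e assms by auto
    have a: "adm (enat M) p q r \<longleftrightarrow> int p < int q + int r \<and> int q < int p + int r \<and> int r < int p + int q
        \<and> int p + int q + int r < 2 * int M" if "odd (p + q + r)" for p q r
      using that by (auto simp: adm_def)
    have o: "odd (Suc i + j + k)" "odd (i - 1 + j + k)" "odd (i + (j - 1) + k)" "odd (i + Suc j + k)"
      using True assms by (auto simp: even_diff_nat)
    have "adm (enat M) (Suc i) j k \<longleftrightarrow> 0 < x \<and> 0 \<le> y \<and> 0 \<le> z \<and> x + y + z < int M"
      "adm (enat M) (i - 1) j k \<longleftrightarrow> 0 \<le> x \<and> 0 < y \<and> 0 < z \<and> x + y + z \<le> int M"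
      "adm (enat M) i (j - 1) k \<longleftrightarrow> 0 < x \<and> 0 \<le> y \<and> 0 < z \<and> x + y + z \<le> int M"
      "adm (enat M) i (Suc j) k \<longleftrightarrow> 0 \<le> x \<and> 0 < y \<and> 0 \<le> z \<and> x + y + z < int M"
      unfolding o[THEN a] i e by linarith+
    moreover have "y + z + 1 < int M" "x + z < int M" "0 < y + z" "0 < x + z" using M assms e by linarith+
    ultimately show ?thesis by (smt (verit))
  next
    case False
    then have "even (Suc i + j + k)" "even (i - 1 + j + k)" "even (i + (j - 1) + k)" "even (i + Suc j + k)"
      using assms by (auto simp: even_diff_nat)
    then show ?thesis by (simp add: adm_def)
  qed
  have "(adm m (Suc i) j k \<or> adm m (i - 1) j k) = (adm m i (j - 1) k \<or> adm m i (Suc j) k) \<and>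
      (adm m (Suc i) j k \<and> adm m (i - 1) j k) = (adm m i (j - 1) k \<and> adm m i (Suc j) k)"
  proof (cases m)
    case (enat M)
    then show ?thesis using fin[of M] assms by simp
  next
    case infinity
    \<comment> \<open>Without truncation any finite level large enough for the four triples involved
      gives the same conditions.\<close>
    have "adm m x y k \<longleftrightarrow> adm (enat (i + j + k + 2)) x y k" if "x + y \<le> i + j + 1" for x y
      using that infinity by (auto simp: adm_def)
    then show ?thesis using fin[of "i + j + k + 2"] assms by simp
  qed
  then show ?thesis by auto
qed

text \<open>Every a i j is a sum of values a 1 k, each taken at most once, plus a boundary term. The
  predicate P and the group are kept abstract, because the recursion is used for integers, for
  Laurent polynomials and for elements of the algebra.\<close>

lemma fusion:
  fixes a :: "nat \<Rightarrow> nat \<Rightarrow> 'm::ab_group_add" and m :: enat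
  assumes rec: "\<And>i j. 0 < i \<Longrightarrow> 0 < j \<Longrightarrow> enat (Suc i) < m \<Longrightarrow> enat j < m \<Longrightarrow>
      a (Suc i) j + a (i - 1) j = a i (j - 1) + a i (Suc j)"
    and a0: "\<And>j. a 0 j = 0" "\<And>i. 1 < i \<Longrightarrow> enat i < m \<Longrightarrow> a i 0 = 0"
    and am: "\<And>i j. m = enat j \<Longrightarrow> 0 < i \<Longrightarrow> enat i < m \<Longrightarrow> a i j = 0"
    and P: "P 0" "\<And>x y. P x \<Longrightarrow> P y \<Longrightarrow> P (x + y)" "\<And>j. enat j < m \<Longrightarrow> P (a 1 j)"
    and i: "0 < i" "enat i < m" and j: "enat j < m"
  shows "P (a i j)"
proof -
  \<comment> \<open>The value a 1 0 is the one boundary value that need not vanish. Alone it would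
    spread along the diagonal i = j + 1, which satisfies the recursion; subtracting it makes the
    whole boundary j = 0 vanish.\<close>
  define b where "b i j = a i j - (if i = Suc j then a 1 0 else 0)" for i j
  define K where "K = i + j"
  have b0: "b 0 j = 0" "b 1 0 = 0" for j by (simp_all add: b_def a0)
  have bi: "b i 0 = 0" if "enat i < m" for i
    using that a0(2)[of i] b0(1)[of 0] b0(2) by (cases "i = 0"; cases "i = 1") (auto simp: b_def)
  have bm: "b i j = 0" if "m = enat j" "0 < i" "enat i < m" for i j
    using am[OF that] that by (auto simp: b_def)
  have brec: "b (Suc i) j = b i (j - 1) + b i (Suc j) - b (i - 1) j"
    if "0 < i" "0 < j" "enat (Suc i) < m" "enat j < m" for i j
  proof -
    have "i - 1 = Suc j \<longleftrightarrow> i = Suc (Suc j)" "i = Suc (j - 1) \<longleftrightarrow> i = j" using that by auto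
    moreover have "a (Suc i) j = a i (j - 1) + a i (Suc j) - a (i - 1) j"
      using rec[OF that] by (simp add: algebra_simps)
    ultimately show ?thesis by (simp add: b_def algebra_simps)
  qed
  have sol: "b i j = (\<Sum>k<K. if adm m i j k then b 1 k else 0)" if "i + j \<le> K" "enat i < m" "enat j \<le> m" for i j
    using that
  proof (induction i arbitrary: j rule: less_induct)
    case (less i)
    consider "i = 0" | "j = 0" | "m = enat j" "0 < i" | "i = 1" "0 < j" "enat j < m"
      | i' where "i = Suc i'" "0 < i'" "0 < j" "enat j < m"
      using less.prems(3) by (cases i; cases "i = 1") (auto simp: order_le_less)
    then show ?case
    proof cases
      case 1
      then have "\<not> adm m i j k" for k by (auto simp: adm_def)
      then show ?thesis using 1 b0 by simp
    next
      case 2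
      then have "\<not> adm m i j k" for k by (auto simp: adm_def)
      then show ?thesis using 2 bi less.prems by simp
    next
      case 3
      then have "\<not> adm m i j k" for k by (auto simp: adm_def)
      then show ?thesis using 3 bm less.prems by simp
    next
      case 4
      have "adm m i j k \<longleftrightarrow> k = j" for k using 4 by (auto simp: adm_def)
      then show ?thesis using 4 less.prems by simp
    next
      case 5
      have lt: "enat i' < m" "enat (i' - 1) < m" "enat (j - 1) \<le> m" "enat (Suc j) \<le> m"
        using less.prems 5 by (cases m; simp)+
      have "b i j = b i' (j - 1) + b i' (Suc j) - b (i' - 1) j" using brec[of i' j] 5 less.prems by simp
      also have "\<dots> = (\<Sum>k<K. (if adm m i' (j - 1) k then b 1 k else 0) + (if adm m i' (Suc j) k then b 1 k else 0)
          - (if adm m (i' - 1) j k then b 1 k else 0))"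
        unfolding sum_subtractf sum.distrib
        using less.IH[of i' "j - 1"] less.IH[of i' "Suc j"] less.IH[of "i' - 1" j] less.prems 5 lt by simp
      also have "\<dots> = (\<Sum>k<K. if adm m i j k then b 1 k else 0)"
      proof (rule sum.cong[OF refl])
        fix k
        have "(if adm m i j k then b 1 k else 0) + (if adm m (i' - 1) j k then b 1 k else 0) =
          (if adm m i' (j - 1) k then b 1 k else 0) + (if adm m i' (Suc j) k then b 1 k else 0)"
          using adm_step[of i' j m k "b 1 k"] 5 less.prems by simp
        then show "(if adm m i' (j - 1) k then b 1 k else 0) + (if adm m i' (Suc j) k then b 1 k else 0)
          - (if adm m (i' - 1) j k then b 1 k else 0) = (if adm m i j k then b 1 k else 0)"
          by (simp add: algebra_simps)
      qed
      finally show ?thesis .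
    qed
  qed
  have "P (\<Sum>k<n. if adm m i j k then b 1 k else 0)" for n
  proof (induction n)
    case (Suc n)
    have "P (if adm m i j n then b 1 n else 0)"
    proof (cases "adm m i j n")
      case True
      then have "0 < n" "enat n < m" using i j by (cases m; auto simp: adm_def)+
      then show ?thesis using True P(3)[of n] by (simp add: b_def)
    qed (simp add: P(1))
    then show ?case using Suc P(2) by simp
  qed (simp add: P(1))
  then have "P (b i j)" using sol[of i j] i j by (simp add: K_def order_less_imp_le)
  moreover have "a i j = b i j + (if i = Suc j then a 1 0 else 0)" by (simp add: b_def)
  moreover have "P (a 1 0)" using P(3)[of 0] i by (cases m) auto
  ultimately show ?thesis using P(1,2) by simp
qed

lemma tp_pred: "0 < i \<Longrightarrow> tp a b (i - 1) = tp a b (Suc i)"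
  by (auto simp: tp_def)

lemma tp_shift: assumes "a \<noteq> b" "{c, d} = {a, b}" shows "tp c d (Suc j) = tp a b i \<longleftrightarrow> tp c d j = tp a b (Suc i)"
proof -
  have "c = a \<and> d = b \<or> c = b \<and> d = a" using assms by (metis doubleton_eq_iff)
  then show ?thesis using assms(1) by (elim disjE conjE; cases "odd i"; cases "odd j") (simp_all add: tp_def)
qed

context cox
begin

subsection \<open>Star reducibility\<close>

text \<open>Keeps only that y sits beyond the bottom of a left string; the induction goes directly
  to index 1 of that string.\<close>

definition star_top :: "'s list set \<Rightarrow> bool" where
  "star_top y \<longleftrightarrow> (\<exists>a b u k. base a b u \<and> 2 \<le> k \<and> enat k < bond X a b \<and> y = ystr a b k u)"

lemma left_star_reducible_top: assumes "left_star_reducible X y x" shows "star_top y"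
proof -
  obtain a b u j k where u: "a \<in> S" "b \<in> S" "u \<in> W" "\<not> commuting X a b" "len (a \<cdot> u) > len u" "len (b \<cdot> u) > len u"
    and j: "1 \<le> j" "enat j < bond X a b" "x = ystr a b j u" and k: "enat k < bond X a b" "y = ystr a b k u"
    and l: "len y = len x + 1"
    using assms unfolding left_star_reducible_def left_string_def ystr_def by blast
  have b: "base a b u" using u by (simp add: base_def dl_def)
  have "len x = j + len u" "len y = k + len u" using len_ystr[OF b] j k by simp_all
  then have "2 \<le> k" using l j(1) by simp
  then show ?thesis using b k unfolding star_top_def by blast
qed

lemma right_star_reducible_top: assumes "right_star_reducible X y x" shows "star_top (iv y)"
proof -
  obtain a b u j k where u: "a \<in> S" "b \<in> S" "u \<in> W" "\<not> commuting X a b" "len (u \<odot> gen X a) > len u" "len (u \<odot> gen X b) > len u"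
    and j: "1 \<le> j" "enat j < bond X a b" "x = u \<odot> ev (rev (alt a b j))"
    and k: "enat k < bond X a b" "y = u \<odot> ev (rev (alt a b k))"
    and l: "len y = len x + 1"
    using assms unfolding right_star_reducible_def right_string_def by blast
  have b: "base a b (iv u)" using u dr_eq(2)[of a u] dr_eq(2)[of b u] by (simp add: base_def dl_def)
  have r: "set (rev (alt a b n)) \<subseteq> S" for n using u by simp
  have i: "iv (u \<odot> ev (rev (alt a b n))) = ystr a b n (iv u)" for n
    using u(3) ev_in_W[OF r] iv_ev[OF r] by (simp add: G.inv_mult_group ystr_def)
  have "len (u \<odot> ev (rev (alt a b n))) = len (ystr a b n (iv u))" for n
    using len_iv[of "u \<odot> ev (rev (alt a b n))"] ev_in_W[OF r] u(3) i by simp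
  then have "len x = j + len u" "len y = k + len u" using len_ystr[OF b] j k u(3) by simp_all
  then have "2 \<le> k" using l j(1) by simp
  then show ?thesis using b k i unfolding star_top_def by blast
qed

text \<open>Of the whole reduction sequence only the step leaving y matters: it is absent, a left
  reduction, or a right one.\<close>

lemma property_F_cases:
  assumes "property_F X" "y \<in> Wc" obtains "commuting_product X y" | "star_top y" | "star_top (iv y)"
proof -
  obtain x where x: "commuting_product X x" "star_reducible X y x" using assms unfolding property_F_def by blast
  from x(2) show thesis unfolding star_reducible_def
  proof (cases rule: converse_rtranclpE)
    case base
    then show ?thesis using that(1) x(1) by simp
  next
    case (step y')
    then show ?thesis using left_star_reducible_top right_star_reducible_top that(2,3) by blast
  qed
qed

lemma commuting_word_descents:
  assumes "set x \<subseteq> S" "distinct x" "\<And>a. a \<in> set x \<Longrightarrow> commuting X s a" "s \<in> S"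
  shows "dl s (ev x) \<longleftrightarrow> s \<in> set x"
  using assms
proof (induction x)
  case Nil
  then show ?case using len_one by (simp add: dl_def)
next
  case (Cons a x)
  then have IH: "dl s (ev x) \<longleftrightarrow> s \<in> set x" and a: "a \<in> S" "ev x \<in> W" "ev (a # x) = a \<cdot> ev x"
    by (simp_all add: lm_ev)
  show ?case
  proof (cases "a = s")
    case True
    then show ?thesis using IH a dl_lm[OF a(1,2)] Cons.prems by simp
  next
    case False
    have "commuting X a s" using Cons.prems(3)[of a] commuting_sym by simp
    then show ?thesis using IH False dl_commute[OF a(1) Cons.prems(4) False _ a(2)] a(3) by simp
  qed
qed

lemma len_ge_descents:
  assumes "z \<in> W" "distinct x" "set x \<subseteq> S" "\<And>a b. a \<in> set x \<Longrightarrow> b \<in> set x \<Longrightarrow> commuting X a b" "\<And>a. a \<in> set x \<Longrightarrow> dl a z"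
  shows "length x \<le> len z"
  using assms
proof (induction x arbitrary: z)
  case (Cons a x)
  then have a: "a \<in> S" "dl a z" by simp_all
  have "length x \<le> len (a \<cdot> z)"
  proof (rule Cons.IH)
    fix b assume b: "b \<in> set x"
    then have "a \<noteq> b" "b \<in> S" "commuting X a b" "dl b z" using Cons.prems by auto
    then show "dl b (a \<cdot> z)" using dl_commute a(1) Cons.prems(1) by blast
  qed (use Cons.prems a in auto)
  then show ?case using dl_len[OF a(1) Cons.prems(1) a(2)] by simp
qed simp

end

section \<open>Nonnegativity of mu\<close>

context cox_W
begin

text \<open>If every letter of the product is a descent of z, then z is at least as long as the
  product and mu vanishes. Otherwise \<open>pp_step\<close> for a missing letter allows only 0 and
  1.\<close>

lemma mu_commuting_product:
  assumes x: "set x \<subseteq> S" "distinct x" "\<And>a b. a \<in> set x \<Longrightarrow> b \<in> set x \<Longrightarrow> commuting X a b" "ev x \<in> Wc" and z: "z \<in> Wc"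
  shows "0 \<le> mu z (ev x)" "mu z (ev x) \<noteq> 0 \<Longrightarrow> \<exists>a\<in>set x. z = a \<cdot> ev x"
proof -
  have "mu z (ev x) = 0 \<or> mu z (ev x) = 1 \<and> (\<exists>a\<in>set x. z = a \<cdot> ev x)"
  proof (cases "\<forall>a\<in>set x. dl a z")
    case True
    then have "len (ev x) \<le> len z" using len_ge_descents[of z x] len_le[of x] x z by (meson Wc_W le_trans)
    then show ?thesis using mu_zero x z by blast
  next
    case False
    then obtain a where a: "a \<in> set x" "\<not> dl a z" "a \<in> S" using x by blast
    have "dl a (ev x)" using commuting_word_descents[OF x(1,2), of a] x(3) a by blast
    then have "mu z (ev x) = (if a \<cdot> z = ev x then 1 else 0)" using pp_step(1)[OF a(3) x(4) _ z a(2)] by blast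
    moreover have "z = a \<cdot> ev x" if "a \<cdot> z = ev x" using that lm_lm[OF a(3) Wc_W[OF z]] by simp
    ultimately show ?thesis using a(1) by auto
  qed
  then show "0 \<le> mu z (ev x)" "mu z (ev x) \<noteq> 0 \<Longrightarrow> \<exists>a\<in>set x. z = a \<cdot> ev x" by auto
qed

text \<open>If the leading letter of y_k is not a descent of z, \<open>pp_step\<close> settles the
  claim. Otherwise z lies on a string z_j of the same pair, and \<open>mu_string\<close> becomes the
  fusion recursion for mu(z_j, y_i).\<close>

lemma mu_star_top:
  assumes b: "base a b u" and k: "0 < k" "enat k < bond X a b" "ystr a b k u \<in> Wc"
    and IH: "\<And>z. z \<in> Wc \<Longrightarrow> 0 \<le> mu z (ystr a b 1 u)" and z: "z \<in> Wc"
  shows "0 \<le> mu z (ystr a b k u)"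
proof -
  let ?y = "\<lambda>i. ystr a b i u" and ?p = "tp a b k" and ?q = "tp b a k"
  have ab: "a \<in> S" "b \<in> S" "\<not> commuting X a b" using b by (auto simp: base_def)
  have yc: "?y i \<in> Wc" if "enat i < bond X a b" for i using ystr_Wc[OF b k(2,1,3)] that .
  have d: "dl (tp a b i) (?y i)" if "enat i < bond X a b" "0 < i" for i using ystr_descents(1)[OF b] that by blast
  have nd: "\<not> dl (tp a b (Suc i)) (?y i)" if "enat i < bond X a b" for i using ystr_descents(2)[OF b] that by blast
  have pq: "?p \<in> S" "?q \<in> S" "\<not> commuting X ?p ?q" "{?p, ?q} = {a, b}" "bond X ?p ?q = bond X a b"
    using ab commuting_sym bond_sym tp_cases[of a b k] by auto
  show ?thesis
  proof (cases "dl ?p z")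
    case False
    have "mu z (?y k) = (if ?p \<cdot> z = ?y k then 1 else 0)" using pp_step(1)[OF pq(1) yc[OF k(2)] d[OF k(2,1)] z False] .
    then show ?thesis by simp
  next
    case True
    obtain c d' j x where s: "{c, d'} = {?p, ?q}" "base c d' x" "0 < j" "enat j < bond X ?p ?q" "z = ystr c d' j x" "tp c d' j = ?p"
      using string_of[OF z pq(1,2,3) True] by metis
    let ?z = "\<lambda>i. ystr c d' i x" and ?m = "bond X a b"
    have bm: "bond X c d' = ?m" using s(1) pq(4) bond_sym ab by (metis doubleton_eq_iff)
    have zc: "?z i \<in> Wc" if "enat i < ?m" for i
      using ystr_Wc[OF s(2), of j i] s(3,4,5) z bm pq(5) that by simp
    have tps: "tp c d' i = tp a b n \<or> tp c d' i = tp b a n" for i n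
      using s(1) pq(4) tp_cases[of c d' i] tp_cases[of a b n] by (metis doubleton_eq_iff)
    \<comment> \<open>The recursion connects only positions with equal leading letters. Masking the
      others by 0 is consistent, as both sides of a masked instance vanish, and lets the recursion
      hold for all indices.\<close>
    define A where "A i j = (if 0 < i \<and> tp c d' j = tp a b i then mu (?z j) (?y i) else 0)" for i j
    have "0 \<le> A k j"
    proof (rule fusion[where P = "\<lambda>x. 0 \<le> x" and m = ?m and a = A])
      fix i j assume i: "0 < i" and j: "0 < j" and im: "enat (Suc i) < ?m" and jm: "enat j < ?m"
      have im': "enat i < ?m" "enat (i - 1) < ?m" using im by (cases ?m; simp)+
      obtain i' where i': "i = Suc i'" using i by (cases i) auto
      obtain j' where j': "j = Suc j'" using j by (cases j) auto
      have e: "tp c d' (j - 1) = tp c d' (Suc j)" "tp a b (i - 1) = tp a b (Suc i)"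
        by (rule tp_pred[OF j], rule tp_pred[OF i])
      show "A (Suc i) j + A (i - 1) j = A i (j - 1) + A i (Suc j)"
      proof (cases "tp c d' j = tp a b (Suc i)")
        case True
        have t: "tp a b i = tp c d' (Suc j)"
          using True tp_shift[OF baseD(4)[OF b], of c d' j i] s(1) pq(4) by simp
        have nc: "\<not> commuting X (tp a b i) (tp a b (Suc i))" using ab commuting_sym by (auto simp: tp_def)
        have y1: "tp a b (Suc i) \<cdot> ?y i = ?y (Suc i)" "tp a b i \<cdot> ?y i = ?y (i - 1)"
          "tp a b i \<cdot> ?z j = ?z (Suc j)" "tp a b (Suc i) \<cdot> ?z j = ?z (j - 1)"
          using ystr_Suc[OF b, of i] tp_ystr[OF b, of i'] ystr_Suc[OF s(2), of j] tp_ystr[OF s(2), of j'] t True i' j' by simp_all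
        have dd: "dl (tp a b (Suc i)) (?y (i - 1)) \<longleftrightarrow> 1 < i"
        proof (cases "i = 1")
          case True
          then show ?thesis using b by (auto simp: base_def tp_def)
        next
          case False
          then have "tp a b (Suc i) = tp a b (i - 1)" using i by (auto simp: tp_def)
          then show ?thesis using d[OF im'(2)] i False by simp
        qed
        have "mu (?z (Suc j)) (?y i) + mu (?z (j - 1)) (?y i) = mu (?z j) (?y (Suc i)) + (if 1 < i then mu (?z j) (?y (i - 1)) else 0)"
          using mu_string[OF _ _ nc yc[OF im'(1)] d[OF im'(1) i] nd[OF im'(1)], of "?z j"]
            baseD(6)[OF b] y1 yc[OF im] zc[OF jm] ystr_descents(1)[OF s(2), of j] bm jm j True dd by simp
        then show ?thesis unfolding A_def e t True using i by simp
      next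
        case False
        then have "tp c d' (Suc j) \<noteq> tp a b i" using tp_shift[OF baseD(4)[OF b], of c d' j i] s(1) pq(4) by simp
        then show ?thesis using False unfolding A_def e by simp
      qed
    next
      fix i :: nat assume i: "1 < i" "enat i < ?m"
      \<comment> \<open>The base z_0 has neither letter as a descent, so mu can be nonzero only if
        y_i is a letter times z_0, which forces i = 1. This is the exceptional value A 1 0 that
        \<open>fusion\<close> admits.\<close>
      have "mu (?z 0) (?y i) = 0" if t: "tp c d' 0 = tp a b i"
      proof -
        have "tp a b i \<in> {c, d'}" using t by (simp add: tp_def)
        then have "\<not> dl (tp a b i) (?z 0)" using s(2) by (auto simp: base_def)
        moreover have "?z 0 \<in> Wc" by (rule zc) (use i in \<open>cases ?m; simp\<close>)
        ultimately have "mu (?z 0) (?y i) = (if tp a b i \<cdot> ?z 0 = ?y i then 1 else 0)"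
          using pp_step(1)[OF _ yc[OF i(2)] d[OF i(2)]] baseD(6)[OF b] i by simp
        moreover have "tp a b i \<cdot> ?z 0 \<noteq> ?y i"
        proof
          assume e: "tp a b i \<cdot> ?z 0 = ?y i"
          obtain i' where i': "i = Suc i'" "0 < i'" using i by (cases i) auto
          have "?z 0 = ?y i'" using e lm_lm[of "tp a b i" "?z 0"] tp_ystr[OF b, of i'] i' baseD(6)[OF b] baseD(3)[OF s(2)] s(2) by simp
          moreover have "dl (tp a b i') (?y i')" by (rule d) (use i i' in \<open>cases ?m; simp\<close>)+
          moreover have "tp a b i' \<in> {c, d'}" using tps[of i' i'] s(1) pq(4) by (auto simp: tp_def)
          ultimately show False using s(2) by (auto simp: base_def)
        qed
        ultimately show ?thesis by simp
      qed
      then show "A i 0 = 0" by (simp add: A_def)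
    next
      fix i j assume j: "?m = enat j" and i: "0 < i" "enat i < ?m"
      then show "A i j = 0" using ystr_top_notin_Wc[OF s(2), of j] bm mu_zero[OF yc[OF i(2)]] by (simp add: A_def)
    next
      fix j assume "enat j < ?m"
      then show "0 \<le> A 1 j" using IH[OF zc] by (simp add: A_def)
    qed (use k s(4) pq(5) in \<open>auto simp: A_def\<close>)
    then show ?thesis using s(5,6) k(1) by (simp add: A_def)
  qed
qed

end

locale cox_FW = cox_W +
  assumes property_F: "property_F X"
begin

lemma mu_nonneg: "y \<in> Wc \<Longrightarrow> z \<in> Wc \<Longrightarrow> 0 \<le> mu z y"
proof (induction "len y" arbitrary: y z rule: less_induct)
  case less
  have top: "0 \<le> mu z' y'" if y': "star_top y'" "y' \<in> Wc" "len y' = len y" "z' \<in> Wc" for y' z'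
  proof -
    obtain a b u k where b: "base a b u" "2 \<le> k" "enat k < bond X a b" "y' = ystr a b k u"
      using y'(1) unfolding star_top_def by blast
    have m: "enat 1 < bond X a b" using b(2,3) by (cases "bond X a b") auto
    have "len (ystr a b 1 u) < len y" using len_ystr[OF b(1), of 1] len_ystr[OF b(1), of k] b m y'(3) by simp
    moreover have "ystr a b 1 u \<in> Wc" using ystr_Wc[OF b(1,3) _ _ m] b(2,4) y'(2) by simp
    ultimately show ?thesis using mu_star_top[OF b(1) _ b(3) _ less.hyps y'(4)] b(2,4) y'(2) by auto
  qed
  from property_F less.prems(1) show ?case
  proof (cases rule: property_F_cases)
    case 1
    then obtain x where "set x \<subseteq> S" "distinct x" "\<forall>s\<in>set x. \<forall>r\<in>set x. commuting X s r" "y = ev x"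
      unfolding commuting_product_def by auto
    then show ?thesis using mu_commuting_product(1)[of x z] less.prems by blast
  next
    case 2
    then show ?thesis using top less.prems by blast
  next
    case 3
    have "0 \<le> mu (iv z) (iv y)" by (rule top) (use 3 iv_Wc less.prems in auto)
    then show ?thesis using mu_io[OF less.prems(1)] less.prems(2) by simp
  qed
qed

end

subsection \<open>Polynomials in \<open>\<delta>\<close> with nonnegative coefficients\<close>

lemma nonneg_deltaI: "poly (map_poly of_nat (p :: nat poly)) delta \<in> nonneg_delta"
  by (auto simp: nonneg_delta_def)

lemma nonneg_deltaE: assumes "g \<in> nonneg_delta" obtains p :: "nat poly" where "g = poly (map_poly of_nat p) delta"
  using assms by (auto simp: nonneg_delta_def)

lemma nonneg_delta_zero [simp]: "0 \<in> nonneg_delta"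
  using nonneg_deltaI[of 0] by simp

lemma nonneg_delta_one [simp]: "1 \<in> nonneg_delta"
  using nonneg_deltaI[of 1] by simp

lemma nonneg_delta_add: assumes "f \<in> nonneg_delta" "g \<in> nonneg_delta" shows "f + g \<in> nonneg_delta"
proof -
  obtain p q :: "nat poly" where "f = poly (map_poly of_nat p) delta" "g = poly (map_poly of_nat q) delta"
    using assms by (metis nonneg_deltaE)
  moreover have "map_poly of_nat (p + q) = (map_poly of_nat p + map_poly of_nat q :: laurent poly)"
    by (rule poly_eqI) (simp add: coeff_map_poly)
  ultimately show ?thesis using nonneg_deltaI[of "p + q"] by simp
qed

lemma poly_of_nat_pCons: "poly (map_poly of_nat (pCons c p)) delta = of_nat c + delta * poly (map_poly of_nat p) delta"
  by (cases "c = 0 \<and> p = 0") (auto simp: map_poly_pCons)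

lemma nonneg_delta_delta_mult: "g \<in> nonneg_delta \<Longrightarrow> delta * g \<in> nonneg_delta"
  using nonneg_deltaI[of "pCons 0 p" for p] poly_of_nat_pCons[of 0] by (auto elim!: nonneg_deltaE)

lemma nonneg_delta_of_nat_mult: "g \<in> nonneg_delta \<Longrightarrow> of_nat n * g \<in> nonneg_delta"
  by (induction n) (simp_all add: distrib_right nonneg_delta_add)

lemma nonneg_delta_mult: assumes "f \<in> nonneg_delta" "g \<in> nonneg_delta" shows "f * g \<in> nonneg_delta"
proof -
  have "poly (map_poly of_nat p) delta * g \<in> nonneg_delta" for p :: "nat poly"
  proof (induction p)
    case (pCons c p)
    then show ?case using assms(2)
      by (simp add: poly_of_nat_pCons distrib_right mult.assoc nonneg_delta_add nonneg_delta_of_nat_mult nonneg_delta_delta_mult)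
  qed simp
  then show ?thesis using assms(1) by (auto elim!: nonneg_deltaE)
qed

lemma nonneg_delta_of_int_mult: "0 \<le> n \<Longrightarrow> g \<in> nonneg_delta \<Longrightarrow> of_int n * g \<in> nonneg_delta"
  using nonneg_delta_of_nat_mult[of g "nat n"] by simp

lemma nonneg_delta_sum: "(\<And>i. i \<in> I \<Longrightarrow> f i \<in> nonneg_delta) \<Longrightarrow> sum f I \<in> nonneg_delta"
  by (induction I rule: infinite_finite_induct) (auto intro: nonneg_delta_add)

text \<open>\<open>\<delta>f\<close> cannot be a nonzero constant: its extreme coefficients are those of \<open>f\<close>, shifted
  outwards by one.\<close>

lemma delta_mult_constant: assumes "delta * f = of_int c" shows "f = 0"
proof (rule ccontr)
  assume "f \<noteq> 0"
  then have ne: "keys f \<noteq> {}" by simp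
  let ?M = "Max (keys f)" and ?N = "Min (keys f)"
  have M: "?M \<in> keys f" and N: "?N \<in> keys f" using Max_in[OF _ ne] Min_in[OF _ ne] by simp_all
  have "\<not> ?M + 2 \<le> ?M" "\<not> ?N \<le> ?N - 2" by simp_all
  then have M': "?M + 2 \<notin> keys f" and N': "?N - 2 \<notin> keys f"
    using Max_ge[OF finite_keys] Min_le[OF finite_keys] by metis+
  have "lookup (delta * f) (?M + 1) \<noteq> 0" "lookup (delta * f) (?N - 1) \<noteq> 0"
    using M N M' N' unfolding lookup_delta_mult by (simp_all add: in_keys_iff algebra_simps)
  then have "?M + 1 = 0" "?N - 1 = 0" unfolding assms lookup_of_int by presburger+
  moreover have "?N \<le> ?M" using Min_le[of "keys f" ?M] M by simp
  ultimately show False by simp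
qed

text \<open>Write delta g = c + delta q(delta). Then delta (g - q(delta)) is the constant c, so g =
  q(delta) by \<open>delta_mult_constant\<close>.\<close>

lemma nonneg_delta_cancel: assumes "delta * g \<in> nonneg_delta" shows "g \<in> nonneg_delta"
proof -
  obtain p :: "nat poly" where p: "delta * g = poly (map_poly of_nat p) delta" using assms by (rule nonneg_deltaE)
  obtain c q where q: "p = pCons c q" by (cases p)
  have "delta * (g - poly (map_poly of_nat q) delta) = of_int (int c)"
    using p unfolding q poly_of_nat_pCons by (simp add: right_diff_distrib)
  from delta_mult_constant[OF this] have "g = poly (map_poly of_nat q) delta" by simp
  then show ?thesis using nonneg_deltaI[of q] by simp
qed

section \<open>Positivity in the canonical basis\<close>

context cox
begin

definition positive :: "'s hecke_elt \<Rightarrow> bool" where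
  "positive m \<longleftrightarrow> (\<forall>z. lookup (kap m) z \<in> nonneg_delta)"

lemma positive_zero: "positive 0"
  by (simp add: positive_def linear_opD(3)[OF linear_coords])

lemma positive_add: "positive m \<Longrightarrow> positive n \<Longrightarrow> positive (m + n)"
  by (simp add: positive_def linear_opD(1)[OF linear_coords] lookup_add nonneg_delta_add)

lemma positive_sum: "(\<And>i. i \<in> I \<Longrightarrow> positive (f i)) \<Longrightarrow> positive (sum f I)"
  by (induction I rule: infinite_finite_induct) (auto intro: positive_add positive_zero)

lemma positive_scale_delta: "positive (scale delta m) \<longleftrightarrow> positive m"
  unfolding positive_def linear_opD(2)[OF linear_coords] lookup_scale
  using nonneg_delta_cancel nonneg_delta_delta_mult by blast

lemma positive_scale_int: "0 \<le> n \<Longrightarrow> positive m \<Longrightarrow> positive (scale (of_int n) m)"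
  by (simp add: positive_def linear_opD(2)[OF linear_coords] nonneg_delta_of_int_mult)

lemma kap_lin: "m \<in> MW \<Longrightarrow> m = (\<Sum>w\<in>keys (kap m). scale (lookup (kap m) w) (C w))"
  using lin_coords[OF unitri_C, of m] by (simp add: lin_def)

text \<open>The anti-automorphism fixes b_r, so b_r at the right end of the first factor may be
  moved to the left end of the second.\<close>

lemma star_io_bop:
  assumes r: "r \<in> S" and m: "m \<in> MW" and n: "n \<in> MW" shows "star (io (bop r m)) n = star (io m) (bop r n)"
proof -
  let ?g = "bop r e1"
  have e: "e1 \<in> MW" by simp
  have e': "?g \<in> MW" by (rule bop_MW)
  have b: "bop r h = star ?g h" if "h \<in> MW" for h using bop_star[OF r e that] star_one_left[of h] by simp
  have g: "io ?g = ?g"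
  proof -
    have "gen X r \<in> Wc" using short_Wc[of "gen X r"] len_gen[OF r] gen_W[OF r] by simp
    moreover have "\<not> dl r (ev [])" by (simp add: dl_def)
    moreover have "r \<cdot> ev [] = gen X r" using r by simp
    ultimately have "?g = T (gen X r)" using bt_up[OF r one_Wc] by simp
    then show ?thesis using io_T[OF gen_W[OF r]] iv_gen[OF r] by simp
  qed
  have "io (bop r m) = star (io m) ?g" using b[OF m] io_star[OF e' m] g by simp
  then show ?thesis using star_assoc[OF io_MW[OF m] e' n] b[OF n] by simp
qed

lemma C_one: "C (ev []) = e1"
  using unitri_C one_Wc unfolding unitri_def by fastforce

end

context cox_W
begin

lemma kap_bop_C_support: assumes "s \<in> S" "w \<in> Wc" "\<not> dl s z" shows "lookup (kap (bop s (C w))) z = 0"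
proof (cases "dl s w")
  case True
  then have "z \<noteq> w" using assms(3) by blast
  then show ?thesis
    using bop_C_dl[OF assms(1,2) True] coords_basis[OF unitri_C assms(2)] by (simp add: linear_opD(2)[OF linear_coords] lookup_T)
next
  case False
  show ?thesis
  proof (cases "z \<in> Wc")
    case True
    then show ?thesis using kap_bop_up[OF assms(1,2) False] assms(3) by simp
  next
    case False
    then have "z \<notin> keys (kap (bop s (C w)))" using coords_keys[OF unitri_C bop_MW] by blast
    then show ?thesis by (simp add: in_keys_iff)
  qed
qed

lemma lookup_kap_bop:
  assumes "m \<in> MW"
  shows "lookup (kap (bop s m)) z = (\<Sum>w\<in>keys (kap m). lookup (kap m) w * lookup (kap (bop s (C w))) z)"
proof -
  have "kap (bop s m) = kap (bop s (\<Sum>w\<in>keys (kap m). scale (lookup (kap m) w) (C w)))" using kap_lin[OF assms] by simp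
  then show ?thesis
    by (simp add: linear_sum[OF linear_bop] linear_sum[OF linear_coords] linear_opD(2)[OF linear_bop] linear_opD(2)[OF linear_coords] lookup_sum)
qed

lemma kap_support:
  assumes "s \<in> S" "m \<in> MW" "bop s m = scale delta m" "\<not> dl s z" shows "lookup (kap m) z = 0"
proof -
  have k: "keys (kap m) \<subseteq> Wc" using coords_keys[OF unitri_C assms(2)] .
  have "lookup (kap (bop s m)) z = 0"
    unfolding lookup_kap_bop[OF assms(2)] by (rule sum.neutral) (use k kap_bop_C_support assms in auto)
  then show ?thesis using assms(3) by (simp add: linear_opD(2)[OF linear_coords])
qed

text \<open>\<open>bop_C_string\<close> read by columns. All c_w occurring in m have the descent p,
  hence not r, so the string rule applies to each, and c_z arises only from w = rz and w =
  pz.\<close>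

lemma kap_bop_string:
  assumes r: "r \<in> S" "p \<in> S" "\<not> commuting X r p" and m: "m \<in> MW" "bop p m = scale delta m" and z: "z \<in> Wc" "dl r z"
  shows "lookup (kap (bop r m)) z = lookup (kap m) (r \<cdot> z) + lookup (kap m) (p \<cdot> z)"
proof -
  let ?l = "kap m"
  have k: "keys ?l \<subseteq> Wc" using coords_keys[OF unitri_C m(1)] .
  have zW: "z \<in> W" using z by blast
  have w: "lookup (kap (bop r (C w))) z = (if w = r \<cdot> z then 1 else 0) + (if w = p \<cdot> z then 1 else 0)" if "w \<in> keys ?l" for w
  proof -
    have wc: "w \<in> Wc" "w \<in> W" using that k by blast+
    have d: "dl p w" using kap_support[OF r(2) m, of w] that by (auto simp: in_keys_iff)
    have nd: "\<not> dl r w" using Wc_descents[OF wc(1) r(1,2)] d r(3) by blast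
    have e: "z = r \<cdot> w \<longleftrightarrow> w = r \<cdot> z" "z = p \<cdot> w \<longleftrightarrow> w = p \<cdot> z" using lm_lm r(1,2) wc(2) zW by metis+
    have pw: "p \<cdot> w \<in> Wc" using Wc_lm r(2) wc(1) d by blast
    have "kap (bop r (C w)) = kap (if r \<cdot> w \<in> Wc then C (r \<cdot> w) else 0) + kap (if dl r (p \<cdot> w) then C (p \<cdot> w) else 0)"
      unfolding bop_C_string[OF r wc(1) d nd] by (rule linear_opD(1)[OF linear_coords])
    also have "kap (if r \<cdot> w \<in> Wc then C (r \<cdot> w) else 0) = (if r \<cdot> w \<in> Wc then T (r \<cdot> w) else 0)"
      using coords_basis[OF unitri_C] linear_opD(3)[OF linear_coords] by simp
    also have "kap (if dl r (p \<cdot> w) then C (p \<cdot> w) else 0) = (if dl r (p \<cdot> w) then T (p \<cdot> w) else 0)"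
      using coords_basis[OF unitri_C pw] linear_opD(3)[OF linear_coords] by simp
    finally have "lookup (kap (bop r (C w))) z
        = (if r \<cdot> w \<in> Wc \<and> z = r \<cdot> w then 1 else 0) + (if dl r (p \<cdot> w) \<and> z = p \<cdot> w then 1 else 0)"
      by (simp add: lookup_add lookup_T)
    moreover have "r \<cdot> w \<in> Wc \<and> z = r \<cdot> w \<longleftrightarrow> w = r \<cdot> z" "dl r (p \<cdot> w) \<and> z = p \<cdot> w \<longleftrightarrow> w = p \<cdot> z"
      using e z by metis+
    ultimately show ?thesis by simp
  qed
  have s: "(\<Sum>w\<in>keys ?l. lookup ?l w * (if w = y then 1 else 0)) = lookup ?l y" for y
    by (simp add: if_distrib[of "(*) _"] in_keys_iff cong: if_cong)
  have "lookup (kap (bop r m)) z = (\<Sum>w\<in>keys ?l. lookup ?l w * (if w = r \<cdot> z then 1 else 0) + lookup ?l w * (if w = p \<cdot> z then 1 else 0))"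
    unfolding lookup_kap_bop[OF m(1)] by (rule sum.cong[OF refl]) (simp only: w distrib_left)
  then show ?thesis unfolding sum.distrib s .
qed

text \<open>The terms beyond the ends of the string drop out: index m is complex, and the base has
  neither letter as a descent.\<close>

lemma bop_C_ystr:
  assumes b: "base a b u" and i: "0 < i" "enat i < bond X a b" "ystr a b i u \<in> Wc"
  shows "bop (tp a b (Suc i)) (C (ystr a b i u)) =
    (if enat (Suc i) < bond X a b then C (ystr a b (Suc i) u) else 0) + (if 1 < i then C (ystr a b (i - 1) u) else 0)"
proof -
  let ?y = "\<lambda>i. ystr a b i u"
  have ab: "a \<in> S" "b \<in> S" "\<not> commuting X a b" using b by (auto simp: base_def)
  have nc: "\<not> commuting X (tp a b (Suc i)) (tp a b i)" using ab commuting_sym by (auto simp: tp_def)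
  obtain i' where i': "i = Suc i'" using i by (cases i) auto
  have e: "tp a b (Suc i) \<cdot> ?y i = ?y (Suc i)" "tp a b i \<cdot> ?y i = ?y (i - 1)"
    using ystr_Suc[OF b, of i] tp_ystr[OF b, of i'] i' by simp_all
  have le: "enat (i - 1) < bond X a b" using i(2) by (cases "bond X a b"; simp)
  have dd: "dl (tp a b (Suc i)) (?y (i - 1)) \<longleftrightarrow> 1 < i"
  proof (cases "i = 1")
    case True
    then show ?thesis using b by (auto simp: base_def tp_def)
  next
    case False
    then show ?thesis using ystr_descents(1)[OF b le] tp_pred[OF i(1), of a b] i(1) by simp
  qed
  have up: "?y (Suc i) \<in> Wc \<longleftrightarrow> enat (Suc i) < bond X a b"
  proof
    assume "?y (Suc i) \<in> Wc"
    then have "bond X a b \<noteq> enat (Suc i)" using ystr_top_notin_Wc[OF b] by blast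
    then show "enat (Suc i) < bond X a b" using i(2) by (cases "bond X a b") auto
  qed (use ystr_Wc[OF b i(2,1,3)] in blast)
  show ?thesis
    using bop_C_string[OF baseD(6)[OF b] baseD(6)[OF b] nc i(3)] ystr_descents(1)[OF b i(2,1)] ystr_descents(2)[OF b i(2)] e dd up
    by simp
qed

text \<open>Put M_i = c_{y_i} n. Applying b to M_i changes i by the string rule; reading the
  coefficient at c_{z_j} changes j by \<open>kap_bop_string\<close>. So these coefficients obey the
  fusion recursion, and i = 1 is the hypothesis.\<close>

lemma positive_left:
  assumes b: "base a b u" and k: "0 < k" "enat k < bond X a b" "ystr a b k u \<in> Wc" and n: "n \<in> MW"
    and IH: "positive (star (C (ystr a b 1 u)) n)"
  shows "positive (star (C (ystr a b k u)) n)"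
  unfolding positive_def
proof
  fix z
  let ?x = "\<lambda>i. ystr a b i u" and ?p = "tp a b k" and ?q = "tp b a k" and ?m = "bond X a b"
  define M where "M i = star (C (?x i)) n" for i
  have ab: "a \<in> S" "b \<in> S" "\<not> commuting X a b" using b by (auto simp: base_def)
  have xc: "?x i \<in> Wc" if "enat i < ?m" for i using ystr_Wc[OF b k(2,1,3)] that .
  have MMW: "M i \<in> MW" if "enat i < ?m" for i unfolding M_def using star_MW[OF C_MW[OF xc[OF that]] n] .
  have Md: "bop (tp a b i) (M i) = scale delta (M i)" if "enat i < ?m" "0 < i" for i
    using bop_star[OF baseD(6)[OF b] C_MW[OF xc[OF that(1)]] n] bop_C_dl[OF baseD(6)[OF b] xc[OF that(1)] ystr_descents(1)[OF b that]]
    by (simp add: M_def linear_opD(2)[OF linear_star_left])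
  have sup: "lookup (kap (M i)) y = 0" if "enat i < ?m" "0 < i" "\<not> dl (tp a b i) y" for i y
    using kap_support[OF baseD(6)[OF b] MMW[OF that(1)] Md[OF that(1,2)] that(3)] .
  have Mu: "bop (tp a b (Suc i)) (M i) = M (Suc i) + (if 1 < i then M (i - 1) else 0)" if "enat (Suc i) < ?m" "0 < i" for i
  proof -
    have im: "enat i < ?m" using that by (cases ?m; simp)
    show ?thesis
      using bop_star[OF baseD(6)[OF b] C_MW[OF xc[OF im]] n] bop_C_ystr[OF b that(2) im xc[OF im]] that
      by (simp add: M_def linear_opD[OF linear_star_left])
  qed
  have pq: "?p \<in> S" "?q \<in> S" "\<not> commuting X ?p ?q" "{?p, ?q} = {a, b}" "bond X ?p ?q = ?m"
    using ab commuting_sym bond_sym tp_cases[of a b k] by auto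
  have "lookup (kap (M k)) z \<in> nonneg_delta"
  proof (cases "z \<in> Wc \<and> dl ?p z")
    case False
    then have "lookup (kap (M k)) z = 0"
      using sup[OF k(2,1)] coords_keys[OF unitri_C MMW[OF k(2)]] by (meson in_keys_iff subsetD)
    then show ?thesis by simp
  next
    case True
    obtain c d j x where s: "{c, d} = {?p, ?q}" "base c d x" "0 < j" "enat j < bond X ?p ?q" "z = ystr c d j x" "tp c d j = ?p"
      using string_of[OF _ pq(1,2,3)] True by metis
    let ?z = "\<lambda>i. ystr c d i x"
    have bm: "bond X c d = ?m" using s(1) pq(4) bond_sym ab by (metis doubleton_eq_iff)
    have zc: "?z i \<in> Wc" if "enat i < ?m" for i
      using ystr_Wc[OF s(2), of j i] s(3,4,5) True bm pq(5) that by simp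
    \<comment> \<open>The base z_0 contributes nothing here: M_i is supported on elements with the
      leading letter of y_i as a descent, which z_0 lacks.\<close>
    define A where "A i j = (if 0 < i \<and> 0 < j \<and> tp c d j = tp a b i then lookup (kap (M i)) (?z j) else 0)" for i j
    have "A k j \<in> nonneg_delta"
    proof (rule fusion[where P = "\<lambda>x. x \<in> nonneg_delta" and m = ?m and a = A])
      fix i j assume i: "0 < i" and j: "0 < j" and im: "enat (Suc i) < ?m" and jm: "enat j < ?m"
      have im': "enat i < ?m" using im by (cases ?m; simp)
      obtain j' where j': "j = Suc j'" using j by (cases j) auto
      have e: "tp c d (j - 1) = tp c d (Suc j)" "tp a b (i - 1) = tp a b (Suc i)"
        by (rule tp_pred[OF j], rule tp_pred[OF i])
      have sh: "tp c d (Suc j) = tp a b i \<longleftrightarrow> tp c d j = tp a b (Suc i)"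
        using tp_shift[OF baseD(4)[OF b]] s(1) pq(4) by simp
      show "A (Suc i) j + A (i - 1) j = A i (j - 1) + A i (Suc j)"
      proof (cases "tp c d j = tp a b (Suc i)")
        case True
        have t: "tp a b i = tp c d (Suc j)" using sh True by simp
        have nc: "\<not> commuting X (tp a b (Suc i)) (tp a b i)" using ab commuting_sym by (auto simp: tp_def)
        have z1: "tp a b i \<cdot> ?z j = ?z (Suc j)" "tp a b (Suc i) \<cdot> ?z j = ?z (j - 1)"
          using ystr_Suc[OF s(2), of j] tp_ystr[OF s(2), of j'] t True j' by simp_all
        have dz: "dl (tp a b (Suc i)) (?z j)" using ystr_descents(1)[OF s(2), of j] bm jm j True by simp
        have "lookup (kap (M (Suc i) + (if 1 < i then M (i - 1) else 0))) (?z j)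
            = lookup (kap (M i)) (?z (j - 1)) + lookup (kap (M i)) (?z (Suc j))"
          using kap_bop_string[OF baseD(6)[OF b] baseD(6)[OF b] nc MMW[OF im'] Md[OF im' i] zc[OF jm] dz] Mu[OF im i] z1 by simp
        moreover have "lookup (kap (M i)) (?z (j - 1)) = 0" if "j = 1"
        proof (rule sup[OF im' i])
          have "tp a b i \<in> {c, d}" using t by (simp add: tp_def)
          then show "\<not> dl (tp a b i) (?z (j - 1))" using that s(2) by (auto simp: base_def)
        qed
        ultimately have "lookup (kap (M (Suc i))) (?z j) + (if 1 < i then lookup (kap (M (i - 1))) (?z j) else 0)
            = (if 1 < j then lookup (kap (M i)) (?z (j - 1)) else 0) + lookup (kap (M i)) (?z (Suc j))"
          using j by (cases "j = 1"; cases "1 < i") (simp_all add: linear_opD(1)[OF linear_coords] lookup_add)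
        then show ?thesis unfolding A_def e t True using i j by simp
      next
        case False
        then show ?thesis using sh unfolding A_def e by simp
      qed
    next
      fix i j assume j: "?m = enat j" and i: "0 < i" "enat i < ?m"
      have "?z j \<notin> keys (kap (M i))"
        using ystr_top_notin_Wc[OF s(2), of j] bm j coords_keys[OF unitri_C MMW[OF i(2)]] by auto
      then show "A i j = 0" by (simp add: A_def in_keys_iff)
    next
      fix j
      show "A 1 j \<in> nonneg_delta" using IH by (simp add: A_def M_def positive_def)
    qed (use k s(4) pq(5) nonneg_delta_add in \<open>auto simp: A_def\<close>)
    then show ?thesis using s(3,5,6) k(1) by (simp add: A_def)
  qed
  then show "lookup (kap (star (C (?x k)) n)) z \<in> nonneg_delta" by (simp add: M_def)
qed

end

context cox_FW
begin

lemma bop_C_nonneg: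
  assumes "s \<in> S" "w \<in> Wc" "\<not> dl s w"
  obtains n where "0 \<le> n" "lookup (kap (bop s (C w))) z = of_int n" "n \<noteq> 0 \<Longrightarrow> z \<in> Wc \<and> dl s z"
proof (cases "z \<in> Wc \<and> dl s z")
  case True
  show ?thesis
  proof (rule that)
    show "lookup (kap (bop s (C w))) z = of_int (mu z w + (if s \<cdot> z = w then 1 else 0))"
      using kap_bop_up[OF assms] True by simp
  qed (use mu_nonneg[OF assms(2)] True in auto)
next
  case False
  have "lookup (kap (bop s (C w))) z = 0"
  proof (cases "dl s z")
    case True
    then have "z \<notin> keys (kap (bop s (C w)))" using coords_keys[OF unitri_C bop_MW] False by blast
    then show ?thesis by (simp add: in_keys_iff)
  qed (use kap_bop_C_support assms in blast)
  then show ?thesis using that[of 0] by simp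
qed

lemma positive_bop_C: assumes "s \<in> S" "w \<in> Wc" shows "positive (bop s (C w))"
proof (cases "dl s w")
  case True
  have "positive (C w)" using coords_basis[OF unitri_C assms(2)] by (simp add: positive_def lookup_T)
  then show ?thesis using bop_C_dl[OF assms True] positive_scale_delta by simp
next
  case False
  show ?thesis unfolding positive_def
  proof
    fix z
    obtain n where n: "0 \<le> n" "lookup (kap (bop s (C w))) z = of_int n" using bop_C_nonneg[OF assms False] .
    then show "lookup (kap (bop s (C w))) z \<in> nonneg_delta" using nonneg_delta_of_int_mult[OF n(1) nonneg_delta_one] by simp
  qed
qed

lemma positive_bop: assumes "s \<in> S" "m \<in> MW" "positive m" shows "positive (bop s m)"
  unfolding positive_def lookup_kap_bop[OF assms(2)]
proof (intro allI nonneg_delta_sum nonneg_delta_mult)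
  fix z w assume "w \<in> keys (kap m)"
  then have "w \<in> Wc" using coords_keys[OF unitri_C assms(2)] by blast
  then show "lookup (kap (bop s (C w))) z \<in> nonneg_delta" using positive_bop_C[OF assms(1)] by (simp add: positive_def)
qed (use assms(3) in \<open>auto simp: positive_def\<close>)

text \<open>Let h(i,j) be the product of c_w, w inverse to x_i, with c_{y_j}. Moving b across the
  product, delta h(i,j) equals both h(i+1,j) + h(i-1,j) and h(i,j+1) + h(i,j-1): one new letter is a
  descent of y_j, the other of x_i. This is the fusion recursion with values in the algebra
  itself.\<close>

lemma positive_right_string:
  assumes b: "base a b u" and k: "0 < k" "enat k < bond X a b" "ystr a b k u \<in> Wc" and y: "y \<in> Wc" "dl (tp a b k) y"
    and IH: "\<And>y. y \<in> Wc \<Longrightarrow> positive (star (io (C (ystr a b 1 u))) (C y))"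
  shows "positive (star (io (C (ystr a b k u))) (C y))"
proof -
  let ?x = "\<lambda>i. ystr a b i u" and ?p = "tp a b k" and ?q = "tp b a k" and ?m = "bond X a b"
  have ab: "a \<in> S" "b \<in> S" "\<not> commuting X a b" using b by (auto simp: base_def)
  have xc: "?x i \<in> Wc" if "enat i < ?m" for i using ystr_Wc[OF b k(2,1,3)] that .
  have pq: "?p \<in> S" "?q \<in> S" "\<not> commuting X ?p ?q" "{?p, ?q} = {a, b}" "bond X ?p ?q = ?m"
    using ab commuting_sym bond_sym tp_cases[of a b k] by auto
  obtain c d j x where s: "{c, d} = {?p, ?q}" "base c d x" "0 < j" "enat j < bond X ?p ?q" "y = ystr c d j x" "tp c d j = ?p"
    using string_of[OF y(1) pq(1,2,3) y(2)] by metis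
  let ?y = "\<lambda>j. ystr c d j x"
  have bm: "bond X c d = ?m" using s(1) pq(4) bond_sym ab by (metis doubleton_eq_iff)
  have yc: "?y i \<in> Wc" if "enat i < ?m" for i
    using ystr_Wc[OF s(2), of j i] s(3,4,5) y bm pq(5) that by simp
  define h where "h i j = star (io (C (?x i))) (C (?y j))" for i j
  define A where "A i j = (if 0 < i \<and> 0 < j \<and> enat j < ?m \<and> tp c d j = tp a b i then h i j else 0)" for i j
  have "positive (A k j)"
  proof (rule fusion[where m = ?m and a = A])
    fix i j assume i: "0 < i" and j: "0 < j" and im: "enat (Suc i) < ?m" and jm: "enat j < ?m"
    have im': "enat i < ?m" and jm': "enat (j - 1) < ?m" using im jm by (cases ?m; simp)+
    have e: "tp c d (j - 1) = tp c d (Suc j)" "tp a b (i - 1) = tp a b (Suc i)"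
      by (rule tp_pred[OF j], rule tp_pred[OF i])
    have sh: "tp c d (Suc j) = tp a b i \<longleftrightarrow> tp c d j = tp a b (Suc i)"
      using tp_shift[OF baseD(4)[OF b]] s(1) pq(4) by simp
    show "A (Suc i) j + A (i - 1) j = A i (j - 1) + A i (Suc j)"
    proof (cases "tp c d j = tp a b (Suc i)")
      case True
      have t: "tp a b i = tp c d (Suc j)" using sh True by simp
      note m = C_MW[OF xc[OF im']] C_MW[OF yc[OF jm]]
      have lin: "linear_op (\<lambda>m. star (io m) n)" for n
        by (rule linear_comp[OF linear_star_left linear_io])
      have "star (io (bop (tp a b (Suc i)) (C (?x i)))) (C (?y j)) = scale delta (h i j)"
        using star_io_bop[OF baseD(6)[OF b, of "Suc i"] m] bop_C_dl[OF baseD(6)[OF s(2)] yc[OF jm] ystr_descents(1)[OF s(2)]] bm jm j True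
        by (simp add: h_def linear_opD(2)[OF linear_star_right])
      moreover have "star (io (bop (tp a b (Suc i)) (C (?x i)))) (C (?y j)) = h (Suc i) j + (if 1 < i then h (i - 1) j else 0)"
        unfolding bop_C_ystr[OF b i im' xc[OF im']] using im by (simp add: h_def linear_opD[OF lin])
      moreover have "star (io (C (?x i))) (bop (tp c d (Suc j)) (C (?y j))) = scale delta (h i j)"
        using star_io_bop[OF baseD(6)[OF b, of i] m] bop_C_dl[OF baseD(6)[OF b] xc[OF im'] ystr_descents(1)[OF b im' i]] t
        by (simp add: h_def linear_opD(2)[OF lin])
      moreover have "star (io (C (?x i))) (bop (tp c d (Suc j)) (C (?y j)))
          = (if enat (Suc j) < ?m then h i (Suc j) else 0) + (if 1 < j then h i (j - 1) else 0)"
        using bop_C_ystr[OF s(2) j, of] bm jm yc[OF jm] by (simp add: h_def linear_opD[OF linear_star_right])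
      ultimately have "h (Suc i) j + (if 1 < i then h (i - 1) j else 0)
          = (if 1 < j then h i (j - 1) else 0) + (if enat (Suc j) < ?m then h i (Suc j) else 0)"
        by (simp only: add.commute)
      then show ?thesis unfolding A_def e t True using i j jm jm' by simp
    next
      case False
      then show ?thesis using sh unfolding A_def e by simp
    qed
  next
    fix j
    show "positive (A 1 j)" using IH[OF yc, of j] positive_zero by (simp add: A_def h_def)
  qed (use k s(4) pq(5) positive_add positive_zero in \<open>auto simp: A_def\<close>)
  then show ?thesis using s(3,4,5,6) pq(5) k(1) by (simp add: A_def h_def)
qed

text \<open>If y lacks the descent p, then delta times the product equals the product with b_p c_y.
  This is a combination of c_w with descent p whose coefficients are nonnegative integers, by
  nonnegativity of mu; then delta is cancelled.\<close>

lemma positive_right: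
  assumes b: "base a b u" and k: "0 < k" "enat k < bond X a b" "ystr a b k u \<in> Wc" and y: "y \<in> Wc"
    and IH: "\<And>y. y \<in> Wc \<Longrightarrow> positive (star (io (C (ystr a b 1 u))) (C y))"
  shows "positive (star (io (C (ystr a b k u))) (C y))"
proof (cases "dl (tp a b k) y")
  case True
  then show ?thesis using positive_right_string[OF b k y _ IH] by blast
next
  case False
  let ?p = "tp a b k" and ?x = "ystr a b k u"
  have p: "?p \<in> S" by (rule baseD(6)[OF b])
  have "scale delta (star (io (C ?x)) (C y)) = star (io (bop ?p (C ?x))) (C y)"
    using bop_C_dl[OF p k(3) ystr_descents(1)[OF b k(2,1)]]
    by (simp add: linear_opD(2)[OF linear_comp[OF linear_star_left linear_io]])
  also have "\<dots> = star (io (C ?x)) (bop ?p (C y))"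
    by (rule star_io_bop[OF p C_MW[OF k(3)] C_MW[OF y]])
  also have "\<dots> = star (io (C ?x)) (\<Sum>w\<in>keys (kap (bop ?p (C y))). scale (lookup (kap (bop ?p (C y))) w) (C w))"
    using kap_lin[OF bop_MW] by metis
  also have "\<dots> = (\<Sum>w\<in>keys (kap (bop ?p (C y))). scale (lookup (kap (bop ?p (C y))) w) (star (io (C ?x)) (C w)))"
    by (simp add: linear_sum[OF linear_star_right] linear_opD(2)[OF linear_star_right])
  finally have e: "scale delta (star (io (C ?x)) (C y)) = \<dots>" .
  have "positive \<dots>"
  proof (rule positive_sum)
    fix w assume w: "w \<in> keys (kap (bop ?p (C y)))"
    obtain n where n: "0 \<le> n" "lookup (kap (bop ?p (C y))) w = of_int n" "n \<noteq> 0 \<Longrightarrow> w \<in> Wc \<and> dl ?p w"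
      using bop_C_nonneg[OF p y False, of w] by blast
    then have "w \<in> Wc" "dl ?p w" using w by (auto simp: in_keys_iff)
    then have "positive (star (io (C ?x)) (C w))" using positive_right_string[OF b k _ _ IH] by blast
    then show "positive (scale (lookup (kap (bop ?p (C y))) w) (star (io (C ?x)) (C w)))"
      unfolding n(2) by (rule positive_scale_int[OF n(1)])
  qed
  then show ?thesis unfolding e[symmetric] positive_scale_delta .
qed

text \<open>Correction terms in b_s c_x would need a z with descent s and mu(z,x) nonzero. Such z
  arise from x by removing a letter, and these lack the descent s.\<close>

lemma bop_C_commuting_product:
  assumes x: "set (s # x) \<subseteq> S" "distinct (s # x)" "\<And>a b. a \<in> set (s # x) \<Longrightarrow> b \<in> set (s # x) \<Longrightarrow> commuting X a b"
    and c: "ev (s # x) \<in> Wc"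
  shows "ev x \<in> Wc" "C (ev (s # x)) = bop s (C (ev x))" "len (ev x) < len (ev (s # x))"
proof -
  have s: "s \<in> S" "set x \<subseteq> S" "s \<notin> set x" "distinct x" using x by auto
  have e: "ev (s # x) = s \<cdot> ev x" "s \<cdot> ev (s # x) = ev x" using s by (simp_all add: lm_ev[symmetric])
  have d: "dl s (ev (s # x))" and nd: "\<not> dl s (ev x)"
    using commuting_word_descents[OF x(1,2), of s] commuting_word_descents[OF s(2,4), of s] x(3) s by auto
  show xc: "ev x \<in> Wc" using Wc_lm[OF s(1) c d] e by simp
  show "len (ev x) < len (ev (s # x))" using d e by (simp add: dl_def)
  have "kap (bop s (C (ev x))) = T (ev (s # x))"
  proof (rule poly_mapping_eqI)
    fix z
    show "lookup (kap (bop s (C (ev x)))) z = lookup (T (ev (s # x))) z"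
    proof (cases "z \<in> Wc \<and> dl s z")
      case True
      then have z: "z \<in> Wc" "z \<in> W" "dl s z" by blast+
      have "s \<cdot> z = ev x \<longleftrightarrow> z = ev (s # x)" using e lm_lm[OF s(1) z(2)] by metis
      moreover have "mu z (ev x) = 0"
      proof (rule ccontr)
        assume "mu z (ev x) \<noteq> 0"
        then obtain r where r: "r \<in> set x" "z = r \<cdot> ev x"
          using mu_commuting_product(2)[OF s(2,4) _ xc z(1)] x(3) by auto
        then have "dl s (ev x)"
          using z(3) dl_commute[of r s "ev x"] x(3)[of r s] s by auto
        then show False using nd by simp
      qed
      ultimately show ?thesis using kap_bop_up[OF s(1) xc nd z(1)] z(3) by (simp add: lookup_T)
    next
      case False
      then have "z \<noteq> ev (s # x)" using c d by blast
      moreover have "lookup (kap (bop s (C (ev x)))) z = 0"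
        using bop_C_nonneg[OF s(1) xc nd, of z] False by (metis of_int_0)
      ultimately show ?thesis by (simp add: lookup_T)
    qed
  qed
  then have "bop s (C (ev x)) = lin C (T (ev (s # x)))" using lin_coords[OF unitri_C bop_MW] by metis
  then show "C (ev (s # x)) = bop s (C (ev x))" by simp
qed

lemma positive_star: "a \<in> Wc \<Longrightarrow> b \<in> Wc \<Longrightarrow> positive (star (C a) (C b))"
proof (induction "len a" arbitrary: a b rule: less_induct)
  case less
  have top: "\<exists>c d u k. base c d u \<and> 0 < k \<and> enat k < bond X c d \<and> y = ystr c d k u \<and> ystr c d 1 u \<in> Wc \<and> len (ystr c d 1 u) < len y"
    if y: "star_top y" "y \<in> Wc" for y
  proof -
    obtain c d u k where b: "base c d u" "2 \<le> k" "enat k < bond X c d" "y = ystr c d k u"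
      using y(1) unfolding star_top_def by blast
    have m: "enat 1 < bond X c d" using b(2,3) by (cases "bond X c d") auto
    have "len (ystr c d 1 u) < len y" using len_ystr[OF b(1), of 1] len_ystr[OF b(1), of k] b m by simp
    moreover have "ystr c d 1 u \<in> Wc" using ystr_Wc[OF b(1,3) _ _ m] b(2,4) y(2) by simp
    ultimately show ?thesis using b by (intro exI[of _ c] exI[of _ d] exI[of _ u] exI[of _ k]) simp
  qed
  from property_F less.prems(1) show ?case
  proof (cases rule: property_F_cases)
    case 1
    then obtain x where x: "set x \<subseteq> S" "distinct x" "\<forall>s\<in>set x. \<forall>r\<in>set x. commuting X s r" "a = ev x"
      unfolding commuting_product_def by auto
    show ?thesis
    proof (cases x)
      case Nil
      then show ?thesis using x(4) coords_basis[OF unitri_C less.prems(2)] by (simp add: C_one star_one_left positive_def lookup_T)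
    next
      case (Cons s x')

      have c: "ev x' \<in> Wc" "C a = bop s (C (ev x'))" "len (ev x') < len a"
        using bop_C_commuting_product[of s x'] x less.prems(1) Cons by auto
      have s: "s \<in> S" using x(1) Cons by simp
      have "star (C a) (C b) = bop s (star (C (ev x')) (C b))"
        using bop_star[OF s C_MW[OF c(1)] C_MW[OF less.prems(2)]] c(2) by simp
      then show ?thesis
        using positive_bop[OF s star_MW[OF C_MW[OF c(1)] C_MW[OF less.prems(2)]] less.hyps[OF c(3,1) less.prems(2)]] by simp
    qed
  next
    case 2
    obtain c d u k where t: "base c d u" "0 < k" "enat k < bond X c d" "a = ystr c d k u" "ystr c d 1 u \<in> Wc" "len (ystr c d 1 u) < len a"
      using top[OF 2 less.prems(1)] by blast
    then show ?thesis
      using positive_left[OF t(1,2,3) _ C_MW[OF less.prems(2)] less.hyps[OF t(6,5) less.prems(2)]] less.prems(1) by simp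
  next
    case 3
    have i: "iv a \<in> Wc" "a \<in> W" using iv_Wc less.prems(1) by blast+
    obtain c d u k where t: "base c d u" "0 < k" "enat k < bond X c d" "iv a = ystr c d k u" "ystr c d 1 u \<in> Wc" "len (ystr c d 1 u) < len (iv a)"
      using top[OF 3 i(1)] by blast
    let ?x = "ystr c d 1 u"
    \<comment> \<open>The induction hypothesis is applied to the inverse of the bottom of the string
      through a^-1; by \<open>io_C\<close> this is the factor that \<open>positive_right\<close>
      starts from.\<close>
    have x: "iv ?x \<in> Wc" "len (iv ?x) < len a" "?x \<in> W" using iv_Wc[OF t(5)] t(5,6) i(2) by auto
    have "positive (star (io (C ?x)) (C y))" if "y \<in> Wc" for y
      using less.hyps[OF x(2,1) that] io_C[OF t(5)] by simp
    from positive_right[OF t(1,2,3) _ less.prems(2) this] have "positive (star (io (C (iv a))) (C b))" using t(4) i by simp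
    then show ?thesis using io_C[OF i(1)] i(2) by simp
  qed
qed

subsection \<open>The canonical basis of the quotient\<close>

lemma canon_fib: assumes w: "w \<in> Wc" shows "canon X w = fib (C w)"
proof -
  have lat: "fib m \<ominus>\<^bsub>TL X\<^esub> tt X w \<in> v_inv_lattice X \<longleftrightarrow> (\<forall>z. degl (- 1) (lookup (tau m - T w) z))" if "m \<in> MW" for m
    using v_inv_lattice_iff[OF MW_closed(3)[OF that t_MW[of w]]] TL_diff[OF that t_MW] tt_fib[of w] tau_t[OF w] w
    by (simp add: linear_opD(5)[OF linear_coords])
  show ?thesis unfolding canon_def
  proof (rule the_equality)
    show "fib (C w) \<in> carrier (TL X) \<and> TL_bar X (fib (C w)) = fib (C w) \<and> fib (C w) \<ominus>\<^bsub>TL X\<^esub> tt X w \<in> v_inv_lattice X"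
      using TL_carrier C_MW[OF w] TL_bar_fib[OF C_MW[OF w]] C_bar[OF w] lat[OF C_MW[OF w]] C[OF w] by (simp add: is_canon_def)
    fix c assume c: "c \<in> carrier (TL X) \<and> TL_bar X c = c \<and> c \<ominus>\<^bsub>TL X\<^esub> tt X w \<in> v_inv_lattice X"
    then obtain m where m: "m \<in> MW" "c = fib m" using TL_carrier by blast
    have "barM m \<in> MW" using m(1) by simp
    then have bm: "barM m = m" using c m TL_bar_fib[OF m(1)] fib_inj[of "barM m" m] by auto
    have "m - C w = 0"
    proof (rule canon_unique)
      show "m - C w \<in> MW" by (rule MW_closed(3)[OF m(1) C_MW[OF w]])
      show "barM (m - C w) = m - C w" using bm C_bar[OF w] by simp
      fix z
      have 1: "degl (- 1) (lookup (tau m - T w) z)" using lat[OF m(1)] c m(2) by blast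
      have 2: "degl (- 1) (lookup (tau (C w) - T w) z)" using C[OF w] by (simp add: is_canon_def)
      have "tau (m - C w) = (tau m - T w) - (tau (C w) - T w)" by (simp add: linear_opD(5)[OF linear_coords])
      then show "degl (- 1) (lookup (tau (m - C w)) z)" using degl_diff[OF 1 2] by (simp only: lookup_minus)
    qed
    then show "c = fib (C w)" using m(2) by simp
  qed
qed

lemma canon_expansion_iff: assumes m: "m \<in> MW" shows "canon_expansion X (fib m) l \<longleftrightarrow> l = kap m"
proof
  assume "canon_expansion X (fib m) l"
  then have l: "keys l \<subseteq> Wc" "fib m = TL_lincomb X l (canon X)" by (auto simp: canon_expansion_def)
  have "TL_lincomb X l (canon X) = fib (lin C l)" "lin C l \<in> MW"
    using TL_lincomb_fib[OF l(1) canon_fib C_MW] by auto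
  then have "m = lin C l" using l(2) fib_inj[OF m] by simp
  then show "l = kap m" using coords_unique[OF unitri_C l(1)] by simp
next
  assume l: "l = kap m"
  then have k: "keys l \<subseteq> Wc" using coords_keys[OF unitri_C m] by simp
  have "TL_lincomb X l (canon X) = fib (lin C l)" using TL_lincomb_fib[OF k canon_fib C_MW] by auto
  then show "canon_expansion X (fib m) l" using k l lin_coords[OF unitri_C m] by (simp add: canon_expansion_def)
qed

end

theorem theorem6p13:
  fixes X :: "'s coxeter_graph"
  assumes "coxeter_graph X"
    and "property_F X"
    and "property_W X"
  shows "\<forall>a\<in>W_c X. \<forall>b\<in>W_c X.
    (\<exists>!l. canon_expansion X (canon X a \<otimes>\<^bsub>TL X\<^esub> canon X b) l) \<and>
    (\<forall>l. canon_expansion X (canon X a \<otimes>\<^bsub>TL X\<^esub> canon X b) l \<longrightarrow>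
      (\<forall>w\<in>W_c X. Poly_Mapping.lookup l w \<in> nonneg_delta))"
proof (intro ballI)
  interpret cox_FW X by standard (use assms in auto)
  fix a b assume a: "a \<in> W_c X" and b: "b \<in> W_c X"
  let ?m = "star (C a) (C b)"
  have "?m \<in> MW" by (rule star_MW[OF C_MW[OF a] C_MW[OF b]])
  from canon_expansion_iff[OF this]
  have e: "canon_expansion X (canon X a \<otimes>\<^bsub>TL X\<^esub> canon X b) l \<longleftrightarrow> l = kap ?m" for l
    using canon_fib[OF a] canon_fib[OF b] TL_mult[OF C_MW[OF a] C_MW[OF b]] by simp
  show "(\<exists>!l. canon_expansion X (canon X a \<otimes>\<^bsub>TL X\<^esub> canon X b) l) \<and>
    (\<forall>l. canon_expansion X (canon X a \<otimes>\<^bsub>TL X\<^esub> canon X b) l \<longrightarrow>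
      (\<forall>w\<in>W_c X. Poly_Mapping.lookup l w \<in> nonneg_delta))"
    using positive_star[OF a b] unfolding e positive_def by simp
qed

end
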